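(* Let $G$ be a 1-tough graph on $n$ vertices with $\sigma_3(G)\geq n\geq 3$. Then $$c(G)\geq \min\{n,\,2\,NC2(G)+4\}.$$
   Context: All graphs are finite, undirected, without loops or multiple edges; all cycles are simple. $G$ is 1-tough if for every nonempty $S\subset V(G)$ the graph $G-S$ has at most $|S|$ connected components. $\alpha(G)$ is the independence number. $\sigma_3(G):=\min\{\deg(v_1)+\deg(v_2)+\deg(v_3): \{v_1,v_2,v_3\}\text{ is an independent set of three vertices}\}$ if $\alpha(G)\geq 3$, and $\sigma_3(G):=3(n-1)$ otherwise. $N(v)$ is the set of vertices adjacent to $v$ and $d(u,v)$ is the distance. $NC2(G):=\min\{|N(u)\cup N(v)| : d(u,v)=2\}$ if $G$ is not complete, and $NC2(G):=n-1$ if $G$ is complete. $c(G)$ is the circumference of $G$, i.e. the length of a longest cycle of $G$. *)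

theory Defs
  imports "Graph_Theory.Graph_Theory"
begin

text \<open>
  A finite simple undirected graph is a \<^locale>\<open>pair_graph\<close>: a finite vertex set together with a
  finite, symmetric, irreflexive arc relation, each edge being represented by two opposite arcs.
\<close>

definition neighbourhood :: "'a pair_pre_digraph \<Rightarrow> 'a \<Rightarrow> 'a set" where
  "neighbourhood G v = {w. v \<rightarrow>\<^bsub>with_proj G\<^esub> w}"

text \<open>Arcs come in opposite pairs, so the number of outgoing arcs is the undirected degree.\<close>

definition degree :: "'a pair_pre_digraph \<Rightarrow> 'a \<Rightarrow> nat" where
  "degree G v = out_degree (with_proj G) v"

definition independent_set :: "'a pair_pre_digraph \<Rightarrow> 'a set \<Rightarrow> bool" where
  "independent_set G S \<longleftrightarrow>
    S \<subseteq> pverts G \<and> (\<forall>u\<in>S. \<forall>v\<in>S. \<not> u \<rightarrow>\<^bsub>with_proj G\<^esub> v)"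

definition independence_number :: "'a pair_pre_digraph \<Rightarrow> nat" where
  "independence_number G = Max {card S | S. independent_set G S}"

text \<open>
  In a symmetric digraph the strongly connected components are the connected components of the
  undirected graph; they are nonempty, so \<open>S = pverts G\<close> leaves none.
\<close>

definition one_tough :: "'a pair_pre_digraph \<Rightarrow> bool" where
  "one_tough G \<longleftrightarrow>
    (\<forall>S. S \<subseteq> pverts G \<and> S \<noteq> {} \<longrightarrow>
      card (pre_digraph.sccs (with_proj G \<restriction> (pverts G - S))) \<le> card S)"

definition sigma3 :: "'a pair_pre_digraph \<Rightarrow> nat" where
  "sigma3 G =
    (if independence_number G \<ge> 3
     then Min {degree G v1 + degree G v2 + degree G v3 | v1 v2 v3.
                 card {v1, v2, v3} = 3 \<and> independent_set G {v1, v2, v3}}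
     else 3 * (card (pverts G) - 1))"

definition complete :: "'a pair_pre_digraph \<Rightarrow> bool" where
  "complete G \<longleftrightarrow> complete_digraph (card (pverts G)) (with_proj G)"

text \<open>Every arc has weight 1, so path cost is the number of edges (infinite if there is no path).\<close>

definition distance :: "'a pair_pre_digraph \<Rightarrow> 'a \<Rightarrow> 'a \<Rightarrow> ereal" where
  "distance G u v = wf_digraph.\<mu> (with_proj G) (\<lambda>_. 1) u v"

text \<open>
  The minimum is over a nonempty set whenever \<open>G\<close> is connected and not complete; it is unspecified
  for a disjoint union of several complete graphs; no such graph with 3 or more vertices is 1-tough.
\<close>

definition NC2 :: "'a pair_pre_digraph \<Rightarrow> nat" where
  "NC2 G =
    (if complete G then card (pverts G) - 1
     else Min {card (neighbourhood G u \<union> neighbourhood G v) | u v.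
                 u \<in> pverts G \<and> v \<in> pverts G \<and> distance G u v = 2})"

text \<open>
  The bound \<open>3 \<le> length p\<close> is needed because \<^const>\<open>pre_digraph.cycle\<close> is the directed notion, for
  which traversing one edge forth and back is a cycle. The maximum is unspecified for a forest;
  no forest with 3 or more vertices is 1-tough.
\<close>

definition circumference :: "'a pair_pre_digraph \<Rightarrow> nat" where
  "circumference G = Max {length p | p. pre_digraph.cycle (with_proj G) p \<and> 3 \<le> length p}"

end

theory Submission imports Defs "HOL-Library.Multiset"
begin

text \<open>
  Let \<open>C\<close> be a longest cycle with \<open>|C| < n\<close> and \<open>|C| \<le> 2 NC2(G) + 3\<close>. Let \<open>H\<close> be a component of \<open>G - C\<close>,
  with attachments \<open>v\<^sub>1, \<dots>, v\<^sub>k\<close> on \<open>C\<close>, which cut \<open>C\<close> into segments \<open>T\<^sub>1, \<dots>, T\<^sub>k\<close>. If no path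
  between two attachments avoids \<open>H\<close> and misses at most one vertex of \<open>C\<close>, then an Ore type count for
  a vertex of \<open>H\<close> and two first vertices of segments (their degrees sum to at least \<open>n\<close>) is tight up to one,
  and toughness, applied to \<open>{v\<^sub>1, \<dots>, v\<^sub>k}\<close> or to this set and one more vertex, gives a contradiction.
  This excludes \<open>|H| \<ge> 2\<close> for every longest cycle. For a single vertex \<open>v\<close> off the cycle, chosen
  with maximal degree, it shows that some segment is a single vertex.

  Woodall's hopping lemma then yields a set \<open>X \<supseteq> N(v)\<close> without consecutive vertices on \<open>C\<close>
  that contains the neighbourhoods of \<open>v\<close> and of all the vertices of \<open>C\<close> between two vertices of \<open>X\<close>. As \<open>X\<close> contains
  the neighbourhoods of two vertices at distance two, \<open>|X| \<ge> NC2(G)\<close>, so that \<open>|C| - 2|X| \<le> 3\<close> and,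
  cutting \<open>C\<close> at \<open>X\<close>, the segments of at least two vertices have sizes \<open>(2,2)\<close>, \<open>(2,3)\<close> or
  \<open>(2,2,2)\<close>, toughness excluding fewer. Toughness also gives an edge between two of them. Since every vertex of \<open>X\<close> is
  adjacent to almost all the remaining vertices, a 2-opt argument finds an alternating path
  through these that closes up to a longer cycle.
\<close>

text \<open>The result on frames without detours (\<open>det_False\<close>) is used twice, and its
  exceptional clause exists for the second use. For |H| >= 2 a path between attachments that loses
  one cycle vertex could be closed through two vertices of \<open>H\<close>, so it does not exist.
  For a single vertex v it only produces another longest cycle, which misses the lost vertex x. This
  is why v has maximal degree among all vertices missed by longest cycles: x then has degree at most
  deg v. If all segments have two or more vertices, 3 deg v < n, so that such low vertices outside
  N(v) are pairwise adjacent; this leaves only attachments as possible losses.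

  A one-vertex segment matters because its vertex y shares a neighbour with v: the two are at
  distance two and both neighbourhoods lie in the hopping set X, which is how NC2 bounds |X| from
  below. The constant 4 comes from |C| - 2|X| <= 3 in a counterexample: only three vertices exceed a
  perfect alternation between X and its complement, few enough for the long segments to be treated
  case by case.\<close>

lemma mset_eq_distinct: "mset xs = mset ys ==> distinct xs \<longleftrightarrow> distinct ys"
  by (simp add: distinct_count_atmost_1 set_mset_mset[symmetric] del: set_mset_mset)

section \<open>Walks and tough graphs\<close>

locale sgraph =
  fixes V :: "'a set" and E :: "'a => 'a => bool"
  assumes fin: "finite V" and sym: "E x y ==> E y x" and irr: "\<not> E x x"
    and EV: "E x y ==> x \<in> V"

begin

definition nb :: "'a => 'a set" where "nb x = {y. E x y}"

definition deg :: "'a => nat" where "deg x = card (nb x)"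

definition walk :: "'a list => bool" where "walk = successively E"

lemma in_nb: "y \<in> nb x \<longleftrightarrow> E x y" by (simp add: nb_def)

lemma EV2: "E x y ==> y \<in> V" using EV sym by blast

lemma nb_V: "nb x \<subseteq> V" using EV2 by (auto simp: in_nb)

lemma fin_nb: "finite (nb x)" using nb_V fin finite_subset by blast

lemma Ec: "E x y \<longleftrightarrow> E y x" using sym by blast

lemma walk_simps[simp]: "walk []" "walk [x]" by (simp_all add: walk_def)

lemma walk_Cons: "walk (x # xs) \<longleftrightarrow> walk xs \<and> (xs = [] \<or> E x (hd xs))"
  by (auto simp: walk_def successively_Cons)

lemma walk_append:
  "walk (xs @ ys) \<longleftrightarrow> walk xs \<and> walk ys \<and> (xs = [] \<or> ys = [] \<or> E (last xs) (hd ys))"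
  by (simp add: walk_def successively_append_iff)

lemma walk_rev[simp]: "walk (rev xs) = walk xs"
proof -
  have eq: "(\<lambda>x y. E y x) = E" using Ec by (intro ext) blast
  show ?thesis unfolding walk_def successively_rev eq ..
qed

text \<open>\<open>Os\<close> will be the set of vertices outside both the cycle and
  \<open>H\<close>. A link plays the part of an edge between two cycle vertices that may run through
  other components.\<close>

definition link :: "'a set => 'a => 'a => bool" where
  "link Os a b \<longleftrightarrow> (\<exists>os. distinct os \<and> set os \<subseteq> Os \<and> walk (a # os @ [b]))"

lemma link_E: "E a b ==> link Os a b"
  unfolding link_def by (rule exI[of _ "[]"]) (auto simp: walk_Cons)

lemma link_sym: "link Os a b ==> link Os b a"
proof -
  assume "link Os a b"
  then obtain os where "distinct os" "set os \<subseteq> Os" "walk (a # os @ [b])" unfolding link_def by auto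
  moreover then have "walk (rev (a # os @ [b]))" by (simp only: walk_rev)
  ultimately show ?thesis unfolding link_def by (intro exI[of _ "rev os"]) auto
qed

lemma walk_shorten:
  assumes "walk (a # os @ [b])" "set os \<subseteq> Os"
  shows "link Os a b"
  using assms
proof (induction "length os" arbitrary: os rule: less_induct)
  case less
  show ?case
  proof (cases "distinct os")
    case True
    with less show ?thesis unfolding link_def by auto
  next
    case False
    then obtain xs y ys zs where d: "os = xs @ [y] @ ys @ [y] @ zs"
      using not_distinct_decomp by blast
    have "walk (a # (xs @ [y] @ zs) @ [b])"
      using less.prems(1) unfolding d by (auto simp: walk_append walk_Cons hd_append split: if_splits)
    moreover have "length (xs @ [y] @ zs) < length os" unfolding d by simp
    moreover have "set (xs @ [y] @ zs) \<subseteq> Os" using less.prems(2) unfolding d by auto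
    ultimately show ?thesis using less.hyps by blast
  qed
qed

end

text \<open>The set \<open>K x\<close> stands for the component of \<open>x\<close> after the removal of \<open>W\<close>.\<close>

locale tgraph = sgraph +
  assumes tough: "\<And>W S (K :: 'a => 'a set). W \<subseteq> V ==> W \<noteq> {} ==> S \<subseteq> V - W ==> (\<And>x. x \<in> S ==> x \<in> K x) ==>
      (\<And>x a b. x \<in> S ==> a \<in> K x ==> E a b ==> b \<notin> W ==> b \<in> K x) ==>
      (\<And>x y. x \<in> S ==> y \<in> S ==> x \<noteq> y ==> y \<notin> K x) ==> card S \<le> card W"
    and sigma: "\<And>a b c. a \<in> V ==> b \<in> V ==> c \<in> V ==> a \<noteq> b ==> a \<noteq> c ==> b \<noteq> c ==>
      \<not> E a b ==> \<not> E a c ==> \<not> E b c ==> card V \<le> deg a + deg b + deg c"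
    and n3: "card V \<ge> 3"

begin

text \<open>Deleting \<open>W\<close> cuts off \<open>H\<close>, which accounts for the additional
  1. A label that is constant along links separates the rest: vertices of \<open>S\<close> have
  different labels and thus cannot be joined outside \<open>W\<close>.\<close>

lemma tough_cl:
  fixes cl :: "'a => 'b"
  assumes W: "W \<subseteq> Cs" "W \<noteq> {}" and CV: "Cs \<subseteq> V" and H: "H \<subseteq> V - Cs" "h \<in> H"
    and NH: "\<And>x y. x \<in> H ==> E x y ==> y \<in> H \<union> W"
    and O: "Os = V - Cs - H"
    and S: "S \<subseteq> Cs - W" "inj_on cl S"
    and cl: "\<And>x y. x \<in> Cs - W ==> y \<in> Cs - W ==> link Os x y ==> cl x = cl y"
  shows "card S + 1 \<le> card W"
proof -
  \<comment> \<open>For x in \<open>S\<close> the closed set consists of the remaining cycle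
    vertices with the label of x and of everything in \<open>Os\<close> that they reach through
    \<open>Os\<close>.\<close>
  define K where "K x = (if x = h then H else {a \<in> Cs - W. cl a = cl x} \<union> {y \<in> Os. \<exists>a \<in> Cs - W. cl a = cl x \<and> (\<exists>os. set os \<subseteq> Os \<and> walk (a # os @ [y]))})" for x
  have hC: "h \<notin> Cs" using H by auto
  have fS: "finite S" using S(1) CV fin by (meson Diff_subset finite_subset)
  have "card (insert h S) \<le> card W"
  proof (rule tough[of W "insert h S" K])
    show "W \<subseteq> V" "W \<noteq> {}" using W CV by auto
    show "insert h S \<subseteq> V - W" using S H W CV by auto
    show "x \<in> K x" if "x \<in> insert h S" for x using that S H by (auto simp: K_def)
    show "b \<in> K x" if "x \<in> insert h S" "a \<in> K x" "E a b" "b \<notin> W" for x a b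
    proof (cases "x = h")
      case True then show ?thesis using that NH by (auto simp: K_def)
    next
      case False
      then have xS: "x \<in> S" using that by auto
      have aH: "a \<notin> H" using that(2) False H O by (auto simp: K_def)
      have bH: "b \<notin> H" using NH[of b a] that(2,3) aH False O W Ec by (auto simp: K_def)
      have bV: "b \<in> V" using EV2 that by blast
      have aK: "a \<in> K x" "E a b" by fact+
      obtain a0 os where a0: "a0 \<in> Cs - W" "cl a0 = cl x" "set os \<subseteq> Os" "walk (a0 # os @ [b])"
      proof (cases "a \<in> Cs - W")
        case True
        then have "cl a = cl x" using aK(1) \<open>x \<noteq> h\<close> O by (auto simp: K_def)
        then show ?thesis using aK True by (intro that[of a "[]"]) (auto simp: walk_Cons)
      next
        case F: False
        then obtain a0 os where "a0 \<in> Cs - W" "cl a0 = cl x" "set os \<subseteq> Os" "walk (a0 # os @ [a])" "a \<in> Os"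
          using aK(1) F \<open>x \<noteq> h\<close> O by (auto simp: K_def)
        then show ?thesis using aK(2)
          by (intro that[of a0 "os @ [a]"]) (auto simp: walk_append walk_Cons hd_append)
      qed
      show ?thesis
      proof (cases "b \<in> Cs")
        case True
        then have "link Os a0 b" using a0 walk_shorten by blast
        then have "cl b = cl x" using cl[of a0 b] a0 True that(4) by auto
        then show ?thesis using True that(4) False by (auto simp: K_def)
      next
        case False
        then show ?thesis using bV bH O a0 \<open>x \<noteq> h\<close> by (auto simp: K_def)
      qed
    qed
    show "y \<notin> K x" if "x \<in> insert h S" "y \<in> insert h S" "x \<noteq> y" for x y
    proof (cases "x = h")
      case True then show ?thesis using that S H by (auto simp: K_def)
    next
      case False
      then show ?thesis using that S H O by (auto simp: K_def inj_on_def)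
    qed
  qed
  moreover have "h \<notin> S" using hC S by auto
  ultimately show ?thesis using fS by simp
qed

end

section \<open>Cycles cut at the attachments of a component\<close>

text \<open>A cycle \<open>v\<^sub>1 T\<^sub>1 v\<^sub>2 T\<^sub>2 \<dots>\<close> is represented by the list of the pairs \<open>(v\<^sub>i, T\<^sub>i)\<close>.\<close>

fun flat :: "('a \<times> 'a list) list => 'a list" where
  "flat [] = []"
| "flat ((v, t) # s) = v # t @ flat s"

lemma flat_append[simp]: "flat (xs @ ys) = flat xs @ flat ys"
  by (induction xs rule: flat.induct) auto

lemma flat_Nil_iff[simp]: "flat s = [] \<longleftrightarrow> s = []"
  by (cases s) auto

definition vs :: "('a \<times> 'a list) list => 'a set" where "vs s = fst ` set s"

lemma vs_simps[simp]: "vs [] = {}" "vs ((v, t) # s) = insert v (vs s)" "vs (xs @ ys) = vs xs \<union> vs ys"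
  by (auto simp: vs_def)

lemma vs_flat: "vs s \<subseteq> set (flat s)"
  by (induction s rule: flat.induct) auto

lemma hd_flat: "s \<noteq> [] ==> hd (flat s) = fst (hd s)"
  by (cases s) auto

lemma seg_disj: "distinct (flat s) ==> (v, t) \<in> set s ==> x \<in> set t ==> x \<notin> vs s"
proof (induction s rule: flat.induct)
  case (2 w u s)
  have "vs s \<subseteq> set (flat s)" by (rule vs_flat)
  moreover have "(v,t) \<in> set s ==> set t \<subseteq> set (flat s)" by (induction s rule: flat.induct) auto
  ultimately show ?case using 2 by auto
qed auto

text \<open>Reverses the orientation of the cycle. In front of a reversed segment stands the
  attachment that used to follow it; \<open>v\<close> is the vertex that follows the last segment,
  so sections of a cycle can be reversed as well.\<close>

fun mir :: "('a \<times> 'a list) list => 'a => ('a \<times> 'a list) list" where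
  "mir [] v = []"
| "mir ((a, t) # s) v = mir s v @ [(if s = [] then v else fst (hd s), rev t)]"

lemma mir_Nil_iff[simp]: "mir s v = [] \<longleftrightarrow> s = []"
  by (cases s) auto

lemma flat_mir: "s \<noteq> [] ==> flat (mir s v) @ [fst (hd s)] = rev (flat s @ [v])"
proof (induction s)
  case (Cons p s)
  obtain a t where p: "p = (a, t)" by (cases p)
  show ?case
  proof (cases "s = []")
    case False
    then have "flat (mir s v) @ [fst (hd s)] = rev (flat s @ [v])" using Cons by blast
    then show ?thesis unfolding p using False by simp
  qed (simp add: p)
qed simp

lemma vs_mir: "s \<noteq> [] ==> vs (mir s v) = insert v (vs (tl s))"
proof (induction s v rule: mir.induct)
  case (2 a t s v)
  then show ?case
  proof (cases "s = []")
    case False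
    then have "vs (tl s) \<union> {fst (hd s)} = vs s" by (cases s) auto
    then show ?thesis using 2 False by auto
  qed simp
qed simp

lemma segs_mir: "(w, t) \<in> set (mir s v) ==> \<exists>w' t'. (w', t') \<in> set s \<and> t = rev t'"
  by (induction s v rule: mir.induct) (auto split: if_splits, (blast+)?)

lemma length_mir[simp]: "length (mir s v) = length s"
  by (induction s v rule: mir.induct) auto

text \<open>Here \<open>a\<close> is the first vertex of a list \<open>zs\<close> and \<open>b\<close> the first vertex of another one;
  these are the positions where the crossing argument of Ore's theorem loses a unit.\<close>

fun unc :: "('a => 'a => bool) => 'a => 'a => 'a list => 'a set" where
  "unc E a b [] = {}"
| "unc E a b [z] = (if E b z then {} else {z})"
| "unc E a b (z # z' # zs) = (if E b z \<or> E a z' then {} else {z}) \<union> unc E a b (z' # zs)"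

lemma unc_sub: "unc E a b zs \<subseteq> set zs"
  by (induction E a b zs rule: unc.induct) auto

lemma unc_mem:
  "distinct (xs @ z # ys) ==> z \<in> unc E a b (xs @ z # ys) \<longleftrightarrow> \<not> E b z \<and> (ys = [] \<or> \<not> E a (hd ys))"
proof (induction xs)
  case Nil
  have "z \<notin> unc E a b ys" using Nil unc_sub[of E a b ys] by auto
  then show ?case by (cases ys) auto
next
  case (Cons x xs)
  then have "z \<in> unc E a b (xs @ z # ys) \<longleftrightarrow> \<not> E b z \<and> (ys = [] \<or> \<not> E a (hd ys))" by auto
  moreover have "x \<noteq> z" using Cons.prems by auto
  ultimately show ?case by (cases xs) auto
qed

text \<open>Each position z is uncovered, or adjacent to b, or followed by a neighbour of a, and the
  hypothesis makes the last two exclusive. The last kind is counted at the successor, hence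
  \<open>tl\<close>.\<close>

lemma unc_card:
  assumes "distinct zs"
    and "\<And>xs z z' ys. zs = xs @ z # z' # ys ==> \<not> (E b z \<and> E a z')"
  shows "card (unc E a b zs) + card {z \<in> set zs. E b z} + card {z \<in> set (tl zs). E a z} = length zs"
  using assms
proof (induction E a b zs rule: unc.induct)
  case (2 E a b z)
  have "{x. x = z \<and> E b x} = (if E b z then {z} else {})" by auto
  then show ?case by auto
next
  case (3 E a b z z' zs)
  have n: "\<not> (E b z \<and> E a z')" using 3(3)[of "[]" z z' zs] by auto
  have IH: "card (unc E a b (z' # zs)) + card {x \<in> set (z' # zs). E b x} + card {x \<in> set zs. E a x} = length (z' # zs)"
    using 3(1) 3(2) 3(3)[of "z # _"] by (auto simp del: unc.simps)
  have fu: "finite (unc E a b (z' # zs))" by (rule finite_subset[OF unc_sub]) auto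
  have zu: "z \<notin> unc E a b (z' # zs)" using 3(2) unc_sub[of E a b "z' # zs"] by auto
  have c1: "card (unc E a b (z # z' # zs)) = (if E b z \<or> E a z' then 0 else 1) + card (unc E a b (z' # zs))"
    using fu zu by auto
  have s2: "{x \<in> set (z # z' # zs). E b x} = (if E b z then {z} else {}) \<union> {x \<in> set (z' # zs). E b x}" by auto
  have c2: "card {x \<in> set (z # z' # zs). E b x} = (if E b z then 1 else 0) + card {x \<in> set (z' # zs). E b x}"
    unfolding s2 using 3(2) by (subst card_Un_disjoint) auto
  have s3: "{x \<in> set (z' # zs). E a x} = (if E a z' then {z'} else {}) \<union> {x \<in> set zs. E a x}" by auto
  have c3: "card {x \<in> set (z' # zs). E a x} = (if E a z' then 1 else 0) + card {x \<in> set zs. E a x}"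
    unfolding s3 using 3(2) by (subst card_Un_disjoint) auto
  show ?case using IH c1 c2 c3 n by auto
qed auto

section \<open>Ore count for two paths that cover the cycle\<close>

context tgraph
begin

text \<open>An edge between the two first vertices, a crossing pair of edges on \<open>A\<close> or
  \<open>B\<close>, or a common neighbour in \<open>Os\<close> would each give a path from
  \<open>last A\<close> to \<open>last B\<close> through everything, which \<open>noQ\<close>
  forbids. So each position and each vertex of \<open>Os\<close> pays for at most one edge at
  \<open>hd A\<close> or \<open>hd B\<close>, and an uncovered position pays for none.\<close>

lemma count_deg:
  assumes d: "distinct (A @ B)" and wA: "walk A" and wB: "walk B" and ne: "A \<noteq> []" "B \<noteq> []"
    and CV: "set (A @ B) \<subseteq> V" and H: "H \<subseteq> V - set (A @ B)"
    and O: "Os = V - set (A @ B) - H"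
    and nH: "\<And>x. x \<in> H ==> \<not> E x (hd A) \<and> \<not> E x (hd B)"
    and noQ: "\<And>os Q. walk Q ==> distinct os ==> set os \<subseteq> Os ==> mset Q = mset (A @ B @ os) ==>
       hd Q = last A ==> last Q = last B ==> False"
  shows "card (unc E (hd A) (hd B) A) + card (unc E (hd B) (hd A) B) + deg (hd A) + deg (hd B) + card H \<le> card V"
proof -
  define a b where "a = hd A" and "b = hd B"
  have ab: "\<not> E a b"
  proof
    assume "E a b"
    then have "walk (rev A @ B)" using wA wB ne by (auto simp: walk_append a_def b_def last_rev)
    from noQ[OF this, of "[]"] ne show False by (simp add: hd_rev)
  qed
  have crA: "\<not> (E b z \<and> E a z')" if "A = xs @ z # z' # ys" for xs z z' ys
  proof
    assume e: "E b z \<and> E a z'"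
    have "walk (rev (z' # ys) @ (xs @ [z]) @ B)"
      using wA wB ne e that unfolding a_def b_def
      by (auto simp: walk_append walk_Cons hd_append hd_rev last_rev Ec split: if_splits)
    then show False by (rule noQ[where os = "[]"]) (use ne that in \<open>auto simp: hd_append last_append hd_rev split: if_splits\<close>)
  qed
  have crB: "\<not> (E a z \<and> E b z')" if "B = xs @ z # z' # ys" for xs z z' ys
  proof
    assume e: "E a z \<and> E b z'"
    have "walk (rev A @ rev (xs @ [z]) @ z' # ys)"
      using wA wB ne e that unfolding a_def b_def
      by (auto simp: walk_append walk_Cons hd_append hd_rev last_rev Ec split: if_splits)
    from noQ[OF this, of "[]"] ne that show False by (auto simp: hd_append last_append hd_rev)
  qed
  have noO: "\<not> (E a y \<and> E b y)" if "y \<in> Os" for y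
  proof
    assume e: "E a y \<and> E b y"
    have "walk (rev A @ [y] @ B)"
      using wA wB ne e unfolding a_def b_def
      by (simp add: walk_append walk_Cons hd_rev last_rev Ec)
    from noQ[OF this, of "[y]"] ne that show False by (auto simp: hd_append last_append hd_rev)
  qed
  have finO: "finite Os" using O fin by auto
  have dA: "distinct A" and dB: "distinct B" and dis: "set A \<inter> set B = {}" using d by auto
  have cA: "card (unc E a b A) + card {z \<in> set A. E b z} + card {z \<in> set (tl A). E a z} = length A"
    by (rule unc_card[OF dA]) (use crA in blast)
  have cB: "card (unc E b a B) + card {z \<in> set B. E a z} + card {z \<in> set (tl B). E b z} = length B"
    by (rule unc_card[OF dB]) (use crB in blast)
  have tA: "{z \<in> set (tl A). E a z} = {z \<in> set A. E a z}"
    using ne irr by (cases A) (auto simp: a_def)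
  have tB: "{z \<in> set (tl B). E b z} = {z \<in> set B. E b z}"
    using ne irr by (cases B) (auto simp: b_def)
  have degs: "deg x = card {z \<in> set A. E x z} + card {z \<in> set B. E x z} + card {z \<in> Os. E x z}"
    if "x = a \<or> x = b" for x
  proof -
    have "nb x = ({z \<in> set A. E x z} \<union> {z \<in> set B. E x z}) \<union> {z \<in> Os. E x z}"
      using that nH O EV2 Ec by (auto simp: in_nb a_def b_def)
    moreover have "card \<dots> = card {z \<in> set A. E x z} + card {z \<in> set B. E x z} + card {z \<in> Os. E x z}"
      using dis O finO fin by (subst card_Un_disjoint; (subst card_Un_disjoint)?) auto
    ultimately show ?thesis by (simp add: deg_def)
  qed
  have "{z \<in> Os. E a z} \<inter> {z \<in> Os. E b z} = {}" using noO by auto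
  then have "card {z \<in> Os. E a z} + card {z \<in> Os. E b z} = card ({z \<in> Os. E a z} \<union> {z \<in> Os. E b z})"
    using finO by (subst card_Un_disjoint) auto
  also have "\<dots> \<le> card Os" using finO by (intro card_mono) auto
  finally have co: "card {z \<in> Os. E a z} + card {z \<in> Os. E b z} \<le> card Os" .
  have finH: "finite H" using H fin finite_subset by blast
  have "V = set A \<union> set B \<union> H \<union> Os" using CV H O by auto
  then have "card V = card ((set A \<union> set B) \<union> H \<union> Os)" by simp
  also have "\<dots> = card (set A \<union> set B) + card H + card Os"
    using finH finO H O fin by (subst card_Un_disjoint; (subst card_Un_disjoint)?) auto
  also have "card (set A \<union> set B) = length A + length B"
    using dis distinct_card[OF dA] distinct_card[OF dB] by (subst card_Un_disjoint) auto
  finally have cV: "card V = length A + length B + card H + card Os" .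
  show ?thesis using cA cB tA tB degs[of a] degs[of b] co cV unfolding a_def b_def by simp
qed

text \<open>The vertices h, \<open>hd A\<close> and \<open>hd B\<close> are independent, so the
  degree condition turns the bound of \<open>count_deg\<close> into one by deg h alone.\<close>

lemma count:
  assumes d: "distinct (A @ B)" and wA: "walk A" and wB: "walk B" and ne: "A \<noteq> []" "B \<noteq> []"
    and CV: "set (A @ B) \<subseteq> V" and H: "H \<subseteq> V - set (A @ B)" "h \<in> H"
    and O: "Os = V - set (A @ B) - H"
    and nH: "\<And>x. x \<in> H ==> \<not> E x (hd A) \<and> \<not> E x (hd B)"
    and noQ: "\<And>os Q. walk Q ==> distinct os ==> set os \<subseteq> Os ==> mset Q = mset (A @ B @ os) ==>
       hd Q = last A ==> last Q = last B ==> False"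
  shows "card (unc E (hd A) (hd B) A) + card (unc E (hd B) (hd A) B) + card H \<le> deg h"
proof -
  have aA: "hd A \<in> set A" and bB: "hd B \<in> set B" using ne by auto
  have "\<not> E (hd A) (hd B)"
  proof
    assume "E (hd A) (hd B)"
    then have "walk (rev A @ B)" using wA wB ne by (auto simp: walk_append last_rev)
    from noQ[OF this, of "[]"] ne show False by (simp add: hd_rev)
  qed
  moreover have "hd A \<noteq> hd B" using aA bB d by auto
  ultimately have "card V \<le> deg h + deg (hd A) + deg (hd B)"
    using H aA bB CV nH[of h] by (intro sigma) auto
  then show ?thesis using count_deg[OF d wA wB ne CV H(1) O nH noQ] by fastforce
qed

section \<open>Cycles cut at attachments, and frames without detours\<close>

definition closed :: "'a list => bool" where
  "closed C \<longleftrightarrow> C \<noteq> [] \<and> distinct C \<and> walk C \<and> E (last C) (hd C) \<and> set C \<subseteq> V"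

lemma closed_rot: "closed (xs @ ys) ==> closed (ys @ xs)"
  unfolding closed_def by (cases "xs = []"; cases "ys = []") (auto simp: walk_append)

lemma closed_rev: "closed xs ==> closed (rev xs)"
  unfolding closed_def using Ec by (auto simp: last_rev hd_rev)

text \<open>The cut vertices contain all neighbours of \<open>H\<close> on the cycle, but need not
  be adjacent to \<open>H\<close>; \<open>frame\<close> adds this. The weaker notion is what holds
  when the cycle is cut at the hopping set, which can be larger than N(v).\<close>

definition ring :: "'a set => ('a \<times> 'a list) list => bool" where
  "ring H s \<longleftrightarrow> length s \<ge> 2 \<and> closed (flat s) \<and> H \<subseteq> V \<and> H \<noteq> {} \<and> H \<inter> set (flat s) = {} \<and>
     (\<forall>h\<in>H. nb h \<subseteq> H \<union> vs s) \<and> (\<forall>v t. (v, t) \<in> set s --> t \<noteq> []) \<and> card (vs s) = length s"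

definition frame :: "'a set => ('a \<times> 'a list) list => bool" where
  "frame H s \<longleftrightarrow> ring H s \<and> (\<forall>v\<in>vs s. \<exists>h\<in>H. E v h)"

lemma frame_ring: "frame H s ==> ring H s" by (simp add: frame_def)

lemma ringD:
  assumes "ring H s"
  shows "length s \<ge> 2" "distinct (flat s)" "walk (flat s)" "E (last (flat s)) (hd (flat s))" "set (flat s) \<subseteq> V"
    "H \<subseteq> V" "H \<noteq> {}" "H \<inter> set (flat s) = {}" "\<And>v t. (v, t) \<in> set s ==> t \<noteq> []" "card (vs s) = length s"
    "\<And>h x. h \<in> H ==> E h x ==> x \<in> H \<union> vs s" "s \<noteq> []"
  using assms unfolding ring_def closed_def nb_def by auto

lemma frame_cong:
  assumes "frame H s" "closed (flat s')" "set (flat s') = set (flat s)" "vs s' = vs s" "length s' = length s"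
    "\<And>v t. (v, t) \<in> set s' ==> t \<noteq> []"
  shows "frame H s'"
  unfolding frame_def ring_def assms(3) assms(4) assms(5) using assms(1)[unfolded frame_def ring_def] assms(2,6) by blast

lemma frame_rot:
  assumes "frame H (xs @ ys)"
  shows "frame H (ys @ xs)"
proof (rule frame_cong[OF assms])
  have "closed (flat xs @ flat ys)" using assms by (simp add: frame_def ring_def)
  then show "closed (flat (ys @ xs))" using closed_rot by simp
  show "\<And>v t. (v, t) \<in> set (ys @ xs) ==> t \<noteq> []" using assms by (auto simp: frame_def ring_def)
qed auto

lemma frameD:
  assumes "frame H s"
  shows "length s \<ge> 2" "distinct (flat s)" "walk (flat s)" "E (last (flat s)) (hd (flat s))" "set (flat s) \<subseteq> V"
    "H \<subseteq> V" "H \<noteq> {}" "H \<inter> set (flat s) = {}" "\<And>v t. (v, t) \<in> set s ==> t \<noteq> []" "card (vs s) = length s"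
    "\<And>h x. h \<in> H ==> E h x ==> x \<in> H \<union> vs s" "s \<noteq> []" "\<And>v. v \<in> vs s ==> \<exists>h\<in>H. E v h"
  using assms unfolding frame_def ring_def closed_def nb_def by auto

lemma frame_mir:
  assumes "frame H s"
  shows "frame H (mir s (fst (hd s)))"
proof (rule frame_cong[OF assms])
  have ne: "s \<noteq> []" using assms by (auto simp: frame_def ring_def)
  then obtain v t s' where s: "s = (v, t) # s'" by (cases s) auto
  have f: "flat (mir s v) @ [v] = rev (flat s @ [v])" using flat_mir[OF ne, of v] s by simp
  then have "flat (mir s v) @ [v] = v # rev (t @ flat s') @ [v]" by (simp add: s)
  then have f2: "flat (mir s v) = v # rev (t @ flat s')" by simp
  have "closed (rev (flat s))" using assms closed_rev by (auto simp: frame_def ring_def)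
  then have "closed (rev (t @ flat s') @ [v])" by (simp add: s)
  then have c: "closed ([v] @ rev (t @ flat s'))" by (rule closed_rot)
  have h: "fst (hd s) = v" by (simp add: s)
  show "closed (flat (mir s (fst (hd s))))" unfolding h f2 using c by simp
  show "set (flat (mir s (fst (hd s)))) = set (flat s)" unfolding h f2 by (auto simp: s)
  show "vs (mir s (fst (hd s))) = vs s" unfolding h using vs_mir[OF ne, of v] by (simp add: s del: mir.simps)
  show "t' \<noteq> []" if "(v', t') \<in> set (mir s (fst (hd s)))" for v' t'
    using segs_mir[OF that] assms by (auto simp: frame_def ring_def)
qed simp

text \<open>The last clause forbids a path between two attachments of \<open>H\<close> that misses at most one vertex
  of the cycle, unless the missed vertex is an attachment of small degree.\<close>

definition det :: "'a set => ('a \<times> 'a list) list => bool" where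
  "det H s \<longleftrightarrow> frame H s \<and>
     (\<forall>Q x. walk Q --> distinct Q --> set Q \<subseteq> V - H --> hd Q \<in> vs s --> last Q \<in> vs s --> hd Q \<noteq> last Q -->
        set (flat s) - set Q \<subseteq> {x} --> x \<in> vs s \<and> deg x \<le> card (vs s) \<and> 3 * card (vs s) + 1 \<le> card V)"

lemma det_frame: "det H s ==> frame H s" by (simp add: det_def)

lemma detQ:
  assumes "det H s" "walk Q" "distinct Q" "set Q \<subseteq> V - H" "hd Q \<in> vs s" "last Q \<in> vs s" "hd Q \<noteq> last Q"
    "set (flat s) - set Q \<subseteq> {x}"
  shows "x \<in> vs s \<and> deg x \<le> card (vs s) \<and> 3 * card (vs s) + 1 \<le> card V"
  using assms unfolding det_def by blast

lemma det_transfer: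
  assumes dt: "det H s" and f: "frame H s'" and e: "set (flat s') = set (flat s)" "vs s' = vs s"
  shows "det H s'"
  unfolding det_def e using f detQ[OF dt] by blast

lemma det_rot:
  assumes "det H (xs @ ys)"
  shows "det H (ys @ xs)"
  by (rule det_transfer[OF assms frame_rot[OF det_frame[OF assms]]]) auto

lemmas detD = frameD[OF det_frame]

lemma set_flat_mir_hd: "s \<noteq> [] ==> set (flat (mir s (fst (hd s)))) = set (flat s)"
proof -
  assume ne: "s \<noteq> []"
  then obtain v t s' where s: "s = (v, t) # s'" by (cases s) auto
  have "flat (mir s v) @ [v] = rev (flat s @ [v])" using flat_mir[OF ne, of v] s by simp
  then have "flat (mir s v) @ [v] = v # rev (t @ flat s') @ [v]" by (simp add: s)
  then have "flat (mir s v) = v # rev (t @ flat s')" by simp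
  then show ?thesis by (auto simp: s simp del: mir.simps)
qed

lemma det_mir:
  assumes "det H s"
  shows "det H (mir s (fst (hd s)))"
proof (rule det_transfer[OF assms frame_mir[OF det_frame[OF assms]]])
  have ne: "s \<noteq> []" using detD(12)[OF assms] .
  then obtain v t s' where s: "s = (v, t) # s'" by (cases s) auto
  show "set (flat (mir s (fst (hd s)))) = set (flat s)" by (rule set_flat_mir_hd[OF ne])
  show "vs (mir s (fst (hd s))) = vs s" using vs_mir[OF ne, of v] by (simp add: s del: mir.simps)
qed

definition Oset :: "'a set => ('a \<times> 'a list) list => 'a set" where
  "Oset H s = V - set (flat s) - H"

text \<open>Stating the path as a multiset (all of the cycle except x, plus some \<open>os\<close>
  off the cycle and off \<open>H\<close>) yields distinctness and coverage together, so that each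
  later detour only needs a walk and its two ends.\<close>

lemma npx:
  assumes dt: "det H s" and w: "walk Q" and m: "mset Q + {#x#} = mset (flat s @ os)"
    and os: "distinct os" "set os \<subseteq> Oset H s"
    and e: "hd Q \<in> vs s" "last Q \<in> vs s" "hd Q \<noteq> last Q"
  shows "x \<in> vs s \<and> deg x \<le> card (vs s) \<and> 3 * card (vs s) + 1 \<le> card V"
proof -
  have m': "mset (x # Q) = mset (flat s @ os)" using m by simp
  have "distinct (flat s @ os)" using detD(2)[OF dt] os by (auto simp: Oset_def)
  then have dx: "distinct (x # Q)" using mset_eq_distinct[OF m'] by simp
  have st: "insert x (set Q) = set (flat s) \<union> set os" using mset_eq_setD[OF m'] by simp
  have "set Q \<subseteq> V - H" using st os detD(5,8)[OF dt] by (auto simp: Oset_def)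
  moreover have "set (flat s) - set Q \<subseteq> {x}" using st by auto
  moreover have "distinct Q" using dx by simp
  ultimately show ?thesis using detQ[OF dt w _ _ e] by blast
qed

lemma np1:
  assumes "det H s" "walk Q" "mset Q + {#x#} = mset (flat s @ os)" "distinct os" "set os \<subseteq> Oset H s"
    "hd Q \<in> vs s" "last Q \<in> vs s" "hd Q \<noteq> last Q" "x \<notin> vs s"
  shows False
  using npx[OF assms(1-8)] assms(9) by auto

lemma np0:
  assumes dt: "det H s" and w: "walk Q" and m: "mset Q = mset (flat s @ os)"
    and os: "distinct os" "set os \<subseteq> Oset H s"
    and e: "hd Q \<in> vs s" "last Q \<in> vs s" "hd Q \<noteq> last Q"
  shows False
proof -
  obtain v t s' where s: "s = (v, t) # s'" using detD(12)[OF dt] by (cases s) auto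
  have t: "t \<noteq> []" using detD(9)[OF dt] s by auto
  have nv: "hd t \<notin> vs s" using seg_disj[OF detD(2)[OF dt], of v t "hd t"] s t by auto
  have "distinct (flat s @ os)" using detD(2)[OF dt] os by (auto simp: Oset_def)
  then have dx: "distinct Q" using mset_eq_distinct[OF m] by simp
  have st: "set Q = set (flat s) \<union> set os" using mset_eq_setD[OF m] by simp
  have "set Q \<subseteq> V - H" using st os detD(5,8)[OF dt] by (auto simp: Oset_def)
  moreover have "set (flat s) - set Q \<subseteq> {hd t}" using st by auto
  moreover note dx
  ultimately have "hd t \<in> vs s" using detQ[OF dt w _ _ e] by blast
  then show ?thesis using nv by simp
qed

end

text \<open>With v the attachment behind the section \<open>s\<close> of the cycle, this is the
  attachment that ends the segment in front of \<open>s\<close>, also if \<open>s\<close> is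
  empty.\<close>

definition nx :: "('a \<times> 'a list) list => 'a => 'a" where "nx s v = (if s = [] then v else fst (hd s))"

lemma nx_simps[simp]: "nx [] v = v" "nx ((a, t) # s) v = a"
  by (auto simp: nx_def)

lemma hd_flat_nx: "hd (flat s @ v # r) = nx s v"
  by (cases s) (auto simp: nx_def)

lemma nx_mem: "s \<noteq> [] ==> nx s v \<in> vs s"
  by (cases s) auto

lemma mir_append: "mir (xs @ ys) v = mir ys v @ mir xs (nx ys v)"
proof (induction xs v rule: mir.induct)
  case (2 a t s v)
  then show ?case by (cases ys; cases s) (auto simp: nx_def)
qed simp

definition hds :: "('a \<times> 'a list) list => 'a set" where "hds s = (\<lambda>(v, t). hd t) ` set s"

lemma hds_simps[simp]: "hds [] = {}" "hds ((v, t) # s) = insert (hd t) (hds s)" "hds (xs @ ys) = hds xs \<union> hds ys"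
  by (auto simp: hds_def)

lemma hds_flat: "\<forall>(v, t) \<in> set s. t \<noteq> [] ==> hds s \<subseteq> set (flat s)"
  by (induction s rule: flat.induct) auto

lemma hds_card: "\<forall>(v, t) \<in> set s. t \<noteq> [] ==> distinct (flat s) ==> card (hds s) = length s"
proof (induction s rule: flat.induct)
  case (2 v t s)
  then have "hds s \<subseteq> set (flat s)" "hd t \<in> set t" using hds_flat by auto
  then have "hd t \<notin> hds s" using 2(3) by auto
  moreover have "finite (hds s)" by (auto simp: hds_def)
  ultimately show ?case using 2 by simp
qed simp

context tgraph
begin

lemmas ls = walk_append walk_Cons hd_append last_append hd_rev last_rev Ec

lemma det_mir2:
  assumes "det H ((vi, Ti) # Ms @ (vj, Tj) # Ns)"
  shows "det H ((nx Ms vj, rev Ti) # mir Ns vi @ (nx Ns vi, rev Tj) # mir Ms vj)"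
proof -
  have "det H (mir ((vi, Ti) # Ms @ (vj, Tj) # Ns) vi)" using det_mir[OF assms] by simp
  also have "mir ((vi, Ti) # Ms @ (vj, Tj) # Ns) vi =
     (mir Ns vi @ (nx Ns vi, rev Tj) # mir Ms vj) @ [(nx Ms vj, rev Ti)]"
    by (cases Ms) (auto simp: mir_append nx_def)
  finally show ?thesis using det_rot by fastforce
qed

lemma Oset_mir2:
  "Oset H ((nx Ms vj, rev Ti) # mir Ns vi @ (nx Ns vi, rev Tj) # mir Ms vj) = Oset H ((vi, Ti) # Ms @ (vj, Tj) # Ns)"
proof -
  have *: "insert (nx s v) (set (flat (mir s v))) = insert v (set (flat s))" for s and v :: 'a
  proof (cases "s = []")
    case False
    then have "set (flat (mir s v) @ [fst (hd s)]) = set (rev (flat s @ [v]))" using flat_mir by metis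
    then show ?thesis using False by (auto simp: nx_def)
  qed simp
  have "set (flat ((nx Ms vj, rev Ti) # mir Ns vi @ (nx Ns vi, rev Tj) # mir Ms vj)) =
    set Ti \<union> set Tj \<union> insert (nx Ms vj) (set (flat (mir Ms vj))) \<union> insert (nx Ns vi) (set (flat (mir Ns vi)))" by auto
  also have "\<dots> = set (flat ((vi, Ti) # Ms @ (vj, Tj) # Ns))" unfolding * by auto
  finally show ?thesis by (simp add: Oset_def del: flat.simps)
qed

lemma ring_pairD:
  assumes cl: "closed (flat ((vi, Ti) # Ms @ (vj, Tj) # Ns))" and ne: "Ti \<noteq> []" "Tj \<noteq> []"
  shows "Ti \<noteq> []" "Tj \<noteq> []" "walk Ti" "walk Tj" "walk (flat Ms)" "walk (flat Ns)"
    "E vi (hd Ti)" "E vj (hd Tj)" "E (last Ti) (nx Ms vj)" "E (last Tj) (nx Ns vi)"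
    "Ms \<noteq> [] ==> E (last (flat Ms)) vj" "Ns \<noteq> [] ==> E (last (flat Ns)) vi"
    "Ms \<noteq> [] ==> nx Ms vj = hd (flat Ms)" "Ns \<noteq> [] ==> nx Ns vi = hd (flat Ns)"
    "distinct (vi # Ti @ flat Ms @ vj # Tj @ flat Ns)"
    "walk (Ti @ flat Ms @ [vj])" "walk (Tj @ flat Ns @ [vi])"
    "nx Ms vj \<noteq> vi" "nx Ns vi \<noteq> vj"
proof -
  show "Ti \<noteq> []" "Tj \<noteq> []" by fact+
  have w: "walk (vi # Ti @ flat Ms @ vj # Tj @ flat Ns)" using cl by (simp add: closed_def)
  have c: "E (last (vi # Ti @ flat Ms @ vj # Tj @ flat Ns)) vi" using cl by (simp add: closed_def)
  show d: "distinct (vi # Ti @ flat Ms @ vj # Tj @ flat Ns)" using cl by (simp add: closed_def)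
  show "walk Ti" "walk Tj" "walk (flat Ms)" "walk (flat Ns)" "E vi (hd Ti)" "E vj (hd Tj)"
    "E (last Ti) (nx Ms vj)" "Ms \<noteq> [] ==> E (last (flat Ms)) vj"
    using w ne by (auto simp: ls hd_flat nx_def split: if_splits)
  show "E (last Tj) (nx Ns vi)" "Ns \<noteq> [] ==> E (last (flat Ns)) vi"
    using w c ne by (auto simp: ls hd_flat nx_def split: if_splits)
  show "Ms \<noteq> [] ==> nx Ms vj = hd (flat Ms)" "Ns \<noteq> [] ==> nx Ns vi = hd (flat Ns)"
    by (auto simp: hd_flat nx_def)
  show "walk (Ti @ flat Ms @ [vj])" "walk (Tj @ flat Ns @ [vi])"
    using w c ne by (auto simp: ls split: if_splits)
  show "nx Ms vj \<noteq> vi" "nx Ns vi \<noteq> vj"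
    using d nx_mem[of Ms vj] nx_mem[of Ns vi] vs_flat[of Ms] vs_flat[of Ns] by (cases "Ms = []"; cases "Ns = []"; auto)+
qed

lemma fpairD:
  assumes dt: "frame H ((vi, Ti) # Ms @ (vj, Tj) # Ns)"
  shows "Ti \<noteq> []" "Tj \<noteq> []" "walk Ti" "walk Tj" "walk (flat Ms)" "walk (flat Ns)"
    "E vi (hd Ti)" "E vj (hd Tj)" "E (last Ti) (nx Ms vj)" "E (last Tj) (nx Ns vi)"
    "Ms \<noteq> [] ==> E (last (flat Ms)) vj" "Ns \<noteq> [] ==> E (last (flat Ns)) vi"
    "Ms \<noteq> [] ==> nx Ms vj = hd (flat Ms)" "Ns \<noteq> [] ==> nx Ns vi = hd (flat Ns)"
    "distinct (vi # Ti @ flat Ms @ vj # Tj @ flat Ns)"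
    "walk (Ti @ flat Ms @ [vj])" "walk (Tj @ flat Ns @ [vi])"
    "nx Ms vj \<noteq> vi" "nx Ns vi \<noteq> vj"
proof -
  have "closed (flat ((vi, Ti) # Ms @ (vj, Tj) # Ns))" using dt by (simp add: frame_def ring_def)
  moreover have "Ti \<noteq> []" "Tj \<noteq> []" using frameD(9)[OF dt] by auto
  ultimately show "Ti \<noteq> []" "Tj \<noteq> []" "walk Ti" "walk Tj" "walk (flat Ms)" "walk (flat Ns)"
    "E vi (hd Ti)" "E vj (hd Tj)" "E (last Ti) (nx Ms vj)" "E (last Tj) (nx Ns vi)"
    "Ms \<noteq> [] ==> E (last (flat Ms)) vj" "Ns \<noteq> [] ==> E (last (flat Ns)) vi"
    "Ms \<noteq> [] ==> nx Ms vj = hd (flat Ms)" "Ns \<noteq> [] ==> nx Ns vi = hd (flat Ns)"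
    "distinct (vi # Ti @ flat Ms @ vj # Tj @ flat Ns)"
    "walk (Ti @ flat Ms @ [vj])" "walk (Tj @ flat Ns @ [vi])"
    "nx Ms vj \<noteq> vi" "nx Ns vi \<noteq> vj"
    using ring_pairD[of vi Ti Ms vj Tj Ns] by blast+
qed

lemmas pairD = fpairD[OF det_frame]

text \<open>A one-vertex segment could be skipped: the rest of the cycle is a path between the
  attachments on its two sides, and the lost vertex is not an attachment.\<close>

lemma len2:
  assumes dt: "det H ((v, T) # R)"
  shows "length T \<ge> 2"
proof (rule ccontr)
  assume "\<not> ?thesis"
  then obtain u where T: "T = [u]" using detD(9)[OF dt, of v T] by (cases T) (auto simp: Suc_le_eq)
  obtain w U R' where R: "R = (w, U) # R'" using detD(1)[OF dt] by (cases R) auto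
  have wk: "walk (flat R @ [v])" using detD(3,4)[OF dt] R by (auto simp: ls)
  have d: "distinct (v # u # flat R)" using detD(2)[OF dt] T by simp
  have "u \<notin> vs ((v, T) # R)" using seg_disj[OF detD(2)[OF dt], of v T u] T by simp
  then show False
    using wk d by (intro np1[OF dt wk, of u "[]"]) (auto simp: T R)
qed

lemma link_nil: "link Os a b ==> (\<And>os. distinct os ==> set os \<subseteq> Os ==> walk (a # os @ [b]) ==> P) ==> P"
  unfolding link_def by auto

lemma walk_link:
  assumes "walk (a # os @ [b])" "xs \<noteq> []" "ys \<noteq> []" "last xs = a" "hd ys = b" "walk xs" "walk ys"
  shows "walk (xs @ os @ ys)"
  using assms by (cases os) (auto simp: ls)

text \<open>The link would close the path from vj back through \<open>Ms\<close> and
  \<open>Ti\<close> to \<open>hd Ti\<close>, then from \<open>hd Tj\<close> through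
  \<open>Ns\<close> to vi, which loses nothing.\<close>

lemma F0:
  assumes dt: "det H ((vi, Ti) # Ms @ (vj, Tj) # Ns)"
  shows "\<not> link (Oset H ((vi, Ti) # Ms @ (vj, Tj) # Ns)) (hd Ti) (hd Tj)"
proof
  note p = pairD[OF dt]
  assume "link (Oset H ((vi, Ti) # Ms @ (vj, Tj) # Ns)) (hd Ti) (hd Tj)"
  then show False
  proof (rule link_nil)
    fix os assume os: "distinct os" "set os \<subseteq> Oset H ((vi, Ti) # Ms @ (vj, Tj) # Ns)" "walk (hd Ti # os @ [hd Tj])"
    have w: "walk (rev (Ti @ flat Ms @ [vj]) @ os @ (Tj @ flat Ns @ [vi]))"
      by (rule walk_link[OF os(3)]) (use p in \<open>auto simp: ls\<close>)
    show False by (rule np0[OF dt w _ os(1,2)]) (use p in \<open>auto simp: ls\<close>)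
  qed
qed

lemma F0E:
  assumes dt: "det H ((vi, Ti) # Ms @ (vj, Tj) # Ns)"
  shows "\<not> E (hd Ti) (hd Tj)" "\<not> E (hd Tj) (hd Ti)"
  using F0[OF dt] link_E Ec by blast+

text \<open>The detour of \<open>F0\<close>, entering the second segment one vertex later; only u is
  lost.\<close>

lemma F0s:
  assumes dt: "det H ((vi, Ti) # Ms @ (vj, u # x # r) # Ns)"
  shows "\<not> E (hd Ti) x"
proof
  note p = pairD[OF dt]
  assume e: "E (hd Ti) x"
  have w: "walk (rev (Ti @ flat Ms @ [vj]) @ (x # r @ flat Ns @ [vi]))"
    using p(16,17) e p(1) by (auto simp: ls)
  have "u \<notin> vs ((vi, Ti) # Ms @ (vj, u # x # r) # Ns)"
    using seg_disj[OF detD(2)[OF dt], of vj "u # x # r" u] by auto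
  then show False by (intro np1[OF dt w, of u "[]"]) (use p in \<open>auto simp: ls\<close>)
qed

abbreviation UU :: "'a => 'a list => ('a \<times> 'a list) list => 'a => 'a list => ('a \<times> 'a list) list => 'a set" where
  "UU vi Ti Ms vj Tj Ns \<equiv> unc E (hd Ti) (hd Tj) (Ti @ flat Ms @ [vj]) \<union> unc E (hd Tj) (hd Ti) (Tj @ flat Ns @ [vi])"

lemma deg_h:
  assumes dt: "det H s" and h: "h \<in> H"
  shows "deg h + 1 \<le> card H + length s"
proof -
  have fH: "finite H" using detD(6)[OF dt] fin finite_subset by blast
  have "nb h \<subseteq> (H - {h}) \<union> vs s" using detD(11)[OF dt h] irr unfolding nb_def by blast
  then have "deg h \<le> card ((H - {h}) \<union> vs s)" unfolding deg_def using fH by (intro card_mono) (auto simp: vs_def)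
  also have "\<dots> \<le> card (H - {h}) + length s" using card_Un_le[of "H - {h}" "vs s"] detD(10)[OF dt] by simp
  finally have "deg h \<le> card (H - {h}) + length s" .
  moreover have "card H > 0" using h fH by (auto simp: card_gt_0_iff)
  moreover have "card (H - {h}) = card H - 1" using h fH by simp
  ultimately show ?thesis by linarith
qed

text \<open>\<open>count\<close> bounds the uncovered vertices by deg h - |H|, and h has at most |H|
  - 1 neighbours in \<open>H\<close> and one per attachment.\<close>

lemma pair_count:
  assumes dt: "det H ((vi, Ti) # Ms @ (vj, Tj) # Ns)"
  shows "card (UU vi Ti Ms vj Tj Ns) + 1 \<le> length ((vi, Ti) # Ms @ (vj, Tj) # Ns)"
proof -
  note p = pairD[OF dt]
  obtain h where h: "h \<in> H" using detD(7)[OF dt] by auto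
  let ?A = "Ti @ flat Ms @ [vj]" and ?B = "Tj @ flat Ns @ [vi]"
  have sub: "set (?A @ ?B) = set (flat ((vi, Ti) # Ms @ (vj, Tj) # Ns))" by auto
  have nv: "hd Ti \<notin> vs ((vi, Ti) # Ms @ (vj, Tj) # Ns)" "hd Tj \<notin> vs ((vi, Ti) # Ms @ (vj, Tj) # Ns)"
    using seg_disj[OF detD(2)[OF dt], of vi Ti "hd Ti"] seg_disj[OF detD(2)[OF dt], of vj Tj "hd Tj"] p(1,2) by auto
  have inC: "hd Ti \<in> set (?A @ ?B)" "hd Tj \<in> set (?A @ ?B)" using p(1,2) by auto
  have nH: "hd Ti \<notin> H" "hd Tj \<notin> H" using inC detD(8)[OF dt] unfolding sub by blast+
  have "card (unc E (hd ?A) (hd ?B) ?A) + card (unc E (hd ?B) (hd ?A) ?B) + card H \<le> deg h"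
  proof (rule count[where Os = "Oset H ((vi, Ti) # Ms @ (vj, Tj) # Ns)"])
    show "distinct (?A @ ?B)" using p(15) by auto
    show "walk ?A" "walk ?B" using p by auto
    show "set (?A @ ?B) \<subseteq> V" using detD(5)[OF dt] sub by simp
    show "H \<subseteq> V - set (?A @ ?B)" using detD(6,8)[OF dt] unfolding sub by blast
    show "Oset H ((vi, Ti) # Ms @ (vj, Tj) # Ns) = V - set (?A @ ?B) - H" unfolding sub Oset_def ..
    show "\<not> E x (hd ?A) \<and> \<not> E x (hd ?B)" if "x \<in> H" for x
    proof -
      have "\<not> E x (hd Ti) \<and> \<not> E x (hd Tj)" using detD(11)[OF dt that] nv nH by blast
      then show ?thesis using p(1,2) by simp
    qed
    show False if "walk Q" "distinct os" "set os \<subseteq> Oset H ((vi, Ti) # Ms @ (vj, Tj) # Ns)"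
       "mset Q = mset (?A @ ?B @ os)" "hd Q = last ?A" "last Q = last ?B" for os Q
      by (rule np0[OF dt that(1) _ that(2,3)]) (use that(4-6) p in auto)
  qed (use h p in auto)
  then have "card (unc E (hd Ti) (hd Tj) ?A) + card (unc E (hd Tj) (hd Ti) ?B) + card H \<le> deg h"
    using p(1,2) by simp
  moreover have "card (UU vi Ti Ms vj Tj Ns) \<le> card (unc E (hd Ti) (hd Tj) ?A) + card (unc E (hd Tj) (hd Ti) ?B)"
    by (rule card_Un_le)
  ultimately show ?thesis using deg_h[OF dt h] by simp
qed

text \<open>The two edges that could cover the first vertex of a third segment are excluded by
  \<open>F0E\<close> and \<open>F0s\<close>. With k segments this gives k - 2 uncovered vertices,
  against at most k - 1 by \<open>pair_count\<close>.\<close>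

lemma hd_unc:
  assumes dt: "det H ((vi, Ti) # (Xs @ (vm, Tm) # Ys) @ (vj, Tj) # Ns)"
  shows "hd Tm \<in> unc E (hd Ti) (hd Tj) (Ti @ flat (Xs @ (vm, Tm) # Ys) @ [vj])"
proof -
  have d1: "det H ((vm, Tm) # Ys @ (vj, Tj) # (Ns @ (vi, Ti) # Xs))"
    using det_rot[of H "(vi, Ti) # Xs" "(vm, Tm) # Ys @ (vj, Tj) # Ns"] dt by simp
  have d2: "det H ((vi, Ti) # Xs @ (vm, Tm) # (Ys @ (vj, Tj) # Ns))" using dt by simp
  have "length Tm \<ge> 2" using len2[OF d1] .
  then obtain u x r where T: "Tm = u # x # r" by (cases Tm; cases "tl Tm") auto
  have n1: "\<not> E (hd Tj) u" using F0E[OF d1] T by simp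
  have n2: "\<not> E (hd Ti) x" using F0s d2 T by blast
  have d: "distinct (Ti @ flat (Xs @ (vm, Tm) # Ys) @ [vj])" using pairD(15)[OF dt] by auto
  have eq: "Ti @ flat (Xs @ (vm, Tm) # Ys) @ [vj] = (Ti @ flat Xs @ [vm]) @ u # (x # r @ flat Ys @ [vj])" using T by simp
  show ?thesis using unc_mem[of "Ti @ flat Xs @ [vm]" u "x # r @ flat Ys @ [vj]" E "hd Ti" "hd Tj"] d n1 n2 unfolding eq by (simp add: T)
qed

text \<open>The count is tight up to one. Most later contradictions consist in exhibiting two
  uncovered vertices besides the first vertices of the other segments.\<close>

lemma extra:
  assumes dt: "det H ((vi, Ti) # Ms @ (vj, Tj) # Ns)"
    and x: "x \<in> UU vi Ti Ms vj Tj Ns" "x \<notin> hds (Ms @ Ns)" and y: "y \<in> UU vi Ti Ms vj Tj Ns" "y \<notin> hds (Ms @ Ns)"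
    and "x \<noteq> y"
  shows False
proof -
  let ?U = "UU vi Ti Ms vj Tj Ns"
  have t: "\<forall>(v, t) \<in> set (Ms @ Ns). t \<noteq> []" using detD(9)[OF dt] by auto
  have c: "card (hds (Ms @ Ns)) = length (Ms @ Ns)" by (rule hds_card[OF t]) (use pairD(15)[OF dt] in auto)
  have dr: "det H ((vj, Tj) # Ns @ (vi, Ti) # Ms)" using det_rot[of H "(vi, Ti) # Ms" "(vj, Tj) # Ns"] dt by simp
  have "hds Ms \<subseteq> ?U"
  proof
    fix z assume "z \<in> hds Ms"
    then obtain vm Tm where "(vm, Tm) \<in> set Ms" "z = hd Tm" by (auto simp: hds_def)
    then show "z \<in> ?U" using hd_unc dt by (metis UnI1 split_list)
  qed
  moreover have "hds Ns \<subseteq> ?U"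
  proof
    fix z assume "z \<in> hds Ns"
    then obtain vm Tm where "(vm, Tm) \<in> set Ns" "z = hd Tm" by (auto simp: hds_def)
    then show "z \<in> ?U" using hd_unc dr by (metis UnI2 split_list)
  qed
  ultimately have "insert x (insert y (hds (Ms @ Ns))) \<subseteq> ?U" using x y by auto
  moreover have "finite ?U" using finite_subset[OF unc_sub] by auto
  ultimately have "card (insert x (insert y (hds (Ms @ Ns)))) \<le> card ?U" by (rule card_mono[rotated])
  moreover have "card (insert x (insert y (hds (Ms @ Ns)))) = length (Ms @ Ns) + 2"
    using x y \<open>x \<noteq> y\<close> c by (simp add: card_insert_if hds_def)
  ultimately show False using pair_count[OF dt] by simp
qed

end

section \<open>Links between segments\<close>

lemma last_ne_hd: "distinct xs ==> length xs \<ge> 2 ==> last xs \<noteq> hd xs"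
  by (cases xs) (auto simp: last_conv_nth nth_eq_iff_index_eq)

lemma nx_vs: "nx s v \<in> insert v (vs s)"
  by (cases s) auto

context tgraph
begin

lemma set_flat: "set (flat s) = (\<Union>(v, t) \<in> set s. insert v (set t))"
  by (induction s rule: flat.induct) auto

lemma Oset_cong: "set s = set s' ==> Oset H s = Oset H s'"
  by (simp add: Oset_def set_flat)

lemma det_rot1: "det H (a # s) ==> det H (s @ [a])"
  using det_rot[of H "[a]" s] by simp

text \<open>With the edge, the path through \<open>Ms\<close> to vj, then \<open>Ti\<close>, the
  link, \<open>Tj\<close> and \<open>Ns\<close> to vi would lose nothing. \<open>X1b\<close> and
  \<open>F1l\<close> exclude similar shortcuts around the link.\<close>

lemma X1a:
  assumes dt: "det H ((vi, Ti) # Ms @ (vj, Tj) # Ns)"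
    and lk: "link (Oset H ((vi, Ti) # Ms @ (vj, Tj) # Ns)) (last Ti) (hd Tj)"
  shows "\<not> E (hd Ti) vj"
proof
  note p = pairD[OF dt]
  assume e: "E (hd Ti) vj"
  from lk show False
  proof (rule link_nil)
    fix os assume os: "distinct os" "set os \<subseteq> Oset H ((vi, Ti) # Ms @ (vj, Tj) # Ns)" "walk (last Ti # os @ [hd Tj])"
    have w: "walk ((flat Ms @ [vj] @ Ti) @ os @ (Tj @ flat Ns @ [vi]))"
      by (rule walk_link[OF os(3)]) (use p e in \<open>auto simp: ls\<close>)
    show False by (rule np0[OF dt w _ os(1,2)]) (use p(1,2,15,18,19) nx_vs[of Ms vj] in \<open>auto simp: hd_flat_nx\<close>)
  qed
qed

lemma X1b:
  assumes dt: "det H ((vi, Ti) # Ms @ (vj, Tj) # Ns)"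
    and lk: "link (Oset H ((vi, Ti) # Ms @ (vj, Tj) # Ns)) (last Ti) (hd Tj)"
  shows "\<not> E (last Tj) (nx Ms vj)"
proof
  note p = pairD[OF dt]
  assume e: "E (last Tj) (nx Ms vj)"
  from lk show False
  proof (rule link_nil)
    fix os assume os: "distinct os" "set os \<subseteq> Oset H ((vi, Ti) # Ms @ (vj, Tj) # Ns)" "walk (last Ti # os @ [hd Tj])"
    have w: "walk ((flat Ns @ [vi] @ Ti) @ os @ (Tj @ flat Ms @ [vj]))"
      by (rule walk_link[OF os(3)]) (use p e in \<open>auto simp: ls\<close>)
    show False by (rule np0[OF dt w _ os(1,2)]) (use p(1,2,15,18,19) nx_vs[of Ns vi] in \<open>auto simp: hd_flat_nx\<close>)
  qed
qed

lemma F1l: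
  assumes dt: "det H ((vi, Ti) # Ms @ (vj, Tj) # Ns)"
    and lk: "link (Oset H ((vi, Ti) # Ms @ (vj, Tj) # Ns)) (last Ti) (hd Tj)"
  shows "\<not> E (hd Ti) (nx Ms vj)"
proof
  note p = pairD[OF dt]
  assume e: "E (hd Ti) (nx Ms vj)"
  from link_sym[OF lk] show False
  proof (rule link_nil)
    fix os assume os: "distinct os" "set os \<subseteq> Oset H ((vi, Ti) # Ms @ (vj, Tj) # Ns)" "walk (hd Tj # os @ [last Ti])"
    have w: "walk (rev (Tj @ flat Ns @ [vi]) @ os @ (rev Ti @ flat Ms @ [vj]))"
      by (rule walk_link[OF os(3)]) (use p e in \<open>auto simp: ls\<close>)
    show False by (rule np0[OF dt w _ os(1,2)]) (use p(1,2,15) in \<open>auto simp: hd_append\<close>)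
  qed
qed

lemma UU1:
  assumes dt: "det H ((vi, Ti) # Ms @ (vj, Tj) # Ns)"
    and eq: "Ti @ flat Ms @ [vj] = xs @ z # ys" and z: "\<not> E (hd Tj) z" "ys = [] \<or> \<not> E (hd Ti) (hd ys)"
  shows "z \<in> UU vi Ti Ms vj Tj Ns"
proof -
  have "distinct (Ti @ flat Ms @ [vj])" using pairD(15)[OF dt] by auto
  then have "distinct (xs @ z # ys)" unfolding eq .
  from unc_mem[OF this, of E "hd Ti" "hd Tj"] have "z \<in> unc E (hd Ti) (hd Tj) (Ti @ flat Ms @ [vj])"
    using z unfolding eq by simp
  then show ?thesis by blast
qed

lemma UU2:
  assumes dt: "det H ((vi, Ti) # Ms @ (vj, Tj) # Ns)"
    and eq: "Tj @ flat Ns @ [vi] = xs @ z # ys" and z: "\<not> E (hd Ti) z" "ys = [] \<or> \<not> E (hd Tj) (hd ys)"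
  shows "z \<in> UU vi Ti Ms vj Tj Ns"
proof -
  have dr: "det H ((vj, Tj) # Ns @ (vi, Ti) # Ms)" using det_rot[of H "(vi, Ti) # Ms" "(vj, Tj) # Ns"] dt by simp
  from UU1[OF dr eq z] show ?thesis by blast
qed

lemma hds_seg:
  assumes dt: "det H (P @ (v, T) # R)" and z: "z \<in> set T" "z \<noteq> hd T \<or> X \<subseteq> set P \<union> set R" and X: "X \<subseteq> set (P @ (v, T) # R)"
  shows "z \<notin> (\<lambda>(v, t). hd t) ` X"
proof
  assume "z \<in> (\<lambda>(v, t). hd t) ` X"
  then obtain w U where w: "(w, U) \<in> X" "z = hd U" by auto
  have ne: "U \<noteq> []" using detD(9)[OF dt, of w U] w X by auto
  have d: "distinct (flat (P @ (v, T) # R))" by (rule detD(2)[OF dt])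
  have *: "(w, U) \<in> set s ==> hd U \<in> set (flat s)" for s using ne by (induction s rule: flat.induct) auto
  have "(w, U) \<in> set P \<or> (w, U) \<in> set R \<or> (w, U) = (v, T)" using w(1) X by auto
  then show False
  proof (elim disjE)
    assume "(w, U) = (v, T)"
    then have "(v, T) \<in> set P \<union> set R" using z w by auto
    then have "z \<in> set (flat P) \<union> set (flat R)" using *[of P] *[of R] w \<open>(w, U) = (v, T)\<close> by auto
    then show False using d z(1) by auto
  qed (use *[of P] *[of R] w d z(1) in auto)
qed

lemma vs_hds:
  assumes dt: "det H s" and "v \<in> vs s"
  shows "v \<notin> hds s"
proof
  assume "v \<in> hds s"
  then obtain w U where w: "(w, U) \<in> set s" "v = hd U" by (auto simp: hds_def)
  then have "v \<in> set U" using detD(9)[OF dt] by auto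
  then show False using seg_disj[OF detD(2)[OF dt] w(1)] assms(2) by blast
qed

text \<open>Otherwise \<open>last Ti\<close> and vj would be two extra uncovered vertices for the
  pair of consecutive segments \<open>Ti\<close>, \<open>Tm\<close>. The lemma moves a link to the
  segment right behind \<open>Ti\<close>.\<close>

lemma X2:
  assumes dt: "det H ((vi, Ti) # ((vm, Tm) # Ms) @ (vj, Tj) # Ns)"
    and lk: "link (Oset H ((vi, Ti) # ((vm, Tm) # Ms) @ (vj, Tj) # Ns)) (last Ti) (hd Tj)"
  shows "E (last Ti) (hd Tm)"
proof (rule ccontr)
  assume n: "\<not> E (last Ti) (hd Tm)"
  let ?N = "Ms @ (vj, Tj) # Ns"
  have dt2: "det H ((vi, Ti) # [] @ (vm, Tm) # ?N)" using dt by simp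
  have dm: "det H ((vm, Tm) # Ms @ (vj, Tj) # Ns @ [(vi, Ti)])" using det_rot1[OF dt] by simp
  have ne: "Ti \<noteq> []" "Tj \<noteq> []" using pairD(1,2)[OF dt] by auto
  have "\<not> E (hd Ti) vm" using F1l[OF dt lk] by simp
  then have "last Ti \<in> UU vi Ti [] vm Tm ?N"
    using ne n Ec[of "hd Tm" "last Ti"] by (intro UU1[OF dt2, of "butlast Ti" "last Ti" "[vm]"]) auto
  moreover have "vj \<in> UU vi Ti [] vm Tm ?N"
    using X1a[OF dt lk] F0E[OF dm] ne
    by (intro UU2[OF dt2, of "Tm @ flat Ms" vj "Tj @ flat Ns @ [vi]"]) auto
  moreover have "last Ti \<notin> hds ([] @ ?N)"
    unfolding hds_def by (rule hds_seg[of H "[]" vi Ti "(vm, Tm) # ?N"]) (use dt2 ne in auto)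
  moreover have "vj \<notin> hds ([] @ ?N)" using vs_hds[OF dt2, of vj] by auto
  moreover have "last Ti \<noteq> vj" using pairD(15)[OF dt] last_in_set[OF ne(1)] by auto
  ultimately show False using extra[OF dt2, of "last Ti" vj] by blast
qed

text \<open>The link joins \<open>T1\<close> and \<open>T2\<close> without v2, so an edge from the
  first or last vertex of a further segment could make v2 the end of a path through the whole
  cycle.\<close>

lemma X3a:
  assumes dt: "det H ((v1, T1) # (v2, T2) # P @ (vm, Tm) # S)"
    and lk: "link (Oset H ((v1, T1) # (v2, T2) # P @ (vm, Tm) # S)) (last T1) (hd T2)"
  shows "\<not> E (hd Tm) v2" "\<not> E (last Tm) v2"
proof -
  have dt12: "det H ((v1, T1) # [] @ (v2, T2) # P @ (vm, Tm) # S)" using dt by simp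
  have dt1m: "det H ((v1, T1) # ((v2, T2) # P) @ (vm, Tm) # S)" using dt by simp
  have dt2m: "det H ((v2, T2) # P @ (vm, Tm) # (S @ [(v1, T1)]))" using det_rot1[OF dt] by simp
  note p = pairD[OF dt12] and q = pairD[OF dt1m] and r = pairD[OF dt2m]
  show "\<not> E (hd Tm) v2"
  proof
    assume e: "E (hd Tm) v2"
    from link_sym[OF lk] show False
    proof (rule link_nil)
      fix os assume os: "distinct os" "set os \<subseteq> Oset H ((v1, T1) # (v2, T2) # P @ (vm, Tm) # S)" "walk (hd T2 # os @ [last T1])"
      have w: "walk (rev (T2 @ flat P @ [vm]) @ os @ (rev T1 @ rev (Tm @ flat S @ [v1]) @ [v2]))"
        by (rule walk_link[OF os(3)])
          (use p(1-3) sym[OF p(7)] e q(2,17) r(16) in \<open>auto simp: walk_append walk_Cons hd_append last_append hd_rev last_rev simp del: rev_append\<close>)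
      show False by (rule np0[OF dt w _ os(1,2)]) (use p(1,2,15) q(1,2,15) in \<open>auto simp: hd_append\<close>)
    qed
  qed
  show "\<not> E (last Tm) v2"
  proof
    assume e: "E (last Tm) v2"
    from lk show False
    proof (rule link_nil)
      fix os assume os: "distinct os" "set os \<subseteq> Oset H ((v1, T1) # (v2, T2) # P @ (vm, Tm) # S)" "walk (last T1 # os @ [hd T2])"
      have w: "walk ((flat S @ [v1] @ T1) @ os @ (T2 @ flat P @ [vm] @ Tm @ [v2]))"
        by (rule walk_link[OF os(3)])
          (use p(1-3,7) e q(2,4,8,17) r(16) in \<open>auto simp: walk_append walk_Cons hd_append last_append split: if_splits\<close>)
      show False by (rule np0[OF dt w _ os(1,2)]) (use p(1,2,15) q(1,2,15,19) nx_vs[of S v1] vs_flat[of S] in \<open>auto simp: hd_flat_nx\<close>)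
    qed
  qed
qed

text \<open>Otherwise \<open>last T1\<close> and v2 would both be extra for the pair
  \<open>T1\<close>, \<open>T3\<close>.\<close>

lemma X3b:
  assumes dt: "det H ((v1, T1) # (v2, T2) # (v3, T3) # Ns)"
    and lk: "link (Oset H ((v1, T1) # (v2, T2) # (v3, T3) # Ns)) (last T1) (hd T2)"
  shows "E (last T1) (hd T3)"
proof (rule ccontr)
  assume n: "\<not> E (last T1) (hd T3)"
  have d12: "det H ((v1, T1) # [] @ (v2, T2) # (v3, T3) # Ns)" using dt by simp
  have d13: "det H ((v1, T1) # [(v2, T2)] @ (v3, T3) # Ns)" using dt by simp
  have ne: "T1 \<noteq> []" "T2 \<noteq> []" using pairD(1,2)[OF d12] by auto
  have n12: "\<not> E (hd T1) v2" using X1a[OF d12] lk by simp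
  have n32: "\<not> E (hd T3) v2" using X3a(1)[of H v1 T1 v2 T2 "[]" v3 T3 Ns] dt lk by simp
  have "last T1 \<in> UU v1 T1 [(v2, T2)] v3 T3 Ns"
    using ne n n12 Ec[of "hd T3" "last T1"] by (intro UU1[OF d13, of "butlast T1" "last T1" "v2 # T2 @ [v3]"]) auto
  moreover have "v2 \<in> UU v1 T1 [(v2, T2)] v3 T3 Ns"
    using n32 F0E[OF d12] ne by (intro UU1[OF d13, of "T1" v2 "T2 @ [v3]"]) auto
  moreover have "last T1 \<notin> hds ([(v2, T2)] @ Ns)"
    unfolding hds_def by (rule hds_seg[of H "[]" v1 T1 "(v2, T2) # (v3, T3) # Ns"]) (use dt ne in auto)
  moreover have "v2 \<notin> hds ([(v2, T2)] @ Ns)" using vs_hds[OF dt, of v2] by auto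
  moreover have "last T1 \<noteq> v2" using pairD(15)[OF d12] last_in_set[OF ne(1)] by auto
  ultimately show False using extra[OF d13, of "last T1" v2] by blast
qed

lemma X3c:
  assumes dt: "det H ((v1, T1) # (v2, T2) # W @ [(vk, Tk)])"
    and lk: "link (Oset H ((v1, T1) # (v2, T2) # W @ [(vk, Tk)])) (last T1) (hd T2)"
  shows "E (hd T2) (last Tk)"
proof -
  have d12: "det H ((v1, T1) # [] @ (v2, T2) # W @ [(vk, Tk)])" using dt by simp
  let ?w = "nx (W @ [(vk, Tk)]) v1"
  have "det H ([(v2, rev T1)] @ (mir (W @ [(vk, Tk)]) v1 @ [(?w, rev T2)]))"
    using det_mir2[OF d12] by simp
  then have "det H ((mir (W @ [(vk, Tk)]) v1 @ [(?w, rev T2)]) @ [(v2, rev T1)])" by (rule det_rot)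
  then have "det H (mir (W @ [(vk, Tk)]) v1 @ ([(?w, rev T2), (v2, rev T1)]))" by simp
  then have "det H ([(?w, rev T2), (v2, rev T1)] @ mir (W @ [(vk, Tk)]) v1)" by (rule det_rot)
  then have dm: "det H ((?w, rev T2) # (v2, rev T1) # (v1, rev Tk) # mir W vk)" by (simp add: mir_append)
  have O: "Oset H ((?w, rev T2) # (v2, rev T1) # (v1, rev Tk) # mir W vk) = Oset H ((v1, T1) # (v2, T2) # W @ [(vk, Tk)])"
  proof -
    have "Oset H ((v2, rev T1) # mir (W @ [(vk, Tk)]) v1 @ [(?w, rev T2)]) = Oset H ((v1, T1) # (v2, T2) # W @ [(vk, Tk)])"
      using Oset_mir2[of H "[]" v2 T1 "W @ [(vk, Tk)]" v1 T2] by simp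
    moreover have "Oset H ((?w, rev T2) # (v2, rev T1) # (v1, rev Tk) # mir W vk) = Oset H ((v2, rev T1) # mir (W @ [(vk, Tk)]) v1 @ [(?w, rev T2)])"
      by (rule Oset_cong) (simp add: mir_append insert_commute)
    ultimately show ?thesis by simp
  qed
  have "T1 \<noteq> []" "T2 \<noteq> []" using pairD(1,2)[OF d12] by auto
  then show ?thesis using X3b[OF dm] link_sym[OF lk] O detD(9)[OF dt, of vk Tk] by (simp add: last_rev hd_rev)
qed

section \<open>Links across an attachment: three or more segments\<close>

definition xp :: "'a set => ('a \<times> 'a list) list => bool" where
  "xp H s \<longleftrightarrow> det H s \<and> link (Oset H s) (last (snd (hd s))) (hd (snd (hd (tl s))))"

text \<open>The path v1 T1 T3 ... Tk T2 v3 loses only v2, so v2 falls under the exception of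
  \<open>det\<close> and has small degree. The count then forces an edge from \<open>last T2\<close>
  to \<open>hd T3\<close>: the situation passes on to the next attachment, and by rotation to all of
  them.\<close>

lemma X3_step:
  assumes "xp H ((v1, T1) # (v2, T2) # (v3, T3) # Ns)"
  shows "xp H ((v2, T2) # (v3, T3) # Ns @ [(v1, T1)])" "deg v2 \<le> length ((v1, T1) # (v2, T2) # (v3, T3) # Ns)"
    "3 * length ((v1, T1) # (v2, T2) # (v3, T3) # Ns) + 1 \<le> card V"
proof -
  have dt: "det H ((v1, T1) # (v2, T2) # (v3, T3) # Ns)"
   and lk: "link (Oset H ((v1, T1) # (v2, T2) # (v3, T3) # Ns)) (last T1) (hd T2)"
    using assms by (auto simp: xp_def)
  have d12: "det H ((v1, T1) # [] @ (v2, T2) # (v3, T3) # Ns)" using dt by simp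
  have d13: "det H ((v1, T1) # [(v2, T2)] @ (v3, T3) # Ns)" using dt by simp
  note p = pairD[OF d12] and q = pairD[OF d13]
  have e13: "E (last T1) (hd T3)" by (rule X3b[OF dt lk])
  obtain W vk Tk where W: "(v3, T3) # Ns = W @ [(vk, Tk)]"
    using append_butlast_last_id[of "(v3, T3) # Ns"] by (metis list.distinct(1) surj_pair)
  have e2k: "E (hd T2) (last Tk)" using X3c[of H v1 T1 v2 T2 W vk Tk] dt lk W by simp
  have lF: "last (T3 @ flat Ns) = last Tk"
  proof -
    have "v3 # T3 @ flat Ns = flat W @ vk # Tk" using arg_cong[OF W, of flat] by simp
    then have "last (v3 # T3 @ flat Ns) = last (flat W @ vk # Tk)" by (simp only:)
    moreover have "(vk, Tk) \<in> set ((v3, T3) # Ns)" by (simp add: W)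
    then have "Tk \<noteq> []" using detD(9)[OF dt, of vk Tk] by auto
    ultimately show ?thesis using q(2) by simp
  qed
  have wF: "walk (T3 @ flat Ns)" using q(17) by (cases Ns) (auto simp: walk_append)
  define F where "F = T3 @ flat Ns"
  have F: "F \<noteq> []" "hd F = hd T3" "last F = last Tk" "walk F" using q(2) lF wF by (simp_all add: F_def)
  have "walk (v1 # T1 @ F @ T2 @ [v3])"
    using p(1-4,7,10) e13 e2k F Ec[of "last F"] by (simp add: walk_Cons walk_append)
  then have w: "walk (v1 # T1 @ (T3 @ flat Ns) @ T2 @ [v3])" unfolding F_def .
  show d: "deg v2 \<le> length ((v1, T1) # (v2, T2) # (v3, T3) # Ns)" "3 * length ((v1, T1) # (v2, T2) # (v3, T3) # Ns) + 1 \<le> card V"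
    using npx[OF dt w, of v2 "[]"] detD(10)[OF dt] q(15) by auto
  have n13: "\<not> E (hd T1) v3" using X1a[OF d13] e13 link_E by simp
  have n32: "\<not> E (hd T3) v2" using X3a(1)[of H v1 T1 v2 T2 "[]" v3 T3 Ns] dt lk by simp
  have e23: "E (last T2) (hd T3)"
  proof (rule ccontr)
    assume n: "\<not> E (last T2) (hd T3)"
    have l2: "length T2 \<ge> 2" using len2[of H v2 T2] det_rot1[OF dt] by simp
    have "distinct T2" using p(15) by simp
    then have lh: "last T2 \<noteq> hd T2" using l2 by (rule last_ne_hd)
    have "last T2 \<in> UU v1 T1 [(v2, T2)] v3 T3 Ns"
      using p(2) n n13 Ec[of "hd T3" "last T2"] by (intro UU1[OF d13, of "T1 @ v2 # butlast T2" "last T2" "[v3]"]) auto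
    moreover have "v2 \<in> UU v1 T1 [(v2, T2)] v3 T3 Ns"
      using n32 F0E[OF d12] p by (intro UU1[OF d13, of "T1" v2 "T2 @ [v3]"]) auto
    moreover have "last T2 \<notin> hds ([(v2, T2)] @ Ns)"
      unfolding hds_def by (rule hds_seg[of H "[(v1, T1)]" v2 T2 "(v3, T3) # Ns"]) (use dt p(2) lh in auto)
    moreover have "v2 \<notin> hds ([(v2, T2)] @ Ns)" using vs_hds[OF dt, of v2] by auto
    moreover have "last T2 \<noteq> v2" using p(15) last_in_set[OF p(2)] by auto
    ultimately show False using extra[OF d13, of "last T2" v2] by blast
  qed
  have "det H ((v2, T2) # (v3, T3) # Ns @ [(v1, T1)])" using det_rot1[OF dt] by simp
  then show "xp H ((v2, T2) # (v3, T3) # Ns @ [(v1, T1)])" using link_E[OF e23] by (simp add: xp_def)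
qed

lemma xp_rot:
  assumes "xp H (xs @ ys)" "length (xs @ ys) \<ge> 3"
  shows "xp H (ys @ xs)"
  using assms
proof (induction xs arbitrary: ys)
  case (Cons a xs)
  obtain v1 T1 v2 T2 v3 T3 Ns where e: "a # xs @ ys = (v1, T1) # (v2, T2) # (v3, T3) # Ns"
  proof -
    have "length (a # xs @ ys) \<ge> 3" using Cons.prems by simp
    then obtain b c d Ns where "a # xs @ ys = b # c # d # Ns"
      by (cases "xs @ ys"; cases "tl (xs @ ys)") auto
    then show ?thesis using that by (cases b; cases c; cases d) auto
  qed
  have "xp H ((v2, T2) # (v3, T3) # Ns @ [(v1, T1)])" using X3_step(1) Cons.prems(1) e by simp
  then have "xp H (xs @ (ys @ [a]))" using e by (metis append_Cons append_assoc list.inject)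
  from Cons.IH[OF this] Cons.prems show ?case by simp
qed simp

lemma xp_second:
  assumes "xp H s" "length s \<ge> 3" "(v, t) \<in> set s"
  obtains a A R where "xp H ((a, A) # (v, t) # R)" "set ((a, A) # (v, t) # R) = set s" "length ((a, A) # (v, t) # R) = length s"
proof -
  obtain xs ys where s: "s = xs @ (v, t) # ys" using assms(3) by (meson split_list)
  show ?thesis
  proof (cases xs rule: rev_cases)
    case Nil
    then obtain ys' a A where ys: "ys = ys' @ [(a, A)]" using assms(2) s by (cases ys rule: rev_cases) auto
    have "xp H (((v, t) # ys') @ [(a, A)])" using assms(1) s Nil ys by simp
    from xp_rot[OF this] show ?thesis using assms(2) s Nil ys by (intro that[of a A ys']) auto
  next
    case (snoc xs' b)
    then obtain a A where b: "b = (a, A)" by (cases b)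
    have "xp H (xs' @ ((a, A) # (v, t) # ys))" using assms(1) s snoc b by simp
    from xp_rot[OF this] show ?thesis using assms(2) s snoc b by (intro that[of a A "ys @ xs'"]) auto
  qed
qed

lemma xp_nadj:
  assumes "xp H s" "length s \<ge> 3" "(v, t) \<in> set s" "(w, u) \<in> set s" "v \<noteq> w"
  shows "\<not> E (hd u) v"
proof -
  obtain a A R where x: "xp H ((a, A) # (v, t) # R)" and st: "set ((a, A) # (v, t) # R) = set s"
    using xp_second[OF assms(1-3)] by metis
  have dt: "det H ((a, A) # (v, t) # R)" and lk: "link (Oset H ((a, A) # (v, t) # R)) (last A) (hd t)"
    using x by (auto simp: xp_def)
  have "(w, u) = (a, A) \<or> (w, u) \<in> set R" using assms(4,5) st by auto
  then show ?thesis
  proof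
    assume "(w, u) = (a, A)"
    then show ?thesis using X1a[of H a A "[]" v t R] dt lk by simp
  next
    assume "(w, u) \<in> set R"
    then obtain P S where R: "R = P @ (w, u) # S" by (meson split_list)
    show ?thesis using X3a(1)[of H a A v t P w u S] dt lk R by simp
  qed
qed

text \<open>No first vertex of a segment is adjacent to the attachment of another one, so with four
  segments v3 and v4 are two extra uncovered vertices. With three segments each attachment has
  degree 3, its neighbours being one vertex of \<open>H\<close> and two inside segments; the
  attachments are then independent with degree sum at most 9, below 3 * 3 + 1 <= n.\<close>

lemma X3_final:
  assumes x: "xp H s" and len: "length s \<ge> 3"
  shows False
proof -
  obtain v1 T1 v2 T2 v3 T3 Ns where s: "s = (v1, T1) # (v2, T2) # (v3, T3) # Ns"
  proof -
    obtain b c d Ns where "s = b # c # d # Ns"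
      using len by (cases s; cases "tl s"; cases "tl (tl s)") auto
    then show ?thesis using that by (cases b; cases c; cases d) auto
  qed
  have dt: "det H s" using x by (simp add: xp_def)
  have d12: "det H ((v1, T1) # [] @ (v2, T2) # (v3, T3) # Ns)" using dt s by simp
  note p = pairD[OF d12]
  have dv: "distinct (flat s)" by (rule detD(2)[OF dt])
  have memU: "w \<in> UU v1 T1 [] v2 T2 ((v3, T3) # Ns)" if "(v3, T3) # Ns = P @ (w, u) # S" for P w u S
  proof -
    have in_s: "(w, u) \<in> set s" "(v1, T1) \<in> set s" using that s by auto
    have ne: "v1 \<noteq> w" using dv that s by auto
    have n1: "\<not> E (hd T1) w" using xp_nadj[OF x len in_s] ne by simp
    have "det H ((v1, T1) # (v2, T2) # P @ (w, u) # S)" using dt s that by simp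
    from det_rot1[OF this] have "det H ((v2, T2) # P @ (w, u) # (S @ [(v1, T1)]))" by simp
    then have n2: "\<not> E (hd T2) (hd u)" using F0E by blast
    have "u \<noteq> []" using detD(9)[OF dt in_s(1)] .
    then show ?thesis using n1 n2 that
      by (intro UU2[OF d12, of "T2 @ flat P" w "u @ flat S @ [v1]"]) auto
  qed
  have "Ns = []"
  proof (rule ccontr)
    assume "Ns \<noteq> []"
    then obtain v4 T4 Ns' where N: "Ns = (v4, T4) # Ns'" by (cases Ns) auto
    have "v3 \<in> UU v1 T1 [] v2 T2 ((v3, T3) # Ns)" using memU[of "[]"] by simp
    moreover have "v4 \<in> UU v1 T1 [] v2 T2 ((v3, T3) # Ns)" using memU[of "[(v3, T3)]"] N by simp
    moreover have "v3 \<notin> hds s" "v4 \<notin> hds s" using vs_hds[OF dt] s N by auto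
    then have "v3 \<notin> hds ([] @ (v3, T3) # Ns)" "v4 \<notin> hds ([] @ (v3, T3) # Ns)" using s by auto
    moreover have "v3 \<noteq> v4" using dv s N by auto
    ultimately show False using extra[OF d12] by blast
  qed
  then have s3: "s = [(v1, T1), (v2, T2), (v3, T3)]" using s by simp
  have nb3: "nb v \<inter> {a, c} = {}" if y: "xp H [(a, A), (v, t), (c, Cc)]" for a A v t c Cc
  proof -
    have dy: "det H [(a, A), (v, t), (c, Cc)]" using y by (simp add: xp_def)
    have d2: "det H ((a, A) # [] @ (v, t) # [(c, Cc)])" using dy by simp
    note q = pairD[OF d2]
    obtain h where h: "h \<in> H" "E v h" using detD(13)[OF dy, of v] by auto
    have dg: "deg v \<le> 3" using X3_step(2)[OF y] by simp
    have sub: "{h, hd t, last A} \<subseteq> nb v" using h q(8,9) Ec by (auto simp: in_nb)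
    have l: "last A \<in> set A" "hd t \<in> set t" using q(1,2) by auto
    have "card {h, hd t, last A} = 3"
    proof -
      have "h \<noteq> hd t" "h \<noteq> last A" using h(1) l detD(8)[OF dy] by auto
      moreover have "hd t \<noteq> last A" using l q(15) by auto
      ultimately show ?thesis by simp
    qed
    then have "nb v = {h, hd t, last A}"
      using card_subset_eq[OF fin_nb sub] card_mono[OF fin_nb sub] dg by (simp add: deg_def)
    moreover have "a \<noteq> h" "c \<noteq> h" using h(1) detD(8)[OF dy] by auto
    moreover have "a \<notin> {hd t, last A}" "c \<notin> {hd t, last A}" using l q(15) by auto
    ultimately show ?thesis by auto
  qed
  have x1: "xp H [(v1, T1), (v2, T2), (v3, T3)]" using x s3 by simp
  have x2: "xp H [(v2, T2), (v3, T3), (v1, T1)]" using xp_rot[of H "[(v1, T1)]" "[(v2, T2), (v3, T3)]"] x1 by simp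
  have x3: "xp H [(v3, T3), (v1, T1), (v2, T2)]" using xp_rot[of H "[(v2, T2)]" "[(v3, T3), (v1, T1)]"] x2 by simp
  have n: "\<not> E v2 v1" "\<not> E v2 v3" "\<not> E v3 v1" using nb3[OF x1] nb3[OF x2] by (auto simp: in_nb)
  have dg: "deg v1 \<le> 3" "deg v2 \<le> 3" "deg v3 \<le> 3"
    using X3_step(2)[OF x1] X3_step(2)[OF x2] X3_step(2)[OF x3] by auto
  have "card V \<le> deg v1 + deg v2 + deg v3"
    using n Ec dv s3 detD(5)[OF dt] by (intro sigma) auto
  moreover have "3 * 3 + 1 \<le> card V" using X3_step(3)[OF x1] by simp
  ultimately show False using dg by linarith
qed

lemma F0m:
  assumes dt: "det H ((vi, Ti) # Ms @ (vj, Tj) # Ns)"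
  shows "\<not> link (Oset H ((vi, Ti) # Ms @ (vj, Tj) # Ns)) (last Ti) (last Tj)"
  using F0[OF det_mir2[OF dt]] pairD(1,2)[OF dt] unfolding Oset_mir2 by (simp add: hd_rev)

section \<open>Links across an attachment: two segments\<close>

lemma link_cross:
  assumes "walk (a # os @ [b])" "walk (c # os' @ [d])" "set os \<subseteq> Os" "set os' \<subseteq> Os" "y \<in> set os" "y \<in> set os'"
  shows "link Os b d"
proof -
  obtain x1 x2 where x: "os = x1 @ y # x2" using assms(5) by (meson split_list)
  obtain y1 y2 where y: "os' = y1 @ y # y2" using assms(6) by (meson split_list)
  have "walk (y # x2 @ [b])" using assms(1) x by (auto simp: walk_append walk_Cons hd_append)
  then have "walk (rev (y # x2 @ [b]))" by (simp only: walk_rev)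
  then have "walk (b # rev x2 @ [y])" by simp
  moreover have "walk (y # y2 @ [d])" using assms(2) y by (auto simp: walk_append walk_Cons hd_append)
  ultimately have "walk (b # (rev x2 @ y # y2) @ [d])" by (auto simp: walk_append walk_Cons hd_append split: if_splits)
  then show ?thesis using walk_shorten[of b "rev x2 @ y # y2" d Os] assms(3,4) x y by auto
qed

text \<open>\<open>T1\<close> is split as Z B at the last neighbour of its first vertex inside
  \<open>T1\<close>. Reversing Z rotates \<open>T1\<close> to a path starting at
  \<open>last Z\<close>, and the Ore count for \<open>last Z\<close> and \<open>hd T2\<close> leaves
  room for one uncovered vertex on \<open>T2 @ [v1]\<close>, although v1 and \<open>last T2\<close>
  both turn out to be uncovered.\<close>

lemma X4_core:
  assumes dt: "det H [(v1, T1), (v2, T2)]"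
    and lk: "link (Oset H [(v1, T1), (v2, T2)]) (last T1) (hd T2)"
    and cr: "link (Oset H [(v1, T1), (v2, T2)]) (last T2) (hd T1) \<or>
       (\<exists>\<alpha> z0 z1 \<beta>. T1 = \<alpha> @ z0 # z1 # \<beta> \<and> E (hd T1) z1 \<and> E (last T2) z0)"
  shows False
proof -
  let ?O = "Oset H [(v1, T1), (v2, T2)]"
  have d12: "det H ((v1, T1) # [] @ (v2, T2) # [])" using dt by simp
  have d21: "det H ((v2, T2) # [] @ (v1, T1) # [])" using det_rot1[OF dt] by simp
  have O21: "Oset H [(v2, T2), (v1, T1)] = ?O" by (rule Oset_cong) auto
  note p = pairD[OF d12]
  note dst = p(15)
  have n12: "\<not> E (hd T1) v2" using X1a[OF d12] lk by simp
  have n21: "\<not> E (hd T2) v1"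
    using cr
  proof
    assume "link ?O (last T2) (hd T1)"
    then show ?thesis using X1a[OF d21] O21 by simp
  next
    assume "\<exists>\<alpha> z0 z1 \<beta>. T1 = \<alpha> @ z0 # z1 # \<beta> \<and> E (hd T1) z1 \<and> E (last T2) z0"
    then obtain \<alpha> z0 z1 \<beta> where z: "T1 = \<alpha> @ z0 # z1 # \<beta>" "E (hd T1) z1" "E (last T2) z0" by blast
    show ?thesis
    proof
      assume e: "E (hd T2) v1"
      have h1: "hd (\<alpha> @ [z0]) = hd T1" using z(1) by (cases \<alpha>) auto
      have w1: "walk (\<alpha> @ [z0])" "walk (z1 # \<beta>)" using p(3) z(1) by (auto simp: walk_append walk_Cons)
      have l1: "last (z1 # \<beta>) = last T1" using z(1) by simp
      have "walk ([v1] @ T2 @ rev (\<alpha> @ [z0]) @ (z1 # \<beta>) @ [v2])"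
        using e z(2,3) h1 w1 l1 p(1-4,9) Ec[of v1 "hd T2"]
        by (simp add: walk_append walk_Cons hd_rev last_rev del: rev_append hd_append append_Cons)
      from np0[OF dt this, of "[]"] show False using dst z(1) by auto
    qed
  qed
  obtain Z B where ZB: "T1 = Z @ B" "Z \<noteq> []" "B \<noteq> []" "E (hd T1) (hd B)" "\<forall>x\<in>set (tl B). \<not> E (hd T1) x"
  proof -
    have "length T1 \<ge> 2" using len2 dt by blast
    then obtain u x r where T1: "T1 = u # x # r" by (cases T1; cases "tl T1") auto
    then have "\<exists>y\<in>set (x # r). E u y" using p(3) by (auto simp: walk_Cons)
    then obtain ys y zs where "x # r = ys @ y # zs" "E u y" "\<forall>a\<in>set zs. \<not> E u a"
      using split_list_last_prop[of "x # r" "E u"] by blast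
    then show ?thesis using T1 by (intro that[of "u # ys" "y # zs"]) auto
  qed
  have hZ: "hd Z = hd T1" and lB: "last B = last T1" using ZB by auto
  have wZ: "walk Z" "walk B" using p(3) ZB by (auto simp: walk_append)
  have BU: "x \<in> UU v1 T1 [] v2 T2 []" if "B = b1 @ x # b2" "\<not> E (hd T2) x" for b1 x b2
    using that ZB n12 by (intro UU1[OF d12, of "Z @ b1" x "b2 @ [v2]"]) (cases b1; cases b2; auto)+
  \<comment> \<open>A connection from the beginning of B to \<open>hd T2\<close>; \<open>pre\<close>
    is the at most one vertex of B lost by using it. If neither of the first two vertices of B were
    adjacent to \<open>hd T2\<close>, they would be two extra uncovered vertices; a one-vertex B
    uses the given link.\<close>
  have "\<exists>pre B2 os. B = pre @ B2 \<and> length pre \<le> 1 \<and> B2 \<noteq> [] \<and> distinct os \<and> set os \<subseteq> ?O \<and> walk (hd B2 # os @ [hd T2])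
     \<and> (os \<noteq> [] --> hd B2 = last T1)"
  proof (cases "E (hd T2) (hd B)")
    case True
    then show ?thesis using ZB(3) Ec[of "hd B"] by - (rule exI[of _ "[]"], rule exI[of _ B], rule exI[of _ "[]"], auto simp: walk_Cons)
  next
    case False
    then obtain b B' where B: "B = b # B'" using ZB by (cases B) auto
    show ?thesis
    proof (cases B')
      case Nil
      then show ?thesis using lk lB B by - (rule exI[of _ "[]"], rule exI[of _ B], auto simp: link_def)
    next
      case (Cons b2 B'')
      have "E (hd T2) b2"
      proof (rule ccontr)
        assume "\<not> E (hd T2) b2"
        then have "b2 \<in> UU v1 T1 [] v2 T2 []" "b \<in> UU v1 T1 [] v2 T2 []"
          using BU[of "[b]" b2 B''] BU[of "[]" b B'] B Cons False by auto
        moreover have "b \<noteq> b2" using dst ZB B Cons by auto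
        ultimately show False using extra[OF d12] by fastforce
      qed
      then show ?thesis using B Cons Ec[of b2] by - (rule exI[of _ "[b]"], rule exI[of _ B'], rule exI[of _ "[]"], auto simp: walk_Cons)
    qed
  qed
  then obtain pre B2 os where B2: "B = pre @ B2" "length pre \<le> 1" "B2 \<noteq> []" and os: "distinct os" "set os \<subseteq> ?O" "walk (hd B2 # os @ [hd T2])"
     "os \<noteq> [] ==> hd B2 = last T1" by blast
  have lB2: "last B2 = last T1" and wB2: "walk B2" using B2 lB wZ by (auto simp: walk_append)
  text \<open>Every way to leave \<open>T2\<close> into \<open>Z\<close> and to come out next to \<open>v1\<close> closes a detour.\<close>
  have fin_path: False if Y: "walk Y" "mset Y = mset Z" "Y \<noteq> []" "E (last Y) v1" and o2: "walk (last T2 # os' @ [hd Y])" "distinct os'" "set os' \<subseteq> ?O" "set os \<inter> set os' = {}" for Y os'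
  proof -
    have w0: "walk ((v2 # rev B2) @ os @ T2)"
    proof (rule walk_link[OF os(3)])
      show "last (v2 # rev B2) = hd B2" using B2(3) by (simp add: last_rev)
      show "walk (v2 # rev B2)" using B2(3) wB2 lB2 p(9) Ec[of v2] by (simp add: walk_Cons hd_rev)
    qed (use p in auto)
    have w1: "walk (((v2 # rev B2) @ os @ T2) @ os' @ (Y @ [v1]))"
      by (rule walk_link[OF o2(1)]) (use w0 p(2) Y in \<open>auto simp: walk_append walk_Cons\<close>)
    have d: "distinct (os @ os')" using os o2 by auto
    show False
    proof (cases pre)
      case Nil
      show False
        by (rule np0[OF dt w1, of "os @ os'"]) (use Nil d os o2 Y ZB B2 dst in auto)
    next
      case (Cons b r)
      then have pre: "pre = [b]" using B2(2) by auto
      have "b \<in> set T1" using ZB B2 pre by auto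
      then have "b \<notin> vs [(v1, T1), (v2, T2)]" using seg_disj[OF detD(2)[OF dt], of v1 T1 b] by auto
      then show False
        by (intro np1[OF dt w1, of b "os @ os'"]) (use pre d os o2 Y ZB B2 dst in auto)
    qed
  qed
  have nzw: "\<not> E (last T2) (last Z)"
  proof
    assume e: "E (last T2) (last Z)"
    have "E (hd Z) v1" using p(7) hZ Ec by simp
    then show False using fin_path[of "rev Z" "[]"] e wZ ZB(2) by (auto simp: walk_Cons hd_rev last_rev)
  qed
  have nzv: "\<not> E (last Z) v1"
  proof
    assume e: "E (last Z) v1"
    show False using cr
    proof
      assume "link ?O (last T2) (hd T1)"
      then show False
      proof (rule link_nil)
        fix os' assume o2: "distinct os'" "set os' \<subseteq> ?O" "walk (last T2 # os' @ [hd T1])"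
        have "set os \<inter> set os' = {}"
        proof (rule ccontr)
          assume "\<not> ?thesis"
          then obtain y where "y \<in> set os" "y \<in> set os'" by auto
          then have "link ?O (hd T2) (hd T1)" using link_cross[OF os(3) o2(3) os(2) o2(2)] by blast
          then show False using F0[OF d21] O21 by simp
        qed
        then show False using fin_path[of Z os'] o2 e wZ ZB(2) hZ by simp
      qed
    next
      assume "\<exists>\<alpha> z0 z1 \<beta>. T1 = \<alpha> @ z0 # z1 # \<beta> \<and> E (hd T1) z1 \<and> E (last T2) z0"
      then obtain \<alpha> z0 z1 \<beta> where z: "T1 = \<alpha> @ z0 # z1 # \<beta>" "E (hd T1) z1" "E (last T2) z0" by blast
      have "z1 \<notin> set (tl B)" using ZB(5) z(2) by auto
      have "\<exists>\<gamma>. Z = \<alpha> @ z0 # \<gamma>"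
      proof -
        have "Z @ B = (\<alpha> @ [z0]) @ (z1 # \<beta>)" using ZB(1) z(1) by simp
        then have "\<exists>us. Z = (\<alpha> @ [z0]) @ us \<and> us @ B = z1 # \<beta> \<or> Z @ us = \<alpha> @ [z0] \<and> B = us @ z1 # \<beta>"
          by (rule iffD1[OF append_eq_append_conv2])
        then obtain us where "Z = (\<alpha> @ [z0]) @ us \<and> us @ B = z1 # \<beta> \<or> Z @ us = \<alpha> @ [z0] \<and> B = us @ z1 # \<beta>" ..
        then show ?thesis
        proof
          assume u: "Z @ us = \<alpha> @ [z0] \<and> B = us @ z1 # \<beta>"
          then have "us = []" using \<open>z1 \<notin> set (tl B)\<close> by (cases us) auto
          then show ?thesis using u by (intro exI[of _ "[]"]) simp
        qed simp
      qed
      then obtain \<gamma> where Z: "Z = \<alpha> @ z0 # \<gamma>" by blast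
      show False
      proof (cases \<gamma>)
        case Nil
        then show False using nzw z(3) Z by simp
      next
        case (Cons z1' \<gamma>')
        then have zz: "z1' = z1" using Z ZB(1) z(1) by auto
        have h1: "hd (\<alpha> @ [z0]) = hd T1" using z(1) by (cases \<alpha>) auto
        have wz: "walk (\<alpha> @ [z0])" "walk (z1 # \<gamma>')" using wZ(1) Z Cons zz by (auto simp: walk_append walk_Cons)
        have "walk (rev (\<alpha> @ [z0]) @ (z1 # \<gamma>'))"
          using wz h1 z(2) by (subst walk_append) (simp add: last_rev del: rev_append)
        then show False using fin_path[of "rev (\<alpha> @ [z0]) @ (z1 # \<gamma>')" "[]"] Z Cons zz e z(3) by (auto simp: walk_Cons)
      qed
    qed
  qed
  obtain h where h: "h \<in> H" using detD(7)[OF dt] by auto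
  \<comment> \<open>The rotated version of \<open>T1 @ [v2]\<close>, with \<open>last Z\<close> as
    its first vertex.\<close>
  let ?A = "rev Z @ B @ [v2]" and ?B = "T2 @ [v1]"
  have sub: "set (?A @ ?B) = set (flat [(v1, T1), (v2, T2)])" using ZB by auto
  have ends: "last Z \<in> set T1" "hd T2 \<in> set T2" using ZB p(2) by auto
  have hA: "hd ?A = last Z" "hd ?B = hd T2" using ZB p(2) by (auto simp: hd_append hd_rev)
  have "card (unc E (hd ?A) (hd ?B) ?A) + card (unc E (hd ?B) (hd ?A) ?B) + card H \<le> deg h"
  proof (rule count[where Os = ?O])
    show "distinct (?A @ ?B)" using dst ZB by auto
    show "walk ?A" using wZ ZB(2-4) hZ lB p(9) by (simp add: walk_append last_rev)
    show "walk ?B" using p(2,4,10) by (simp add: walk_append)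
    show "set (?A @ ?B) \<subseteq> V" using detD(5)[OF dt] sub by simp
    show "H \<subseteq> V - set (?A @ ?B)" using detD(6,8)[OF dt] unfolding sub by blast
    show "?O = V - set (?A @ ?B) - H" unfolding sub Oset_def ..
    show "\<not> E x (hd ?A) \<and> \<not> E x (hd ?B)" if "x \<in> H" for x
    proof -
      have "last Z \<notin> vs [(v1, T1), (v2, T2)]" "hd T2 \<notin> vs [(v1, T1), (v2, T2)]"
        using ends seg_disj[OF detD(2)[OF dt], of v1 T1 "last Z"] seg_disj[OF detD(2)[OF dt], of v2 T2 "hd T2"] by auto
      moreover have "last Z \<notin> H" "hd T2 \<notin> H" using ends detD(8)[OF dt] by auto
      ultimately show ?thesis unfolding hA using detD(11)[OF dt that] by blast
    qed
    show False if "walk Q" "distinct os" "set os \<subseteq> ?O"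
       "mset Q = mset (?A @ ?B @ os)" "hd Q = last ?A" "last Q = last ?B" for os Q
      by (rule np0[OF dt that(1) _ that(2,3)]) (use that(4-6) dst ZB in auto)
  qed (use h p in auto)
  then have c: "card (unc E (hd T2) (last Z) ?B) \<le> 1" unfolding hA using deg_h[OF dt h] by simp
  have dB: "distinct ?B" using dst by auto
  have "v1 \<in> unc E (hd T2) (last Z) ?B" using unc_mem[of T2 v1 "[]" E] dB nzv by simp
  moreover have "last T2 \<in> unc E (hd T2) (last Z) ?B"
  proof -
    have eq: "?B = butlast T2 @ last T2 # [v1]" using p(2) by simp
    show ?thesis using unc_mem[of "butlast T2" "last T2" "[v1]" E "hd T2" "last Z"] dB nzw n21 Ec unfolding eq by auto
  qed
  moreover have "last T2 \<noteq> v1" using last_in_set[OF p(2)] dst by auto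
  moreover have "finite (unc E (hd T2) (last Z) ?B)" by (rule finite_subset[OF unc_sub]) auto
  ultimately have "card {v1, last T2} \<le> card (unc E (hd T2) (last Z) ?B)" by (intro card_mono) auto
  then show False using c \<open>last T2 \<noteq> v1\<close> by simp
qed

end

lemma hd_mir: "s \<noteq> [] ==> fst (hd (mir s v)) = v"
proof (induction s v rule: mir.induct)
  case (2 a t s v)
  then show ?case by (cases "s = []") auto
qed simp

lemma segs_mir2: "(w, t) \<in> set s ==> \<exists>w'. (w', rev t) \<in> set (mir s v)"
  by (induction s v rule: mir.induct) auto

context tgraph
begin

text \<open>\<open>X4_core\<close> excludes crossings between \<open>hd T1\<close> and
  \<open>last T2\<close> along \<open>T1 @ T2\<close>, where \<open>last T1\<close> and
  \<open>last T2\<close> are uncovered. Off this path each of the two can only see v1 and vertices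
  of \<open>Os\<close>, where they share none, so with h their degrees sum to less than n.\<close>

lemma X4_main:
  assumes dt: "det H [(v1, T1), (v2, T2)]"
    and lk: "link (Oset H [(v1, T1), (v2, T2)]) (last T1) (hd T2)"
  shows False
proof -
  let ?O = "Oset H [(v1, T1), (v2, T2)]"
  have d12: "det H ((v1, T1) # [] @ (v2, T2) # [])" using dt by simp
  note p = pairD[OF d12]
  note dst = p(15)
  have nl: "\<not> link ?O (last T2) (hd T1)" using X4_core[OF dt lk] by blast
  have nc1: "\<not> (E (hd T1) z1 \<and> E (last T2) z0)" if "T1 = \<alpha> @ z0 # z1 # \<beta>" for \<alpha> z0 z1 \<beta>
    using X4_core[OF dt lk] that by blast
  have nc2: "\<not> (E (hd T1) z1 \<and> E (last T2) z0)" if T2: "T2 = \<alpha> @ z0 # z1 # \<beta>" for \<alpha> z0 z1 \<beta>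
  proof
    assume e: "E (hd T1) z1 \<and> E (last T2) z0"
    have dm: "det H [(v1, rev T2), (v2, rev T1)]"
      using det_rot1[of H "(v2, rev T1)" "[(v1, rev T2)]"] det_mir2[OF d12] by simp
    have O: "Oset H [(v1, rev T2), (v2, rev T1)] = ?O" by (auto simp: Oset_def)
    have "rev T2 = rev \<beta> @ z1 # z0 # rev \<alpha>" using T2 by simp
    moreover have "E (hd (rev T2)) z0" "E (last (rev T1)) z1" using e p(1,2) by (auto simp: hd_rev last_rev)
    moreover have "link ?O (last (rev T2)) (hd (rev T1))" using link_sym[OF lk] p(1,2) by (simp add: hd_rev last_rev)
    ultimately show False using X4_core[OF dm] unfolding O by blast
  qed
  have n12: "\<not> E (hd T1) v2" using X1a[OF d12] lk by simp
  have n22: "\<not> E (last T2) v2" using X1b[OF d12] lk by simp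
  have nu: "\<not> E (hd T1) (hd T2)" by (rule F0E(1)[OF d12])
  have nw: "\<not> E (last T2) (last T1)" using F0m[OF d12] link_E Ec by blast
  have nuw: "\<not> E (hd T1) (last T2)" using nl link_E Ec by blast
  let ?Q = "T1 @ T2"
  have dQ: "distinct ?Q" using dst by auto
  have noc: "\<not> (E (last T2) z \<and> E (hd T1) z')" if "?Q = xs @ z # z' # ys" for xs z z' ys
  proof -
    have "?Q = (xs @ [z]) @ (z' # ys)" using that by simp
    then have "\<exists>us. T1 = (xs @ [z]) @ us \<and> us @ T2 = z' # ys \<or> T1 @ us = xs @ [z] \<and> T2 = us @ z' # ys"
      by (rule iffD1[OF append_eq_append_conv2])
    then obtain us where us: "T1 = (xs @ [z]) @ us \<and> us @ T2 = z' # ys \<or> T1 @ us = xs @ [z] \<and> T2 = us @ z' # ys" ..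
    show ?thesis
    proof (cases "us = []")
      case True
      then have "z = last T1" "z' = hd T2" using us p(2) by auto
      then show ?thesis using nu by simp
    next
      case False
      from us show ?thesis
      proof
        assume "T1 = (xs @ [z]) @ us \<and> us @ T2 = z' # ys"
        then have "T1 = xs @ z # z' # tl us" using False by (cases us) auto
        then show ?thesis using nc1 by blast
      next
        assume u: "T1 @ us = xs @ [z] \<and> T2 = us @ z' # ys"
        then have "last us = z" using False by (metis last_appendR last_snoc)
        then have "T2 = butlast us @ z # z' # ys" using u False append_butlast_last_id by fastforce
        then show ?thesis using nc2 by blast
      qed
    qed
  qed
  have cQ: "card (unc E (hd T1) (last T2) ?Q) + card {z \<in> set ?Q. E (last T2) z} + card {z \<in> set (tl ?Q). E (hd T1) z} = length ?Q"
    by (rule unc_card[OF dQ]) (use noc in blast)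
  have "card {last T1, last T2} \<le> card (unc E (hd T1) (last T2) ?Q)"
  proof (rule card_mono)
    show "finite (unc E (hd T1) (last T2) ?Q)" by (rule finite_subset[OF unc_sub]) auto
    have e1: "?Q = butlast T1 @ last T1 # T2" and e2: "?Q = (T1 @ butlast T2) @ last T2 # []" using p(1,2) by auto
    have "last T1 \<in> unc E (hd T1) (last T2) ?Q"
      unfolding e1 using unc_mem[of "butlast T1" "last T1" T2 E] dQ nw nu unfolding e1 by simp
    moreover have "last T2 \<in> unc E (hd T1) (last T2) ?Q"
      unfolding e2 using unc_mem[of "T1 @ butlast T2" "last T2" "[]" E] dQ irr unfolding e2 by simp
    ultimately show "{last T1, last T2} \<subseteq> unc E (hd T1) (last T2) ?Q" by simp
  qed
  moreover have l: "last T1 \<in> set T1" "last T2 \<in> set T2" "hd T1 \<in> set T1" using p(1,2) by auto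
  then have "last T1 \<noteq> last T2" using dst by auto
  ultimately have c2: "2 \<le> card (unc E (hd T1) (last T2) ?Q)" by simp
  obtain h where h: "h \<in> H" using detD(7)[OF dt] by auto
  have finO: "finite ?O" using fin by (simp add: Oset_def)
  have fH: "finite H" using detD(6)[OF dt] fin finite_subset by blast
  have nH: "\<not> E x y" if "x \<in> set T1 \<union> set T2" "y \<in> H" for x y
  proof -
    have "x \<notin> vs [(v1, T1), (v2, T2)]" using that(1) dst by auto
    moreover have "x \<notin> H" using that(1) detD(8)[OF dt] by auto
    ultimately show ?thesis using detD(11)[OF dt that(2), of x] Ec by blast
  qed
  have dg: "deg x \<le> card {z \<in> set ?Q. E x z} + 1 + card {z \<in> ?O. E x z}" if "x = hd T1 \<or> x = last T2" for x
  proof -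
    have xT: "x \<in> set T1 \<union> set T2" using that l by auto
    have "nb x \<subseteq> ({z \<in> set ?Q. E x z} \<union> {v1}) \<union> {z \<in> ?O. E x z}"
    proof
      fix y assume "y \<in> nb x"
      then have e: "E x y" by (simp add: in_nb)
      then have "y \<in> V" "y \<notin> H" "y \<noteq> v2" using EV2 nH[OF xT] that n12 n22 by auto
      then show "y \<in> ({z \<in> set ?Q. E x z} \<union> {v1}) \<union> {z \<in> ?O. E x z}" using e by (auto simp: Oset_def)
    qed
    then have "deg x \<le> card (({z \<in> set ?Q. E x z} \<union> {v1}) \<union> {z \<in> ?O. E x z})"
      unfolding deg_def using finO by (intro card_mono) auto
    also have "\<dots> \<le> card ({z \<in> set ?Q. E x z} \<union> {v1}) + card {z \<in> ?O. E x z}" by (rule card_Un_le)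
    also have "card ({z \<in> set ?Q. E x z} \<union> {v1}) \<le> card {z \<in> set ?Q. E x z} + card {v1}" by (rule card_Un_le)
    finally show ?thesis by simp
  qed
  have "{z \<in> ?O. E (hd T1) z} \<inter> {z \<in> ?O. E (last T2) z} = {}"
  proof -
    have False if "z \<in> ?O" "E (hd T1) z" "E (last T2) z" for z
    proof -
      have "walk (last T2 # [z] @ [hd T1])" using that Ec by (auto simp: walk_Cons)
      then have "link ?O (last T2) (hd T1)" using that walk_shorten[of "last T2" "[z]" "hd T1" ?O] by auto
      then show False using nl by simp
    qed
    then show ?thesis by auto
  qed
  then have "card {z \<in> ?O. E (hd T1) z} + card {z \<in> ?O. E (last T2) z} = card ({z \<in> ?O. E (hd T1) z} \<union> {z \<in> ?O. E (last T2) z})"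
    using finO by (subst card_Un_disjoint) auto
  also have "\<dots> \<le> card ?O" using finO by (intro card_mono) auto
  finally have co: "card {z \<in> ?O. E (hd T1) z} + card {z \<in> ?O. E (last T2) z} \<le> card ?O" .
  have "V = (set (flat [(v1, T1), (v2, T2)]) \<union> H) \<union> ?O" using detD(5,6)[OF dt] by (auto simp: Oset_def)
  then have "card V = card ((set (flat [(v1, T1), (v2, T2)]) \<union> H) \<union> ?O)" by (rule arg_cong)
  also have "\<dots> = card (set (flat [(v1, T1), (v2, T2)]) \<union> H) + card ?O"
    using finO fH by (intro card_Un_disjoint) (auto simp: Oset_def)
  also have "card (set (flat [(v1, T1), (v2, T2)]) \<union> H) = card (set (flat [(v1, T1), (v2, T2)])) + card H"
    using fH detD(8)[OF dt] by (intro card_Un_disjoint) auto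
  also have "card (set (flat [(v1, T1), (v2, T2)])) = length T1 + length T2 + 2"
    using distinct_card[OF detD(2)[OF dt]] by simp
  finally have cV: "card V = length T1 + length T2 + 2 + card H + card ?O" .
  have "tl ?Q = tl T1 @ T2" using p(1) by simp
  then have "{z \<in> set (tl ?Q). E (hd T1) z} = {z \<in> set ?Q. E (hd T1) z}" using p(1) irr by (cases T1) auto
  moreover have "card V \<le> deg h + deg (hd T1) + deg (last T2)"
  proof (rule sigma)
    show "h \<in> V" "hd T1 \<in> V" "last T2 \<in> V" using h detD(5,6)[OF dt] l by auto
    show "h \<noteq> hd T1" "h \<noteq> last T2" using h detD(8)[OF dt] l by auto
    show "hd T1 \<noteq> last T2" using l dst by auto
    show "\<not> E h (hd T1)" "\<not> E h (last T2)" using nH[OF _ h] l Ec by blast+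
  qed (rule nuw)
  ultimately show False using dg[of "hd T1"] dg[of "last T2"] co cV cQ c2 deg_h[OF dt h] by simp
qed

text \<open>\<open>X2\<close> moves the link to the segment following \<open>Ti\<close>; the number
  of segments then decides between \<open>X4_main\<close> and \<open>X3_final\<close>.\<close>

lemma noX:
  assumes dt: "det H ((vi, Ti) # Ms @ (vj, Tj) # Ns)"
  shows "\<not> link (Oset H ((vi, Ti) # Ms @ (vj, Tj) # Ns)) (last Ti) (hd Tj)"
proof
  let ?s = "(vi, Ti) # Ms @ (vj, Tj) # Ns"
  assume lk: "link (Oset H ?s) (last Ti) (hd Tj)"
  obtain vm Tm R where s: "?s = (vi, Ti) # (vm, Tm) # R" "link (Oset H ?s) (last Ti) (hd Tm)"
  proof (cases Ms)
    case Nil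
    then show ?thesis using that lk by auto
  next
    case (Cons m Ms')
    obtain vm Tm where m: "m = (vm, Tm)" by (cases m)
    have "E (last Ti) (hd Tm)" using X2[of H vi Ti vm Tm Ms' vj Tj Ns] dt lk Cons m by simp
    then show ?thesis using that[of vm Tm "Ms' @ (vj, Tj) # Ns"] Cons m link_E by simp
  qed
  show False
  proof (cases R)
    case Nil
    then show False using X4_main[of H vi Ti vm Tm] s dt by simp
  next
    case (Cons c R')
    then have "xp H ?s" "length ?s \<ge> 3" using s dt unfolding xp_def by simp_all
    then show False by (rule X3_final)
  qed
qed

text \<open>The detour enters \<open>Ti\<close> at g from \<open>hd Tj\<close>, runs back to
  \<open>hd Ti\<close> and jumps to the vertex behind g1, so that only g1 is lost.\<close>

lemma F2:
  assumes dt: "det H ((vi, Ti) # Ms @ (vj, Tj) # Ns)"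
    and T: "Ti = \<alpha> @ g # g1 # \<gamma>" and e: "E (hd Tj) g"
  shows "\<not> E (hd Ti) (hd (\<gamma> @ [nx Ms vj]))"
proof
  note p = pairD[OF dt]
  assume e2: "E (hd Ti) (hd (\<gamma> @ [nx Ms vj]))"
  have h: "hd (\<gamma> @ flat Ms @ [vj]) = hd (\<gamma> @ [nx Ms vj])" by (cases \<gamma>) (auto simp: hd_flat_nx)
  have h1: "hd (\<alpha> @ [g]) = hd Ti" using T by (cases \<alpha>) auto
  have wT: "walk (\<alpha> @ [g])" "walk (\<gamma> @ flat Ms @ [vj])"
    using p(16) T by (auto simp: walk_append walk_Cons)
  have w1: "walk (rev (\<alpha> @ [g]) @ (\<gamma> @ flat Ms @ [vj]))"
    using wT h h1 e2 by (subst walk_append) (simp add: last_rev del: rev_append)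
  have w: "walk (rev (Tj @ flat Ns @ [vi]) @ rev (\<alpha> @ [g]) @ (\<gamma> @ flat Ms @ [vj]))"
    using w1 p(2,17) e by (subst walk_append) (simp add: last_rev hd_rev del: rev_append)
  have "g1 \<notin> vs ((vi, Ti) # Ms @ (vj, Tj) # Ns)" using seg_disj[OF detD(2)[OF dt], of vi Ti g1] T by auto
  then show False
    by (intro np1[OF dt w, of g1 "[]"]) (use p(1,2,15) T in \<open>auto simp: hd_append\<close>)
qed

section \<open>Defective segments\<close>

text \<open>In such a segment a path can be cut after any vertex: the part up to it is reversed, and
  the first vertex of t continues behind the cut.\<close>

definition good :: "'a list => 'a => bool" where
  "good t v \<longleftrightarrow> (\<forall>y \<in> set (tl t) \<union> {v}. E (hd t) y)"

text \<open>g stands immediately before the last vertex of \<open>t @ [v]\<close> that the first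
  vertex of t does not see.\<close>

definition lastbad :: "'a list => 'a => 'a => bool" where
  "lastbad t v g \<longleftrightarrow> (\<exists>\<alpha> \<beta>. t = \<alpha> @ g # \<beta> \<and> \<not> E (hd t) (hd (\<beta> @ [v])) \<and> (\<forall>y \<in> set (tl (\<beta> @ [v])). E (hd t) y))"

lemma lastbad_ex:
  assumes "\<not> good t v" "t \<noteq> []"
  obtains g where "lastbad t v g"
proof -
  obtain u r where t: "t = u # r" using assms(2) by (cases t) auto
  have "\<exists>y\<in>set (r @ [v]). \<not> E u y" using assms(1) t by (auto simp: good_def)
  then obtain ys y zs where y: "r @ [v] = ys @ y # zs" "\<not> E u y" "\<forall>a\<in>set zs. \<not> \<not> E u a"
    using split_list_last_prop[of "r @ [v]" "\<lambda>y. \<not> E u y"] by blast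
  define \<beta> where "\<beta> = butlast (y # zs)"
  have b: "\<beta> @ [v] = y # zs"
  proof -
    have "last (y # zs) = v" using arg_cong[OF y(1), of last] by simp
    then show ?thesis unfolding \<beta>_def using append_butlast_last_id[of "y # zs"] by simp
  qed
  have "r @ [v] = (ys @ \<beta>) @ [v]" using y(1) b by simp
  then have "r = ys @ \<beta>" by simp
  then have "t = butlast (u # ys) @ last (u # ys) # \<beta>" using t append_butlast_last_id[of "u # ys"] by simp
  moreover have "\<not> E (hd t) (hd (\<beta> @ [v]))" "\<forall>y \<in> set (tl (\<beta> @ [v])). E (hd t) y" unfolding b using y t by auto
  ultimately have "lastbad t v (last (u # ys))" unfolding lastbad_def by blast
  then show ?thesis by (rule that)
qed

text \<open>The successor of g is not a neighbour of \<open>hd Ti\<close>, so only an edge from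
  \<open>hd Tj\<close> could cover g. If g is not the last vertex, the vertex two places behind g is
  a neighbour of \<open>hd Ti\<close> and \<open>F2\<close> applies; otherwise \<open>noX\<close>
  does. A defective segment thus uses up the slack of \<open>extra\<close>.\<close>

lemma lastbad_UU:
  assumes dt: "det H ((vi, Ti) # Ms @ (vj, Tj) # Ns)" and g: "lastbad Ti (nx Ms vj) g"
  shows "g \<in> UU vi Ti Ms vj Tj Ns" "g \<in> set Ti" "g \<notin> hds (Ms @ Ns)"
proof -
  obtain \<alpha> \<beta> where T: "Ti = \<alpha> @ g # \<beta>" and n: "\<not> E (hd Ti) (hd (\<beta> @ [nx Ms vj]))"
    and r: "\<forall>y \<in> set (tl (\<beta> @ [nx Ms vj])). E (hd Ti) y" using g by (auto simp: lastbad_def)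
  have h: "hd (\<beta> @ flat Ms @ [vj]) = hd (\<beta> @ [nx Ms vj])" by (cases \<beta>) (auto simp: hd_flat_nx)
  have "\<not> E (hd Tj) g"
  proof (cases \<beta>)
    case Nil
    then have "g = last Ti" using T by simp
    then show ?thesis using noX[OF dt] link_E Ec by blast
  next
    case (Cons g1 \<gamma>)
    have "hd (\<gamma> @ [nx Ms vj]) \<in> set (tl (\<beta> @ [nx Ms vj]))" using Cons by (cases \<gamma>) auto
    then show ?thesis using F2[OF dt, of \<alpha> g g1 \<gamma>] T Cons r by blast
  qed
  then show "g \<in> UU vi Ti Ms vj Tj Ns" using n h T by (intro UU1[OF dt, of \<alpha> g "\<beta> @ flat Ms @ [vj]"]) auto
  show gT: "g \<in> set Ti" using T by simp
  show "g \<notin> hds (Ms @ Ns)"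
    unfolding hds_def by (rule hds_seg[of H "[]" vi Ti "Ms @ (vj, Tj) # Ns"]) (use dt gT in auto)
qed

lemma two_bad:
  assumes dt: "det H ((vi, Ti) # Ms @ (vj, Tj) # Ns)"
  shows "good Ti (nx Ms vj) \<or> good Tj (nx Ns vi)"
proof (rule ccontr)
  assume n: "\<not> ?thesis"
  have dr: "det H ((vj, Tj) # Ns @ (vi, Ti) # Ms)" using det_rot[of H "(vi, Ti) # Ms" "(vj, Tj) # Ns"] dt by simp
  note p = pairD[OF dt]
  obtain g where g: "lastbad Ti (nx Ms vj) g" using lastbad_ex n p(1) by blast
  obtain g' where g': "lastbad Tj (nx Ns vi) g'" using lastbad_ex n p(2) by blast
  note a = lastbad_UU[OF dt g] and b = lastbad_UU[OF dr g']
  have "g \<noteq> g'" using a(2) b(2) p(15) by auto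
  then show False using extra[OF dt a(1,3), of g'] b by auto
qed

text \<open>A path arriving at q runs back to \<open>hd Tj\<close> and continues behind q. If
  \<open>hd Ti\<close> saw the successor of p, or the vertex after it, the other side could be
  completed in the same way and at most one inner vertex would be lost.\<close>

lemma good_link:
  assumes dt: "det H ((vi, Ti) # Ms @ (vj, Tj) # Ns)"
    and gd: "good Tj (nx Ns vi)" and T: "Ti = \<alpha> @ p # \<beta>" and q: "q \<in> set Tj"
    and lk: "link (Oset H ((vi, Ti) # Ms @ (vj, Tj) # Ns)) p q"
  shows "\<not> E (hd Ti) (hd (\<beta> @ [nx Ms vj]))" "\<alpha> \<noteq> []" "\<beta> = b # \<beta>' ==> \<not> E (hd Ti) (hd (\<beta>' @ [nx Ms vj]))"
proof -
  note pD = pairD[OF dt]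
  obtain \<gamma> \<delta> where Tj: "Tj = \<gamma> @ q # \<delta>" using q by (meson split_list)
  have h\<delta>: "hd (\<delta> @ flat Ns @ [vi]) = hd (\<delta> @ [nx Ns vi])" by (cases \<delta>) (auto simp: hd_flat_nx)
  have "hd (\<delta> @ [nx Ns vi]) \<in> set (tl Tj) \<union> {nx Ns vi}" using Tj by (cases \<delta>; cases \<gamma>) auto
  then have eq1: "E (hd Tj) (hd (\<delta> @ flat Ns @ [vi]))" using gd h\<delta> unfolding good_def by auto
  have h1: "hd (\<gamma> @ [q]) = hd Tj" "hd (\<alpha> @ [p]) = hd Ti" using T Tj by (cases \<gamma>; cases \<alpha>; auto)+
  have wj: "walk (\<gamma> @ [q])" "walk (\<delta> @ flat Ns @ [vi])" using pD(17) Tj by (auto simp: walk_append walk_Cons)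
  have wB: "walk (rev (\<gamma> @ [q]) @ (\<delta> @ flat Ns @ [vi]))"
    using wj eq1 h1 by (subst walk_append) (simp add: last_rev del: rev_append)
  have wa: "walk (\<alpha> @ [p])" using pD(3) T by (auto simp: walk_append walk_Cons)
  have gen: "length pre = 1 \<and> hd pre \<notin> vs ((vi, Ti) # Ms @ (vj, Tj) # Ns) \<or> pre = [] ==> \<beta> = pre @ \<beta>' ==> \<not> E (hd Ti) (hd (\<beta>' @ [nx Ms vj]))" for pre \<beta>'
  proof
    assume pre: "length pre = 1 \<and> hd pre \<notin> vs ((vi, Ti) # Ms @ (vj, Tj) # Ns) \<or> pre = []" "\<beta> = pre @ \<beta>'" and e: "E (hd Ti) (hd (\<beta>' @ [nx Ms vj]))"
    have hb: "hd (\<beta>' @ flat Ms @ [vj]) = hd (\<beta>' @ [nx Ms vj])" by (cases \<beta>') (auto simp: hd_flat_nx)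
    have wb: "walk (\<beta>' @ flat Ms @ [vj])" using pD(16) T pre by (auto simp: walk_append walk_Cons)
    have wA: "walk (rev (\<beta>' @ flat Ms @ [vj]) @ (\<alpha> @ [p]))"
      using wb wa e h1 hb Ec by (subst walk_append) (simp add: last_rev del: rev_append)
    from lk show False
    proof (rule link_nil)
      fix os assume os: "distinct os" "set os \<subseteq> Oset H ((vi, Ti) # Ms @ (vj, Tj) # Ns)" "walk (p # os @ [q])"
      have w: "walk ((rev (\<beta>' @ flat Ms @ [vj]) @ (\<alpha> @ [p])) @ os @ (rev (\<gamma> @ [q]) @ (\<delta> @ flat Ns @ [vi])))"
        by (rule walk_link[OF os(3)]) (use wA wB in auto)
      from pre(1) show False
      proof
        assume "pre = []"
        then show False by (intro np0[OF dt w _ os(1,2)]) (use pre T Tj pD(15) in auto)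
      next
        assume l: "length pre = 1 \<and> hd pre \<notin> vs ((vi, Ti) # Ms @ (vj, Tj) # Ns)"
        then obtain b where "pre = [b]" by (cases pre) auto
        then show False by (intro np1[OF dt w _ os(1,2), of b]) (use pre l T Tj pD(15) in auto)
      qed
    qed
  qed
  show n: "\<not> E (hd Ti) (hd (\<beta> @ [nx Ms vj]))" using gen[of "[]" \<beta>] by simp
  show "\<alpha> \<noteq> []"
  proof
    assume "\<alpha> = []"
    then have "E (hd Ti) (hd (\<beta> @ [nx Ms vj]))" using T pD(3,9) by (cases \<beta>) (auto simp: walk_Cons)
    then show False using n by simp
  qed
  show "\<beta> = b # \<beta>' ==> \<not> E (hd Ti) (hd (\<beta>' @ [nx Ms vj]))"
    using gen[of "[b]" \<beta>'] seg_disj[OF detD(2)[OF dt], of vi Ti b] T by auto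
qed

end

lemma nx_mir: "nx (mir s v) (nx s v) = v"
  using hd_mir[of s v] by (cases "s = []") (auto simp: nx_def)

lemma nx_append: "nx (Ms @ (a, t) # Ns) v = nx Ms a"
  by (cases Ms) auto

lemma split_unique: "distinct (a @ x # b) ==> a @ x # b = a' @ x # b' ==> a = a' \<and> b = b'"
  by (metis append_Cons_eq_iff distinct.simps(2) distinct_append Un_iff disjoint_iff list.set_intros(1) set_append not_distinct_conv_prefix append_same_eq)

context tgraph
begin

lemma mir1:
  assumes dt: "det H ((v1, T1) # R)"
  shows "det H ((nx R v1, rev T1) # mir R v1)" "Oset H ((nx R v1, rev T1) # mir R v1) = Oset H ((v1, T1) # R)"
proof -
  obtain vj Tj Ns where R: "R = (vj, Tj) # Ns" using detD(1)[OF dt] by (cases R) auto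
  have d: "det H ((v1, T1) # [] @ (vj, Tj) # Ns)" using dt R by simp
  have m: "mir R v1 = mir Ns v1 @ [(nx Ns v1, rev Tj)]" using R by (auto simp: nx_def)
  show "det H ((nx R v1, rev T1) # mir R v1)" using det_mir2[OF d] R unfolding m by simp
  show "Oset H ((nx R v1, rev T1) # mir R v1) = Oset H ((v1, T1) # R)"
    using Oset_mir2[of H "[]" vj T1 Ns v1 Tj] R unfolding m by simp
qed

text \<open>g is already the one extra uncovered vertex, so x must be covered, and under the
  hypothesis only an edge from \<open>hd Tj\<close> can do so.\<close>

lemma bad_adj:
  assumes dt: "det H ((v1, T1) # R)" and g: "lastbad T1 (nx R v1) g"
    and T: "T1 = a @ x # b" "x \<noteq> g" "\<not> E (hd T1) (hd (b @ [nx R v1]))" and j: "(vj, Tj) \<in> set R"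
  shows "E (hd Tj) x"
proof (rule ccontr)
  assume n: "\<not> E (hd Tj) x"
  obtain Ms Ns where R: "R = Ms @ (vj, Tj) # Ns" using j by (meson split_list)
  have d: "det H ((v1, T1) # Ms @ (vj, Tj) # Ns)" using dt R by simp
  have nx: "nx R v1 = nx Ms vj" unfolding R by (rule nx_append)
  have h: "hd (b @ flat Ms @ [vj]) = hd (b @ [nx Ms vj])" by (cases b) (auto simp: hd_flat_nx)
  have x: "x \<in> UU v1 T1 Ms vj Tj Ns"
    using n h T nx by (intro UU1[OF d, of a x "b @ flat Ms @ [vj]"]) auto
  have "x \<notin> hds (Ms @ Ns)"
    unfolding hds_def by (rule hds_seg[of H "[]" v1 T1 "Ms @ (vj, Tj) # Ns"]) (use d T in auto)
  then show False using extra[OF d x] lastbad_UU[OF d] g nx T(2) by metis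
qed

lemma bad_good:
  assumes dt: "det H ((v1, T1) # Ms @ (vj, Tj) # Ns)" and b: "\<not> good T1 (nx Ms vj)"
  shows "good Tj (nx Ns v1)"
  using two_bad[OF dt] b by blast

lemma good_unlinked:
  assumes dt: "det H ((vi, Ti) # Ms @ (vj, Tj) # Ns)"
    and gd: "good Ti (nx Ms vj)" "good Tj (nx Ns vi)" and pq: "p \<in> set Ti" "q \<in> set Tj"
  shows "\<not> link (Oset H ((vi, Ti) # Ms @ (vj, Tj) # Ns)) p q"
proof
  assume lk: "link (Oset H ((vi, Ti) # Ms @ (vj, Tj) # Ns)) p q"
  obtain \<alpha> \<beta> where T: "Ti = \<alpha> @ p # \<beta>" using pq by (meson split_list)
  have "\<not> E (hd Ti) (hd (\<beta> @ [nx Ms vj]))" using good_link(1)[OF dt gd(2) T pq(2) lk] .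
  moreover have "hd (\<beta> @ [nx Ms vj]) \<in> set (tl Ti) \<union> {nx Ms vj}" using T by (cases \<alpha>; cases \<beta>) auto
  ultimately show False using gd(1) by (auto simp: good_def)
qed

lemma bad_unlinked:
  assumes dt: "det H ((v1, T1) # A @ (vj, Tj) # B @ (vl, Tl) # D)"
    and b: "\<not> good T1 (nx (A @ (vj, Tj) # B @ (vl, Tl) # D) v1)" and pq: "p \<in> set Tj" "q \<in> set Tl"
  shows "\<not> link (Oset H ((v1, T1) # A @ (vj, Tj) # B @ (vl, Tl) # D)) p q"
proof -
  have d1: "det H ((v1, T1) # A @ (vj, Tj) # (B @ (vl, Tl) # D))" using dt by simp
  have d2: "det H ((v1, T1) # (A @ (vj, Tj) # B) @ (vl, Tl) # D)" using dt by simp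
  have g1: "good Tj (nx (B @ (vl, Tl) # D) v1)" using bad_good[OF d1] b by (simp add: nx_append)
  have b': "\<not> good T1 (nx (A @ (vj, Tj) # B) vl)" using b by (simp add: nx_append)
  have g2: "good Tl (nx D v1)" using bad_good[OF d2 b'] .
  have "det H (((v1, T1) # A) @ ((vj, Tj) # B @ (vl, Tl) # D))" using dt by simp
  from det_rot[OF this] have d3: "det H ((vj, Tj) # B @ (vl, Tl) # (D @ (v1, T1) # A))" by simp
  have O: "Oset H ((vj, Tj) # B @ (vl, Tl) # (D @ (v1, T1) # A)) = Oset H ((v1, T1) # A @ (vj, Tj) # B @ (vl, Tl) # D)"
    by (rule Oset_cong) auto
  show ?thesis using good_unlinked[OF d3 _ _ pq] g1 g2 unfolding O by (simp add: nx_append)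
qed

lemma bad_unlinked2:
  assumes dt: "det H ((v1, T1) # R)" and b: "\<not> good T1 (nx R v1)"
    and jl: "(vj, Tj) \<in> set R" "(vl, Tl) \<in> set R" "(vj, Tj) \<noteq> (vl, Tl)" and pq: "p \<in> set Tj" "q \<in> set Tl"
  shows "\<not> link (Oset H ((v1, T1) # R)) p q"
proof -
  obtain A D where R: "R = A @ (vj, Tj) # D" using jl(1) by (meson split_list)
  have "(vl, Tl) \<in> set A \<or> (vl, Tl) \<in> set D" using jl R by auto
  then show ?thesis
  proof
    assume "(vl, Tl) \<in> set D"
    then obtain B D' where "D = B @ (vl, Tl) # D'" by (meson split_list)
    then show ?thesis using bad_unlinked[of H v1 T1 A vj Tj B vl Tl D'] dt b pq R by simp
  next
    assume "(vl, Tl) \<in> set A"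
    then obtain B A' where "A = A' @ (vl, Tl) # B" by (meson split_list)
    then show ?thesis using bad_unlinked[of H v1 T1 A' vl Tl B vj Tj D q p] dt b pq R link_sym by auto
  qed
qed

lemma mir2r:
  assumes dt: "det H ((v1, T1) # Ms @ (vj, Tj) # Ns)"
  shows "det H ((nx Ns v1, rev Tj) # mir Ms vj @ (nx Ms vj, rev T1) # mir Ns v1)"
    "Oset H ((nx Ns v1, rev Tj) # mir Ms vj @ (nx Ms vj, rev T1) # mir Ns v1) = Oset H ((v1, T1) # Ms @ (vj, Tj) # Ns)"
proof -
  show "det H ((nx Ns v1, rev Tj) # mir Ms vj @ (nx Ms vj, rev T1) # mir Ns v1)"
    using det_rot[of H "(nx Ms vj, rev T1) # mir Ns v1" "(nx Ns v1, rev Tj) # mir Ms vj"] det_mir2[OF dt] by simp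
  have "Oset H ((nx Ns v1, rev Tj) # mir Ms vj @ (nx Ms vj, rev T1) # mir Ns v1) = Oset H ((nx Ms vj, rev T1) # mir Ns v1 @ (nx Ns v1, rev Tj) # mir Ms vj)"
    by (rule Oset_cong) auto
  then show "Oset H ((nx Ns v1, rev Tj) # mir Ms vj @ (nx Ms vj, rev T1) # mir Ns v1) = Oset H ((v1, T1) # Ms @ (vj, Tj) # Ns)"
    unfolding Oset_mir2 .
qed

text \<open>In the reversed cycle, too, linked segments cannot both be good and two segments cannot
  both be defective.\<close>

lemma bad_mirror:
  assumes dt: "det H ((v1, T1) # Ms @ (vj, Tj) # Ns)"
    and lk: "link (Oset H ((v1, T1) # Ms @ (vj, Tj) # Ns)) p q" and pq: "p \<in> set T1" "q \<in> set Tj"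
  shows "good (rev T1) v1 \<longleftrightarrow> \<not> good (rev Tj) vj"
  using two_bad[OF det_mir2[OF dt]] good_unlinked[OF det_mir2[OF dt], of p q] lk pq
  unfolding Oset_mir2 nx_mir by auto

text \<open>If \<open>last T1\<close> were linked to q, then in the reversed orientation
  \<open>Tj\<close> would be the defective segment and q would be adjacent to the last vertex of
  every other segment. A third segment would then be linked to \<open>Tj\<close>, although apart
  from \<open>T1\<close> all segments are good. With two segments a detour is written down.\<close>

lemma alpha:
  assumes dt: "det H ((v1, T1) # R)" and b: "\<not> good T1 (nx R v1)"
    and j: "(vj, Tj) \<in> set R" "q \<in> set Tj" and lk: "link (Oset H ((v1, T1) # R)) (last T1) q"
  shows False
proof -
  let ?O = "Oset H ((v1, T1) # R)"
  obtain Ms Ns where R: "R = Ms @ (vj, Tj) # Ns" using j(1) by (meson split_list)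
  have d: "det H ((v1, T1) # Ms @ (vj, Tj) # Ns)" using dt R by simp
  have b': "\<not> good T1 (nx Ms vj)" using b by (simp add: R nx_append)
  note p = pairD[OF d]
  have l1: "last T1 \<in> set T1" using p(1) by simp
  note m = mir2r[OF d]
  have gj: "good Tj (nx Ns v1)" by (rule bad_good[OF d b'])
  have rT1: "rev T1 = [] @ last T1 # rev (butlast T1)"
    using p(1) by (cases T1 rule: rev_cases) auto
  have nb: "\<not> good (rev Tj) vj"
  proof
    assume "good (rev Tj) vj"
    then show False using good_link(2)[OF det_mir2[OF d], of "[]" "last T1" "rev (butlast T1)" q] rT1 j(2) lk R
      unfolding Oset_mir2 nx_mir by auto
  qed
  have g1: "good (rev T1) v1" using bad_mirror[OF d _ l1 j(2)] lk R nb by simp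
  obtain g where g: "lastbad (rev Tj) vj g" using lastbad_ex[OF nb] p(2) by auto
  have nxm: "nx (mir Ms vj @ (nx Ms vj, rev T1) # mir Ns v1) (nx Ns v1) = vj" by (simp add: nx_append nx_mir)
  have qfacts: "\<gamma> \<noteq> []" "\<not> E (last Tj) (last \<gamma>)" "\<not> E (last Tj) (hd (rev (butlast \<gamma>) @ [vj]))" "x \<noteq> g"
    if Tj: "Tj = \<gamma> @ x # \<delta>" and l: "link ?O (last T1) x" for \<gamma> x \<delta>
  proof -
    have rT: "rev Tj = rev \<delta> @ x # rev \<gamma>" using Tj by simp
    show ne: "\<gamma> \<noteq> []"
    proof
      assume "\<gamma> = []"
      then have "x = hd Tj" using Tj by simp
      then show False using noX[OF d] l R by simp
    qed
    then have rg: "rev \<gamma> = last \<gamma> # rev (butlast \<gamma>)" by (cases \<gamma> rule: rev_cases) auto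
    note gl = good_link[OF m(1), of "rev \<delta>" x "rev \<gamma>" "last T1"]
    have hT: "hd (rev Tj) = last Tj" using p(2) by (simp add: hd_rev)
    have pr: "good (rev T1) (nx (mir Ns v1) (nx Ns v1))" "last T1 \<in> set (rev T1)"
      "link (Oset H ((nx Ns v1, rev Tj) # mir Ms vj @ (nx Ms vj, rev T1) # mir Ns v1)) x (last T1)"
      using g1 l1 link_sym[OF l] R unfolding m(2) nx_mir by simp_all
    have a1: "hd (rev \<gamma> @ [nx (mir Ms vj) (nx Ms vj)]) = last \<gamma>" unfolding rg by simp
    show n: "\<not> E (last Tj) (last \<gamma>)"
      using gl(1)[OF pr(1) rT pr(2,3)] unfolding hT a1 .
    show n2: "\<not> E (last Tj) (hd (rev (butlast \<gamma>) @ [vj]))"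
      using gl(3)[OF pr(1) rT pr(2,3) rg] unfolding hT nx_mir .
    show "x \<noteq> g"
    proof
      assume "x = g"
      then obtain \<alpha> \<beta> where ab: "rev Tj = \<alpha> @ x # \<beta>" "\<forall>y \<in> set (tl (\<beta> @ [vj])). E (hd (rev Tj)) y"
        using g by (auto simp: lastbad_def)
      have "distinct (rev Tj)" using p(15) by simp
      then have "\<beta> = rev \<gamma>" using split_unique[of "rev \<delta>" x "rev \<gamma>"] rT ab(1) by metis
      then have "\<beta> @ [vj] = last \<gamma> # (rev (butlast \<gamma>) @ [vj])" using rg by (simp only: append_Cons)
      then have "tl (\<beta> @ [vj]) = rev (butlast \<gamma>) @ [vj]" by (simp only: list.sel)
      then have "hd (rev (butlast \<gamma>) @ [vj]) \<in> set (tl (\<beta> @ [vj]))" by (simp only:) (rule hd_in_set, simp)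
      then show False using ab(2) n2 p(2) by (auto simp: hd_rev)
    qed
  qed
  have adj: "E (hd t) x" if Tj: "Tj = \<gamma> @ x # \<delta>" and n: "\<not> E (last Tj) (hd (rev \<gamma> @ [vj]))" "x \<noteq> g"
     and t: "(w, t) \<in> set (mir Ms vj @ (nx Ms vj, rev T1) # mir Ns v1)" for \<gamma> x \<delta> w t
  proof -
    have rT: "rev Tj = rev \<delta> @ x # rev \<gamma>" using Tj by simp
    have hT: "hd (rev Tj) = last Tj" using p(2) by (simp add: hd_rev)
    show ?thesis by (rule bad_adj[OF m(1) _ rT n(2) _ t]) (unfold nxm hT, rule g, rule n(1))
  qed
  have qadj: "E (hd t) x" if "Tj = \<gamma> @ x # \<delta>" "link ?O (last T1) x" "(w, t) \<in> set (mir Ms vj @ (nx Ms vj, rev T1) # mir Ns v1)" for \<gamma> x \<delta> w t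
  proof -
    note qf = qfacts[OF that(1,2)]
    have "hd (rev \<gamma> @ [vj]) = last \<gamma>" using qf(1) by (simp add: hd_append hd_rev)
    then show ?thesis using adj[OF that(1) _ qf(4) that(3)] qf(2) by simp
  qed
  have "Ms = [] \<and> Ns = []"
  proof (rule ccontr)
    assume "\<not> ?thesis"
    then obtain vl Tl where l: "(vl, Tl) \<in> set Ms \<union> set Ns" by (cases Ms; cases Ns) auto
    then obtain w' where w': "(w', rev Tl) \<in> set (mir Ms vj @ (nx Ms vj, rev T1) # mir Ns v1)"
      using segs_mir2 by fastforce
    obtain \<gamma> \<delta> where Tj: "Tj = \<gamma> @ q # \<delta>" using j(2) by (meson split_list)
    have ne: "Tl \<noteq> []" using detD(9)[OF d, of vl Tl] l by auto
    have "E (last Tl) q" using qadj[OF Tj lk w'] ne by (simp add: hd_rev)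
    then have "link ?O (last Tl) q" by (rule link_E)
    moreover have "(vl, Tl) \<noteq> (vj, Tj)"
    proof
      assume "(vl, Tl) = (vj, Tj)"
      then have "vj \<in> vs Ms \<union> vs Ns" using l unfolding vs_def by force
      then have "vj \<in> set (flat Ms) \<union> set (flat Ns)" using vs_flat[of Ms] vs_flat[of Ns] by blast
      then show False using p(15) by auto
    qed
    ultimately show False using bad_unlinked2[OF dt b _ j(1) _ _ j(2), of vl Tl "last Tl"] l R ne by auto
  qed
  then have MN: "Ms = []" "Ns = []" by auto
  have T1in: "(nx Ms vj, rev T1) \<in> set (mir Ms vj @ (nx Ms vj, rev T1) # mir Ns v1)" by simp
  obtain \<gamma> \<delta> where "Tj = \<gamma> @ q # \<delta>" using j(2) by (meson split_list)
  from qadj[OF this lk T1in] have "E (last T1) q" using p(1) by (simp add: hd_rev)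
  then obtain \<gamma> x \<delta> where x: "Tj = \<gamma> @ x # \<delta>" "E (last T1) x" "\<forall>y\<in>set \<gamma>. \<not> E (last T1) y"
    using split_list_first_prop[of Tj "E (last T1)"] j(2) by blast
  note qf = qfacts[OF x(1) link_E[OF x(2)]]
  obtain \<gamma>' where \<gamma>: "\<gamma> = \<gamma>' @ [last \<gamma>]" using qf(1) append_butlast_last_id by metis
  \<comment> \<open>Otherwise \<open>adj\<close> would make the vertex before x adjacent to
    \<open>last T1\<close>, but x is the first such neighbour in \<open>Tj\<close>.\<close>
  have bg: "last \<gamma> = g"
  proof (rule ccontr)
    assume "last \<gamma> \<noteq> g"
    have "Tj = \<gamma>' @ last \<gamma> # (x # \<delta>)" using x(1) \<gamma> by (metis append_Cons append_assoc append_Nil)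
    from adj[OF this _ \<open>last \<gamma> \<noteq> g\<close> T1in] have "E (last T1) (last \<gamma>)"
      using qf(3) \<gamma> p(1) by (metis butlast_snoc hd_rev)
    then show False using x(3) qf(1) by simp
  qed
  obtain \<alpha> \<beta> where ab: "rev Tj = \<alpha> @ g # \<beta>" "\<forall>y \<in> set (tl (\<beta> @ [vj])). E (hd (rev Tj)) y"
    using g by (auto simp: lastbad_def)
  have "rev Tj = (rev \<delta> @ [x]) @ g # rev \<gamma>'" using x(1) \<gamma> bg by (metis append_Cons append_assoc append_Nil rev_append rev.simps(2) rev_rev_ident)
  moreover have "distinct (rev Tj)" using p(15) by simp
  ultimately have \<beta>: "\<beta> = rev \<gamma>'" using split_unique[of "rev \<delta> @ [x]" g "rev \<gamma>'"] ab(1) by metis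
  have w1: "walk (rev T1 @ [v1])" using p(1,3,7) Ec by (simp add: walk_append last_rev)
  have xw: "x \<noteq> last Tj" using F0m[OF d] link_E[OF x(2)] R by auto
  then have \<delta>: "\<delta> \<noteq> []" using x(1) by auto
  have wTj: "walk \<gamma>" "walk (x # \<delta>)" "walk \<delta>" "walk (\<gamma> @ [x])" using p(4) x(1) by (auto simp: walk_append walk_Cons)
  have uj: "hd Tj = hd \<gamma>" using x(1) qf(1) by simp
  have eu: "E (hd \<gamma>) y" if "y \<in> set \<delta>" for y
    using gj that x(1) qf(1) uj unfolding good_def by (cases \<gamma>) auto
  show False
  proof (cases \<gamma>')
    case Nil
    then have g1: "\<gamma> = [hd \<gamma>]" using \<gamma> by (metis append_Nil list.sel(1))
    have "walk ([vj] @ \<gamma> @ rev (x # \<delta>) @ (rev T1 @ [v1]))"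
    proof -
      have a: "walk (rev (x # \<delta>) @ (rev T1 @ [v1]))"
        using w1 wTj x(2) p(1) Ec by (subst walk_append) (simp add: last_rev hd_append hd_rev del: rev.simps)
      have "hd (rev (x # \<delta>) @ (rev T1 @ [v1])) = last \<delta>" using \<delta> by (simp add: hd_append hd_rev)
      moreover have "last \<gamma> = hd \<gamma>" using g1 by (metis last.simps)
      moreover have "E (hd \<gamma>) (last \<delta>)" using eu \<delta> by simp
      ultimately have "walk (\<gamma> @ rev (x # \<delta>) @ (rev T1 @ [v1]))"
        using wTj(1) a by (subst walk_append) simp
      then show ?thesis using p(8) uj qf(1) by (subst walk_append) simp
    qed
    from np0[OF d this, of "[]"] show False using p(15) x(1) MN by auto
  next
    case (Cons c \<gamma>'')
    then have "vj \<in> set (tl (\<beta> @ [vj]))" using \<beta> by (cases "rev \<gamma>''") auto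
    then have ew: "E (last Tj) vj" using ab(2) p(2) by (auto simp: hd_rev)
    have "walk ([vj] @ rev \<delta> @ (\<gamma> @ [x]) @ (rev T1 @ [v1]))"
    proof -
      have a: "walk ((\<gamma> @ [x]) @ (rev T1 @ [v1]))"
        using w1 wTj x(2) p(1) Ec by (subst walk_append) (simp add: hd_append hd_rev)
      have "E (hd \<delta>) (hd \<gamma>)" using eu \<delta> Ec by simp
      then have "walk (rev \<delta> @ (\<gamma> @ [x]) @ (rev T1 @ [v1]))"
        using wTj(3) a \<delta> qf(1) by (subst walk_append) (simp add: last_rev)
      moreover have "last Tj = last \<delta>" using x(1) \<delta> by simp
      ultimately show ?thesis using ew \<delta> Ec by (subst walk_append) (simp add: hd_append hd_rev)
    qed
    from np0[OF d this, of "[]"] show False using p(15) x(1) MN by auto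
  qed
qed

section \<open>The contacts of a defective segment with the others\<close>

definition Pset :: "'a set => 'a list => ('a \<times> 'a list) list => 'a set" where
  "Pset Os T R = {p \<in> set T. \<exists>v t q. (v, t) \<in> set R \<and> q \<in> set t \<and> link Os p q}"

lemma Pset_mir: "Pset Os (rev T) (mir R v) = Pset Os T R"
proof -
  have "(\<exists>w t q. (w, t) \<in> set (mir R v) \<and> q \<in> set t \<and> link Os p q) \<longleftrightarrow> (\<exists>w t q. (w, t) \<in> set R \<and> q \<in> set t \<and> link Os p q)" for p
  proof
    assume "\<exists>w t q. (w, t) \<in> set (mir R v) \<and> q \<in> set t \<and> link Os p q"
    then obtain w t q where w: "(w, t) \<in> set (mir R v)" "q \<in> set t" "link Os p q" by blast
    obtain w' t' where "(w', t') \<in> set R" "t = rev t'" using segs_mir[OF w(1)] by blast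
    then show "\<exists>w t q. (w, t) \<in> set R \<and> q \<in> set t \<and> link Os p q" using w by auto
  next
    assume "\<exists>w t q. (w, t) \<in> set R \<and> q \<in> set t \<and> link Os p q"
    then obtain w t q where w: "(w, t) \<in> set R" "q \<in> set t" "link Os p q" by blast
    obtain w' where w': "(w', rev t) \<in> set (mir R v)" using segs_mir2[OF w(1)] by blast
    have "q \<in> set (rev t)" using w by simp
    then show "\<exists>w t q. (w, t) \<in> set (mir R v) \<and> q \<in> set t \<and> link Os p q" using w' w(3) by blast
  qed
  then show ?thesis by (simp add: Pset_def)
qed

text \<open>Beside a defective \<open>T1\<close> all segments are good, so \<open>good_link\<close>
  controls what follows a contact p, and \<open>bad_adj\<close> makes p adjacent to the first
  vertices of all other segments. \<open>bad_adj\<close> for the successor of p makes it a contact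
  as well, unless it is g.\<close>

lemma Pfacts:
  assumes dt: "det H ((v1, T1) # R)" and b: "\<not> good T1 (nx R v1)" and g: "lastbad T1 (nx R v1) g"
    and p: "p \<in> Pset (Oset H ((v1, T1) # R)) T1 R" and T: "T1 = a @ p # c"
  shows "c \<noteq> []" "a \<noteq> []" "\<not> E (hd T1) (hd (c @ [nx R v1]))" "p \<noteq> g"
    "\<And>v t. (v, t) \<in> set R ==> E (hd t) p" "hd c = g \<or> hd c \<in> Pset (Oset H ((v1, T1) # R)) T1 R"
proof -
  obtain vj Tj q where j: "(vj, Tj) \<in> set R" "q \<in> set Tj" "link (Oset H ((v1, T1) # R)) p q"
    using p by (auto simp: Pset_def)
  obtain Ms Ns where R: "R = Ms @ (vj, Tj) # Ns" using j(1) by (meson split_list)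
  have d: "det H ((v1, T1) # Ms @ (vj, Tj) # Ns)" using dt R by simp
  have nR: "nx R v1 = nx Ms vj" by (simp add: R nx_append)
  have gj: "good Tj (nx Ns v1)" by (rule bad_good[OF d]) (use b nR in simp)
  have lk: "link (Oset H ((v1, T1) # Ms @ (vj, Tj) # Ns)) p q" using j(3) R by simp
  show c: "c \<noteq> []" using alpha[OF dt b j(1,2)] j(3) T by auto
  show "a \<noteq> []" by (rule good_link(2)[OF d gj T j(2) lk])
  show n: "\<not> E (hd T1) (hd (c @ [nx R v1]))" using good_link(1)[OF d gj T j(2) lk] nR by simp
  obtain c0 c' where cc: "c = c0 # c'" using c by (cases c) auto
  have n2: "\<not> E (hd T1) (hd (c' @ [nx R v1]))" using good_link(3)[OF d gj T j(2) lk cc] nR by simp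
  have dT: "distinct T1" using detD(2)[OF dt] by simp
  show pg: "p \<noteq> g"
  proof
    assume "p = g"
    then obtain \<alpha> \<beta> where ab: "T1 = \<alpha> @ p # \<beta>" "\<forall>y \<in> set (tl (\<beta> @ [nx R v1])). E (hd T1) y"
      using g by (auto simp: lastbad_def)
    have "\<beta> = c" using split_unique[of a p c \<alpha> \<beta>] dT T ab(1) by metis
    then have "tl (\<beta> @ [nx R v1]) = c' @ [nx R v1]" using cc by simp
    then have "hd (c' @ [nx R v1]) \<in> set (tl (\<beta> @ [nx R v1]))" by (simp only:) (rule hd_in_set, simp)
    then show False using ab(2) n2 by blast
  qed
  show "\<And>v t. (v, t) \<in> set R ==> E (hd t) p" by (rule bad_adj[OF dt g T pg n])
  show "hd c = g \<or> hd c \<in> Pset (Oset H ((v1, T1) # R)) T1 R"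
  proof (rule disjCI)
    assume "hd c \<notin> Pset (Oset H ((v1, T1) # R)) T1 R"
    show "hd c = g"
    proof (rule ccontr)
      assume "hd c \<noteq> g"
      have T': "T1 = (a @ [p]) @ hd c # c'" using T cc by simp
      have "E (hd Tj) (hd c)" by (rule bad_adj[OF dt g T' \<open>hd c \<noteq> g\<close> n2 j(1)])
      then have "link (Oset H ((v1, T1) # R)) (hd c) (hd Tj)" using link_E Ec by blast
      moreover have "hd Tj \<in> set Tj" using j(2) by (cases Tj) auto
      moreover have "hd c \<in> set T1" using T cc by simp
      ultimately have "hd c \<in> Pset (Oset H ((v1, T1) # R)) T1 R" using j(1) unfolding Pset_def by blast
      then show False using \<open>hd c \<notin> _\<close> by simp
    qed
  qed
qed

text \<open>By \<open>Pfacts\<close> a run of consecutive contacts ends immediately before g. If no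
  two contacts are consecutive, p is therefore the vertex before g and the only contact. The
  conclusions describe the side of p at the first vertex; the other side follows from the reversed
  cycle.\<close>

lemma half:
  assumes dt: "det H ((v1, T1) # R)" and b: "\<not> good T1 (nx R v1)"
    and P: "P = Pset (Oset H ((v1, T1) # R)) T1 R"
    and nc: "\<And>a x y c. T1 = a @ x # y # c ==> x \<in> P ==> y \<in> P ==> False"
    and p: "p \<in> P" and T: "T1 = L @ p # M"
  shows "L \<noteq> []" "M \<noteq> []" "\<And>y. y \<in> set (tl L) \<union> {p} ==> E (hd T1) y" "P = {p}"
    "length M \<ge> 2 ==> E (hd T1) (nx R v1)" "\<And>v t. (v, t) \<in> set R ==> E (hd t) p"
proof -
  have dT: "distinct T1" and ne: "T1 \<noteq> []" using detD(2,9)[OF dt] by auto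
  obtain g where g: "lastbad T1 (nx R v1) g" using lastbad_ex[OF b ne] .
  note pf = Pfacts[OF dt b g]
  note pp = pf[OF p[unfolded P] T]
  show L: "L \<noteq> []" and M: "M \<noteq> []" and "\<And>v t. (v, t) \<in> set R ==> E (hd t) p" using pp by auto
  obtain \<beta> where M\<beta>: "M = g # \<beta>"
  proof -
    have "hd M = g" using pp(6) nc[of L p "hd M" "tl M"] T M p unfolding P by auto
    then show ?thesis using that[of "tl M"] M by (metis list.collapse)
  qed
  have gr: "\<forall>y \<in> set (tl (\<beta> @ [nx R v1])). E (hd T1) y"
  proof -
    obtain \<alpha>' \<beta>' where ab: "T1 = \<alpha>' @ g # \<beta>'" "\<forall>y \<in> set (tl (\<beta>' @ [nx R v1])). E (hd T1) y"
      using g by (auto simp: lastbad_def)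
    have "(L @ [p]) @ g # \<beta> = \<alpha>' @ g # \<beta>'" using T M\<beta> ab(1) by simp
    moreover have "distinct ((L @ [p]) @ g # \<beta>)" using dT T M\<beta> by simp
    ultimately have "\<beta> = \<beta>'" using split_unique by metis
    then show ?thesis using ab(2) by simp
  qed
  have PL: "P \<inter> set L = {}"
  proof (rule ccontr)
    assume "\<not> ?thesis"
    then have "\<exists>x\<in>set L. x \<in> P" by auto
    then obtain a x c where x: "L = a @ x # c" "x \<in> P" "\<forall>y\<in>set c. y \<notin> P"
      using split_list_last_prop[of L "\<lambda>x. x \<in> P"] by blast
    have T': "T1 = a @ x # (c @ p # M)" using T x(1) by simp
    have h: "hd (c @ p # M) = g \<or> hd (c @ p # M) \<in> P" using pf(6)[OF x(2)[unfolded P] T'] P by simp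
    show False
    proof (cases c)
      case Nil
      then show False using nc[of a x p M] T' x(2) p by simp
    next
      case (Cons c0 c')
      then have "c0 = g" using h x(3) by auto
      then show False using dT T' Cons M\<beta> by simp
    qed
  qed
  have PM: "P \<inter> set M = {}"
  proof (rule ccontr)
    assume "\<not> ?thesis"
    then obtain x where x: "x \<in> P" "x \<in> set M" by auto
    have "x \<noteq> g"
    proof -
      obtain a c where "T1 = a @ x # c" using x T by (metis in_set_conv_decomp list.set_intros(2) set_append Un_iff)
      then show ?thesis using pf(4) x(1) P by blast
    qed
    then obtain e f where ef: "\<beta> = e @ x # f" using x(2) M\<beta> by (metis in_set_conv_decomp set_ConsD)
    have "T1 = (L @ p # g # e) @ x # f" using T M\<beta> ef by simp
    then have "\<not> E (hd T1) (hd (f @ [nx R v1]))" using pf(3) x(1) P by blast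
    moreover have "hd (f @ [nx R v1]) \<in> set (tl (\<beta> @ [nx R v1]))" using ef by (cases e; cases f) auto
    ultimately show False using gr by blast
  qed
  have "P \<subseteq> set T1" by (auto simp: P Pset_def)
  then show "P = {p}" using PL PM T p by auto
  show "length M \<ge> 2 ==> E (hd T1) (nx R v1)"
  proof -
    assume "length M \<ge> 2"
    then have "nx R v1 \<in> set (tl (\<beta> @ [nx R v1]))" using M\<beta> by (cases \<beta>) auto
    then show ?thesis using gr by blast
  qed
  \<comment> \<open>The predecessor of a non-neighbour y would be adjacent to \<open>hd Tj\<close>
    by \<open>bad_adj\<close> and so be a second contact.\<close>
  show "E (hd T1) y" if y: "y \<in> set (tl L) \<union> {p}" for y
  proof (rule ccontr)
    assume n: "\<not> E (hd T1) y"
    obtain u L' where L': "L = u # L'" using L by (cases L) auto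
    have "y \<in> set (L' @ [p])" using y L' by auto
    then obtain e f where ef: "L' @ [p] = e @ y # f" by (meson split_list)
    have Lb: "L = (u # e) @ butlast (y # f)"
    proof -
      have "L @ [p] = (u # e) @ (y # f)" using ef L' by simp
      then have "butlast (L @ [p]) = butlast ((u # e) @ (y # f))" by (simp only:)
      then show ?thesis by (simp add: butlast_append)
    qed
    define x where "x = last (u # e)"
    have "last (u # e) \<in> set (u # e)" by (rule last_in_set) simp
    then have xL: "x \<in> set L" unfolding x_def using Lb by (metis Un_iff set_append)
    have T': "T1 = butlast (u # e) @ x # (y # f @ M)"
    proof -
      have "u # e = butlast (u # e) @ [x]" unfolding x_def by (rule append_butlast_last_id[symmetric]) simp
      moreover have "T1 = (u # e) @ (y # f @ M)" using T ef L' by (metis append_Cons append_Nil append_assoc)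
      ultimately show ?thesis by (metis append_Cons append_Nil append_assoc)
    qed
    have "x \<noteq> g" using xL dT T M\<beta> by auto
    obtain vj Tj q where j: "(vj, Tj) \<in> set R" "q \<in> set Tj" using p unfolding P Pset_def by auto
    have "E (hd Tj) x" by (rule bad_adj[OF dt g T' \<open>x \<noteq> g\<close> _ j(1)]) (use n in simp)
    then have "link (Oset H ((v1, T1) # R)) x (hd Tj)" using link_E Ec by blast
    moreover have "hd Tj \<in> set Tj" using j(2) by (cases Tj) auto
    moreover have "x \<in> set T1" using xL T by simp
    ultimately have "x \<in> P" unfolding P Pset_def using j(1) by blast
    then show False using PL xL by auto
  qed
qed

lemma seg_inj:
  assumes "distinct (flat s)" "(v, t) \<in> set s" "(w, u) \<in> set s" "x \<in> set t" "x \<in> set u"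
  shows "(v, t) = (w, u)"
  using assms
proof (induction s rule: flat.induct)
  case (2 a T s)
  have *: "(v, t) \<in> set s ==> x \<in> set t ==> x \<in> set (flat s)" for v t by (auto simp: set_flat)
  show ?case using 2 * by auto
qed simp

text \<open>Otherwise deleting the k cut vertices would leave the k segments in different
  components, and \<open>H\<close> as one more.\<close>

lemma tough_link:
  assumes fr: "ring H s"
  shows "\<exists>v t w u p q. (v, t) \<in> set s \<and> (w, u) \<in> set s \<and> (v, t) \<noteq> (w, u) \<and> p \<in> set t \<and> q \<in> set u \<and> link (Oset H s) p q"
proof (rule ccontr)
  assume n: "\<not> ?thesis"
  obtain h where h: "h \<in> H" using ringD(7)[OF fr] by auto
  define cl where "cl x = {(v, t) \<in> set s. x \<in> set t}" for x
  have df: "distinct (flat s)" by (rule ringD(2)[OF fr])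
  have cl1: "cl x = {(v, t)}" if "(v, t) \<in> set s" "x \<in> set t" for x v t
  proof -
    have "(w, u) = (v, t)" if "(w, u) \<in> set s" "x \<in> set u" for w u
      by (rule seg_inj[OF df that(1) \<open>(v, t) \<in> set s\<close> that(2) \<open>x \<in> set t\<close>])
    then show ?thesis using that unfolding cl_def by blast
  qed
  have tne: "\<forall>(v, t)\<in>set s. t \<noteq> []" using ringD(9)[OF fr] by auto
  have hin: "hd t \<in> set t" if "(v, t) \<in> set s" for v t using tne that by auto
  have "card (hds s) + 1 \<le> card (vs s)"
  proof (rule tough_cl[where cl = cl and Cs = "set (flat s)" and H = H and h = h and Os = "Oset H s"])
    show "vs s \<subseteq> set (flat s)" by (rule vs_flat)
    show "vs s \<noteq> {}" using ringD(12)[OF fr] by (cases s) auto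
    show "set (flat s) \<subseteq> V" "h \<in> H" using ringD(5)[OF fr] h by auto
    show "H \<subseteq> V - set (flat s)" using ringD(6,8)[OF fr] by blast
    show "\<And>x y. x \<in> H ==> E x y ==> y \<in> H \<union> vs s" using ringD(11)[OF fr] .
    show "Oset H s = V - set (flat s) - H" by (simp add: Oset_def)
    show "hds s \<subseteq> set (flat s) - vs s"
    proof -
      have "x \<notin> vs s" if "x \<in> hds s" for x
      proof -
        obtain v t where "(v, t) \<in> set s" "x = hd t" using \<open>x \<in> hds s\<close> by (auto simp: hds_def)
        then show ?thesis using seg_disj[OF df] hin by blast
      qed
      then show ?thesis using hds_flat[OF tne] by blast
    qed
    show "inj_on cl (hds s)"
    proof (rule inj_onI)
      fix x y assume "x \<in> hds s" "y \<in> hds s" and c: "cl x = cl y"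
      then obtain v t w u where "(v, t) \<in> set s" "x = hd t" "(w, u) \<in> set s" "y = hd u" by (auto simp: hds_def)
      then show "x = y" using c cl1[of v t x] cl1[of w u y] hin by auto
    qed
    show "cl x = cl y" if xy: "x \<in> set (flat s) - vs s" "y \<in> set (flat s) - vs s" "link (Oset H s) x y" for x y
    proof -
      have "\<exists>v t. (v, t) \<in> set s \<and> z \<in> set t" if "z \<in> set (flat s) - vs s" for z
        using that unfolding set_flat vs_def by force
      then obtain v t w u where *: "(v, t) \<in> set s" "x \<in> set t" "(w, u) \<in> set s" "y \<in> set u" using xy by blast
      then have "(v, t) = (w, u)" using n xy(3) by blast
      then show ?thesis using cl1 * by metis
    qed
  qed
  moreover have "card (hds s) = length s" by (rule hds_card[OF tne df])
  ultimately show False using ringD(10)[OF fr] by simp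
qed

lemma rot_pair:
  assumes "det H s" "a \<in> set s" "b \<in> set s" "a \<noteq> b"
  obtains Ms Ns where "det H (a # Ms @ b # Ns)" "set (a # Ms @ b # Ns) = set s"
proof -
  obtain P S where s: "s = P @ a # S" using assms(2) by (meson split_list)
  have d: "det H (a # S @ P)" using det_rot[of H P "a # S"] assms(1) s by simp
  have "b \<in> set (S @ P)" using assms(3,4) s by auto
  then obtain Ms Ns where "S @ P = Ms @ b # Ns" by (meson split_list)
  then show ?thesis using that[of Ms Ns] d s by (metis append_Cons set_append Un_commute list.simps(15) set_rotate rotate_append Un_insert_right)
qed

end

lemma flat_len: "\<forall>(v, t) \<in> set s. length t \<ge> 2 ==> 3 * length s \<le> length (flat s)"
  by (induction s rule: flat.induct) auto

context tgraph
begin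

lemma all_len2: "det H s ==> (v, t) \<in> set s ==> length t \<ge> 2"
proof -
  assume dt: "det H s" and m: "(v, t) \<in> set s"
  obtain P S where s: "s = P @ (v, t) # S" using m by (meson split_list)
  have "det H ((v, t) # S @ P)" using det_rot[of H P "(v, t) # S"] dt s by simp
  then show ?thesis by (rule len2)
qed

lemma card_V_det:
  assumes dt: "det H s"
  shows "card V = length (flat s) + card H + card (Oset H s)"
proof -
  have finO: "finite (Oset H s)" using fin by (simp add: Oset_def)
  have fH: "finite H" using detD(6)[OF dt] fin finite_subset by blast
  have "V = (set (flat s) \<union> H) \<union> Oset H s" using detD(5,6)[OF dt] by (auto simp: Oset_def)
  then have "card V = card ((set (flat s) \<union> H) \<union> Oset H s)" by (rule arg_cong)
  also have "\<dots> = card (set (flat s) \<union> H) + card (Oset H s)"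
    using finO fH by (intro card_Un_disjoint) (auto simp: Oset_def)
  also have "card (set (flat s) \<union> H) = card (set (flat s)) + card H"
    using fH detD(8)[OF dt] by (intro card_Un_disjoint) auto
  also have "card (set (flat s)) = length (flat s)" using distinct_card[OF detD(2)[OF dt]] .
  finally show ?thesis .
qed

text \<open>In both orientations \<open>T1\<close> is defective, and it has one contact p only: T1 =
  L p M. Toughness links L with M, a degree count shows that \<open>last L\<close> reaches v1, v2 or
  M, and rearranging L and M then gives a path through everything.\<close>

lemma base_False:
  assumes dt: "det H ((v1, T1) # (v2, T2) # R')" and b: "\<not> good T1 v2"
    and P: "P = Pset (Oset H ((v1, T1) # (v2, T2) # R')) T1 ((v2, T2) # R')" and p: "p \<in> P"
  shows False
proof -
  define R where "R = (v2, T2) # R'"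
  define Os where "Os = Oset H ((v1, T1) # R)"
  have dR: "det H ((v1, T1) # R)" using dt R_def by simp
  have bR: "\<not> good T1 (nx R v1)" using b R_def by simp
  have PR: "P = Pset (Oset H ((v1, T1) # R)) T1 R" using P R_def by simp
  have d12: "det H ((v1, T1) # [] @ (v2, T2) # R')" using dt by simp
  note q = pairD[OF d12]
  have nxR: "nx R v1 = v2" by (simp add: R_def)
  have dT: "distinct T1" and ne: "T1 \<noteq> []" using q(15,1) by auto
  have in2: "(v2, T2) \<in> set R" by (simp add: R_def)
  obtain g where g: "lastbad T1 (nx R v1) g" using lastbad_ex[OF bR ne] .
  note pf = Pfacts[OF dR bR g, folded PR]
  have pT1: "x \<in> P ==> x \<in> set T1" for x by (auto simp: PR Pset_def)
  have inP: "x \<in> P" if "x \<in> set T1" "(v, t) \<in> set R" "y \<in> set t" "link Os x y" for x v t y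
    using that unfolding PR Pset_def Os_def by blast
  have adjP: "E (hd t) x" if "x \<in> P" "(v, t) \<in> set R" for x v t
  proof -
    have "x \<in> set T1" using pT1 that(1) by blast
    then obtain a c where "T1 = a @ x # c" by (meson split_list)
    then show ?thesis using pf(5) that by blast
  qed
  note m = mir1[OF dR]
  define R\<^sub>m where "R\<^sub>m = mir R v1"
  have dm: "det H ((v2, rev T1) # R\<^sub>m)" and Om: "Oset H ((v2, rev T1) # R\<^sub>m) = Os"
    using m unfolding R\<^sub>m_def Os_def nxR by auto
  have nxm: "nx R\<^sub>m v2 = v1" using nx_mir[of R v1] unfolding nxR R\<^sub>m_def .
  \<comment> \<open>If \<open>T1\<close> were good backwards, a linked \<open>Tj\<close> would be
    defective backwards with its last vertex linked to p, against \<open>alpha\<close>.\<close>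
  have bm: "\<not> good (rev T1) (nx R\<^sub>m v2)"
  proof
    assume gm: "good (rev T1) (nx R\<^sub>m v2)"
    obtain vj Tj r where j: "(vj, Tj) \<in> set R" "r \<in> set Tj" "link Os p r" using p unfolding PR Pset_def Os_def by blast
    obtain Ms Ns where RR: "R = Ms @ (vj, Tj) # Ns" using j(1) by (meson split_list)
    have d: "det H ((v1, T1) # Ms @ (vj, Tj) # Ns)" using dR RR by simp
    have O: "Oset H ((v1, T1) # Ms @ (vj, Tj) # Ns) = Os" using RR Os_def by simp
    have nb: "\<not> good (rev Tj) vj" using bad_mirror[OF d _ pT1[OF p] j(2)] j(3) gm unfolding O nxm by blast
    note mm = mir2r[OF d]
    have nn: "nx (mir Ms vj @ (nx Ms vj, rev T1) # mir Ns v1) (nx Ns v1) = vj" by (simp add: nx_append nx_mir)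
    have "link Os (hd Tj) p" using link_E[OF adjP[OF p j(1)]] .
    then have l: "link Os (last (rev Tj)) p" using j(2) by (cases Tj) auto
    show False
      by (rule alpha[OF mm(1), of "nx Ms vj" "rev T1" p]) (use nb l pT1[OF p] in \<open>simp_all add: nn mm(2) O\<close>)
  qed
  have Pm: "P = Pset (Oset H ((v2, rev T1) # R\<^sub>m)) (rev T1) R\<^sub>m" unfolding Om unfolding R\<^sub>m_def Pset_mir PR Os_def ..
  obtain gm where gm: "lastbad (rev T1) (nx R\<^sub>m v2) gm" using lastbad_ex[OF bm] ne by auto
  note pfm = Pfacts[OF dm bm gm, folded Pm]
  have adjPm: "E (last t) x" if "x \<in> P" "(v, t) \<in> set R" for x v t
  proof -
    have "x \<in> set (rev T1)" using pT1 that(1) by simp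
    then obtain a c where "rev T1 = a @ x # c" by (meson split_list)
    moreover have "\<exists>w. (w, rev t) \<in> set R\<^sub>m" using segs_mir2[OF that(2)] unfolding R\<^sub>m_def by blast
    then obtain w where "(w, rev t) \<in> set R\<^sub>m" by blast
    moreover have "t \<noteq> []" using detD(9)[OF dR, of v t] that(2) by auto
    ultimately show ?thesis using pfm(5)[OF that(1), of a c w "rev t"] by (simp add: hd_rev)
  qed
  \<comment> \<open>All of \<open>T2\<close> could be inserted between two consecutive contacts,
    with v2 moved to the end of the path.\<close>
  have nc: False if "T1 = a @ x # y # c" "x \<in> P" "y \<in> P" for a x y c
  proof -
    have e: "E (hd T2) x" "E (last T2) y" using adjP adjPm that in2 by blast+
    have w0: "walk (a @ [x])" "walk (y # c)" using q(3) that(1) by (auto simp: walk_append walk_Cons)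
    have w1: "walk (T2 @ (y # c) @ [v2])"
    proof -
      have "E (last (y # c)) v2" using q(9) that(1) by simp
      then have "walk ((y # c) @ [v2])" using w0(2) by (subst walk_append) simp
      then show ?thesis using q(2,4) e(2) by (subst walk_append) simp
    qed
    have w2: "walk ((a @ [x]) @ T2 @ (y # c) @ [v2])"
      using w0(1) w1 e(1) q(2) Ec by (subst walk_append) simp
    have h: "hd ((a @ [x]) @ T2 @ (y # c) @ [v2]) = hd T1" using that(1) by (cases a) auto
    have w3: "walk (flat R' @ [v1])" using q(6,12) by (cases "R' = []") (auto simp: walk_append)
    have "walk ((flat R' @ [v1]) @ (a @ [x]) @ T2 @ (y # c) @ [v2])"
      using w3 w2 h q(7) by (subst walk_append) simp
    from np0[OF dt this, of "[]"] show False
      using q(15,19) that(1) nx_vs[of R' v1] by (auto simp: hd_flat_nx)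
  qed
  obtain L M where T: "T1 = L @ p # M" using pT1[OF p] by (meson split_list)
  have Tm: "rev T1 = rev M @ p # rev L" using T by simp
  have nc': False if "rev T1 = a @ x # y # c" "x \<in> P" "y \<in> P" for a x y c
  proof -
    have "T1 = rev c @ y # x # rev a" using arg_cong[OF that(1), of rev] by simp
    then show False using nc that by blast
  qed
  have hf: "L \<noteq> []" "M \<noteq> []" "\<And>y. y \<in> set (tl L) \<union> {p} ==> E (hd T1) y" "P = {p}"
    "length M \<ge> 2 ==> E (hd T1) (nx R v1)"
    subgoal by (rule half(1)[OF dR bR PR _ p T]) (erule (2) nc)
    subgoal by (rule half(2)[OF dR bR PR _ p T]) (erule (2) nc)
    subgoal premises pr by (rule half(3)[OF dR bR PR _ p T pr]) (erule (2) nc)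
    subgoal by (rule half(4)[OF dR bR PR _ p T]) (erule (2) nc)
    subgoal premises pr by (rule half(5)[OF dR bR PR _ p T pr]) (erule (2) nc)
    done
  have hm: "(rev M) \<noteq> []" "(rev L) \<noteq> []" "\<And>y. y \<in> set (tl (rev M)) \<union> {p} ==> E (hd (rev T1)) y" "P = {p}"
    "length (rev L) \<ge> 2 ==> E (hd (rev T1)) (nx R\<^sub>m v2)"
    subgoal by (rule half(1)[OF dm bm Pm _ p Tm]) (erule (2) nc')
    subgoal by (rule half(2)[OF dm bm Pm _ p Tm]) (erule (2) nc')
    subgoal premises pr by (rule half(3)[OF dm bm Pm _ p Tm pr]) (erule (2) nc')
    subgoal by (rule half(4)[OF dm bm Pm _ p Tm]) (erule (2) nc')
    subgoal premises pr by (rule half(5)[OF dm bm Pm _ p Tm pr]) (erule (2) nc')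
    done
  note L = hf(1) and M = hf(2)
  have Pp: "P = {p}" by (rule hf(4))
  have hT: "hd T1 = hd L" "last T1 = last M" using T L M by auto
  have hrT: "hd (rev T1) = last M" using hT ne by (simp add: hd_rev)
  have uL: "E (hd L) y" if "y \<in> set (tl L) \<union> {p}" for y using hf(3)[OF that] hT by simp
  have wM: "E (last M) y" if "y \<in> set (butlast M) \<union> {p}" for y
  proof -
    have "tl (rev M) = rev (butlast M)" by (cases M rule: rev_cases) auto
    then show ?thesis using hm(3)[of y] that unfolding hrT by simp
  qed
  have e2p: "E (hd T2) p" "E (last T2) p" using adjP[OF p in2] adjPm[OF p in2] by auto
  have wLM: "walk L" "walk M" "walk (p # M)" "walk (L @ [p])" "E (last L) p" "E p (hd M)"
    using q(3) T L M by (auto simp: walk_append walk_Cons)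
  have wR: "walk (T2 @ flat R' @ [v1])" by (rule q(17))
  have inT1: "x \<notin> vs ((v1, T1) # (v2, T2) # R')" if "x \<in> set T1" for x
    using seg_disj[OF detD(2)[OF dt], of v1 T1 x] that by auto
  have L2: "length L \<ge> 2"
  proof (rule ccontr)
    assume "\<not> ?thesis"
    then obtain x where x: "L = [x]" using L by (cases L) (auto simp: Suc_le_eq)
    have "walk ((p # M) @ [v2])" using wLM(3) M hT q(9) by (subst walk_append) simp
    then have "walk (rev (T2 @ flat R' @ [v1]) @ (p # M) @ [v2])"
      using wR e2p q(2) by (subst walk_append) (simp add: last_rev del: rev_append)
    from np1[OF dt this, of x "[]"] show False using q(15) T x inT1[of x] by auto
  qed
  have M2: "length M \<ge> 2"
  proof (rule ccontr)
    assume "\<not> ?thesis"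
    then obtain x where x: "M = [x]" using M by (cases M) (auto simp: Suc_le_eq)
    have w0: "walk (flat R' @ [v1])" using q(6,12) by (cases "R' = []") (auto simp: walk_append)
    have "walk (rev (L @ [p]) @ rev (flat R' @ [v1]))"
      using w0 wLM(4) hT q(7) L Ec by (subst walk_append) (simp add: last_rev hd_append hd_rev del: rev_append)
    then have "walk (T2 @ rev (L @ [p]) @ rev (flat R' @ [v1]))"
      using q(2,4) e2p by (subst walk_append) (simp add: hd_append hd_rev)
    then have w2: "walk ([v2] @ T2 @ rev (L @ [p]) @ rev (flat R' @ [v1]))"
      using q(2,8) by (subst walk_append) simp
    have la: "last ([v2] @ T2 @ rev (L @ [p]) @ rev (flat R' @ [v1])) = nx R' v1"
      by (simp add: last_rev hd_flat_nx del: rev_append)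
    have lv: "last ([v2] @ T2 @ rev (L @ [p]) @ rev (flat R' @ [v1])) \<in> vs ((v1, T1) # (v2, T2) # R')"
      unfolding la using nx_vs[of R' v1] by auto
    have ln: "hd ([v2] @ T2 @ rev (L @ [p]) @ rev (flat R' @ [v1])) \<noteq> last ([v2] @ T2 @ rev (L @ [p]) @ rev (flat R' @ [v1]))"
      unfolding la using q(19) by simp
    have "x \<notin> vs ((v1, T1) # (v2, T2) # R')" using inT1[of x] T x by simp
    then show False using np1[OF dt w2 _ _ _ _ lv ln, of x "[]"] T x by simp
  qed
  have uv2: "E (hd L) v2" using hf(5)[OF M2] hT nxR by simp
  obtain h where h: "h \<in> H" using detD(7)[OF dt] by auto
  let ?s = "(v1, T1) # R"
  have df: "distinct (flat ?s)" by (rule detD(2)[OF dR])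
  have T1R: "x \<notin> set t" if "x \<in> set T1" "(v, t) \<in> set R" for x v t
  proof
    assume "x \<in> set t"
    then have "x \<in> set (flat R)" using that by (auto simp: set_flat)
    then show False using df that by auto
  qed
  have tneR: "\<forall>(v, t)\<in>set R. t \<noteq> []" using detD(9)[OF dR] by auto
  text \<open>Without an edge between the two sides of \<open>p\<close>, deleting \<open>p\<close> as well leaves too many components.\<close>
  have "\<exists>l\<in>set L. \<exists>m\<in>set M. link Os l m"
  proof (rule ccontr)
    assume n: "\<not> ?thesis"
    define cl where "cl x = (x \<in> set L, x \<in> set M, {(v, t) \<in> set R. x \<in> set t})" for x
    define S where "S = insert (hd L) (insert (hd M) (hds R))"
    have clL: "cl x = (True, False, {})" if "x \<in> set L" for x
    proof -
      have "x \<in> set T1" "x \<notin> set M" using that dT T by auto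
      then show ?thesis using that T1R unfolding cl_def by blast
    qed
    have clM: "cl x = (False, True, {})" if "x \<in> set M" for x
    proof -
      have "x \<in> set T1" "x \<notin> set L" using that dT T by auto
      then show ?thesis using that T1R unfolding cl_def by blast
    qed
    have clR: "cl x = (False, False, {(v, t)})" if "(v, t) \<in> set R" "x \<in> set t" for x v t
    proof -
      have "(w, u) = (v, t)" if "(w, u) \<in> set R" "x \<in> set u" for w u
        by (rule seg_inj[of R]) (use df that \<open>(v, t) \<in> set R\<close> \<open>x \<in> set t\<close> in auto)
      then have "{(v, t) \<in> set R. x \<in> set t} = {(v, t)}" using that by blast
      moreover have "x \<notin> set T1" using T1R that by blast
      ultimately show ?thesis using T by (simp add: cl_def)
    qed
    have hdR: "hd t \<in> set t" if "(v, t) \<in> set R" for v t using tneR that by auto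
    have cLM: "hd L \<in> set L" "hd M \<in> set M" using L M by auto
    have hdsR: "x \<notin> set T1" if hx: "x \<in> hds R" for x
    proof -
      obtain v t where "(v, t) \<in> set R" "x = hd t" using hx by (auto simp: hds_def)
      then show ?thesis using hdR T1R by blast
    qed
    have finR: "finite (hds R)" by (simp add: hds_def)
    have "card S = length R + 2"
    proof -
      have "card (hds R) = length R" by (rule hds_card[OF tneR]) (use df in auto)
      moreover have "hd M \<notin> hds R" "hd L \<notin> hds R" using hdsR cLM T by auto
      moreover have "hd L \<noteq> hd M" using cLM dT T by auto
      ultimately show ?thesis using finR by (simp add: S_def)
    qed
    moreover have "card S + 1 \<le> card (insert p (vs ?s))"
    proof (rule tough_cl[where cl = cl and Cs = "set (flat ?s)" and H = H and h = h and Os = Os])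
      show "insert p (vs ?s) \<subseteq> set (flat ?s)" using vs_flat[of ?s] pT1[OF p] by auto
      show "set (flat ?s) \<subseteq> V" "h \<in> H" using detD(5)[OF dR] h by auto
      show "H \<subseteq> V - set (flat ?s)" using detD(6,8)[OF dR] by blast
      show "\<And>x y. x \<in> H ==> E x y ==> y \<in> H \<union> insert p (vs ?s)" using detD(11)[OF dR] by blast
      show "Os = V - set (flat ?s) - H" by (simp add: Oset_def Os_def)
      show "S \<subseteq> set (flat ?s) - insert p (vs ?s)"
      proof -
        have "hd L \<notin> vs ?s" "hd M \<notin> vs ?s" using inT1[of "hd L"] inT1[of "hd M"] cLM T by (auto simp: R_def)
        moreover have "hds R \<inter> vs ?s = {}" using vs_hds[OF dR] by auto
        moreover have "hds R \<subseteq> set (flat R)" by (rule hds_flat[OF tneR])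
        moreover have "p \<noteq> hd L" "p \<noteq> hd M" using cLM dT T by auto
        moreover have "p \<notin> hds R" using hdsR pT1[OF p] by blast
        ultimately show ?thesis using cLM T by (auto simp: S_def)
      qed
      show "inj_on cl S"
      proof (rule inj_onI)
        fix x y assume x: "x \<in> S" and y: "y \<in> S" and c: "cl x = cl y"
        have *: "z = hd L \<or> z = hd M \<or> (\<exists>v t. (v, t) \<in> set R \<and> z = hd t \<and> cl z = (False, False, {(v, t)}))" if zS: "z \<in> S" for z
        proof -
          consider "z = hd L" | "z = hd M" | v t where "(v, t) \<in> set R" "z = hd t" using zS unfolding S_def hds_def by auto
          then show ?thesis
          proof cases
            case 3
            then have "cl z = (False, False, {(v, t)})" using clR[OF 3(1)] hdR[OF 3(1)] by simp
            then show ?thesis using 3 by blast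
          qed blast+
        qed
        show "x = y" using *[OF x] *[OF y] c clL[OF cLM(1)] clM[OF cLM(2)] by auto
      qed
      show "cl x = cl y" if x: "x \<in> set (flat ?s) - insert p (vs ?s)" and y: "y \<in> set (flat ?s) - insert p (vs ?s)"
        and xy: "link Os x y" for x y
      proof -
        have *: "z \<in> set L \<or> z \<in> set M \<or> (\<exists>v t. (v, t) \<in> set R \<and> z \<in> set t)" if "z \<in> set (flat ?s) - insert p (vs ?s)" for z
          using that T unfolding set_flat vs_def by force
        have lT: False if "a \<in> set T1" "a \<noteq> p" "(v, t) \<in> set R" "d \<in> set t" "link Os a d" for a d v t
          using inP[OF that(1,3,4,5)] Pp that(2) by simp
        have inT: "z \<in> set T1" if "z \<in> set L \<union> set M" for z using that T by auto
        have xp: "x \<noteq> p" "y \<noteq> p" using x y by auto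
        consider "x \<in> set L \<and> y \<in> set L" | "x \<in> set M \<and> y \<in> set M" | "x \<in> set L \<and> y \<in> set M \<or> x \<in> set M \<and> y \<in> set L"
          | v t where "(v, t) \<in> set R" "y \<in> set t" "x \<in> set L \<union> set M" | v t where "(v, t) \<in> set R" "x \<in> set t" "y \<in> set L \<union> set M"
          | v t w u where "(v, t) \<in> set R" "x \<in> set t" "(w, u) \<in> set R" "y \<in> set u"
          using *[OF x] *[OF y] by blast
        then show ?thesis
        proof cases
          case 1 then show ?thesis using clL by metis
        next
          case 2 then show ?thesis using clM by metis
        next
          case 3 then show ?thesis using n xy link_sym by blast
        next
          case 4 then show ?thesis using lT[OF inT _ _ _ xy] xp by blast
        next
          case 5 then show ?thesis using lT[OF inT _ _ _ link_sym[OF xy]] xp by blast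
        next
          case 6
          then have "(v, t) = (w, u)" using bad_unlinked2[OF dR bR] xy unfolding Os_def by blast
          then show ?thesis using clR 6 by metis
        qed
      qed
    qed auto
    moreover have "card (insert p (vs ?s)) \<le> card (vs ?s) + 1" by (simp add: card_insert_if vs_def)
    ultimately show False using detD(10)[OF dR] by simp
  qed
  then obtain l0 m0 where lm0: "l0 \<in> set L" "m0 \<in> set M" "link Os l0 m0" by blast
  define pm where "pm = last L"
  have pmL: "pm \<in> set L" "pm \<in> set T1" using L T by (auto simp: pm_def)
  have pmp: "pm \<noteq> p" using pmL dT T by auto
  \<comment> \<open>Otherwise h, \<open>last L\<close> and \<open>hd T2\<close> would be independent
    with too small a degree sum. The comparison uses n >= |T1| + |T2| + 2 + 3 (k - 2) + |H| + |Os|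
    for k segments, as each of the other segments has two vertices.\<close>
  have pm_adj: "E pm v1 \<or> E pm v2 \<or> E pm (hd M)"
  proof (rule ccontr)
    assume n: "\<not> ?thesis"
    have u2: "hd T2 \<in> set T2" using q(2) by simp
    have no_pm: "\<not> link Os pm y" if "(v, t) \<in> set R" "y \<in> set t" for v t y
      using inP[OF pmL(2) that] Pp pmp by auto
    define A where "A x = {z \<in> Os. E x z}" for x
    have finO: "finite Os" using fin by (simp add: Oset_def Os_def)
    have fv: "finite (vs ?s)" by (simp add: vs_def)
    have Vc: "y \<in> set (flat ?s) \<or> y \<in> Os" if "E x y" "x \<notin> H" "x \<notin> vs ?s" for x y
    proof -
      have "y \<notin> H" using detD(11)[OF dR, of y x] that Ec by blast
      then show ?thesis using EV2[OF that(1)] by (auto simp: Os_def Oset_def)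
    qed
    have nH: "x \<notin> H" if "x \<in> set (flat ?s)" for x using that detD(8)[OF dR] by auto
    have s1: "nb pm \<subseteq> ((set T1 - {pm, hd M}) \<union> (vs ?s - {v1, v2})) \<union> A pm"
    proof
      fix y assume "y \<in> nb pm"
      then have e: "E pm y" by (simp add: in_nb)
      then have ny: "y \<noteq> pm" "y \<noteq> hd M" "y \<noteq> v1" "y \<noteq> v2" using n irr by auto
      have "y \<notin> set t" if "(v, t) \<in> set R" for v t using no_pm[OF that] link_E[OF e] by blast
      moreover have "y \<in> set (flat ?s) \<or> y \<in> Os" using Vc[OF e] nH inT1[OF pmL(2)] pmL(2) by (auto simp: R_def)
      ultimately have "y \<in> set T1 \<or> y \<in> vs ?s \<or> y \<in> Os" unfolding set_flat vs_def by force
      then show "y \<in> ((set T1 - {pm, hd M}) \<union> (vs ?s - {v1, v2})) \<union> A pm" using ny e by (auto simp: A_def)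
    qed
    have s2: "nb (hd T2) \<subseteq> ((set T2 - {hd T2}) \<union> insert p (vs ?s)) \<union> A (hd T2)"
    proof
      fix y assume "y \<in> nb (hd T2)"
      then have e: "E (hd T2) y" by (simp add: in_nb)
      then have ny: "y \<noteq> hd T2" using irr by auto
      have "y = p" if "y \<in> set T1" using inP[OF that in2 u2] link_E[of y "hd T2"] e Ec Pp by auto
      moreover have "(v, t) = (v2, T2)" if "(v, t) \<in> set R" "y \<in> set t" for v t
        using bad_unlinked2[OF dR bR in2 that(1) _ u2 that(2)] link_E[OF e] by blast
      moreover have "y \<in> set (flat ?s) \<or> y \<in> Os"
        using Vc[OF e] nH u2 seg_disj[OF df, of v2 T2 "hd T2"] in2 by (auto simp: R_def)
      ultimately have "y = p \<or> y \<in> set T2 \<or> y \<in> vs ?s \<or> y \<in> Os" unfolding set_flat vs_def by force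
      then show "y \<in> ((set T2 - {hd T2}) \<union> insert p (vs ?s)) \<union> A (hd T2)" using ny e by (auto simp: A_def)
    qed
    have "hd M \<in> set T1" "pm \<noteq> hd M" using M T pmL dT by auto
    then have cT1: "card (set T1 - {pm, hd M}) = length T1 - 2"
      using pmL(2) distinct_card[OF dT] by (subst card_Diff_subset) auto
    have "v1 \<noteq> v2" using df by (auto simp: R_def)
    then have cv: "card (vs ?s - {v1, v2}) = card (vs ?s) - 2"
      using fv by (subst card_Diff_subset) (auto simp: R_def)
    have d1: "deg pm \<le> (length T1 - 2) + (card (vs ?s) - 2) + card (A pm)"
    proof -
      have "deg pm \<le> card (((set T1 - {pm, hd M}) \<union> (vs ?s - {v1, v2})) \<union> A pm)"
        unfolding deg_def using s1 finO fv by (intro card_mono) (auto simp: A_def)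
      also have "\<dots> \<le> card ((set T1 - {pm, hd M}) \<union> (vs ?s - {v1, v2})) + card (A pm)" by (rule card_Un_le)
      also have "card ((set T1 - {pm, hd M}) \<union> (vs ?s - {v1, v2})) \<le> card (set T1 - {pm, hd M}) + card (vs ?s - {v1, v2})" by (rule card_Un_le)
      finally show ?thesis unfolding cT1 cv by simp
    qed
    have dT2: "distinct T2" using q(15) by simp
    have d2: "deg (hd T2) \<le> (length T2 - 1) + (card (vs ?s) + 1) + card (A (hd T2))"
    proof -
      have "deg (hd T2) \<le> card (((set T2 - {hd T2}) \<union> insert p (vs ?s)) \<union> A (hd T2))"
        unfolding deg_def using s2 finO fv by (intro card_mono) (auto simp: A_def)
      also have "\<dots> \<le> card ((set T2 - {hd T2}) \<union> insert p (vs ?s)) + card (A (hd T2))" by (rule card_Un_le)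
      also have "card ((set T2 - {hd T2}) \<union> insert p (vs ?s)) \<le> card (set T2 - {hd T2}) + card (insert p (vs ?s))" by (rule card_Un_le)
      also have "card (set T2 - {hd T2}) = length T2 - 1" using u2 distinct_card[OF dT2] by simp
      also have "card (insert p (vs ?s)) \<le> card (vs ?s) + 1" using fv by (simp add: card_insert_if)
      finally show ?thesis by simp
    qed
    have dis: "A pm \<inter> A (hd T2) = {}"
    proof -
      have False if "z \<in> A pm" "z \<in> A (hd T2)" for z
      proof -
        have "walk (pm # [z] @ [hd T2])" using that Ec by (auto simp: walk_Cons A_def)
        then have "link Os pm (hd T2)" using that walk_shorten[of pm "[z]" "hd T2" Os] by (auto simp: A_def)
        then show False using no_pm[OF in2 u2] by simp
      qed
      then show ?thesis by auto
    qed
    have "card (A pm) + card (A (hd T2)) = card (A pm \<union> A (hd T2))"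
      using finO dis by (subst card_Un_disjoint) (auto simp: A_def)
    also have "\<dots> \<le> card Os" using finO by (intro card_mono) (auto simp: A_def)
    finally have co: "card (A pm) + card (A (hd T2)) \<le> card Os" .
    have "\<forall>(v, t) \<in> set R'. length t \<ge> 2" using all_len2[OF dt] by auto
    then have "3 * length R' \<le> length (flat R')" by (rule flat_len)
    then have cV: "card V \<ge> length T1 + length T2 + 2 + 3 * length R' + card H + card Os"
      using card_V_det[OF dR] by (simp add: R_def Os_def)
    have "card V \<le> deg h + deg pm + deg (hd T2)"
    proof (rule sigma)
      have fl: "pm \<in> set (flat ?s)" "hd T2 \<in> set (flat ?s)" using pmL u2 by (auto simp: R_def)
      show "h \<in> V" "pm \<in> V" "hd T2 \<in> V" using h detD(5,6)[OF dR] fl by blast+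
      show "h \<noteq> pm" "h \<noteq> hd T2" using h nH fl by auto
      show "pm \<noteq> hd T2" using pmL u2 q(15) by auto
      show "\<not> E h pm" "\<not> E h (hd T2)" using detD(11)[OF dR h] nH fl inT1[OF pmL(2)] seg_disj[OF df, of v2 T2 "hd T2"] in2 u2
        by (auto simp: R_def)
      show "\<not> E pm (hd T2)" using no_pm[OF in2 u2] link_E by blast
    qed
    moreover have "card (vs ?s) = length R' + 2" using detD(10)[OF dR] by (simp add: R_def)
    moreover have "length T1 \<ge> 2" "length T2 \<ge> 2" using all_len2[OF dt] by auto
    ultimately show False using d1 d2 co cV deg_h[OF dR h] by (simp add: R_def)
  qed
  \<comment> \<open>X rearranges L so as to begin next to v1 or v2 and to leave into M at m. Since
    \<open>last M\<close> sees all of M, M can be traversed from m to a neighbour of p, and p leads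
    on to the other segments.\<close>
  have fin_path: False if X: "walk X" "mset X = mset L" "X \<noteq> []" "E (hd X) v1 \<or> E (hd X) v2" and m: "m \<in> set M" and lk: "link Os (last X) m" for X m
  proof -
    obtain c e where M_split: "M = c @ m # e" using m by (meson split_list)
    have "\<exists>Y. walk Y \<and> mset Y = mset M \<and> Y \<noteq> [] \<and> hd Y = m \<and> E (last Y) p"
    proof (cases "c = []")
      case True
      then show ?thesis using wLM(2) M_split M wM[of p] by (intro exI[of _ M]) auto
    next
      case False
      have wce: "walk c" "walk (m # e)" using wLM(2) M_split by (auto simp: walk_append)
      have "last c \<in> set (butlast M)" using M_split False by (auto simp: butlast_append)
      then have "E (last M) (last c)" using wM by blast
      moreover have "last M = last (m # e)" using M_split by simp
      ultimately have "walk ((m # e) @ rev c)" using wce False by (subst walk_append) (simp add: hd_rev)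
      moreover have "E (last ((m # e) @ rev c)) p" using wLM(6) M_split False Ec by (auto simp: last_rev)
      ultimately show ?thesis using M_split by (intro exI[of _ "(m # e) @ rev c"]) auto
    qed
    then obtain Y where Y: "walk Y" "mset Y = mset M" "Y \<noteq> []" "hd Y = m" "E (last Y) p" by blast
    from lk show False
    proof (rule link_nil)
      fix os assume os: "distinct os" "set os \<subseteq> Os" "walk (last X # os @ [m])"
      have w0: "walk (X @ os @ (Y @ [p]))"
        by (rule walk_link[OF os(3)]) (use X Y in \<open>auto simp: walk_append\<close>)
      have lst: "last (X @ os @ (Y @ [p])) = p" by simp
      from X(4) show False
      proof
        assume e: "E (hd X) v2"
        have w1: "walk ((X @ os @ (Y @ [p])) @ (T2 @ flat R' @ [v1]))"
          using w0 wR e2p q(2) lst Ec[of p] by (subst walk_append) simp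
        have w2: "walk ([v2] @ (X @ os @ (Y @ [p])) @ (T2 @ flat R' @ [v1]))"
          using w1 e X(3) Ec[of v2] by (subst walk_append) simp
        show False by (rule np0[OF dt w2 _ os(1)]) (use os(2) X Y T q(15) in \<open>auto simp: Os_def R_def\<close>)
      next
        assume e: "E (hd X) v1"
        have lR: "E p (last (T2 @ flat R'))"
        proof (cases R' rule: rev_cases)
          case Nil
          then show ?thesis using e2p q(2) Ec by simp
        next
          case (snoc R'' vt)
          obtain v t where vt: "vt = (v, t)" using prod.exhaust[of vt] by blast
          have i: "(v, t) \<in> set R" using snoc vt by (simp add: R_def)
          then have "t \<noteq> []" using tneR by auto
          then have "last (T2 @ flat R') = last t" using snoc vt by simp
          then show ?thesis using adjPm[OF p i] Ec by simp
        qed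
        have w1: "walk (rev (T2 @ flat R') @ [v2])"
        proof -
          have "walk (T2 @ flat R')" using wR walk_append[of "T2 @ flat R'" "[v1]"] by simp
          moreover have "last (rev (T2 @ flat R')) = hd T2" using q(2) by (simp add: last_rev del: rev_append)
          ultimately show ?thesis using q(8) Ec[of v2] by (subst walk_append) (simp del: rev_append)
        qed
        have w2: "walk ((X @ os @ (Y @ [p])) @ (rev (T2 @ flat R') @ [v2]))"
          using w0 w1 lR lst q(2) by (subst walk_append) (simp add: hd_append hd_rev del: rev_append last_append)
        have w3: "walk ([v1] @ (X @ os @ (Y @ [p])) @ (rev (T2 @ flat R') @ [v2]))"
          using w2 e X(3) Ec[of v1] by (subst walk_append) simp
        show False by (rule np0[OF dt w3 _ os(1)]) (use os(2) X Y T q(15) in \<open>auto simp: Os_def R_def\<close>)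
      qed
    qed
  qed
  have fromL: False if "m \<in> set M" "link Os pm m" for m
    using fin_path[of L m] that uv2 wLM(1) L by (simp add: pm_def)
  show False
  proof (cases "E pm (hd M)")
    case True
    then show False using fromL[of "hd M"] link_E M by simp
  next
    case False
    then have pv: "E pm v1 \<or> E pm v2" using pm_adj by simp
    obtain a b where ab: "L = a @ l0 # b" using lm0(1) by (meson split_list)
    show False
    proof (cases "b = []")
      case True
      then show False using fromL[of m0] lm0 ab by (simp add: pm_def)
    next
      case bne: False
      have wab: "walk (a @ [l0])" "walk b" using wLM(1) ab by (auto simp: walk_append walk_Cons)
      have "hd b \<in> set (tl L)" using ab bne by (cases a) auto
      then have "E (hd L) (hd b)" using uL by blast
      moreover have "hd (a @ [l0]) = hd L" using ab by (cases a) auto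
      ultimately have w: "walk (rev b @ (a @ [l0]))" using wab bne Ec by (subst walk_append) (simp add: last_rev)
      have "hd (rev b @ (a @ [l0])) = pm" using bne ab by (simp add: pm_def hd_append hd_rev)
      then show False using fin_path[OF w _ _ _ lm0(2)] pv lm0(3) ab by auto
    qed
  qed
qed

text \<open>Toughness links two segments. As good segments are not linked, one of the two is
  defective, with a contact.\<close>

theorem det_False:
  assumes dt: "det H s"
  shows False
proof -
  obtain v t w u p q where l: "(v, t) \<in> set s" "(w, u) \<in> set s" "(v, t) \<noteq> (w, u)" "p \<in> set t" "q \<in> set u" "link (Oset H s) p q"
    using tough_link[OF frame_ring[OF det_frame[OF dt]]] by blast
  obtain Ms Ns where d: "det H ((v, t) # Ms @ (w, u) # Ns)" and st: "set ((v, t) # Ms @ (w, u) # Ns) = set s"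
    using rot_pair[OF dt l(1,2,3)] by metis
  have main: False if d: "det H ((v, t) # Ms @ (w, u) # Ns)" and b: "\<not> good t (nx Ms w)" and pq: "p \<in> set t" "q \<in> set u"
    and lk: "link (Oset H ((v, t) # Ms @ (w, u) # Ns)) p q" for v t w u Ms Ns p q
  proof -
    obtain v2 T2 R' where R: "Ms @ (w, u) # Ns = (v2, T2) # R'" by (cases Ms) auto
    have "nx Ms w = v2" using R nx_append[of Ms w u Ns v] by simp
    then have b': "\<not> good t v2" using b by simp
    have "p \<in> Pset (Oset H ((v, t) # (v2, T2) # R')) t ((v2, T2) # R')"
      unfolding R[symmetric] Pset_def using pq lk by auto
    then show False using base_False[of H v t v2 T2 R' _ p] d b' R by simp
  qed
  have O: "Oset H ((v, t) # Ms @ (w, u) # Ns) = Oset H s" by (rule Oset_cong[OF st])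
  have d2: "det H ((w, u) # Ns @ (v, t) # Ms)" using det_rot[of H "(v, t) # Ms" "(w, u) # Ns"] d by simp
  have O2: "Oset H ((w, u) # Ns @ (v, t) # Ms) = Oset H s" unfolding O[symmetric] by (rule Oset_cong) auto
  show False
  proof (cases "good t (nx Ms w)")
    case False
    then show False using main[OF d False l(4,5)] l(6) O by simp
  next
    case True
    have "\<not> good u (nx Ns v)" using good_unlinked[OF d True _ l(4,5)] l(6) O by auto
    then show False using main[OF d2 _ l(5,4)] link_sym[OF l(6)] O2 by simp
  qed
qed

end

section \<open>Longest cycles are dominating\<close>

function cuts :: "'a set => 'a list => ('a \<times> 'a list) list" where
  "cuts W [] = []"
| "cuts W (v # xs) = (v, takeWhile (\<lambda>x. x \<notin> W) xs) # cuts W (dropWhile (\<lambda>x. x \<notin> W) xs)"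
  by pat_completeness auto

termination by (relation "Wellfounded.measure (length \<circ> snd)") (auto simp: length_dropWhile_le less_Suc_eq_le)

lemma flat_cuts[simp]: "flat (cuts W xs) = xs"
  by (induction W xs rule: cuts.induct) auto

lemma vs_cuts: "xs = [] \<or> hd xs \<in> W ==> vs (cuts W xs) = W \<inter> set xs"
proof (induction W xs rule: cuts.induct)
  case (2 W v xs)
  let ?d = "dropWhile (\<lambda>x. x \<notin> W) xs"
  have "?d = [] \<or> hd ?d \<in> W" using hd_dropWhile[of "\<lambda>x. x \<notin> W" xs] by auto
  then have IH: "vs (cuts W ?d) = W \<inter> set ?d" using 2 by simp
  have "set xs = set (takeWhile (\<lambda>x. x \<notin> W) xs) \<union> set ?d"
    by (metis set_append takeWhile_dropWhile_id)
  moreover have "W \<inter> set (takeWhile (\<lambda>x. x \<notin> W) xs) = {}" by (auto dest: set_takeWhileD)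
  ultimately have "W \<inter> set xs = W \<inter> set ?d" by auto
  then show ?case using 2 IH by auto
qed auto

lemma card_vs: "distinct (flat s) ==> card (vs s) = length s"
proof (induction s rule: flat.induct)
  case (2 v t s)
  then have "v \<notin> vs s" using vs_flat[of s] by auto
  then show ?case using 2 by (simp add: vs_def)
qed auto

lemma flat_len0: "(\<And>v t. (v, t) \<in> set s ==> t \<noteq> []) ==> 2 * length s \<le> length (flat s)"
proof (induction s rule: flat.induct)
  case (2 v t s)
  then have "2 * length s \<le> length (flat s)" "t \<noteq> []" by auto
  then show ?case by (cases t) auto
qed simp

lemma card_marked:
  assumes "distinct (flat s)" "\<And>v t. (v, t) \<in> set s ==> t \<noteq> [] \<and> (v \<in> U \<or> hd t \<in> U)"
  shows "length s \<le> card (U \<inter> set (flat s))"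
  using assms
proof (induction s rule: flat.induct)
  case (2 v t s)
  have IH: "length s \<le> card (U \<inter> set (flat s))" using 2 by auto
  have "t \<noteq> []" "v \<in> U \<or> hd t \<in> U" using "2.prems"(2)[of v t] by auto
  then obtain x where x: "x \<in> U" "x \<in> set (v # t)" by (cases t) auto
  have "insert x (U \<inter> set (flat s)) \<subseteq> U \<inter> set (flat ((v, t) # s))" using x by auto
  then have "card (insert x (U \<inter> set (flat s))) \<le> card (U \<inter> set (flat ((v, t) # s)))" by (intro card_mono) auto
  moreover have "x \<notin> set (flat s)" using x "2.prems"(1) by auto
  ultimately show ?case using IH by simp
qed auto

context sgraph
begin

lemma walk_path:
  assumes "walk P" "P \<noteq> []"
  shows "\<exists>Q. walk Q \<and> distinct Q \<and> Q \<noteq> [] \<and> set Q \<subseteq> set P \<and> hd Q = hd P \<and> last Q = last P"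
  using assms
proof (induction "length P" arbitrary: P rule: less_induct)
  case less
  show ?case
  proof (cases "distinct P")
    case True
    with less show ?thesis by blast
  next
    case False
    then obtain xs y ys zs where d: "P = xs @ [y] @ ys @ [y] @ zs"
      using not_distinct_decomp by blast
    let ?P = "xs @ [y] @ zs"
    have w: "walk ?P" using less.prems(1) unfolding d by (auto simp: walk_append walk_Cons hd_append split: if_splits)
    have l: "length ?P < length P" unfolding d by simp
    have e: "set ?P \<subseteq> set P" "hd ?P = hd P" "last ?P = last P" unfolding d by (auto simp: hd_append)
    obtain Q where "walk Q \<and> distinct Q \<and> Q \<noteq> [] \<and> set Q \<subseteq> set ?P \<and> hd Q = hd ?P \<and> last Q = last ?P"
      using less.hyps[OF l w] by auto
    then show ?thesis using e by (intro exI[of _ Q]) auto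
  qed
qed

text \<open>A component of the graph minus the cycle. Connectedness is given by paths inside
  \<open>H\<close>, which is the form in which \<open>comp_join\<close> inserts \<open>H\<close>
  into cycles.\<close>

definition comp :: "'a set => 'a list => bool" where
  "comp H C \<longleftrightarrow> H \<subseteq> V - set C \<and> H \<noteq> {} \<and> (\<forall>h\<in>H. nb h \<subseteq> H \<union> set C) \<and>
     (\<forall>a\<in>H. \<forall>b\<in>H. \<exists>P. walk P \<and> distinct P \<and> P \<noteq> [] \<and> set P \<subseteq> H \<and> hd P = a \<and> last P = b)"

lemma comp_ex:
  assumes "x \<in> V - set C"
  shows "\<exists>H. x \<in> H \<and> comp H C"
proof -
  define R where "R y P \<longleftrightarrow> walk P \<and> P \<noteq> [] \<and> set P \<subseteq> V - set C \<and> hd P = x \<and> last P = y" for y P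
  define H where "H = {y. \<exists>P. R y P}"
  have xH: "x \<in> H" using assms by (auto simp: H_def R_def intro!: exI[of _ "[x]"])
  have inH: "set P \<subseteq> H" if "R y P" for y P
  proof
    fix z assume "z \<in> set P"
    then obtain a b where P: "P = a @ z # b" by (meson split_list)
    have "R z (a @ [z])" using that unfolding R_def P by (auto simp: walk_append walk_Cons hd_append)
    then show "z \<in> H" by (auto simp: H_def)
  qed
  have "comp H C" unfolding comp_def
  proof (intro conjI ballI)
    show "H \<subseteq> V - set C"
    proof
      fix y assume "y \<in> H"
      then obtain P where "R y P" by (auto simp: H_def)
      then have "y \<in> set P" "set P \<subseteq> V - set C" by (auto simp: R_def)
      then show "y \<in> V - set C" by blast
    qed
    show "H \<noteq> {}" using xH by auto
    show "nb h \<subseteq> H \<union> set C" if hH: "h \<in> H" for h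
    proof
      fix y assume "y \<in> nb h"
      then have e: "E h y" by (simp add: in_nb)
      obtain P where P: "R h P" using hH by (auto simp: H_def)
      show "y \<in> H \<union> set C"
      proof (cases "y \<in> set C")
        case False
        have "R y (P @ [y])" using P e EV2[OF e] False by (auto simp: R_def walk_append)
        then show ?thesis by (auto simp: H_def)
      qed simp
    qed
    show "\<exists>P. walk P \<and> distinct P \<and> P \<noteq> [] \<and> set P \<subseteq> H \<and> hd P = a \<and> last P = b" if ab: "a \<in> H" "b \<in> H" for a b
    proof -
      obtain P Q where P: "R a P" and Q: "R b Q" using ab by (auto simp: H_def)
      let ?W = "rev P @ tl Q"
      obtain Q' where Q': "Q = x # Q'" using Q by (cases Q) (auto simp: R_def)
      have "walk ?W" using P Q unfolding Q' R_def by (auto simp: walk_append walk_Cons last_rev)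
      moreover have "?W \<noteq> []" "hd ?W = a" using P by (auto simp: R_def hd_rev)
      moreover have "last ?W = b" using P Q unfolding Q' R_def by (auto simp: last_rev split: if_splits)
      moreover have "set ?W \<subseteq> H" using inH[OF P] inH[OF Q] Q' by auto
      ultimately show ?thesis using walk_path[of ?W] by fastforce
    qed
  qed
  then show ?thesis using xH by blast
qed

end

context tgraph
begin

definition longest :: "'a list => bool" where
  "longest C \<longleftrightarrow> closed C \<and> (\<forall>D. closed D --> length D \<le> length C)"

lemma longest_cong: "longest C ==> closed D ==> length D = length C ==> longest D"
  by (simp add: longest_def)

lemma join:
  assumes Q: "walk Q" "distinct Q" "set Q \<subseteq> V - H" "Q \<noteq> []"
    and P: "walk P" "distinct P" "set P \<subseteq> H" "P \<noteq> []" and H: "H \<subseteq> V"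
    and e: "E (last Q) (hd P)" "E (last P) (hd Q)"
  shows "closed (Q @ P)"
  unfolding closed_def using assms by (auto simp: walk_append)

lemma comp_join:
  assumes C: "longest C" and H: "comp H C" and Q: "walk Q" "distinct Q" "set Q \<subseteq> V - H" "Q \<noteq> []"
    and e: "a \<in> H" "b \<in> H" "E (last Q) a" "E (hd Q) b"
  shows "length Q + (if a = b then 1 else 2) \<le> length C"
proof -
  obtain P where P: "walk P" "distinct P" "P \<noteq> []" "set P \<subseteq> H" "hd P = a" "last P = b"
    using H e unfolding comp_def by blast
  have "closed (Q @ P)" by (rule join[of _ H]) (use Q P e H Ec[of "hd Q"] in \<open>auto simp: comp_def\<close>)
  then have "length (Q @ P) \<le> length C" using C unfolding longest_def by blast
  moreover have "length P \<ge> (if a = b then 1 else 2)"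
  proof (cases P)
    case (Cons x P')
    then show ?thesis using P by (cases P') auto
  qed (use P in simp)
  ultimately show ?thesis by simp
qed

lemma cover_length: "distinct C ==> set C - set Q \<subseteq> {x} ==> length C \<le> length Q + 1"
proof -
  assume d: "distinct C" and s: "set C - set Q \<subseteq> {x}"
  have "length C = card (set C)" using distinct_card[OF d] by simp
  also have "\<dots> \<le> card (insert x (set Q))" using s by (intro card_mono) auto
  also have "\<dots> \<le> card (set Q) + 1" by (simp add: card_insert_if)
  also have "\<dots> \<le> length Q + 1" using card_length[of Q] by simp
  finally show ?thesis .
qed

lemma cover_length0: "distinct C ==> set C \<subseteq> set Q ==> length C \<le> length Q"
  proof -
  assume d: "distinct C" and s: "set C \<subseteq> set Q"
  have "length C = card (set C)" using distinct_card[OF d] by simp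
  also have "\<dots> \<le> card (set Q)" using s by (intro card_mono) auto
  also have "\<dots> \<le> length Q" by (rule card_length)
  finally show ?thesis .
qed

text \<open>With at most one attachment, deleting a single cycle vertex would separate
  \<open>H\<close> from the rest of the cycle.\<close>

lemma attach2:
  assumes C: "closed C" "length C \<ge> 3" and H: "comp H C"
  shows "\<exists>v w. v \<in> set C \<and> w \<in> set C \<and> v \<noteq> w \<and> (\<exists>h\<in>H. E h v) \<and> (\<exists>h\<in>H. E h w)"
proof (rule ccontr)
  assume n: "\<not> ?thesis"
  have d: "distinct C" and CV: "set C \<subseteq> V" and ne: "C \<noteq> []" using C by (auto simp: closed_def)
  obtain x0 where x0: "x0 \<in> set C" "\<And>v h. v \<in> set C ==> h \<in> H ==> E h v ==> v = x0"
  proof (cases "\<exists>v\<in>set C. \<exists>h\<in>H. E h v")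
    case True
    then show ?thesis using n that by blast
  next
    case False
    then show ?thesis using that[of "hd C"] ne by force
  qed
  have "card (set C) \<ge> 3" using distinct_card[OF d] C by simp
  then have "\<not> set C \<subseteq> {x0}" using card_mono[of "{x0}" "set C"] by auto
  then obtain y where y: "y \<in> set C" "y \<noteq> x0" by auto
  obtain h where h: "h \<in> H" using H by (auto simp: comp_def)
  have hC: "H \<subseteq> V" "H \<inter> set C = {}" using H by (auto simp: comp_def)
  define K where "K x = (if x = h then H else V - H - {x0})" for x
  have "card {h, y} \<le> card {x0}"
  proof (rule tough[of "{x0}" "{h, y}" K])
    show "{x0} \<subseteq> V" "{h, y} \<subseteq> V - {x0}" using x0 y h hC CV by auto
    show "\<And>x. x \<in> {h, y} ==> x \<in> K x" using y h hC CV by (auto simp: K_def)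
    show "\<And>x y'. x \<in> {h, y} ==> y' \<in> {h, y} ==> x \<noteq> y' ==> y' \<notin> K x" using y h hC by (auto simp: K_def)
    show "b \<in> K x" if p: "x \<in> {h, y}" "a \<in> K x" "E a b" "b \<notin> {x0}" for x a b
    proof (cases "x = h")
      case True
      then have a: "a \<in> H" using p by (simp add: K_def)
      then have "b \<in> H \<union> set C" using H p by (auto simp: comp_def nb_def)
      then show ?thesis using x0(2)[OF _ a p(3)] p(4) True by (auto simp: K_def)
    next
      case False
      then have a: "a \<in> V - H - {x0}" using p by (simp add: K_def)
      have "b \<notin> H"
      proof
        assume b: "b \<in> H"
        have e: "E b a" using p Ec by blast
        then have "a \<in> H \<union> set C" using H b by (auto simp: comp_def nb_def)
        then show False using x0(2)[OF _ b e] a by auto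
      qed
      then show ?thesis using False p EV2[OF p(3)] by (auto simp: K_def)
    qed
  qed auto
  moreover have "h \<noteq> y" using h y hC by blast
  ultimately show False by simp
qed

definition lframe :: "'a set => ('a \<times> 'a list) list => bool" where
  "lframe H s \<longleftrightarrow> frame H s \<and> longest (flat s) \<and> comp H (flat s)"

lemma lframeD: "lframe H s ==> frame H s" "lframe H s ==> longest (flat s)" "lframe H s ==> comp H (flat s)"
  by (auto simp: lframe_def)

lemma lframe_rot:
  assumes "lframe H (xs @ ys)"
  shows "lframe H (ys @ xs)"
proof -
  have f: "frame H (ys @ xs)" using frame_rot lframeD(1)[OF assms] .
  then have "closed (flat (ys @ xs))" by (simp add: frame_def ring_def)
  then have "longest (flat (ys @ xs))" using longest_cong[OF lframeD(2)[OF assms]] by simp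
  moreover have "comp H (flat (ys @ xs))" using lframeD(3)[OF assms] by (simp add: comp_def Un_commute)
  ultimately show ?thesis using f by (simp add: lframe_def)
qed

lemma lframe_pair:
  assumes "lframe H s" "(v, t) \<in> set s" "(w, u) \<in> set s" "(v, t) \<noteq> (w, u)"
  shows "\<exists>Ms Ns. lframe H ((v, t) # Ms @ (w, u) # Ns) \<and> set ((v, t) # Ms @ (w, u) # Ns) = set s"
proof -
  obtain A B where s: "s = A @ (v, t) # B" using assms(2) by (meson split_list)
  have l: "lframe H (((v, t) # B) @ A)" using lframe_rot[of H A "(v, t) # B"] assms(1) s by simp
  have "(w, u) \<in> set (B @ A)" using assms(3,4) s by auto
  then obtain Ms Ns where BA: "B @ A = Ms @ (w, u) # Ns" by (meson split_list)
  have "set (B @ A) = set (Ms @ (w, u) # Ns)" using BA by simp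
  then have "set ((v, t) # Ms @ (w, u) # Ns) = set s" using s by auto
  moreover have "lframe H ((v, t) # Ms @ (w, u) # Ns)" using l BA by simp
  ultimately show ?thesis by blast
qed

lemma frame_ex:
  assumes C: "longest C" "length C \<ge> 3" and H: "comp H C"
  shows "\<exists>s. lframe H s \<and> length (flat s) = length C \<and> set (flat s) = set C"
proof -
  have cl: "closed C" using C by (simp add: longest_def)
  define W where "W = {x \<in> set C. \<exists>h\<in>H. E h x}"
  obtain v w where vw: "v \<in> W" "w \<in> W" "v \<noteq> w" using attach2[OF cl C(2) H] by (auto simp: W_def)
  then obtain A B where AB: "C = A @ v # B" by (auto simp: W_def dest: split_list)
  define D where "D = v # B @ A"
  have clD: "closed D" using closed_rot[of A "v # B"] cl AB by (simp add: D_def)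
  have D: "set D = set C" "length D = length C" using AB by (auto simp: D_def)
  have lD: "longest D" by (rule longest_cong[OF C(1) clD D(2)])
  have HD: "comp H D" using H by (simp add: comp_def D(1))
  define s where "s = cuts W D"
  have fs: "flat s = D" by (simp add: s_def)
  have vsW: "vs s = W"
  proof -
    have "vs s = W \<inter> set D" unfolding s_def by (rule vs_cuts) (use vw in \<open>simp add: D_def\<close>)
    then show ?thesis using D by (auto simp: W_def)
  qed
  have dD: "distinct D" and wD: "walk D" and DV: "set D \<subseteq> V" and cD: "E (last D) (hd D)" using clD by (auto simp: closed_def)
  have cv: "card (vs s) = length s" by (rule card_vs) (use fs dD in simp)
  have "card {v, w} \<le> card W" using vw by (intro card_mono) (auto simp: W_def)
  then have l2: "length s \<ge> 2" using vw cv vsW by simp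
  have DH: "set D \<inter> H = {}" using HD by (auto simp: comp_def)
  have noQ: False if q: "walk Q" "distinct Q" "set Q = set D" "hd Q \<in> W" "last Q \<in> W" for Q
  proof -
    obtain a b where ab: "a \<in> H" "b \<in> H" "E (last Q) a" "E (hd Q) b" using q(4,5) sym unfolding W_def by blast
    have ne: "Q \<noteq> []" using q(3) by (auto simp: D_def)
    have "length Q < length D" using comp_join[OF lD HD q(1,2) _ ne ab] q(3) DV DH by (fastforce split: if_splits)
    moreover have "length D \<le> length Q" by (rule cover_length0[OF dD]) (use q in simp)
    ultimately show False by simp
  qed
  \<comment> \<open>Opening the cycle between two consecutive attachments would give a path through
    all of it that closes through \<open>H\<close>.\<close>
  have ne: "t \<noteq> []" if xt: "(x, t) \<in> set s" for x t
  proof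
    assume t: "t = []"
    obtain P S where s: "s = P @ (x, t) # S" using xt by (meson split_list)
    have xW: "x \<in> W" using vsW s by auto
    show False
    proof (cases S)
      case Nil
      have "D = flat P @ [x]" using fs s t Nil by simp
      then have "last D = x" by simp
      then show False using noQ[OF wD dD refl] xW vw by (simp add: D_def)
    next
      case (Cons yu S')
      obtain y u where yu: "yu = (y, u)" using prod.exhaust[of yu] by blast
      have yW: "y \<in> W" using vsW s Cons yu by auto
      have Dd: "D = (flat P @ [x]) @ (y # u @ flat S')" using fs s t Cons yu by simp
      have "closed ((y # u @ flat S') @ (flat P @ [x]))" by (rule closed_rot) (use Dd clD in simp)
      then show False using xW yW Dd by (intro noQ[of "(y # u @ flat S') @ (flat P @ [x])"]) (auto simp: closed_def)
    qed
  qed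
  have "\<exists>h\<in>H. E x h" if "x \<in> W" for x using that Ec[of x] by (auto simp: W_def)
  moreover have "nb h \<subseteq> H \<union> W" if "h \<in> H" for h using HD that D by (auto simp: comp_def W_def in_nb)
  moreover have "H \<subseteq> V" "H \<noteq> {}" "H \<inter> set D = {}" using HD by (auto simp: comp_def)
  moreover have "card W = length s" using cv vsW by simp
  ultimately have "frame H s" unfolding frame_def ring_def fs vsW using l2 clD ne by blast
  then show ?thesis using fs lD HD D by (intro exI[of _ s]) (auto simp: lframe_def)
qed

lemma noQ0:
  assumes lf: "lframe H s"
    and Q: "walk Q" "distinct Q" "set Q \<subseteq> V - H" "hd Q \<in> vs s" "last Q \<in> vs s" "set (flat s) \<subseteq> set Q"
  shows False
proof -
  note fr = lframeD(1)[OF lf] and lg = lframeD(2)[OF lf] and cp = lframeD(3)[OF lf]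
  have ne: "Q \<noteq> []" using Q(6) frameD(12)[OF fr] by (cases s) auto
  obtain a b where ab: "a \<in> H" "b \<in> H" "E (last Q) a" "E (hd Q) b" using frameD(13)[OF fr] Q by metis
  have "length Q < length (flat s)" using comp_join[OF lg cp Q(1,2,3) ne ab] by (auto split: if_splits)
  then show False using cover_length0[OF frameD(2)[OF fr] Q(6)] by simp
qed

lemma fp0:
  assumes lf: "lframe H s"
    and w: "walk Q" and m: "mset Q = mset (flat s @ os)" and os: "distinct os" "set os \<subseteq> Oset H s"
    and e: "hd Q \<in> vs s" "last Q \<in> vs s"
  shows False
proof -
  note fr = lframeD(1)[OF lf] and lg = lframeD(2)[OF lf] and cp = lframeD(3)[OF lf]
  have "distinct (flat s @ os)" using frameD(2)[OF fr] os by (auto simp: Oset_def)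
  then have dx: "distinct Q" using mset_eq_distinct[OF m] by simp
  have st: "set Q = set (flat s) \<union> set os" using mset_eq_setD[OF m] by simp
  have "set Q \<subseteq> V - H" using st os frameD(5,8)[OF fr] by (auto simp: Oset_def)
  then show False using noQ0[OF lf w dx _ e] st by auto
qed

text \<open>Two such attachments are joined through \<open>H\<close> by a path with two or more
  vertices, so that even a detour that loses one cycle vertex would give a longer cycle.\<close>

definition heavy :: "'a set => 'a => 'a => bool" where
  "heavy H v w \<longleftrightarrow> (\<exists>a\<in>H. \<exists>b\<in>H. a \<noteq> b \<and> E v a \<and> E w b)"

lemma heavy_sym: "heavy H v w \<longleftrightarrow> heavy H w v" unfolding heavy_def by metis

lemma noQ1:
  assumes lf: "lframe H s"
    and Q: "walk Q" "distinct Q" "set Q \<subseteq> V - H" "Q \<noteq> []" "set (flat s) - set Q \<subseteq> {x}"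
    and hv: "heavy H (hd Q) (last Q)"
  shows False
proof -
  note fr = lframeD(1)[OF lf] and lg = lframeD(2)[OF lf] and cp = lframeD(3)[OF lf]
  obtain a b where "b \<in> H" "a \<in> H" "b \<noteq> a" "E (hd Q) b" "E (last Q) a" using hv by (auto simp: heavy_def)
  then have "length Q + 2 \<le> length (flat s)" using comp_join[OF lg cp Q(1-4), of a b] by auto
  then show False using cover_length[OF frameD(2)[OF fr] Q(5)] by simp
qed

lemma frame_heads_link:
  assumes lf: "lframe H ((vi, Ti) # Ms @ (vj, Tj) # Ns)" (is "lframe H ?s")
  shows "\<not> link (Oset H ?s) (hd Ti) (hd Tj)"
proof
  assume "link (Oset H ?s) (hd Ti) (hd Tj)"
  then obtain os where os: "distinct os" "set os \<subseteq> Oset H ?s" "walk (hd Ti # os @ [hd Tj])" by (auto simp: link_def)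
  note p = fpairD[OF lframeD(1)[OF lf]]
  have "walk (rev (Ti @ flat Ms @ [vj]) @ os @ (Tj @ flat Ns @ [vi]))"
    by (rule walk_link[of "hd Ti" os "hd Tj"]) (use p(1,2,16,17) os in \<open>simp_all add: last_rev del: rev_append\<close>)
  then show False by (rule fp0[OF lf _ _ os(1,2)]) auto
qed

lemma frame_heads: "lframe H ((vi, Ti) # Ms @ (vj, Tj) # Ns) ==> \<not> E (hd Ti) (hd Tj)"
  using frame_heads_link link_E by blast

lemma frame_lasts_link:
  assumes lf: "lframe H ((vi, Ti) # Ms @ (vj, Tj) # Ns)" (is "lframe H ?s")
  shows "\<not> link (Oset H ?s) (last Ti) (last Tj)"
proof
  assume "link (Oset H ?s) (last Ti) (last Tj)"
  then obtain os where os: "distinct os" "set os \<subseteq> Oset H ?s" "walk (last Ti # os @ [last Tj])" by (auto simp: link_def)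
  note p = fpairD[OF lframeD(1)[OF lf]]
  have "walk (vi # Ti)" "walk (vj # Tj)" using p(1-4,7,8) by (auto simp: walk_Cons)
  then have w: "walk (flat Ns @ (vi # Ti))" "walk (flat Ms @ (vj # Tj))" using p(5,6,11,12) by (auto simp: walk_append)
  have "walk ((flat Ns @ vi # Ti) @ os @ rev (flat Ms @ vj # Tj))"
    by (rule walk_link[of "last Ti" os "last Tj"]) (use p(1,2) w os in \<open>simp_all add: hd_rev del: rev_append\<close>)
  then show False
    by (rule fp0[OF lf _ _ os(1,2)]) (use nx_vs[of Ns vi] nx_vs[of Ms vj] in \<open>auto simp: hd_flat_nx last_rev simp del: rev_append\<close>)
qed

lemma frame_lasts: "lframe H ((vi, Ti) # Ms @ (vj, Tj) # Ns) ==> \<not> E (last Ti) (last Tj)"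
  using frame_lasts_link link_E by blast

text \<open>A substitute for \<open>hd_unc\<close> when losing one vertex is not yet excluded. If
  both v and \<open>hd t\<close> were covered, it would be by an edge from \<open>hd Tj\<close> to v
  and one from \<open>hd Ti\<close> to the vertex behind \<open>hd t\<close>; together they give a
  path from vj to vi that loses only \<open>hd t\<close>.\<close>

lemma seg_unc:
  assumes lf: "lframe H ((vi, Ti) # Ms @ (vj, Tj) # Ns)" (is "lframe H ?s") and m: "(v, t) \<in> set Ms"
    and noL: "\<And>Q. walk Q ==> distinct Q ==> hd Q = vj ==> last Q = vi ==> Q \<noteq> [] ==>
       insert (hd t) (set Q) = set (flat ((vi, Ti) # Ms @ (vj, Tj) # Ns)) ==> hd t \<notin> set Q ==> False"
  shows "t \<noteq> [] \<and> (v \<in> unc E (hd Ti) (hd Tj) (Ti @ flat Ms @ [vj]) \<or> hd t \<in> unc E (hd Ti) (hd Tj) (Ti @ flat Ms @ [vj]))"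
proof -
  note p = fpairD[OF lframeD(1)[OF lf]]
  obtain X Y where M: "Ms = X @ (v, t) # Y" using m by (meson split_list)
  have t: "t \<noteq> []" using frameD(9)[OF lframeD(1)[OF lf], of v t] m by auto
  then obtain u t' where tt: "t = u # t'" by (cases t) auto
  have au: "\<not> E (hd Ti) u" using frame_heads[of H vi Ti X v t "Y @ (vj, Tj) # Ns"] lf M tt by simp
  have lf2: "lframe H ((v, t) # Y @ (vj, Tj) # (Ns @ (vi, Ti) # X))"
    using lframe_rot[of H "(vi, Ti) # X" "(v, t) # Y @ (vj, Tj) # Ns"] lf M by simp
  have bu: "\<not> E (hd Tj) u" using frame_heads[OF lf2] tt Ec[of u] by simp
  define A where "A = Ti @ flat Ms @ [vj]"
  define F where "F = Ti @ flat X"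
  define G where "G = t' @ flat Y @ [vj]"
  have A: "A = F @ v # u # G" by (simp add: A_def F_def G_def M tt)
  have dA: "distinct A" using p(15) by (auto simp: A_def)
  have G: "G \<noteq> []" "last G = vj" and F: "F \<noteq> []" "hd F = hd Ti" using p(1) by (auto simp: F_def G_def)
  have wA: "walk A" using p(16) by (simp add: A_def)
  have "v \<in> unc E (hd Ti) (hd Tj) A \<or> hd t \<in> unc E (hd Ti) (hd Tj) A"
  proof (rule ccontr)
    assume n: "\<not> ?thesis"
    have "E (hd Tj) v" using n unc_mem[of F v "u # G" E "hd Ti" "hd Tj"] dA A au by simp
    moreover have "E (hd Ti) (hd G)" using n unc_mem[of "F @ [v]" u G E "hd Ti" "hd Tj"] dA A bu G tt by simp
    moreover have "walk (F @ [v])" "walk G" using wA by (auto simp: A walk_append walk_Cons)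
    ultimately have w: "walk (rev G @ (F @ [v]) @ (Tj @ flat Ns @ [vi]))"
    proof -
      assume e: "E (hd Tj) v" "E (hd Ti) (hd G)" and fg: "walk (F @ [v])" "walk G"
      have "walk ((F @ [v]) @ (Tj @ flat Ns @ [vi]))" using fg p(2,17) e Ec[of v] by (subst walk_append) simp
      then show ?thesis using fg e F G Ec[of "hd G"] by (subst walk_append) (simp add: last_rev)
    qed
    let ?Q = "rev G @ (F @ [v]) @ (Tj @ flat Ns @ [vi])"
    have m: "mset (u # ?Q) = mset (flat ?s)" by (simp add: F_def G_def M tt)
    then have "distinct (u # ?Q)" using mset_eq_distinct[OF m] frameD(2)[OF lframeD(1)[OF lf]] by blast
    then have d: "distinct ?Q" "hd t \<notin> set ?Q" by (simp_all add: tt)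
    have st: "insert (hd t) (set ?Q) = set (flat ?s)" using mset_eq_setD[OF m] by (simp add: tt)
    have "hd ?Q = vj" "last ?Q = vi" "?Q \<noteq> []" using G by (simp_all add: hd_rev)
    then show False using noL[OF w d(1) _ _ _ st d(2)] by blast
  qed
  then show ?thesis using t by (simp add: A_def)
qed

text \<open>Each of the k - 2 other segments contributes an uncovered vertex, unless its first
  vertex belongs to \<open>L\<close>, the vertices that a detour from vi to vj may lose. The two
  parts combine this with \<open>count\<close> and with \<open>count_deg\<close>.\<close>

lemma frame_count:
  assumes lf: "lframe H ((vi, Ti) # Ms @ (vj, Tj) # Ns)" (is "lframe H ?s") and h: "h \<in> H"
    and L: "finite L"
    and noL: "\<And>Q x v t. walk Q ==> distinct Q ==> {hd Q, last Q} = {vi, vj} ==> Q \<noteq> [] ==> (v, t) \<in> set Ms \<union> set Ns ==> x = hd t ==>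
       insert x (set Q) = set (flat ((vi, Ti) # Ms @ (vj, Tj) # Ns)) ==> x \<notin> set Q ==> x \<in> L"
  shows "length Ms + length Ns + card H \<le> deg h + card L"
    "length Ms + length Ns + deg (hd Ti) + deg (hd Tj) + card H \<le> card V + card L"
proof -
  let ?A = "Ti @ flat Ms @ [vj]" and ?B = "Tj @ flat Ns @ [vi]"
  note fr = lframeD(1)[OF lf]
  note p = fpairD[OF fr]
  have lf2: "lframe H ((vj, Tj) # Ns @ (vi, Ti) # Ms)"
    using lframe_rot[of H "(vi, Ti) # Ms" "(vj, Tj) # Ns"] lf by simp
  have hdA: "hd ?A = hd Ti" "hd ?B = hd Tj" using p(1,2) by auto
  have c: "card (unc E (hd ?A) (hd ?B) ?A) + card (unc E (hd ?B) (hd ?A) ?B) + card H \<le> deg h"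
  proof (rule count[where Os = "Oset H ?s"])
    show "distinct (?A @ ?B)" using p(15) by auto
    show "walk ?A" "walk ?B" "h \<in> H" by fact+
    show "set (?A @ ?B) \<subseteq> V" "H \<subseteq> V - set (?A @ ?B)" "Oset H ?s = V - set (?A @ ?B) - H"
      using frameD(5,6,8)[OF fr] by (auto simp: Oset_def)
    show "\<not> E x (hd ?A) \<and> \<not> E x (hd ?B)" if "x \<in> H" for x
    proof -
      have "hd Ti \<notin> H" "hd Tj \<notin> H" using p(1,2) frameD(8)[OF fr] hd_in_set[of Ti] hd_in_set[of Tj] by auto
      moreover have "hd Ti \<notin> vs ?s" "hd Tj \<notin> vs ?s"
        using seg_disj[OF frameD(2)[OF fr]] p(1,2) by (metis hd_in_set in_set_conv_decomp list.set_intros set_ConsD Un_iff set_append)+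
      ultimately show ?thesis unfolding hdA using frameD(11)[OF fr that] by auto
    qed
    show False if "walk Q" "distinct os" "set os \<subseteq> Oset H ?s" "mset Q = mset (?A @ ?B @ os)" "hd Q = last ?A" "last Q = last ?B" for os Q
      by (rule fp0[OF lf that(1) _ that(2,3)]) (use that in auto)
  qed (use p in auto)
  have c2: "card (unc E (hd ?A) (hd ?B) ?A) + card (unc E (hd ?B) (hd ?A) ?B) + deg (hd ?A) + deg (hd ?B) + card H \<le> card V"
  proof (rule count_deg[where Os = "Oset H ?s"])
    show "distinct (?A @ ?B)" using p(15) by auto
    show "walk ?A" "walk ?B" by fact+
    show "set (?A @ ?B) \<subseteq> V" "H \<subseteq> V - set (?A @ ?B)" "Oset H ?s = V - set (?A @ ?B) - H"
      using frameD(5,6,8)[OF fr] by (auto simp: Oset_def)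
    show "\<not> E x (hd ?A) \<and> \<not> E x (hd ?B)" if "x \<in> H" for x
    proof -
      have "hd Ti \<notin> H" "hd Tj \<notin> H" using p(1,2) frameD(8)[OF fr] hd_in_set[of Ti] hd_in_set[of Tj] by auto
      moreover have "hd Ti \<notin> vs ?s" "hd Tj \<notin> vs ?s"
        using seg_disj[OF frameD(2)[OF fr]] p(1,2) by (metis hd_in_set in_set_conv_decomp list.set_intros set_ConsD Un_iff set_append)+
      ultimately show ?thesis unfolding hdA using frameD(11)[OF fr that] by auto
    qed
    show False if "walk Q" "distinct os" "set os \<subseteq> Oset H ?s" "mset Q = mset (?A @ ?B @ os)" "hd Q = last ?A" "last Q = last ?B" for os Q
      by (rule fp0[OF lf that(1) _ that(2,3)]) (use that in auto)
  qed (use p in auto)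
  define U1 where "U1 = unc E (hd Ti) (hd Tj) ?A"
  define U2 where "U2 = unc E (hd Tj) (hd Ti) ?B"
  have fU: "finite U1" "finite U2" unfolding U1_def U2_def by (rule finite_subset[OF unc_sub], simp)+
  have m1: "length Ms \<le> card ((U1 \<union> L) \<inter> set (flat Ms))"
  proof (rule card_marked)
    show "t \<noteq> [] \<and> (v \<in> U1 \<union> L \<or> hd t \<in> U1 \<union> L)" if m: "(v, t) \<in> set Ms" for v t
    proof (cases "hd t \<in> L")
      case True
      then show ?thesis using frameD(9)[OF fr, of v t] m by auto
    next
      case False
      have "t \<noteq> [] \<and> (v \<in> U1 \<or> hd t \<in> U1)" unfolding U1_def
        by (rule seg_unc[OF lf m]) (use noL[OF _ _ _ _ _ refl, of _ v t] m False in blast)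
      then show ?thesis by auto
    qed
  qed (use p(15) in auto)
  have m2: "length Ns \<le> card ((U2 \<union> L) \<inter> set (flat Ns))"
  proof (rule card_marked)
    show "t \<noteq> [] \<and> (v \<in> U2 \<union> L \<or> hd t \<in> U2 \<union> L)" if m: "(v, t) \<in> set Ns" for v t
    proof (cases "hd t \<in> L")
      case True
      then show ?thesis using frameD(9)[OF fr, of v t] m by auto
    next
      case False
      have e: "set (flat ((vj, Tj) # Ns @ (vi, Ti) # Ms)) = set (flat ?s)" by auto
      have "t \<noteq> [] \<and> (v \<in> U2 \<or> hd t \<in> U2)" unfolding U2_def
        by (rule seg_unc[OF lf2 m]) (use noL[OF _ _ _ _ _ refl, of _ v t] m False in \<open>unfold e, blast\<close>)
      then show ?thesis by auto
    qed
  qed (use p(15) in auto)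
  have "length Ms + length Ns \<le> card ((U1 \<union> L) \<inter> set (flat Ms)) + card ((U2 \<union> L) \<inter> set (flat Ns))" using m1 m2 by simp
  also have "\<dots> \<le> (card U1 + card (L \<inter> set (flat Ms))) + (card U2 + card (L \<inter> set (flat Ns)))"
  proof -
    have "card ((U1 \<union> L) \<inter> X) \<le> card U1 + card (L \<inter> X)" if "finite U1" for U1 X
    proof -
      have "card ((U1 \<union> L) \<inter> X) \<le> card (U1 \<union> (L \<inter> X))" using that L by (intro card_mono) auto
      then show ?thesis using card_Un_le[of U1 "L \<inter> X"] by simp
    qed
    from this[OF fU(1)] this[OF fU(2)] show ?thesis using add_mono by blast
  qed
  finally have t: "length Ms + length Ns \<le> (card U1 + card (L \<inter> set (flat Ms))) + (card U2 + card (L \<inter> set (flat Ns)))" .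
  have "card (L \<inter> set (flat Ms)) + card (L \<inter> set (flat Ns)) = card ((L \<inter> set (flat Ms)) \<union> (L \<inter> set (flat Ns)))"
    using p(15) by (subst card_Un_disjoint) auto
  also have "\<dots> \<le> card L" using L by (intro card_mono) auto
  finally have "length Ms + length Ns \<le> card U1 + card U2 + card L" using t by simp
  then show "length Ms + length Ns + card H \<le> deg h + card L"
    "length Ms + length Ns + deg (hd Ti) + deg (hd Tj) + card H \<le> card V + card L"
    using c c2 unfolding hdA U1_def[symmetric] U2_def[symmetric] by simp_all
qed

text \<open>The Ore count shows that every vertex of \<open>H\<close> misses at most one vertex of \<open>H\<close> and its
  attachments, so that any two attachments are joined by paths through two vertices of \<open>H\<close>.\<close>

lemma dominated:
  assumes C: "longest C" "length C \<ge> 3" and cp: "comp H C" and g: "g \<in> H" "g' \<in> H" "g \<noteq> g'"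
  shows False
proof -
  obtain s where lf: "lframe H s" using frame_ex[OF C cp] by blast
  note fr = lframeD(1)[OF lf]
  note f = frameD[OF fr]
  have fv: "finite (vs s)" by (simp add: vs_def)
  \<comment> \<open>Otherwise all attachments have the same single neighbour a in \<open>H\<close>,
    and deleting a separates another vertex of \<open>H\<close> from the cycle.\<close>
  have "\<exists>v\<in>vs s. \<exists>w\<in>vs s. v \<noteq> w \<and> heavy H v w"
  proof (rule ccontr)
    assume n: "\<not> ?thesis"
    have "\<not> card (vs s) \<le> 1" using f(1,10) by simp
    then have "\<not> (\<forall>v\<in>vs s. \<forall>w\<in>vs s. v = w)" using card_le_Suc0_iff_eq[OF fv] by simp
    then obtain v w where vw: "v \<in> vs s" "w \<in> vs s" "v \<noteq> w" by blast
    obtain a where a: "a \<in> H" "E v a" using f(13)[OF vw(1)] by blast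
    obtain b where b: "b \<in> H" "E w b" using f(13)[OF vw(2)] by blast
    have ab: "a = b" using n vw a b unfolding heavy_def by blast
    have one: "h = a" if "x \<in> vs s" "h \<in> H" "E x h" for x h
    proof (cases "x = v")
      case True
      then show ?thesis using n vw that b unfolding heavy_def ab by blast
    next
      case False
      then show ?thesis using n vw(1) that a unfolding heavy_def by blast
    qed
    obtain g0 where g0: "g0 \<in> H" "g0 \<noteq> a" using g by blast
    have vV: "v \<in> V" "v \<notin> H" using vw(1) vs_flat[of s] f(5,8) by auto
    define K where "K x = (if x = g0 then H - {a} else V - H)" for x
    have "card {g0, v} \<le> card {a}"
    proof (rule tough[of "{a}" "{g0, v}" K])
      show "{a} \<subseteq> V" "{g0, v} \<subseteq> V - {a}" using a g0 vV f(6) by auto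
      show "\<And>x. x \<in> {g0, v} ==> x \<in> K x" using g0 vV by (auto simp: K_def)
      show "\<And>x y'. x \<in> {g0, v} ==> y' \<in> {g0, v} ==> x \<noteq> y' ==> y' \<notin> K x" using g0 vV by (auto simp: K_def)
      show "y \<in> K x" if p: "x \<in> {g0, v}" "z \<in> K x" "E z y" "y \<notin> {a}" for x z y
      proof (cases "x = g0")
        case True
        then have z: "z \<in> H" "z \<noteq> a" using p by (auto simp: K_def)
        then have "y \<in> H \<union> vs s" using f(11) p(3) by blast
        moreover have "y \<notin> vs s" using one[of y z] z Ec[of y] p(3) by blast
        ultimately show ?thesis using True p(4) by (simp add: K_def)
      next
        case False
        then have z: "z \<in> V" "z \<notin> H" using p by (auto simp: K_def)
        have "y \<notin> H"
        proof
          assume y: "y \<in> H"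
          have "z \<in> H \<union> vs s" using f(11)[OF y] p(3) Ec by blast
          then show False using one[of z y] y p z by simp
        qed
        then show ?thesis using False EV2[OF p(3)] by (simp add: K_def)
      qed
    qed auto
    moreover have "g0 \<noteq> v" using g0 vV by blast
    ultimately show False by simp
  qed
  then obtain v w where vw: "v \<in> vs s" "w \<in> vs s" "v \<noteq> w" "heavy H v w" by blast
  then obtain t u where "(v, t) \<in> set s" "(w, u) \<in> set s" by (auto simp: vs_def)
  then obtain Ms Ns where l2: "lframe H ((v, t) # Ms @ (w, u) # Ns)" and st: "set ((v, t) # Ms @ (w, u) # Ns) = set s"
    using lframe_pair[OF lf] vw(3) by blast
  have V2: "vs ((v, t) # Ms @ (w, u) # Ns) = vs s" unfolding vs_def st ..
  \<comment> \<open>With a heavy pair as ends nothing can be lost, so \<open>frame_count\<close>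
    applies with the empty set. A vertex of \<open>H\<close> has at most |H| - 1 + k neighbours and
    is seen here to miss at most one of them.\<close>
  have many: "card H + card (vs s) \<le> deg h + 2" if "h \<in> H" for h
  proof -
    have "length Ms + length Ns + card H \<le> deg h + card ({} :: 'a set)"
    proof (rule frame_count(1)[OF l2 that])
      show "x \<in> {}" if q: "walk Q" "distinct Q" "{hd Q, last Q} = {v, w}" "Q \<noteq> []"
        "insert x (set Q) = set (flat ((v, t) # Ms @ (w, u) # Ns))" for Q x
      proof -
        have "heavy H (hd Q) (last Q)" using q(3) vw(4) heavy_sym by (metis doubleton_eq_iff)
        moreover have "set Q \<subseteq> V - H" using q(5) frameD(5,8)[OF lframeD(1)[OF l2]] by blast
        ultimately show ?thesis using noQ1[OF l2 q(1,2) _ q(4), of x] q(5) by blast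
      qed
    qed simp
    then show ?thesis using frameD(10)[OF lframeD(1)[OF l2]] unfolding V2 by simp
  qed
  have fH: "finite H" using f(6) fin finite_subset by blast
  \<comment> \<open>If x and y had only the common neighbour a in \<open>H\<close>, a further vertex
    g0 of \<open>H\<close> would miss both.\<close>
  have hv: "heavy H x y" if xy: "x \<in> vs s" "y \<in> vs s" "x \<noteq> y" for x y
  proof (rule ccontr)
    assume n: "\<not> ?thesis"
    obtain a where a: "a \<in> H" "E x a" using f(13)[OF xy(1)] by blast
    obtain b where b: "b \<in> H" "E y b" using f(13)[OF xy(2)] by blast
    have ab: "a = b" using n a b unfolding heavy_def by blast
    obtain g0 where g0: "g0 \<in> H" "g0 \<noteq> a" using g by blast
    have n1: "\<not> E g0 x"
    proof
      assume "E g0 x"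
      then have "E x g0" by (rule sym)
      then show False using n b g0 ab unfolding heavy_def by blast
    qed
    have n2: "\<not> E g0 y"
    proof
      assume "E g0 y"
      then have "E y g0" by (rule sym)
      then have "a \<noteq> g0 \<and> E x a \<and> E y g0" using a g0 by simp
      then have "heavy H x y" unfolding heavy_def using a(1) g0(1) by blast
      then show False using n by simp
    qed
    note nn = n1 n2
    have "nb g0 \<subseteq> (H - {g0}) \<union> (vs s - {x, y})"
    proof (intro subsetI)
      fix z assume z: "z \<in> nb g0"
      then have e: "E g0 z" by (simp add: in_nb)
      have "z \<noteq> g0" "z \<noteq> x" "z \<noteq> y" using e nn irr by auto
      then show "z \<in> (H - {g0}) \<union> (vs s - {x, y})" using f(11)[OF g0(1) e] by simp
    qed
    then have "deg g0 \<le> card ((H - {g0}) \<union> (vs s - {x, y}))" unfolding deg_def using fH fv by (intro card_mono) auto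
    also have "\<dots> \<le> card (H - {g0}) + card (vs s - {x, y})" by (rule card_Un_le)
    also have "card (H - {g0}) = card H - 1" using g0 by simp
    also have "card (vs s - {x, y}) = card (vs s) - 2" using xy by (subst card_Diff_subset) auto
    finally have "deg g0 \<le> (card H - 1) + (card (vs s) - 2)" .
    moreover have "card H \<ge> 1" using card_gt_0_iff[of H] g0 fH by (metis One_nat_def Suc_leI empty_iff)
    moreover have "card (vs s) \<ge> 2" using f(1,10) by simp
    ultimately show False using many[OF g0(1)] by simp
  qed
  have "det H s" unfolding det_def
  proof (intro conjI allI impI fr)
    fix Q x assume q: "walk Q" "distinct Q" "set Q \<subseteq> V - H" "hd Q \<in> vs s" "last Q \<in> vs s" "hd Q \<noteq> last Q"
      "set (flat s) - set Q \<subseteq> {x}"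
    have "Q \<noteq> []"
    proof
      assume "Q = []"
      then show False using cover_length[OF f(2) q(7)] flat_len0[OF f(9)] f(1) by fastforce
    qed
    then have False using noQ1[OF lf q(1,2,3) _ q(7) hv[OF q(4,5,6)]] by simp
    then show "x \<in> vs s" "deg x \<le> card (vs s)" "3 * card (vs s) + 1 \<le> card V" by simp_all
  qed
  then show False by (rule det_False)
qed

end

section \<open>Some segment is a single vertex\<close>

lemma hd_ne_last: "distinct xs ==> length xs \<ge> 2 ==> hd xs \<noteq> last xs"
  by (cases xs) auto

context tgraph
begin

lemma lframe_mir:
  assumes lf: "lframe H ((v1, T1) # R)"
  shows "lframe H ((nx R v1, rev T1) # mir R v1)"
proof -
  have e: "mir ((v1, T1) # R) (fst (hd ((v1, T1) # R))) = mir R v1 @ [(nx R v1, rev T1)]" by (simp add: nx_def)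
  have f: "frame H (mir R v1 @ [(nx R v1, rev T1)])" using frame_mir[OF lframeD(1)[OF lf]] unfolding e .
  have st: "set (flat (mir R v1 @ [(nx R v1, rev T1)])) = set (flat ((v1, T1) # R))"
    using set_flat_mir_hd[of "(v1, T1) # R"] unfolding e by simp
  have "length (flat (mir R v1 @ [(nx R v1, rev T1)])) = length (flat ((v1, T1) # R))"
    using distinct_card[OF frameD(2)[OF f]] distinct_card[OF frameD(2)[OF lframeD(1)[OF lf]]] st by simp
  then have "longest (flat (mir R v1 @ [(nx R v1, rev T1)]))"
    using longest_cong[OF lframeD(2)[OF lf]] f by (simp add: frame_def ring_def)
  then have "lframe H (mir R v1 @ [(nx R v1, rev T1)])"
    using f lframeD(3)[OF lf] unfolding lframe_def comp_def st by blast
  then show ?thesis using lframe_rot by fastforce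
qed

text \<open>The situation to be refuted. The degree of v is compared over all longest cycles,
  because a detour replaces the present one by another.\<close>

definition gapless :: "'a => ('a \<times> 'a list) list => bool" where
  "gapless v s \<longleftrightarrow> lframe {v} s \<and> (\<forall>D w. longest D --> w \<in> V - set D --> deg w \<le> deg v) \<and> (\<forall>(w, t)\<in>set s. 2 \<le> length t)"

lemma gapless_lf: "gapless v s ==> lframe {v} s" by (simp add: gapless_def)

lemma gapless_rot: "gapless v (xs @ ys) ==> gapless v (ys @ xs)"
  using lframe_rot[of "{v}" xs ys] unfolding gapless_def by (simp add: Un_commute)

lemma gapless_mir:
  assumes "gapless v ((v1, T1) # R)"
  shows "gapless v ((nx R v1, rev T1) # mir R v1)"
proof -
  have "2 \<le> length t" if "(w, t) \<in> set ((nx R v1, rev T1) # mir R v1)" for w t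
  proof -
    have "(w, t) = (nx R v1, rev T1) \<or> (\<exists>w' t'. (w', t') \<in> set R \<and> t = rev t')" using that segs_mir[of w t R v1] by auto
    then show ?thesis using assms unfolding gapless_def by auto
  qed
  then show ?thesis using lframe_mir assms unfolding gapless_def by blast
qed

lemma gapless_pair:
  assumes "gapless v s" "(a, t) \<in> set s" "(b, u) \<in> set s" "(a, t) \<noteq> (b, u)"
  shows "\<exists>Ms Ns. gapless v ((a, t) # Ms @ (b, u) # Ns) \<and> set ((a, t) # Ms @ (b, u) # Ns) = set s"
proof -
  obtain Ms Ns where "lframe {v} ((a, t) # Ms @ (b, u) # Ns)" and st: "set ((a, t) # Ms @ (b, u) # Ns) = set s"
    using lframe_pair[OF gapless_lf[OF assms(1)] assms(2-4)] by blast
  then have "gapless v ((a, t) # Ms @ (b, u) # Ns)" using assms(1) unfolding gapless_def st by blast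
  then show ?thesis using st by blast
qed

lemma gaplessD:
  assumes g: "gapless v s"
  shows "nb v = vs s" "deg v = length s" "card V = length (flat s) + 1 + card (Oset {v} s)" "3 * deg v + 1 \<le> card V"
    "v \<in> V" "v \<notin> set (flat s)" "distinct (flat s)" "\<And>w t. (w, t) \<in> set s ==> 2 \<le> length t" "finite (Oset {v} s)" "frame {v} s"
proof -
  show fr: "frame {v} s" using lframeD(1)[OF gapless_lf[OF g]] .
  note f = frameD[OF fr]
  have "x \<in> vs s" if "E v x" for x using f(11)[of v x] that irr by auto
  moreover have "E v x" if "x \<in> vs s" for x using f(13)[OF that] Ec[of v x] by auto
  ultimately show n: "nb v = vs s" by (auto simp: in_nb)
  then show d: "deg v = length s" using f(10) by (simp add: deg_def)
  show v: "v \<in> V" "v \<notin> set (flat s)" "distinct (flat s)" using f(2,6,8) by auto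
  show fo: "finite (Oset {v} s)" using fin by (simp add: Oset_def)
  have "V = insert v (set (flat s) \<union> Oset {v} s)" using v(1) f(5) by (auto simp: Oset_def)
  then have "card V = card (insert v (set (flat s) \<union> Oset {v} s))" by (rule arg_cong)
  also have "\<dots> = card (set (flat s) \<union> Oset {v} s) + 1" using v fo by (subst card_insert_disjoint) (auto simp: Oset_def)
  also have "card (set (flat s) \<union> Oset {v} s) = length (flat s) + card (Oset {v} s)"
    using fo distinct_card[OF v(3)] by (subst card_Un_disjoint) (auto simp: Oset_def)
  finally show c: "card V = length (flat s) + 1 + card (Oset {v} s)" by simp
  show l: "\<And>w t. (w, t) \<in> set s ==> 2 \<le> length t" using g by (auto simp: gapless_def)
  have "3 * length s \<le> length (flat s)" by (rule flat_len) (use l in auto)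
  then show "3 * deg v + 1 \<le> card V" using c d by simp
qed

text \<open>With v added, Q becomes a cycle of the original length; it is a longest one that misses
  x, so the choice of v applies to x.\<close>

lemma lost_low:
  assumes g: "gapless v s" and Q: "walk Q" "distinct Q" "set Q \<subseteq> V - {v}" "hd Q \<in> vs s" "last Q \<in> vs s" "Q \<noteq> []"
    and x: "set (flat s) \<subseteq> insert x (set Q)" "x \<in> set (flat s)" "x \<notin> set Q"
  shows "deg x \<le> deg v"
proof -
  note gd = gaplessD[OF g]
  have e: "E v (hd Q)" "E (last Q) v" using Q gd(1) Ec[of v] by (auto simp: nb_def)
  have c: "closed (Q @ [v])" unfolding closed_def using Q e gd(5) by (auto simp: walk_append)
  have "length (flat s) \<le> length Q + 1" by (rule cover_length[OF gd(7), of _ x]) (use x in auto)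
  moreover have L: "longest (flat s)" using lframeD(2)[OF gapless_lf[OF g]] .
  moreover have "length (Q @ [v]) \<le> length (flat s)" using L c unfolding longest_def by blast
  ultimately have "longest (Q @ [v])" using longest_cong[OF L c] by simp
  moreover have "x \<in> V - set (Q @ [v])" using x frameD(5)[OF gd(10)] gd(6) by auto
  ultimately show ?thesis using g unfolding gapless_def by blast
qed

lemma lost_low':
  assumes g: "gapless v s" and Q: "walk Q" and m: "mset (x # Q) = mset (flat s @ os)" and os: "distinct os" "set os \<subseteq> Oset {v} s"
    and e: "hd Q \<in> vs s" "last Q \<in> vs s" "x \<in> set (flat s)"
  shows "deg x \<le> deg v"
proof -
  note gd = gaplessD[OF g]
  have "distinct (flat s @ os)" using gd(7) os by (auto simp: Oset_def)
  then have dx: "distinct (x # Q)" using mset_eq_distinct[OF m] by simp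
  have st: "insert x (set Q) = set (flat s) \<union> set os" using mset_eq_setD[OF m] by simp
  have "set Q \<subseteq> V - {v}" using st os frameD(5,8)[OF gd(10)] by (auto simp: Oset_def)
  moreover have "length (x # Q) = length (flat s @ os)" using m by (metis size_mset)
  then have "Q \<noteq> []" using flat_len[of s] gd(8) frameD(1)[OF gd(10)] by fastforce
  ultimately show ?thesis using lost_low[OF g Q _ _ e(1,2), of x] dx st e(3) by auto
qed

text \<open>Together with v, two non-adjacent such vertices would have degree sum at most 3 deg v,
  which is less than n since every segment has two vertices.\<close>

lemma low_adj:
  assumes g: "gapless v s" and x: "x \<in> V - insert v (vs s)" "y \<in> V - insert v (vs s)" "x \<noteq> y" and d: "deg x \<le> deg v" "deg y \<le> deg v"
  shows "E x y"
proof (rule ccontr)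
  assume "\<not> E x y"
  then have "card V \<le> deg v + deg x + deg y"
    using x gaplessD(1,5)[OF g] by (intro sigma) (auto simp: nb_def)
  then show False using d gaplessD(4)[OF g] by simp
qed

lemma gapless_inner:
  assumes g: "gapless v s" and x: "(w, t) \<in> set s" "x \<in> set t"
  shows "x \<in> V - insert v (vs s)" "x \<in> set (flat s)"
proof -
  show f: "x \<in> set (flat s)" using x by (auto simp: set_flat)
  then have "x \<in> V" "x \<noteq> v" using frameD(5,8)[OF gaplessD(10)[OF g]] by auto
  then show "x \<in> V - insert v (vs s)" using seg_disj[OF gaplessD(7)[OF g] x] by auto
qed

text \<open>Here deg v = 2, so b has only its two cycle neighbours. The degree condition for v, b
  and an inner vertex z not adjacent to b gives deg z >= n - 4: among the vertices other than z, v
  and b, z misses at most one. The edges obtained in this way close a path through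
  everything.\<close>

lemma gapless_two_aux:
  assumes g: "gapless v [(v1, T1), (v2, T2)]" (is "gapless v ?s") and T: "T1 = X @ b # Y" "Y \<noteq> []" and db: "deg b \<le> 2"
  shows False
proof -
  note gd = gaplessD[OF g]
  have lf: "lframe {v} ((v1, T1) # [] @ (v2, T2) # [])" using gapless_lf[OF g] by simp
  have lf2: "lframe {v} ((v2, T2) # [] @ (v1, T1) # [])" using lframe_rot[of "{v}" "[(v1, T1)]" "[(v2, T2)]"] lf by simp
  note p = fpairD[OF lframeD(1)[OF lf]]
  have dv: "deg v = 2" using gd(2) by simp
  have inn: "x \<in> V - {v, v1, v2}" if "x \<in> set T1 \<or> x \<in> set T2" for x
    using that gapless_inner(1)[OF g, of v1 T1 x] gapless_inner(1)[OF g, of v2 T2 x] by auto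
  have vV: "v1 \<in> V" "v2 \<in> V" "v1 \<noteq> v" "v2 \<noteq> v" using frameD(5,8)[OF gd(10)] by auto
  have bT: "b \<in> set T1" using T by simp
  define w1 where "w1 = last T1"
  define w2 where "w2 = last T2"
  define u1 where "u1 = hd T1"
  define u2 where "u2 = hd T2"
  have mem: "w1 \<in> set T1" "w2 \<in> set T2" "u1 \<in> set T1" "u2 \<in> set T2" using p(1,2) by (auto simp: w1_def w2_def u1_def u2_def)
  have dT: "distinct T1" "distinct T2" "set T1 \<inter> set T2 = {}" "v1 \<noteq> v2" using p(15) by auto
  have u2w2: "u2 \<noteq> w2" unfolding u2_def w2_def by (rule hd_ne_last[OF dT(2)]) (use gd(8)[of v2 T2] in simp)
  have nbb: "nb b = {last (v1 # X), hd Y}"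
  proof -
    have "walk (v1 # T1)" using p(1,3,7) by (simp add: walk_Cons)
    then have w: "walk ((v1 # X) @ b # Y)" using T by simp
    have "E (last (v1 # X)) b" "E b (hd Y)" using w T(2) unfolding walk_append walk_Cons by simp_all
    then have s: "{last (v1 # X), hd Y} \<subseteq> nb b" using Ec[of b] by (simp add: in_nb)
    have "hd Y \<in> set Y" using T(2) by simp
    moreover have "last (v1 # X) \<in> set (v1 # X)" by (rule last_in_set) simp
    moreover have "set (v1 # X) \<inter> set Y = {}" using p(15) T by auto
    ultimately have "hd Y \<noteq> last (v1 # X)" by (metis disjoint_iff)
    then have "card {last (v1 # X), hd Y} = 2" by simp
    then show ?thesis using card_seteq[OF fin_nb s] db by (simp add: deg_def)
  qed
  have nbT: "y = v1 \<or> y \<in> set T1" if "E b y" for y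
  proof -
    have "y \<in> nb b" using that by (simp add: in_nb)
    moreover have "hd Y \<in> set T1" using T by simp
    moreover have "last (v1 # X) = v1 \<or> last (v1 # X) \<in> set T1" using T(1) by simp
    ultimately show ?thesis unfolding nbb by blast
  qed
  have c2: "E z x \<or> E z y" if z: "z \<in> set T1 \<union> set T2" "z \<noteq> b" "\<not> E b z" and xy: "x \<in> V - {z, v, b}" "y \<in> V - {z, v, b}" "x \<noteq> y" for x y z
  proof (rule ccontr)
    assume n: "\<not> ?thesis"
    have "z \<in> V - {v, v1, v2}" "b \<in> V - {v, v1, v2}" using inn z bT by auto
    then have zz: "z \<in> V" "z \<noteq> v" "b \<in> V" "b \<noteq> v" "\<not> E v z" "\<not> E v b" using gd(1) by (auto simp: in_nb[symmetric])
    then have c: "card V \<le> deg v + deg b + deg z" using z gd(5) by (intro sigma) auto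
    have "nb z \<subseteq> V - {z, v, b, x, y}"
    proof
      fix a assume "a \<in> nb z"
      then have e: "E z a" by (simp add: in_nb)
      then have "a \<noteq> z" "a \<noteq> v" "a \<noteq> b" "a \<noteq> x" "a \<noteq> y" using n irr zz(5) z(3) sym[OF e] by auto
      then show "a \<in> V - {z, v, b, x, y}" using EV2[OF e] by simp
    qed
    then have "deg z \<le> card (V - {z, v, b, x, y})" unfolding deg_def using fin by (intro card_mono) auto
    also have "\<dots> = card V - card {z, v, b, x, y}" using fin xy zz gd(5) by (intro card_Diff_subset) auto
    also have "card {z, v, b, x, y} = 5" using xy zz z(2) by auto
    finally show False using c db dv gd(4) by simp
  qed
  have bu: "b \<noteq> u2" "b \<noteq> w2" "\<not> E b w2" "\<not> E b u2"
  proof -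
    have "v1 \<notin> set T2" using p(15) by simp
    then have "y \<noteq> b \<and> \<not> E b y" if "y \<in> set T2" for y using nbT[of y] that bT dT(3) by auto
    then show "b \<noteq> u2" "b \<noteq> w2" "\<not> E b w2" "\<not> E b u2" using mem(2,4) by blast+
  qed
  have Yl: "last Y = w1" "w1 \<in> set Y" using T by (auto simp: w1_def)
  have bw1: "b \<noteq> w1" using Yl dT T by auto
  have w2v2: "E w2 v2"
  proof -
    have "\<not> E w2 w1" using frame_lasts[OF lf2] by (simp add: w1_def w2_def)
    then show ?thesis using c2[of w2 w1 v2] mem bu inn[of w1] inn[of b] inn[of w2] vV bw1 dT(3) bT by blast
  qed
  have r2: "walk ([v2] @ rev T2)" using w2v2 p(2,4) Ec[of v2] by (simp add: walk_Cons hd_rev w2_def)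
  show False
  proof (cases "X \<noteq> [] \<or> length Y \<ge> 2")
    case True
    have "E u2 w1"
    proof (cases "X = []")
      case False
      have "u1 \<in> set X" using False T by (simp add: u1_def)
      then have ub: "u1 \<noteq> b" "u1 \<noteq> w1" using dT(1) T Yl by auto
      have "\<not> E u2 u1" using frame_heads[OF lf2] by (simp add: u1_def u2_def)
      then show ?thesis using c2[of u2 u1 w1] mem bu inn[of w1] inn[of u1] bw1 dT(3) ub by blast
    next
      case X: True
      then have "length Y \<ge> 2" using True by simp
      then have "w1 \<noteq> hd Y" using hd_ne_last[of Y] dT(1) T Yl by auto
      moreover have "w1 \<noteq> v1" using inn[of w1] mem by auto
      ultimately have "\<not> E b w1" using nbb X by (auto simp: in_nb[symmetric])
      moreover have "\<not> E w1 w2" using frame_lasts[OF lf] by (simp add: w1_def w2_def)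
      ultimately have "E w1 u2" using c2[of w1 w2 u2] mem bu inn[of u2] inn[of w2] bw1 dT(3) u2w2 by blast
      then show ?thesis by (rule sym)
    qed
    then have "walk (([v2] @ rev T2) @ rev T1 @ [v1])"
      using r2 p(1,2,3,7) Ec[of "hd T1"] by (simp add: walk_append walk_Cons hd_rev last_rev hd_append w1_def u2_def)
    then show False by (rule fp0[OF lf, of _ "[]"]) auto
  next
    case False
    \<comment> \<open>\<open>T1\<close> is now just b and w1. Toughness provides a link to
      \<open>T2\<close>, and it has to start at w1.\<close>
    then have X: "X = []" and Y: "Y = [w1]" using T Yl by (auto simp: Suc_le_eq; cases Y; auto)+
    have T1: "T1 = [b, w1]" using T X Y by simp
    obtain a t c u q r where l: "(a, t) \<in> set ?s" "(c, u) \<in> set ?s" "(a, t) \<noteq> (c, u)" "q \<in> set t" "r \<in> set u" "link (Oset {v} ?s) q r"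
      using tough_link[OF frame_ring[OF gd(10)]] by blast
    have "\<exists>q r. q \<in> set T1 \<and> r \<in> set T2 \<and> link (Oset {v} ?s) q r"
    proof -
      consider "q \<in> set T1" "r \<in> set T2" | "q \<in> set T2" "r \<in> set T1" using l by auto
      then show ?thesis using l(6) link_sym[OF l(6)] by cases blast+
    qed
    then obtain q r where qr: "q \<in> set T1" "r \<in> set T2" "link (Oset {v} ?s) q r" by blast
    then obtain os where os: "distinct os" "set os \<subseteq> Oset {v} ?s" "walk (q # os @ [r])" by (auto simp: link_def)
    have "q \<noteq> b"
    proof
      assume "q = b"
      then have "E b (hd (os @ [r]))" using os(3) by (simp add: walk_Cons)
      then have "hd (os @ [r]) = v1 \<or> hd (os @ [r]) \<in> set T1" by (rule nbT)
      moreover have "hd (os @ [r]) \<in> Oset {v} ?s \<union> set T2" using os(2) qr(2) by (cases os) auto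
      ultimately show False using dT(3) p(15) by (auto simp: Oset_def)
    qed
    then have q: "q = w1" using qr T1 by simp
    obtain P R where T2: "T2 = P @ r # R" using qr(2) by (meson split_list)
    have w1: "walk (v1 # T1)" using p(1,3,7) by (simp add: walk_Cons)
    have l1: "last (v1 # T1) = w1" using T1 by simp
    show False
    proof (cases "P = []")
      case True
      have "walk (T2 @ [v2])" using p(2,4) w2v2 by (simp add: walk_append w2_def)
      then have "walk ((v1 # T1) @ os @ (T2 @ [v2]))"
        by (intro walk_link[OF os(3)]) (use w1 l1 q T2 True in auto)
      then show False by (rule fp0[OF lf _ _ os(1)]) (use os(2) in auto)
    next
      case False
      have "last P \<in> set P" using False by simp
      then have lP: "last P \<in> set T2" "last P \<noteq> w2" using T2 dT(2) by (auto simp: w2_def)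
      have "\<not> E w2 w1" using frame_lasts[OF lf2] by (simp add: w1_def w2_def)
      then have "E w2 (last P)" using c2[of w2 w1 "last P"] mem bu inn[of w1] inn[of "last P"] lP bw1 dT(3) bT by blast
      moreover have "w2 = last (r # R)" using T2 by (simp add: w2_def)
      moreover have "walk P" "walk (r # R)" using p(4) T2 by (auto simp: walk_append)
      moreover have "hd P = hd T2" using T2 False by simp
      ultimately have "walk (rev P @ [v2])" "E (last (r # R)) (hd (rev P @ [v2]))" "walk (r # R)"
        using False p(8) Ec[of v2] by (simp_all add: walk_append hd_rev last_rev hd_append del: last.simps)
      then have "walk ((r # R) @ rev P @ [v2])" by (simp only: walk_append[of "r # R"] simp_thms)
      then have "walk ((v1 # T1) @ os @ ((r # R) @ rev P @ [v2]))"
        by (intro walk_link[OF os(3)]) (use w1 l1 q in auto)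
      then show False by (rule fp0[OF lf _ _ os(1)]) (use os(2) T2 in auto)
    qed
  qed
qed

lemma gapless_two:
  assumes g: "gapless v s" and l: "length s = 2" and b: "(w, t) \<in> set s" "b \<in> set t" "deg b \<le> deg v"
  shows False
proof -
  obtain A B where s: "s = A @ (w, t) # B" using b(1) by (meson split_list)
  have "gapless v ((w, t) # B @ A)" using gapless_rot[of v A "(w, t) # B"] g s by simp
  moreover obtain v2 T2 where "B @ A = [(v2, T2)]"
  proof -
    have "length (B @ A) = 1" using s l by simp
    then show ?thesis using that by (cases "B @ A") auto
  qed
  ultimately have g2: "gapless v [(w, t), (v2, T2)]" by simp
  have db: "deg b \<le> 2" using b(3) gaplessD(2)[OF g] l by simp
  obtain X Y where t: "t = X @ b # Y" using b(2) by (meson split_list)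
  show False
  proof (cases "Y = []")
    case False
    then show False using gapless_two_aux[OF g2 t _ db] by simp
  next
    case True
    then have "X \<noteq> []" using gaplessD(8)[OF g b(1)] t by auto
    moreover have "gapless v [(v2, rev t), (w, rev T2)]" using gapless_mir[OF g2] by simp
    moreover have "rev t = rev Y @ b # rev X" using t by simp
    ultimately show False using gapless_two_aux db by blast
  qed
qed

text \<open>First vertices are pairwise non-adjacent, whereas low vertices are adjacent, so at most
  one first vertex is low and can be lost. \<open>frame_count\<close> then bounds deg x + deg y from
  above, and the degree condition for v, b with x and with y bounds it from below.\<close>

lemma two_heads:
  assumes g: "gapless v s" and b: "b \<in> V - insert v (vs s)" "deg b \<le> deg v"
    and x: "x \<in> hds s" "y \<in> hds s" "x \<noteq> y" "x \<noteq> b" "y \<noteq> b" "\<not> E b x" "\<not> E b y"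
  shows "card V \<le> 3 * deg v + 2"
proof -
  obtain a t c u where au: "(a, t) \<in> set s" "x = hd t" "(c, u) \<in> set s" "y = hd u" using x by (auto simp: hds_def)
  then obtain Ms Ns where g2: "gapless v ((a, t) # Ms @ (c, u) # Ns)" and st: "set ((a, t) # Ms @ (c, u) # Ns) = set s"
    using gapless_pair[OF g au(1,3)] x(3) by blast
  let ?s = "(a, t) # Ms @ (c, u) # Ns"
  note gd = gaplessD[OF g2]
  have hdin: "hd r \<in> set r" if "(w, r) \<in> set s" for w r using gaplessD(8)[OF g that] by (cases r) auto
  have hV: "z \<in> V - insert v (vs s)" if "z \<in> hds s" for z
  proof -
    obtain w r where "(w, r) \<in> set s" "z = hd r" using \<open>z \<in> hds s\<close> by (auto simp: hds_def)
    then show ?thesis using gapless_inner(1)[OF g] hdin by blast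
  qed
  define L where "L = {z \<in> hds s. deg z \<le> deg v}"
  have fL: "finite L" by (simp add: L_def hds_def)
  have "z = z'" if z: "z \<in> L" "z' \<in> L" for z z'
  proof (rule ccontr)
    assume n: "z \<noteq> z'"
    obtain w r w' r' where wr: "(w, r) \<in> set s" "z = hd r" "(w', r') \<in> set s" "z' = hd r'" using z by (auto simp: L_def hds_def)
    then obtain As Bs where "gapless v ((w, r) # As @ (w', r') # Bs)" using gapless_pair[OF g wr(1,3)] n by blast
    then have "\<not> E z z'" using frame_heads[OF gapless_lf] wr by blast
    moreover have "E z z'" by (rule low_adj[OF g hV hV n]) (use z in \<open>auto simp: L_def\<close>)
    ultimately show False by simp
  qed
  then have cL: "card L \<le> 1" using card_le_Suc0_iff_eq[OF fL] by simp
  have "length Ms + length Ns + deg (hd t) + deg (hd u) + card {v} \<le> card V + card L"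
  proof (rule frame_count(2)[OF gapless_lf[OF g2] _ fL])
    show "z \<in> L" if q: "walk Q" "distinct Q" "{hd Q, last Q} = {a, c}" "Q \<noteq> []" "(w, r) \<in> set Ms \<union> set Ns" "z = hd r"
      "insert z (set Q) = set (flat ?s)" "z \<notin> set Q" for Q z w r
    proof -
      have wr: "(w, r) \<in> set s" using q(5) st by auto
      have e: "hd Q \<in> vs ?s" "last Q \<in> vs ?s" using q(3) by (auto simp: doubleton_eq_iff)
      have sV: "set Q \<subseteq> V - {v}" using q(7) frameD(5)[OF gd(10)] gd(6) by blast
      have "deg z \<le> deg v" by (rule lost_low[OF g2 q(1,2) sV e q(4)]) (use q(7,8) in auto)
      moreover have "z \<in> hds s" using wr q(6) by (force simp: hds_def)
      ultimately show ?thesis by (simp add: L_def)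
    qed
  qed simp
  moreover have "deg v = length Ms + length Ns + 2" using gd(2) by simp
  moreover have "card V \<le> deg v + deg b + deg z" if "z \<in> hds s" "z \<noteq> b" "\<not> E b z" for z
    using hV[OF that(1)] that(2,3) b gaplessD(1,5)[OF g] by (intro sigma) (auto simp: nb_def)
  from this[OF x(1,4,6)] this[OF x(2,5,7)] have "card V \<le> deg v + deg b + deg x" "card V \<le> deg v + deg b + deg y" .
  ultimately show ?thesis using cL b(2) au by simp
qed

text \<open>If n were larger, \<open>two_heads\<close> would make b adjacent to all but one of the k
  first vertices and, in the reversed cycle, to all but one of the k last vertices. These sets are
  disjoint, so deg b >= 2 k - 2 > k = deg v.\<close>

lemma gapless_bound:
  assumes g: "gapless v s" and l: "length s \<ge> 3" and b: "b \<in> V - insert v (vs s)" "deg b \<le> deg v"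
  shows "card V \<le> 3 * deg v + 2"
proof (rule ccontr)
  assume n: "\<not> ?thesis"
  obtain v1 T1 R where s: "s = (v1, T1) # R" using l by (cases s) auto
  define s' where "s' = (nx R v1, rev T1) # mir R v1"
  have g': "gapless v s'" using gapless_mir g s by (simp add: s'_def)
  have vs': "vs s' = vs s" using gaplessD(1)[OF g] gaplessD(1)[OF g'] by simp
  have sub: "\<exists>w t. (w, t) \<in> set s \<and> x = last t" if xs': "x \<in> hds s'" for x
  proof -
    obtain w t where wt: "(w, t) \<in> set s'" "x = hd t" using xs' by (auto simp: hds_def)
    then have "\<exists>w' t'. (w', t') \<in> set s \<and> t = rev t'" using segs_mir[of w t R v1] by (auto simp: s'_def s)
    then obtain w' t' where "(w', t') \<in> set s" "t = rev t'" by blast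
    then show ?thesis using wt(2) by (intro exI[of _ w'] exI[of _ t']) (simp add: hd_rev)
  qed
  have main: "b \<notin> hds r \<and> card (hds r \<inter> nb b) + 1 \<ge> length r" if gr: "gapless v r" "vs r = vs s" "length r \<ge> 3" for r
  proof -
    have f: "finite (hds r)" by (simp add: hds_def)
    have "\<forall>(w, t)\<in>set r. t \<noteq> []" using gaplessD(8)[OF gr(1)] by force
    then have c: "card (hds r) = length r" using hds_card gaplessD(7)[OF gr(1)] by blast
    have "\<forall>x\<in>hds r - {b} - nb b. \<forall>y\<in>hds r - {b} - nb b. x = y"
      using two_heads[OF gr(1) _ b(2)] b(1) n unfolding gr(2) nb_def by blast
    then have c1: "card (hds r - {b} - nb b) \<le> 1" using card_le_Suc0_iff_eq[of "hds r - {b} - nb b"] f by simp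
    have nb: "b \<notin> hds r"
    proof
      assume bb: "b \<in> hds r"
      have "x \<notin> nb b" if xr: "x \<in> hds r" "x \<noteq> b" for x
      proof -
        obtain w t w' t' where wr: "(w, t) \<in> set r" "b = hd t" "(w', t') \<in> set r" "x = hd t'" using xr(1) bb unfolding hds_def by force
        then obtain As Bs where "gapless v ((w, t) # As @ (w', t') # Bs)" using gapless_pair[OF gr(1) wr(1,3)] xr(2) wr(2,4) by blast
        then show ?thesis using frame_heads[OF gapless_lf] wr by (simp add: in_nb)
      qed
      then have "hds r - {b} - nb b = hds r - {b}" by auto
      then show False using c1 c gr(3) bb by simp
    qed
    have "hds r = (hds r - {b} - nb b) \<union> (hds r \<inter> nb b)" using nb by auto
    then have "card (hds r) = card ((hds r - {b} - nb b) \<union> (hds r \<inter> nb b))" by (rule arg_cong)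
    also have "\<dots> \<le> card (hds r - {b} - nb b) + card (hds r \<inter> nb b)" by (rule card_Un_le)
    finally show ?thesis using c1 c nb by simp
  qed
  have dis: "hds s \<inter> hds s' = {}"
  proof -
    have False if x: "x \<in> hds s" "x \<in> hds s'" for x
    proof -
      obtain w t where wt: "(w, t) \<in> set s" "x = hd t" using x(1) by (auto simp: hds_def)
      obtain w' t' where wt': "(w', t') \<in> set s" "x = last t'" using sub[OF x(2)] by blast
      have "t \<noteq> []" "t' \<noteq> []" using gaplessD(8)[OF g wt(1)] gaplessD(8)[OF g wt'(1)] by auto
      then have "x \<in> set t" "x \<in> set t'" unfolding wt(2) using wt(2) wt'(2) last_in_set[of t'] by simp_all
      then have "(w, t) = (w', t')" using seg_inj[OF gaplessD(7)[OF g] wt(1) wt'(1)] by blast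
      moreover have "distinct t"
      proof -
        obtain A B where "s = A @ (w, t) # B" using wt(1) by (meson split_list)
        then show ?thesis using gaplessD(7)[OF g] by simp
      qed
      ultimately show False using hd_ne_last[of t] gaplessD(8)[OF g wt(1)] wt wt' by auto
    qed
    then show ?thesis by blast
  qed
  have m1: "length s \<le> card (hds s \<inter> nb b) + 1" using main[OF g refl l] by simp
  have l': "length s' = length s" using gaplessD(2)[OF g] gaplessD(2)[OF g'] by simp
  have m2: "length s \<le> card (hds s' \<inter> nb b) + 1" using main[OF g' vs'] l l' by simp
  have "card (hds s \<inter> nb b) + card (hds s' \<inter> nb b) = card ((hds s \<inter> nb b) \<union> (hds s' \<inter> nb b))"
    using dis fin_nb by (subst card_Un_disjoint) auto
  also have "\<dots> \<le> deg b" unfolding deg_def using fin_nb by (intro card_mono) auto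
  finally show False using m1 m2 l b(2) gaplessD(2)[OF g] by simp
qed

end

section \<open>The tight case, with n at most 3 deg v + 2\<close>

lemma len2_ex: "length t = 2 ==> \<exists>a b. t = [a, b]"
  by (cases t; cases "tl t") auto

lemma flat_cases: "x \<in> set (flat s) ==> x \<in> vs s \<or> (\<exists>w t. (w, t) \<in> set s \<and> x \<in> set t)"
  by (induction s rule: flat.induct) auto

lemma hd_rev_snoc: "hd (rev (xs @ [v]) @ ys) = v"
  by simp

context tgraph
begin

text \<open>With k segments of at least two vertices, n >= 3 k + 1 already, so there is only one
  spare vertex, and the long segment takes it.\<close>

lemma gapless_sizes:
  assumes g: "gapless v s" and c: "card V \<le> 3 * deg v + 2" and t: "(w, t) \<in> set s" "length t \<noteq> 2"
  shows "length t = 3" "\<And>w' t'. (w', t') \<in> set s ==> (w', t') \<noteq> (w, t) ==> length t' = 2" "Oset {v} s = {}" "card V = 3 * deg v + 2"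
proof -
  note gd = gaplessD[OF g]
  obtain A B where s: "s = A @ (w, t) # B" using t(1) by (meson split_list)
  have fl: "3 * length X \<le> length (flat X)" if "set X \<subseteq> set s" for X
    by (rule flat_len) (use gd(8) that in auto)
  have AB: "3 * length A \<le> length (flat A)" "3 * length B \<le> length (flat B)" using fl s by auto
  have t2: "length t \<ge> 2" using gd(8)[OF t(1)] .
  have c2: "length (flat s) + card (Oset {v} s) \<le> 3 * length s + 1" using c gd(2,3) by simp
  then have m: "length (flat A) + length (flat B) + length t + card (Oset {v} s) \<le> 3 * length A + 3 * length B + 3" using s by simp
  then show l3: "length t = 3" using AB t2 t(2) by simp
  then have O: "card (Oset {v} s) = 0" using m AB by simp
  then show "Oset {v} s = {}" using gd(9) by simp
  have LA: "length (flat A) = 3 * length A" "length (flat B) = 3 * length B" using m l3 O AB by auto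
  then show "card V = 3 * deg v + 2" using gd(2,3) O s l3 by simp
  have two: "length t' = 2" if X: "(w', t') \<in> set X" "set X \<subseteq> set s" "length (flat X) = 3 * length X" for X w' t'
  proof -
    obtain P Q where XX: "X = P @ (w', t') # Q" using X(1) by (meson split_list)
    have "3 * length P \<le> length (flat P)" "3 * length Q \<le> length (flat Q)" using fl X(2) XX by auto
    moreover have "2 \<le> length t'" using gd(8) X(1,2) by blast
    ultimately show ?thesis using X(3) XX by simp
  qed
  show "length t' = 2" if "(w', t') \<in> set s" "(w', t') \<noteq> (w, t)" for w' t'
    using that two[of w' t' A] two[of w' t' B] LA s by auto
qed

text \<open>Using the link, one detour loses only wm and another only ul. Both are therefore low and
  adjacent, and the new edge gives a path that loses nothing.\<close>

lemma two_two:
  assumes g: "gapless v ((vm, [um, wm]) # Ms @ (vl, [ul, wl]) # Ns)" (is "gapless v ?s") and lk: "link (Oset {v} ((vm, [um, wm]) # Ms @ (vl, [ul, wl]) # Ns)) um wl"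
  shows False
proof -
  obtain os where os: "distinct os" "set os \<subseteq> Oset {v} ?s" "walk (um # os @ [wl])" using lk by (auto simp: link_def)
  have os': "walk (wl # rev os @ [um])" using walk_rev[of "um # os @ [wl]"] os(3) by simp
  note lf = gapless_lf[OF g]
  note p = fpairD[OF lframeD(1)[OF lf]]
  note nv = nx_vs[of Ms vl] nx_vs[of Ns vm]
  have wMs: "walk (flat Ms @ [vl, ul])" using p(5,8,11) by (cases "Ms = []") (simp_all add: walk_append walk_Cons)
  have wNs: "walk (flat Ns @ [vm])" using p(6,12) by (cases "Ns = []") (simp_all add: walk_append)
  have wm: "deg wm \<le> deg v"
  proof -
    have "walk ((flat Ms @ [vl, ul, wl]) @ rev os @ (um # rev (flat Ns @ [vm])))"
    proof (rule walk_link[OF os'])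
      show "walk (flat Ms @ [vl, ul, wl])" using wMs p(4) by (simp add: walk_append walk_Cons)
      show "walk (um # rev (flat Ns @ [vm]))" using wNs p(7) Ec[of um] by (subst walk_Cons) (simp add: hd_rev del: rev_append)
    qed auto
    then show ?thesis
      by (rule lost_low'[OF g _ _ os(1,2)]) (use nv in \<open>auto simp: hd_flat_nx last_rev hd_rev_snoc simp del: rev_append\<close>)
  qed
  have ul: "deg ul \<le> deg v"
  proof -
    have "walk ((rev (flat Ms @ [vl]) @ [wm, um]) @ os @ (wl # flat Ns @ [vm]))"
    proof (rule walk_link[OF os(3)])
      have "walk (flat Ms @ [vl])" using wMs by (simp add: walk_append)
      moreover have "E (nx Ms vl) wm" "E wm um" using p(3,9) sym by (simp_all add: walk_Cons)
      ultimately show "walk (rev (flat Ms @ [vl]) @ [wm, um])"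
        by (subst walk_append) (simp add: last_rev hd_flat_nx walk_Cons del: rev_append)
      show "walk (wl # flat Ns @ [vm])" using wNs p(10) by (subst walk_Cons) (simp add: hd_flat_nx)
    qed auto
    then show ?thesis
      by (rule lost_low'[OF g _ _ os(1,2)]) (auto simp: hd_rev_snoc simp del: rev_append)
  qed
  have "E ul wm"
    by (rule low_adj[OF g _ _ _ ul wm]) (use gapless_inner(1)[OF g, of vm "[um, wm]" wm] gapless_inner(1)[OF g, of vl "[ul, wl]" ul] p(15) in auto)
  then have "walk ((flat Ms @ [vl, ul, wm, um]) @ os @ (wl # flat Ns @ [vm]))"
  proof (intro walk_link[OF os(3)])
    assume e: "E ul wm"
    show "walk (flat Ms @ [vl, ul, wm, um])" using wMs p(3) e Ec[of wm] by (simp add: walk_append walk_Cons)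
    show "walk (wl # flat Ns @ [vm])" using wNs p(10) by (subst walk_Cons) (simp add: hd_flat_nx)
  qed auto
  then show False
    by (rule fp0[OF lf _ _ os(1,2)]) (use nv in \<open>auto simp: hd_flat_nx\<close>)
qed

lemma two_two':
  assumes g: "gapless v s" and a: "(a, [u, w]) \<in> set s" "(b, [u', w']) \<in> set s" "(a, [u, w]) \<noteq> (b, [u', w'])"
    and lk: "link (Oset {v} s) x y" "x \<in> {u, w}" "y \<in> {u', w'}"
  shows False
proof -
  obtain Ms Ns where g2: "gapless v ((a, [u, w]) # Ms @ (b, [u', w']) # Ns)" and st: "set ((a, [u, w]) # Ms @ (b, [u', w']) # Ns) = set s"
    using gapless_pair[OF g a] by blast
  have O: "Oset {v} ((a, [u, w]) # Ms @ (b, [u', w']) # Ns) = Oset {v} s" by (rule Oset_cong[OF st])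
  have g3: "gapless v ((b, [u', w']) # Ns @ (a, [u, w]) # Ms)"
    using gapless_rot[of v "(a, [u, w]) # Ms" "(b, [u', w']) # Ns"] g2 by simp
  have O3: "Oset {v} ((b, [u', w']) # Ns @ (a, [u, w]) # Ms) = Oset {v} s" unfolding O[symmetric] by (rule Oset_cong) auto
  show False
    using frame_heads_link[OF gapless_lf[OF g2]] frame_lasts_link[OF gapless_lf[OF g2]] two_two[OF g2] two_two[OF g3] lk link_sym[OF lk(1)]
    unfolding O O3 by auto
qed

text \<open>The edge yields a detour that loses um, so um is low. Exclusion of further edges leaves
  w1 only u1, x and the attachments as neighbours, while the degree condition for v, um and w1
  demands k + 2 of them; hence w1 sees v1, and this last edge completes a path.\<close>

lemma three_cross:
  assumes g: "gapless v ((v1, [u1, x, w1]) # Ms @ (vm, [um, wm]) # Ns)" (is "gapless v ?s")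
    and c: "card V = 3 * deg v + 2" and two: "\<And>w t. (w, t) \<in> set Ms \<union> set Ns ==> length t = 2" and O: "Oset {v} ((v1, [u1, x, w1]) # Ms @ (vm, [um, wm]) # Ns) = {}"
    and e: "E u1 wm"
  shows False
proof -
  note lf = gapless_lf[OF g]
  note gd = gaplessD[OF g]
  note p = fpairD[OF lframeD(1)[OF lf]]
  note nv = nx_vs[of Ms vm] nx_vs[of Ns v1]
  have ad: "E v1 u1" "E u1 x" "E x w1" "E w1 (nx Ms vm)" "E vm um" "E um wm" "E wm (nx Ns v1)"
    using p(3,4,7-10) by (simp_all add: walk_Cons)
  note ad' = ad(1-6)[THEN sym] e[THEN sym]
  have wMs: "walk (flat Ms @ [vm])" using p(5,11) by (cases "Ms = []") (simp_all add: walk_append)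
  have wNs: "walk (flat Ns @ [v1])" using p(6,12) by (cases "Ns = []") (simp_all add: walk_append)
  have A: "walk (rev (flat Ms @ [vm]) @ w1 # r)" if "walk (w1 # r)" for r
    using wMs that ad' by (subst walk_append) (simp add: last_rev hd_flat_nx del: rev_append)
  have B: "walk (r @ wm # flat Ns @ [v1])" if "walk (r @ [wm])" for r
    using wNs that ad(7) by (cases "r = []") (simp_all add: walk_append[of r] walk_Cons hd_flat_nx)
  have C: "walk (r @ u1 # rev (flat Ns @ [v1]))" if "walk (r @ [u1])" for r
    using wNs that ad'(1) by (cases "r = []") (simp_all add: walk_append[of r] walk_Cons hd_rev del: rev_append)
  have inn: "z \<in> V - insert v (vs ?s)" "z \<in> set (flat ?s)" if "z \<in> {u1, x, w1, um, wm}" for z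
    using that gapless_inner[OF g, of v1 "[u1, x, w1]" z] gapless_inner[OF g, of vm "[um, wm]" z] by auto
  have ne: "x \<noteq> um" "w1 \<noteq> um" "u1 \<noteq> um" "x \<noteq> w1" "u1 \<noteq> x" "u1 \<noteq> w1" using p(15) by auto
  have um: "deg um \<le> deg v"
  proof -
    have "walk ([w1, x, u1] @ [wm])" using ad' e by (simp add: walk_Cons)
    then have "walk (w1 # [x, u1] @ wm # flat Ns @ [v1])" using B[of "[w1, x, u1]"] by simp
    from A[OF this] show ?thesis
      by (rule lost_low'[OF g, of _ _ "[]"]) (auto simp: hd_rev_snoc simp del: rev_append)
  qed
  have xum: "\<not> E x um"
  proof
    assume "E x um"
    then have "walk ([w1, x, um, wm] @ [u1])" using ad ad' by (simp add: walk_Cons)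
    then have "walk (w1 # [x, um, wm] @ u1 # rev (flat Ns @ [v1]))" using C[of "[w1, x, um, wm]"] by simp
    from A[OF this] show False
      by (rule fp0[OF lf, of _ "[]"]) (use nv in \<open>auto simp: hd_flat_nx last_rev hd_rev_snoc simp del: rev_append\<close>)
  qed
  have low_no: "\<not> deg z \<le> deg v" if "z \<in> {u1, x, w1}" "\<not> E z um" for z
    using low_adj[OF g inn(1)[of z] inn(1)[of um] _ _ um] that ne by auto
  have w1um: "\<not> E w1 um"
  proof
    assume "E w1 um"
    then have "walk ([w1, um, wm] @ [u1])" using ad ad' by (simp add: walk_Cons)
    then have "walk (w1 # [um, wm] @ u1 # rev (flat Ns @ [v1]))" using C[of "[w1, um, wm]"] by simp
    from A[OF this] have "deg x \<le> deg v"
      by (rule lost_low'[OF g, of _ _ "[]"]) (use nv in \<open>auto simp: hd_flat_nx last_rev hd_rev_snoc simp del: rev_append\<close>)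
    then show False using low_no xum by simp
  qed
  have w1n: "\<not> E w1 y" if l: "(vl, [ul, wl]) \<in> set Ms \<union> set Ns \<union> {(vm, [um, wm])}" "y \<in> {ul, wl}" for vl ul wl y
  proof
    assume ey: "E w1 y"
    have ls: "(vl, [ul, wl]) \<in> set ?s" using l by auto
    obtain As Bs where g2: "gapless v ((v1, [u1, x, w1]) # As @ (vl, [ul, wl]) # Bs)"
      and st: "set ((v1, [u1, x, w1]) # As @ (vl, [ul, wl]) # Bs) = set ?s"
      using gapless_pair[OF g, of v1 "[u1, x, w1]" vl "[ul, wl]"] ls by auto
    note q = fpairD[OF lframeD(1)[OF gapless_lf[OF g2]]]
    have "\<not> E w1 wl" using frame_lasts[OF gapless_lf[OF g2]] by simp
    then have y: "E w1 ul" using ey l(2) by blast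
    have lm: "(vl, [ul, wl]) \<noteq> (vm, [um, wm])" using y w1um by auto
    have "walk (flat As @ [vl])" using q(5,11) by (cases "As = []") (simp_all add: walk_append)
    then have wA: "walk (ul # rev (flat As @ [vl]))" using q(8) Ec[of ul] by (subst walk_Cons) (simp add: hd_rev del: rev_append)
    have wB: "walk (flat Bs @ [v1])" using q(6,12) by (cases "Bs = []") (simp_all add: walk_append)
    have "walk ([u1, x, w1] @ ul # rev (flat As @ [vl]))" using wA y ad by (simp add: walk_Cons del: rev_append)
    then have "walk ((flat Bs @ [v1]) @ [u1, x, w1] @ ul # rev (flat As @ [vl]))"
      using wB ad(1) by (subst walk_append) (simp del: rev_append)
    then have wl: "deg wl \<le> deg v"
      by (rule lost_low'[OF g2, of _ _ "[]"]) (use nx_vs[of As vl] nx_vs[of Bs v1] in \<open>auto simp: hd_flat_nx last_rev hd_rev_snoc simp del: rev_append\<close>)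
    have "wl \<in> V - insert v (vs ?s)" by (rule gapless_inner(1)[OF g ls]) simp
    moreover have "um \<noteq> wl"
    proof
      assume "um = wl"
      then have "(vl, [ul, wl]) = (vm, [um, wm])" using seg_inj[OF gd(7) ls, of vm "[um, wm]" um] by simp
      then show False using lm by simp
    qed
    ultimately have "E um wl" using low_adj[OF g inn(1)[of um] _ _ um wl] by simp
    then show False
      using two_two'[OF g, of vm um wm vl ul wl um wl] ls lm link_E by auto
  qed
  have "nb w1 \<subseteq> {u1, x} \<union> (vs ?s)"
  proof
    fix y assume "y \<in> nb w1"
    then have ey: "E w1 y" by (simp add: in_nb)
    then have yV: "y \<in> V" "y \<noteq> w1" "y \<noteq> v" using EV2 irr inn(1)[of w1] gd(1) Ec by (auto simp: nb_def)
    then have "y \<in> set (flat ?s)" using O by (auto simp: Oset_def)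
    then consider "y \<in> vs ?s" | w t where "(w, t) \<in> set ?s" "y \<in> set t" using flat_cases[of y ?s] by blast
    then show "y \<in> {u1, x} \<union> (vs ?s)"
    proof cases
      case 1
      then show ?thesis by blast
    next
      case 2
      show ?thesis
      proof (cases "(w, t) = (v1, [u1, x, w1])")
        case True
        then show ?thesis using 2 yV by auto
      next
        case False
        then have wt: "(w, t) \<in> set Ms \<union> set Ns \<union> {(vm, [um, wm])}" using 2 by auto
        then have "length t = 2" using two by auto
        then obtain ul wl where "t = [ul, wl]" using len2_ex by blast
        then show ?thesis using w1n[of w ul wl y] wt 2 ey by auto
      qed
    qed
  qed
  moreover have "card ({u1, x} \<union> vs ?s) \<le> deg w1"
  proof -
    have "card ({u1, x} \<union> vs ?s) \<le> card {u1, x} + card (vs ?s)" by (rule card_Un_le)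
    also have "\<dots> = 2 + deg v" using gd(1) ne by (simp add: deg_def)
    finally have "card ({u1, x} \<union> vs ?s) \<le> 2 + deg v" .
    moreover have "card V \<le> deg v + deg um + deg w1"
      using inn(1)[of um] inn(1)[of w1] w1um ne gd(1,5) Ec[of um] by (intro sigma) (auto simp: nb_def)
    ultimately show ?thesis using c um by simp
  qed
  ultimately have "nb w1 = {u1, x} \<union> vs ?s" by (intro card_seteq) (auto simp: deg_def vs_def)
  then have "E w1 v1" by (auto simp: nb_def)
  then have "walk ((flat Ns @ [v1]) @ [w1, x, u1, wm, um] @ rev (flat Ms @ [vm]))"
  proof -
    assume "E w1 v1"
    have "walk (um # rev (flat Ms @ [vm]))" using wMs ad' by (subst walk_Cons) (simp add: hd_rev del: rev_append)
    then have "walk ([w1, x, u1, wm, um] @ rev (flat Ms @ [vm]))" using ad' e by (simp add: walk_Cons del: rev_append)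
    then show ?thesis using wNs \<open>E w1 v1\<close> Ec[of v1] by (subst walk_append) (simp del: rev_append)
  qed
  then show False
    by (rule fp0[OF lf, of _ "[]"]) (use nv in \<open>auto simp: hd_flat_nx last_rev hd_rev_snoc simp del: rev_append\<close>)
qed

text \<open>In both orientations \<open>three_cross\<close> leaves x as the only vertex of its
  segment with edges to the others. Toughness for the attachments together with x gives the edge u1
  w1, and with an edge from x to another segment a path through everything arises.\<close>

lemma gapless_three_False:
  assumes g: "gapless v ((v1, [u1, x, w1]) # R)" (is "gapless v ?s")
    and c: "card V = 3 * deg v + 2" and two: "\<And>w t. (w, t) \<in> set R ==> length t = 2" and O: "Oset {v} ((v1, [u1, x, w1]) # R) = {}"
  shows False
proof -
  note gd = gaplessD[OF g]
  note f = frameD[OF gd(10)]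
  have lE: "link (Oset {v} ?s) a b \<longleftrightarrow> E a b" for a b
    unfolding O link_def by (auto simp: walk_Cons)
  have uwm: "\<not> E u1 wm" if "R = Ms @ (vm, [um, wm]) # Ns" for Ms vm um wm Ns
    using three_cross[of v v1 u1 x w1 Ms vm um wm Ns] g c two O that by auto
  have wum: "\<not> E w1 um" if R: "R = Ms @ (vm, [um, wm]) # Ns" for Ms vm um wm Ns
  proof
    assume e: "E w1 um"
    have g2: "gapless v ((nx R v1, [w1, x, u1]) # mir Ns v1 @ (nx Ns v1, [wm, um]) # mir Ms vm)"
      using gapless_mir[OF g] R by (simp add: mir_append nx_def)
    have st: "set (flat ((nx R v1, [w1, x, u1]) # mir Ns v1 @ (nx Ns v1, [wm, um]) # mir Ms vm)) = set (flat ?s)"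
    proof -
      have "vs ((nx R v1, [w1, x, u1]) # mir Ns v1 @ (nx Ns v1, [wm, um]) # mir Ms vm) = vs ?s" using gd(1) gaplessD(1)[OF g2] by simp
      moreover have "V - {v} - Oset {v} ?s = set (flat ?s)" using f(5,8) by (auto simp: Oset_def)
      moreover have "card (set (flat ((nx R v1, [w1, x, u1]) # mir Ns v1 @ (nx Ns v1, [wm, um]) # mir Ms vm))) \<ge> card V - 1"
      proof -
        have "length (flat (mir ?s v1)) = length (flat ?s)"
        proof -
          have "flat (mir ?s v1) @ [fst (hd ?s)] = rev (flat ?s @ [v1])" by (rule flat_mir) simp
          from arg_cong[OF this, of length] show ?thesis by (simp del: mir.simps flat.simps)
        qed
        moreover have "length (flat (mir ?s v1)) = length (flat ((nx R v1, [w1, x, u1]) # mir Ns v1 @ (nx Ns v1, [wm, um]) # mir Ms vm))"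
          using R by (simp add: mir_append nx_def)
        ultimately show ?thesis using distinct_card[OF gaplessD(7)[OF g2]] gd(3) O by simp
      qed
      moreover have "set (flat ((nx R v1, [w1, x, u1]) # mir Ns v1 @ (nx Ns v1, [wm, um]) # mir Ms vm)) \<subseteq> V - {v}"
        using frameD(5,8)[OF gaplessD(10)[OF g2]] by blast
      moreover have "card (V - {v}) = card V - 1" using fin gd(5) by simp
      ultimately have "set (flat ((nx R v1, [w1, x, u1]) # mir Ns v1 @ (nx Ns v1, [wm, um]) # mir Ms vm)) = V - {v}"
        using fin by (intro card_seteq) auto
      then show ?thesis using O f(5,8) by (auto simp: Oset_def)
    qed
    show False
    proof (rule three_cross[OF g2 c])
      show "length t = 2" if "(w, t) \<in> set (mir Ns v1) \<union> set (mir Ms vm)" for w t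
      proof -
        have "\<exists>w' t'. (w', t') \<in> set R \<and> t = rev t'" using that segs_mir[of w t Ns v1] segs_mir[of w t Ms vm] R by auto
        then show ?thesis using two by fastforce
      qed
      show "Oset {v} ((nx R v1, [w1, x, u1]) # mir Ns v1 @ (nx Ns v1, [wm, um]) # mir Ms vm) = {}"
        using O unfolding Oset_def st .
      show "E w1 um" by fact
    qed
  qed
  have only: "a = x" if wt: "(w, t) \<in> set R" "q \<in> set t" "a \<in> {u1, x, w1}" "E a q" for w t q a
  proof -
    obtain um wm where t: "t = [um, wm]" using len2_ex[OF two[OF wt(1)]] by blast
    obtain Ms Ns where R: "R = Ms @ (w, [um, wm]) # Ns" using wt(1) t by (meson split_list)
    have lf: "lframe {v} ((v1, [u1, x, w1]) # Ms @ (w, [um, wm]) # Ns)" using gapless_lf[OF g] R by simp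
    show ?thesis using frame_heads[OF lf] frame_lasts[OF lf] uwm[OF R] wum[OF R] wt t by auto
  qed
  have d: "distinct (v1 # [u1, x, w1] @ flat R)" using gd(7) by simp
  have no2: "(a, t) = (b, u)" if ab: "(a, t) \<in> set R" "(b, u) \<in> set R" "p \<in> set t" "q \<in> set u" "E p q" for a t b u p q
  proof (rule ccontr)
    assume n: "\<not> ?thesis"
    obtain u1 w1 where t: "t = [u1, w1]" using len2_ex[OF two[OF ab(1)]] by blast
    obtain u2 w2 where u: "u = [u2, w2]" using len2_ex[OF two[OF ab(2)]] by blast
    show False using two_two'[OF g, of a u1 w1 b u2 w2 p q] ab n t u lE by auto
  qed
  have x_link: "\<exists>w t q. (w, t) \<in> set R \<and> q \<in> set t \<and> E x q"
  proof -
    obtain a t b u p q where l: "(a, t) \<in> set ?s" "(b, u) \<in> set ?s" "(a, t) \<noteq> (b, u)" "p \<in> set t" "q \<in> set u" "E p q"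
      using tough_link[OF frame_ring[OF gd(10)]] unfolding lE by blast
    consider "(a, t) \<in> set R" "(b, u) \<in> set R" | "(a, t) = (v1, [u1, x, w1])" "(b, u) \<in> set R" | "(b, u) = (v1, [u1, x, w1])" "(a, t) \<in> set R"
      using l(1-3) by auto
    then show ?thesis
    proof cases
      case 1 then show ?thesis using no2 l by blast
    next
      case 2 then have "p = x" using only[of b u q p] l by auto
      then show ?thesis using 2 l by blast
    next
      case 3 then have "q = x" using only[of a t p q] l sym[OF l(6)] by auto
      then show ?thesis using 3 l sym[OF l(6)] by blast
    qed
  qed
  have tneR: "\<forall>(v, t)\<in>set R. t \<noteq> []" using f(9) by auto
  have hin: "hd t \<in> set t" if "(w, t) \<in> set R" for w t using tneR that by auto
  have uw: "E u1 w1"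
  proof (rule ccontr)
    assume n: "\<not> E u1 w1"
    define cl where "cl z = (z = u1, z = w1, {(w, t) \<in> set R. z \<in> set t})" for z
    define S where "S = insert u1 (insert w1 (hds R))"
    have TR: "z \<notin> set t" if "z \<in> {v1, u1, x, w1}" "(w, t) \<in> set R" for z w t
      using that d by (auto simp: set_flat)
    have clR: "cl z = (False, False, {(w, t)})" if "(w, t) \<in> set R" "z \<in> set t" for z w t
    proof -
      have "(w', t') = (w, t)" if "(w', t') \<in> set R" "z \<in> set t'" for w' t'
        by (rule seg_inj[of R]) (use d that \<open>(w, t) \<in> set R\<close> \<open>z \<in> set t\<close> in auto)
      then have "{(w, t) \<in> set R. z \<in> set t} = {(w, t)}" using that by blast
      moreover have "z \<noteq> u1" "z \<noteq> w1" using TR[of u1 w t] TR[of w1 w t] that by auto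
      ultimately show ?thesis by (simp add: cl_def)
    qed
    have clu: "fst (cl u1) = True" "fst (cl w1) = False" "fst (snd (cl w1)) = True" using d by (auto simp: cl_def)
    have hR: "\<exists>w t. (w, t) \<in> set R \<and> z = hd t \<and> cl z = (False, False, {(w, t)}) \<and> z \<in> set t" if zh: "z \<in> hds R" for z
    proof -
      obtain w t where "(w, t) \<in> set R" "z = hd t" using zh by (auto simp: hds_def)
      then show ?thesis using clR hin by blast
    qed
    have "u1 \<notin> hds R" "w1 \<notin> hds R" using hR TR by blast+
    moreover have "card (hds R) = length R" by (rule hds_card[OF tneR]) (use d in auto)
    moreover have "u1 \<noteq> w1" "finite (hds R)" using d by (auto simp: hds_def)
    ultimately have "card S = length R + 2" by (simp add: S_def)
    moreover have "card S + 1 \<le> card (insert x (vs ?s))"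
    proof (rule tough_cl[where cl = cl and Cs = "set (flat ?s)" and H = "{v}" and h = v and Os = "Oset {v} ?s"])
      show "insert x (vs ?s) \<subseteq> set (flat ?s)" using vs_flat[of ?s] by auto
      show "set (flat ?s) \<subseteq> V" "{v} \<subseteq> V - set (flat ?s)" "Oset {v} ?s = V - set (flat ?s) - {v}" using f(5,6,8) by (auto simp: Oset_def)
      show "\<And>z y. z \<in> {v} ==> E z y ==> y \<in> {v} \<union> insert x (vs ?s)" using f(11) by blast
      show "S \<subseteq> set (flat ?s) - insert x (vs ?s)"
      proof
        fix z assume "z \<in> S"
        then consider "z = u1" | "z = w1" | w t where "(w, t) \<in> set R" "z \<in> set t" unfolding S_def using hR by blast
        then show "z \<in> set (flat ?s) - insert x (vs ?s)"
        proof cases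
          case 1 then show ?thesis using d gapless_inner(1)[OF g, of v1 "[u1, x, w1]" u1] by auto
        next
          case 2 then show ?thesis using d gapless_inner(1)[OF g, of v1 "[u1, x, w1]" w1] by auto
        next
          case 3 then show ?thesis using gapless_inner[OF g, of w t z] TR[of x w t] by auto
        qed
      qed
      show "inj_on cl S"
      proof (rule inj_onI)
        fix a b assume ab: "a \<in> S" "b \<in> S" "cl a = cl b"
        have *: "z = u1 \<or> z = w1 \<or> (\<exists>w t. (w, t) \<in> set R \<and> z = hd t \<and> cl z = (False, False, {(w, t)}))" if "z \<in> S" for z
          using that hR unfolding S_def by blast
        show "a = b" using *[OF ab(1)] *[OF ab(2)] ab(3) clu by auto
      qed
      show "cl a = cl b" if a: "a \<in> set (flat ?s) - insert x (vs ?s)" and b: "b \<in> set (flat ?s) - insert x (vs ?s)"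
        and l: "link (Oset {v} ?s) a b" for a b
      proof -
        have e: "E a b" using l lE by blast
        have *: "z = u1 \<or> z = w1 \<or> (\<exists>w t. (w, t) \<in> set R \<and> z \<in> set t)" if "z \<in> set (flat ?s) - insert x (vs ?s)" for z
          using that flat_cases[of z ?s] by auto
        have nx1: "\<not> (z \<in> {u1, w1} \<and> (w, t) \<in> set R \<and> q \<in> set t \<and> E z q)" for z w t q
          using only[of w t q z] d by auto
        show ?thesis
          using *[OF a] *[OF b] nx1[of a] nx1[of b] e sym[OF e] n irr no2 clR by (metis insertCI)
      qed
    qed auto
    moreover have "card (insert x (vs ?s)) \<le> card (vs ?s) + 1" by (simp add: card_insert_if vs_def)
    ultimately show False using f(10) by simp
  qed
  obtain w t q where q: "(w, t) \<in> set R" "q \<in> set t" "E x q" using x_link by blast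
  obtain um wm where t: "t = [um, wm]" using len2_ex[OF two[OF q(1)]] by blast
  obtain Ms Ns where R: "R = Ms @ (w, [um, wm]) # Ns" using q(1) t by (meson split_list)
  have lf: "lframe {v} ((v1, [u1, x, w1]) # Ms @ (w, [um, wm]) # Ns)" using gapless_lf[OF g] R by simp
  note p = fpairD[OF lframeD(1)[OF lf]]
  note nv = nx_vs[of Ms w] nx_vs[of Ns v1]
  have ad: "E v1 u1" "E u1 x" "E x w1" "E w1 (nx Ms w)" "E w um" "E um wm" "E wm (nx Ns v1)"
    using p(3,4,7-10) by (simp_all add: walk_Cons)
  note ad' = ad(1-6)[THEN sym] uw[THEN sym] q(3)[THEN sym]
  have wMs: "walk (flat Ms @ [w])" using p(5,11) by (cases "Ms = []") (simp_all add: walk_append)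
  have wNs: "walk (flat Ns @ [v1])" using p(6,12) by (cases "Ns = []") (simp_all add: walk_append)
  from q(2) t consider "q = um" | "q = wm" by auto
  then show False
  proof cases
    case 1
    have "walk (wm # flat Ns @ [v1])" using wNs ad(7) by (subst walk_Cons) (simp add: hd_flat_nx)
    then have "walk ([w1, u1, x, um, wm] @ flat Ns @ [v1])" using ad ad' q(3) 1 by (simp add: walk_Cons)
    then have "walk (rev (flat Ms @ [w]) @ [w1, u1, x, um, wm] @ flat Ns @ [v1])"
      using wMs ad' by (subst walk_append) (simp add: last_rev hd_flat_nx del: rev_append)
    then show False by (rule fp0[OF lf, of _ "[]"]) auto
  next
    case 2
    have "walk (u1 # rev (flat Ns @ [v1]))" using wNs ad' by (subst walk_Cons) (simp add: hd_rev del: rev_append)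
    then have "walk ([um, wm, x, w1, u1] @ rev (flat Ns @ [v1]))" using ad ad' q(3) 2 by (simp add: walk_Cons del: rev_append)
    then have "walk ((flat Ms @ [w]) @ [um, wm, x, w1, u1] @ rev (flat Ns @ [v1]))"
      using wMs ad by (subst walk_append) (simp del: rev_append)
    then show False
      by (rule fp0[OF lf, of _ "[]"]) (use nv in \<open>auto simp: hd_flat_nx last_rev hd_rev_snoc simp del: rev_append\<close>)
  qed
qed

lemma gapless_bound_False:
  assumes g: "gapless v s" and c: "card V \<le> 3 * deg v + 2"
  shows False
proof (cases "\<exists>w t. (w, t) \<in> set s \<and> length t \<noteq> 2")
  case True
  then obtain w t where t: "(w, t) \<in> set s" "length t \<noteq> 2" by blast
  note sz = gapless_sizes[OF g c t]
  obtain u x w' where tt: "t = [u, x, w']" using sz(1) by (auto simp: length_Suc_conv numeral_3_eq_3)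
  obtain A B where s: "s = A @ (w, t) # B" using t(1) by (meson split_list)
  have g2: "gapless v ((w, [u, x, w']) # B @ A)" using gapless_rot[of v A "(w, t) # B"] g s tt by simp
  show False
  proof (rule gapless_three_False[OF g2 sz(4)])
    have "distinct (flat s)" using gaplessD(7)[OF g] .
    then have n: "(w, t) \<notin> set (B @ A)" using tt s by (auto simp: set_flat)
    show "length t' = 2" if "(a, t') \<in> set (B @ A)" for a t'
    proof -
      have "(a, t') \<noteq> (w, t)" using n that by auto
      then show ?thesis using sz(2)[of a t'] that s by auto
    qed
    have "set ((w, [u, x, w']) # B @ A) = set s" using s tt by auto
    then show "Oset {v} ((w, [u, x, w']) # B @ A) = {}" using Oset_cong sz(3) by metis
  qed
next
  case False
  obtain a t b u p q where l: "(a, t) \<in> set s" "(b, u) \<in> set s" "(a, t) \<noteq> (b, u)" "p \<in> set t" "q \<in> set u" "link (Oset {v} s) p q"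
    using tough_link[OF frame_ring[OF gaplessD(10)[OF g]]] by blast
  have "length t = 2" "length u = 2" using False l by auto
  then obtain u1 w1 u2 w2 where "t = [u1, w1]" "u = [u2, w2]" using len2_ex[of t] len2_ex[of u] by blast
  then show False using two_two'[OF g, of a u1 w1 b u2 w2 p q] l by auto
qed

text \<open>No inner vertex of a segment is low: two segments are covered by
  \<open>gapless_two\<close>, more by the bound on n. A vertex lost by a detour is low, hence an
  attachment, and this is exactly the exception that \<open>det\<close> admits.\<close>

theorem gapless_False:
  assumes g: "gapless v s"
  shows False
proof -
  note gd = gaplessD[OF g]
  note f = frameD[OF gd(10)]
  have nolow: False if b: "b \<in> set (flat s)" "b \<notin> vs s" "deg b \<le> deg v" for b
  proof -
    obtain w t where wt: "(w, t) \<in> set s" "b \<in> set t" using b(1,2) flat_cases[of b s] by blast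
    show False
    proof (cases "length s = 2")
      case True
      then show False using gapless_two[OF g _ wt b(3)] by simp
    next
      case False
      then show False using gapless_bound_False[OF g gapless_bound[OF g _ gapless_inner(1)[OF g wt] b(3)]] f(1) by simp
    qed
  qed
  have "det {v} s" unfolding det_def
  proof (intro conjI allI impI gd(10))
    fix Q x assume q: "walk Q" "distinct Q" "set Q \<subseteq> V - {v}" "hd Q \<in> vs s" "last Q \<in> vs s" "hd Q \<noteq> last Q"
      "set (flat s) - set Q \<subseteq> {x}"
    have nc: "\<not> set (flat s) \<subseteq> set Q" using noQ0[OF gapless_lf[OF g] q(1-5)] by blast
    then have x: "x \<in> set (flat s)" "x \<notin> set Q" using q(7) by auto
    have "Q \<noteq> []"
    proof
      assume "Q = []"
      then show False using cover_length[OF gd(7) q(7)] flat_len0[OF f(9)] f(1) by fastforce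
    qed
    then have d: "deg x \<le> deg v" using lost_low[OF g q(1-5) _ _ x] q(7) by auto
    show "x \<in> vs s" using nolow[OF x(1)] d by blast
    show "deg x \<le> card (vs s)" "3 * card (vs s) + 1 \<le> card V" using d gd(2,4) f(10) by auto
  qed
  then show False by (rule det_False)
qed

lemma off_comp:
  assumes C: "longest C" "length C \<ge> 3" and v: "v \<in> V - set C"
  shows "comp {v} C"
proof -
  obtain H where H: "v \<in> H" "comp H C" using comp_ex[OF v] by blast
  then have "H = {v}" using dominated[OF C H(2)] by blast
  then show ?thesis using H by simp
qed

theorem single_gap:
  assumes C: "longest C" "length C \<ge> 3" and v: "v \<in> V - set C"
    and mx: "\<And>D w. longest D ==> w \<in> V - set D ==> deg w \<le> deg v"
  shows "\<exists>s w y. lframe {v} s \<and> length (flat s) = length C \<and> set (flat s) = set C \<and> (w, [y]) \<in> set s"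
proof -
  obtain s where s: "lframe {v} s" "length (flat s) = length C" "set (flat s) = set C"
    using frame_ex[OF C off_comp[OF C v]] by blast
  have "\<not> gapless v s" using gapless_False by blast
  then obtain w t where t: "(w, t) \<in> set s" "\<not> 2 \<le> length t" using s(1) mx unfolding gapless_def by blast
  moreover have "t \<noteq> []" using frameD(9)[OF lframeD(1)[OF s(1)] t(1)] .
  ultimately obtain y where "t = [y]" by (cases t) (auto simp: Suc_le_eq)
  then show ?thesis using s t by blast
qed

end

section \<open>Hopping\<close>

fun con :: "'a list => 'a => 'a => bool" where
  "con (x # y # zs) a b \<longleftrightarrow> (a = x \<and> b = y) \<or> (a = y \<and> b = x) \<or> con (y # zs) a b"
| "con _ a b \<longleftrightarrow> False"

lemma con_Cons: "con (x # xs) a b \<longleftrightarrow> con xs a b \<or> (xs \<noteq> [] \<and> (a = x \<and> b = hd xs \<or> a = hd xs \<and> b = x))"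
  by (cases xs) auto

lemma con_Nil[simp]: "\<not> con [] a b" by simp

lemma con_append: "con (xs @ ys) a b \<longleftrightarrow> con xs a b \<or> con ys a b \<or>
    (xs \<noteq> [] \<and> ys \<noteq> [] \<and> (a = last xs \<and> b = hd ys \<or> a = hd ys \<and> b = last xs))"
proof (induction xs)
  case (Cons x xs)
  show ?case
  proof (cases "xs = []")
    case False
    then show ?thesis using Cons by (auto simp: con_Cons)
  qed (auto simp: con_Cons)
qed simp

lemma con_rev[simp]: "con (rev xs) a b \<longleftrightarrow> con xs a b"
  by (induction xs) (auto simp: con_append con_Cons last_rev)

lemma con_mem: "con xs a b ==> a \<in> set xs \<and> b \<in> set xs"
  by (induction xs) (auto simp: con_Cons)

lemma con_split: "con xs a b ==> \<exists>P R. xs = P @ a # b # R \<or> xs = P @ b # a # R"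
proof (induction xs)
  case (Cons x xs)
  then consider "con xs a b" | "xs \<noteq> []" "a = x \<and> b = hd xs \<or> a = hd xs \<and> b = x" by (auto simp: con_Cons)
  then show ?case
  proof cases
    case 1
    then obtain P R where "xs = P @ a # b # R \<or> xs = P @ b # a # R" using Cons.IH by blast
    then have "x # xs = (x # P) @ a # b # R \<or> x # xs = (x # P) @ b # a # R" by auto
    then show ?thesis by blast
  next
    case 2
    then have "x # xs = [] @ a # b # tl xs \<or> x # xs = [] @ b # a # tl xs" by (cases xs) auto
    then show ?thesis by blast
  qed
qed simp

lemma con_at:
  assumes "distinct (A @ y # B)"
  shows "con (A @ y # B) y a \<longleftrightarrow> (A \<noteq> [] \<and> a = last A) \<or> (B \<noteq> [] \<and> a = hd B)"
proof -
  have "\<not> con A y a" "\<not> con B y a" using con_mem[of A y a] con_mem[of B y a] assms by auto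
  moreover have "A \<noteq> [] ==> y \<noteq> last A" using last_in_set[of A] assms by auto
  moreover have "B \<noteq> [] ==> y \<noteq> hd B" using hd_in_set[of B] assms by auto
  ultimately show ?thesis by (auto simp: con_append con_Cons)
qed

lemma con_mid:
  assumes d: "distinct Q" and c: "con Q y a" "con Q y b" "a \<noteq> b"
  shows "\<exists>A B. Q = A @ y # B \<and> A \<noteq> [] \<and> B \<noteq> [] \<and> {last A, hd B} = {a, b}"
proof -
  obtain A B where Q: "Q = A @ y # B" using con_mem[OF c(1)] by (meson split_list)
  then show ?thesis using con_at[of A y B] d c by (intro exI[of _ A] exI[of _ B]) auto
qed

definition cyc :: "'a list => 'a => 'a => bool" where
  "cyc C a b \<longleftrightarrow> con C a b \<or> (C \<noteq> [] \<and> (a = last C \<and> b = hd C \<or> a = hd C \<and> b = last C))"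

lemma cyc_rot: "cyc (xs @ ys) a b \<longleftrightarrow> cyc (ys @ xs) a b"
  by (cases "xs = []"; cases "ys = []") (auto simp: cyc_def con_append)

text \<open>The step from X to Y in Woodall's iteration: the cycle vertices lying between two
  vertices of \<open>S\<close>.\<close>

definition Yf :: "'a list => 'a set => 'a set" where
  "Yf C S = {y \<in> set C. \<forall>a. cyc C y a --> a \<in> S}"

definition nocon :: "'a list => 'a set => bool" where
  "nocon C S \<longleftrightarrow> (\<forall>a b. cyc C a b --> \<not> (a \<in> S \<and> b \<in> S))"

text \<open>Such a y still stands between its two cycle neighbours on Q, which is what a hop at y
  requires.\<close>

definition intact :: "'a list => 'a list => 'a => bool" where
  "intact C Q y \<longleftrightarrow> (\<forall>a. cyc C y a --> con Q y a)"

lemma Yf_mono: "S \<subseteq> T ==> Yf C S \<subseteq> Yf C T" by (auto simp: Yf_def)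

lemma intact_rev[simp]: "intact C (rev Q) y \<longleftrightarrow> intact C Q y" by (simp add: intact_def)

context tgraph
begin

lemma closed_at:
  assumes C: "closed C" "length C \<ge> 3" and y: "y \<in> set C"
  shows "\<exists>L. closed (y # L) \<and> mset (y # L) = mset C \<and> cyc (y # L) = cyc C \<and> length L \<ge> 2 \<and>
    (\<forall>z. cyc C y z \<longleftrightarrow> z = hd L \<or> z = last L) \<and> hd L \<noteq> last L"
proof -
  obtain A B where AB: "C = A @ y # B" using y by (meson split_list)
  let ?L = "B @ A"
  have cl: "closed (y # ?L)" using closed_rot[of A "y # B"] C AB by simp
  have c: "cyc (y # ?L) = cyc C" using cyc_rot[of A "y # B"] AB by (intro ext) simp
  have l: "length ?L \<ge> 2" using C AB by simp
  then have Lne: "?L \<noteq> []" by (metis length_0_conv not_numeral_le_zero)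
  have d: "distinct (y # ?L)" using cl unfolding closed_def by blast
  have "last ?L \<in> set ?L" using Lne by (rule last_in_set)
  then have yl: "y \<noteq> last ?L" using d by (metis distinct.simps(2))
  have "cyc (y # ?L) y z \<longleftrightarrow> z = hd ?L \<or> z = last ?L" for z
    using con_at[of "[]" y ?L z] d Lne yl by (auto simp: cyc_def simp del: append_is_Nil_conv)
  moreover have "hd ?L \<noteq> last ?L" by (rule hd_ne_last) (use d l in auto)
  ultimately show ?thesis using cl c l AB by (intro exI[of _ ?L]) (simp add: c)
qed

lemma cyc_cut:
  assumes C: "closed C" and x: "cyc C x x'"
  shows "\<exists>Q. walk Q \<and> mset Q = mset C \<and> hd Q = x \<and> last Q = x' \<and>
    (\<forall>a b. cyc C a b --> con Q a b \<or> (a = x \<and> b = x') \<or> (a = x' \<and> b = x))"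
proof -
  have "\<exists>D. closed D \<and> mset D = mset C \<and> cyc D = cyc C \<and> (hd D = x \<and> last D = x' \<or> hd D = x' \<and> last D = x)"
  proof (cases "con C x x'")
    case False
    then show ?thesis using x C by (intro exI[of _ C]) (auto simp: cyc_def)
  next
    case True
    then obtain P R where "C = P @ x # x' # R \<or> C = P @ x' # x # R" using con_split by fast
    then obtain c d where cd: "C = (P @ [c]) @ (d # R)" "{c, d} = {x, x'}" by auto
    then have "closed ((d # R) @ (P @ [c]))" "cyc ((d # R) @ (P @ [c])) = cyc C"
      using closed_rot[of "P @ [c]" "d # R"] C cyc_rot[of "d # R" "P @ [c]"] by (auto intro!: ext)
    then show ?thesis using cd by (intro exI[of _ "(d # R) @ (P @ [c])"]) (auto simp: doubleton_eq_iff)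
  qed
  then obtain D where D: "closed D" "mset D = mset C" "cyc D = cyc C" "hd D = x \<and> last D = x' \<or> hd D = x' \<and> last D = x" by blast
  have w: "walk D" "D \<noteq> []" using D(1) by (auto simp: closed_def)
  have e: "con D a b \<or> (a = x \<and> b = x') \<or> (a = x' \<and> b = x)" if "cyc C a b" for a b
    using that D(4) unfolding D(3)[symmetric] cyc_def by auto
  from D(4) show ?thesis
  proof
    assume "hd D = x \<and> last D = x'"
    then show ?thesis using w D(2) e by (intro exI[of _ D]) simp
  next
    assume "hd D = x' \<and> last D = x"
    then show ?thesis using w D(2) e by (intro exI[of _ "rev D"]) (simp add: hd_rev last_rev)
  qed
qed

lemma Yf_notin:
  assumes C: "closed C" "length C \<ge> 3" and n: "nocon C S" and y: "y \<in> Yf C S"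
  shows "y \<notin> S"
proof -
  obtain L where "\<forall>z. cyc C y z \<longleftrightarrow> z = hd L \<or> z = last L" using closed_at[OF C, of y] y by (auto simp: Yf_def)
  then have "cyc C y (hd L)" by simp
  then show ?thesis using n y by (auto simp: Yf_def nocon_def)
qed

lemma intact_mid:
  assumes C: "closed C" "length C \<ge> 3" and y: "y \<in> Yf C S" and Q: "distinct Q" "intact C Q y"
  shows "\<exists>A B. Q = A @ y # B \<and> A \<noteq> [] \<and> B \<noteq> [] \<and> last A \<in> S \<and> hd B \<in> S"
proof -
  obtain L where L: "\<forall>z. cyc C y z \<longleftrightarrow> z = hd L \<or> z = last L" "hd L \<noteq> last L" using closed_at[OF C, of y] y by (auto simp: Yf_def)
  then have "con Q y (hd L)" "con Q y (last L)" "{hd L, last L} \<subseteq> S" using Q(2) y by (auto simp: intact_def Yf_def)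
  then show ?thesis using con_mid[OF Q(1) _ _ L(2)] by (metis insert_subset)
qed

text \<open>For Q = A y B, reversing A moves the start of the path to the former predecessor of y, a
  vertex of S. Only y and that predecessor change neighbours, and the latter lies outside
  \<open>Yf C S\<close> since S has no consecutive vertices.\<close>

lemma hop1:
  assumes C: "closed C" "length C \<ge> 3" and n: "nocon C S" and y: "y \<in> Yf C S"
    and Q: "walk Q" "distinct Q" "intact C Q y" and e: "E (hd Q) y"
  shows "\<exists>Q'. walk Q' \<and> mset Q' = mset Q \<and> last Q' = last Q \<and> hd Q' \<in> S \<and>
    (\<forall>z\<in>Yf C S. z \<noteq> y --> intact C Q z --> intact C Q' z)"
proof -
  obtain A B where AB: "Q = A @ y # B" "A \<noteq> []" "B \<noteq> []" "last A \<in> S" using intact_mid[OF C y Q(2,3)] by blast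
  let ?Q = "rev A @ y # B"
  have "walk ?Q" using Q(1) e AB by (auto simp: walk_append last_rev)
  moreover have "intact C ?Q z" if z: "z \<in> Yf C S" "z \<noteq> y" "intact C Q z" for z
  proof -
    have "z \<noteq> last A" using Yf_notin[OF C n z(1)] AB(4) by auto
    then show ?thesis using z(2,3) unfolding intact_def AB(1) by (auto simp: con_append)
  qed
  ultimately show ?thesis using AB by (intro exI[of _ ?Q]) (auto simp: hd_rev)
qed

text \<open>Both ends hop at the same y. This has to be done at once, because y is no longer intact
  after a hop at one end.\<close>

lemma hop2:
  assumes C: "closed C" "length C \<ge> 3" and n: "nocon C S" and y: "y \<in> Yf C S"
    and Q: "walk Q" "distinct Q" "intact C Q y" and e: "E (hd Q) y" "E (last Q) y"
  shows "\<exists>Q'. walk Q' \<and> mset Q' = mset Q \<and> last Q' \<in> S \<and> hd Q' \<in> S \<and>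
    (\<forall>z\<in>Yf C S. z \<noteq> y --> intact C Q z --> intact C Q' z)"
proof -
  obtain A B where AB: "Q = A @ y # B" "A \<noteq> []" "B \<noteq> []" "last A \<in> S" "hd B \<in> S" using intact_mid[OF C y Q(2,3)] by blast
  let ?Q = "rev A @ y # rev B"
  have "walk A" "walk B" using Q(1) AB(1) by (auto simp: walk_append walk_Cons)
  then have "walk ?Q" using e AB(1-3) Ec[of y] by (simp add: walk_append walk_Cons last_rev hd_rev)
  moreover have "intact C ?Q z" if z: "z \<in> Yf C S" "z \<noteq> y" "intact C Q z" for z
  proof -
    have "z \<noteq> last A" "z \<noteq> hd B" using Yf_notin[OF C n z(1)] AB(4,5) by auto
    then show ?thesis using z(2,3) unfolding intact_def AB(1) by (auto simp: con_append con_Cons)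
  qed
  ultimately show ?thesis using AB by (intro exI[of _ ?Q]) (auto simp: hd_rev last_rev)
qed

section \<open>Woodall's iteration\<close>

fun Ys :: "'a list => 'a => nat => 'a set" where
  "Ys C v 0 = {}"
| "Ys C v (Suc n) = Yf C (nb v \<union> (\<Union>y\<in>Ys C v n. nb y))"

definition Xs :: "'a list => 'a => nat => 'a set" where
  "Xs C v n = nb v \<union> (\<Union>y\<in>Ys C v n. nb y)"

lemma Ys_Suc: "Ys C v (Suc n) = Yf C (Xs C v n)" by (simp add: Xs_def)

declare Ys.simps(2)[simp del]

lemma Ys_mono: "Ys C v n \<subseteq> Ys C v (Suc n)"
proof (induction n)
  case (Suc n)
  then have "Xs C v n \<subseteq> Xs C v (Suc n)" by (auto simp: Xs_def)
  then show ?case unfolding Ys_Suc by (rule Yf_mono)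
qed simp

text \<open>The inductive form of the hopping lemma: a path with ends in the n-th X that leaves the
  n-th Y intact can be rearranged and closed through v without losing a vertex.\<close>

definition hopP :: "'a list => 'a => nat => bool" where
  "hopP C v n \<longleftrightarrow> (\<forall>Q. walk Q --> distinct Q --> set Q \<subseteq> V - {v} --> length Q \<ge> 2 --> hd Q \<in> Xs C v n --> last Q \<in> Xs C v n -->
     (\<forall>z\<in>Ys C v n. intact C Q z) --> (\<exists>D. closed D \<and> set D = insert v (set Q)))"

lemma hopP_0:
  assumes v: "v \<in> V"
  shows "hopP C v 0"
  unfolding hopP_def
proof (intro allI impI)
  fix Q assume Q: "walk Q" "distinct Q" "set Q \<subseteq> V - {v}" "length Q \<ge> 2" "hd Q \<in> Xs C v 0" "last Q \<in> Xs C v 0"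
  then have "E v (hd Q)" "E (last Q) v" "Q \<noteq> []" using Ec[of v] by (auto simp: Xs_def in_nb)
  then have "closed (Q @ [v])" unfolding closed_def using Q v by (auto simp: walk_append)
  then show "\<exists>D. closed D \<and> set D = insert v (set Q)" by (intro exI[of _ "Q @ [v]"]) auto
qed

text \<open>An end that is new in X is adjacent to a new y of Y, and a hop at y brings the end into
  the old X. The old vertices of Y stay intact since y is not among them. The ends are treated one
  after the other, except that \<open>hop2\<close> is used if both see the same y.\<close>

lemma hopP_Suc:
  assumes C: "closed C" "length C \<ge> 3" and n: "nocon C (Xs C v n)" and h: "hopP C v n"
  shows "hopP C v (Suc n)"
  unfolding hopP_def
proof (intro allI impI)
  let ?X = "Xs C v n" and ?Y = "Ys C v (Suc n)"
  fix Q assume Q: "walk Q" "distinct Q" "set Q \<subseteq> V - {v}" "length Q \<ge> 2" "hd Q \<in> Xs C v (Suc n)" "last Q \<in> Xs C v (Suc n)"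
    and i: "\<forall>z\<in>?Y. intact C Q z"
  have fin: "\<exists>D. closed D \<and> set D = insert v (set Q)"
    if q: "walk Q'" "mset Q' = mset Q" "hd Q' \<in> ?X" "last Q' \<in> ?X" "\<forall>z\<in>Ys C v n. intact C Q' z" for Q'
  proof -
    have "distinct Q'" "set Q' = set Q" "length Q' = length Q"
      using mset_eq_distinct[OF q(2)] mset_eq_setD[OF q(2)] mset_eq_length[OF q(2)] Q(2) by auto
    then show ?thesis using h q Q(3,4) unfolding hopP_def by metis
  qed
  have new: "\<exists>y\<in>?Y. y \<notin> Ys C v n \<and> E x y" if x: "x \<in> Xs C v (Suc n)" "x \<notin> ?X" for x
  proof -
    obtain y where "y \<in> ?Y" "E y x" using x by (auto simp: Xs_def in_nb)
    moreover have "y \<notin> Ys C v n" using x(2) \<open>E y x\<close> by (auto simp: Xs_def in_nb)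
    ultimately show ?thesis using sym by blast
  qed
  have half: "\<exists>D. closed D \<and> set D = insert v (set Q)"
    if q: "walk Q'" "mset Q' = mset Q" "hd Q' \<in> Xs C v (Suc n)" "last Q' \<in> ?X" "\<forall>z\<in>Ys C v n. intact C Q' z"
      "\<And>y. hd Q' \<notin> ?X ==> y \<in> ?Y ==> E (hd Q') y ==> intact C Q' y" for Q'
  proof (cases "hd Q' \<in> ?X")
    case True
    then show ?thesis using fin q by blast
  next
    case False
    then obtain y where y: "y \<in> ?Y" "y \<notin> Ys C v n" "E (hd Q') y" using new q(3) by blast
    have "distinct Q'" using mset_eq_distinct[OF q(2)] Q(2) by simp
    then obtain Q2 where Q2: "walk Q2" "mset Q2 = mset Q'" "last Q2 = last Q'" "hd Q2 \<in> ?X"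
      "\<forall>z\<in>Yf C ?X. z \<noteq> y --> intact C Q' z --> intact C Q2 z"
      using hop1[OF C n _ q(1) _ q(6)[OF False y(1,3)] y(3)] y(1) unfolding Ys_Suc by blast
    have "\<forall>z\<in>Ys C v n. intact C Q2 z"
    proof
      fix z assume z: "z \<in> Ys C v n"
      have "z \<in> Yf C ?X" using Ys_mono[of C v n] z unfolding Ys_Suc by blast
      moreover have "z \<noteq> y" using z y(2) by blast
      ultimately show "intact C Q2 z" using Q2(5) q(5) z by blast
    qed
    then show ?thesis using fin[OF Q2(1)] Q2(2-4) q(2,4) by simp
  qed
  have i': "\<forall>z\<in>Ys C v n. intact C Q z" using i Ys_mono[of C v n] by blast
  show "\<exists>D. closed D \<and> set D = insert v (set Q)"
  proof (cases "last Q \<in> ?X")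
    case True
    then show ?thesis using half[OF Q(1) refl Q(5)] i i' by blast
  next
    case False
    then obtain y where y: "y \<in> ?Y" "y \<notin> Ys C v n" "E (last Q) y" using new[OF Q(6)] by blast
    have Yy: "y \<in> Yf C ?X" using y(1) unfolding Ys_Suc .
    have iy: "intact C Q y" using i y(1) by blast
    show ?thesis
    proof (cases "hd Q \<in> ?X \<or> \<not> E (hd Q) y")
      case True
      have Qr: "E (hd (rev Q)) y" "distinct (rev Q)" "walk (rev Q)" "intact C (rev Q) y"
        using y(3) Q(1,2,4) iy by (auto simp: hd_rev)
      obtain Q2 where Q2: "walk Q2" "mset Q2 = mset Q" "last Q2 = hd Q" "hd Q2 \<in> ?X"
        "\<forall>z\<in>Yf C ?X. z \<noteq> y --> intact C Q z --> intact C Q2 z"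
        using hop1[OF C n Yy Qr(3,2,4,1)] Q(4) by (auto simp: last_rev)
      have ne: "Q2 \<noteq> []" using Q2(2) Q(4) by auto
      show ?thesis
      proof (rule half[of "rev Q2"])
        show "\<forall>z\<in>Ys C v n. intact C (rev Q2) z" using Q2(5) i y(2) Ys_mono[of C v n] unfolding Ys_Suc by auto
        show "intact C (rev Q2) z" if z: "hd (rev Q2) \<notin> ?X" "z \<in> ?Y" "E (hd (rev Q2)) z" for z
        proof -
          have "z \<noteq> y" using True z(1,3) ne Q2(3) by (auto simp: hd_rev)
          then have "intact C Q2 z" using Q2(5) i z(2) unfolding Ys_Suc by blast
          then show ?thesis by simp
        qed
      qed (use Q2 Q ne in \<open>auto simp: hd_rev last_rev\<close>)
    next
      case False
      then obtain Q2 where Q2: "walk Q2" "mset Q2 = mset Q" "last Q2 \<in> ?X" "hd Q2 \<in> ?X"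
        "\<forall>z\<in>Yf C ?X. z \<noteq> y --> intact C Q z --> intact C Q2 z"
        using hop2[OF C n Yy Q(1,2) iy _ y(3)] by blast
      have "\<forall>z\<in>Ys C v n. intact C Q2 z"
    proof
      fix z assume z: "z \<in> Ys C v n"
      have "z \<in> Yf C ?X" using Ys_mono[of C v n] z unfolding Ys_Suc by blast
      moreover have "z \<noteq> y" using z y(2) by blast
      ultimately show "intact C Q2 z" using Q2(5) i' z by blast
    qed
      then show ?thesis using fin[OF Q2(1,2,4,3)] by blast
    qed
  qed
qed

lemma closed_length: "closed D ==> set D = insert v (set Q) ==> distinct Q ==> v \<notin> set Q ==> length D = length Q + 1"
  using distinct_card[of D] distinct_card[of Q] by (simp add: closed_def)

text \<open>The cycle opened between a and b is a path in which only a and b lose a cycle neighbour,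
  so it would close to a longer cycle.\<close>

lemma hop_nocon:
  assumes C: "longest C" "length C \<ge> 3" and v: "v \<in> V - set C" and h: "hopP C v n"
    and ab: "a \<in> Xs C v n" "b \<in> Xs C v n" "a \<notin> Ys C v n" "b \<notin> Ys C v n"
  shows "\<not> cyc C a b"
proof
  assume c: "cyc C a b"
  have cl: "closed C" using C by (simp add: longest_def)
  obtain Q where Q: "walk Q" "mset Q = mset C" "hd Q = a" "last Q = b"
    "\<forall>x y. cyc C x y --> con Q x y \<or> (x = a \<and> y = b) \<or> (x = b \<and> y = a)" using cyc_cut[OF cl c] by blast
  have q: "distinct Q" "set Q = set C" "length Q = length C"
    using mset_eq_distinct[OF Q(2)] mset_eq_setD[OF Q(2)] mset_eq_length[OF Q(2)] cl by (auto simp: closed_def)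
  have "\<forall>z\<in>Ys C v n. intact C Q z" using Q(5) ab(3,4) unfolding intact_def by blast
  moreover have "set Q \<subseteq> V - {v}" using q(2) cl v by (auto simp: closed_def)
  ultimately obtain D where D: "closed D" "set D = insert v (set Q)"
    using h Q(1,3,4) q(1,3) C(2) ab(1,2) unfolding hopP_def by force
  then have "length D = length C + 1" using closed_length[OF D q(1)] q(2,3) v by auto
  then show False using C(1) D(1) by (fastforce simp: longest_def)
qed

text \<open>The edge rearranges the cycle to a path that loses nothing and runs from a cycle
  neighbour of y to one of y'. Both ends lie in X, so the path would close to a longer
  cycle.\<close>

lemma hop_cross:
  assumes C: "longest C" "length C \<ge> 3" and v: "v \<in> V - set C" and h: "hopP C v n" and nc: "nocon C (Xs C v n)"
    and y: "y \<in> Ys C v (Suc n)" "y' \<in> Ys C v (Suc n)"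
  shows "\<not> E y y'"
proof
  let ?X = "Xs C v n"
  assume e: "E y y'"
  have cl: "closed C" using C by (simp add: longest_def)
  have Yf: "y \<in> Yf C ?X" "y' \<in> Yf C ?X" using y unfolding Ys_Suc by auto
  have nX: "z \<notin> ?X" if "z \<in> Yf C ?X" for z using Yf_notin[OF cl C(2) nc that] .
  have old: "y \<notin> Ys C v n" "y' \<notin> Ys C v n"
    using nX[OF Yf(1)] nX[OF Yf(2)] e sym[OF e] by (auto simp: Xs_def in_nb)
  obtain L where L: "closed (y # L)" "mset (y # L) = mset C" "cyc (y # L) = cyc C" "length L \<ge> 2"
    "\<forall>z. cyc C y z \<longleftrightarrow> z = hd L \<or> z = last L" using closed_at[OF cl C(2), of y] Yf(1) by (auto simp: Yf_def)
  have ends: "hd L \<in> ?X" "last L \<in> ?X" using L(5) Yf(1) by (auto simp: Yf_def)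
  have "set (y # L) = set C" by (rule mset_eq_setD[OF L(2)])
  then have "y' \<in> set L" using Yf(2) e irr[of y] by (auto simp: Yf_def)
  then obtain A B where AB: "L = A @ y' # B" by (meson split_list)
  have Ane: "A \<noteq> []" using ends(1) nX[OF Yf(2)] AB by auto
  have Bne: "B \<noteq> []" using ends(2) nX[OF Yf(2)] AB by auto
  have hB: "hd B \<in> ?X"
  proof -
    have "con (y # L) y' (hd B)" unfolding AB using Bne by (auto simp: con_append con_Cons)
    then have "cyc C y' (hd B)" unfolding L(3)[symmetric] cyc_def by simp
    then show ?thesis using Yf(2) by (auto simp: Yf_def)
  qed
  let ?Q = "(A @ [y']) @ y # rev B"
  have w: "walk (A @ [y'])" "walk (y' # B)" "E (last L) y" using L(1) AB unfolding closed_def by (auto simp: walk_append walk_Cons)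
  have "walk (y # rev B)" using w(2,3) AB Bne Ec[of y] by (auto simp: walk_Cons hd_rev)
  then have wQ: "walk ?Q" using w(1) sym[OF e] by (subst walk_append) simp
  have m: "mset ?Q = mset C" unfolding L(2)[symmetric] AB by (simp add: add_mset_commute)
  have q: "distinct ?Q" "set ?Q = set C" "length ?Q = length C"
    using mset_eq_distinct[OF m] mset_eq_setD[OF m] mset_eq_length[OF m] cl by (simp_all add: closed_def)
  have "intact C ?Q z" if z: "z \<in> Ys C v n" for z
    unfolding intact_def
  proof (intro allI impI)
    fix d assume d: "cyc C z d"
    have zX: "z \<notin> ?X" "z \<noteq> y" "z \<noteq> y'" using nX[of z] z old Ys_mono[of C v n] unfolding Ys_Suc by auto
    have "cyc (y # A @ y' # B) z d" using d L(3) AB by simp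
    moreover have "z \<noteq> hd A" "z \<noteq> last B" "z \<noteq> hd B" using ends hB zX(1) AB Ane Bne by auto
    ultimately show "con ?Q z d" using zX(2,3) Ane Bne by (auto simp: cyc_def con_append con_Cons)
  qed
  moreover have "set ?Q \<subseteq> V - {v}" using q(2) cl v by (auto simp: closed_def)
  moreover have "hd ?Q \<in> ?X" "last ?Q \<in> ?X" using ends(1) AB Ane hB Bne by (auto simp: last_rev)
  moreover have "length ?Q \<ge> 2" by simp
  ultimately obtain D where D: "closed D" "set D = insert v (set ?Q)"
    using h wQ q(1) unfolding hopP_def by blast
  then have "length D = length C + 1" using closed_length[OF D q(1)] q(2,3) v by auto
  then show False using C(1) D(1) by (fastforce simp: longest_def)
qed

text \<open>If y in the new Y saw x off the cycle, y could be exchanged for v by hopping. The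
  resulting longest cycle would miss the adjacent vertices y and x, but the components off a longest
  cycle are single vertices.\<close>

lemma hop_sub:
  assumes C: "longest C" "length C \<ge> 3" and v: "v \<in> V - set C" and h: "hopP C v n" and nc: "nocon C (Xs C v n)"
    and sub: "Xs C v n \<subseteq> set C"
  shows "Xs C v (Suc n) \<subseteq> set C"
proof
  let ?X = "Xs C v n"
  fix x assume x: "x \<in> Xs C v (Suc n)"
  have cl: "closed C" using C by (simp add: longest_def)
  show "x \<in> set C"
  proof (rule ccontr)
    assume n: "x \<notin> set C"
    then have xX: "x \<notin> ?X" using sub by blast
    obtain y where y: "y \<in> Ys C v (Suc n)" "E y x" using x xX by (auto simp: Xs_def in_nb)
    have Yf: "y \<in> Yf C ?X" using y unfolding Ys_Suc by auto
    have nX: "z \<notin> ?X" if "z \<in> Yf C ?X" for z using Yf_notin[OF cl C(2) nc that] .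
    have old: "y \<notin> Ys C v n" using xX y(2) by (auto simp: Xs_def in_nb)
    have xv: "x \<noteq> v" using nX[OF Yf] sym[OF y(2)] by (auto simp: Xs_def in_nb)
    obtain L where L: "closed (y # L)" "mset (y # L) = mset C" "cyc (y # L) = cyc C" "length L \<ge> 2"
      "\<forall>z. cyc C y z \<longleftrightarrow> z = hd L \<or> z = last L" using closed_at[OF cl C(2), of y] Yf by (auto simp: Yf_def)
    have Lne: "L \<noteq> []" using L(4) by auto
    have ends: "hd L \<in> ?X" "last L \<in> ?X" using L(5) Yf by (auto simp: Yf_def)
    have st: "insert y (set L) = set C" using mset_eq_setD[OF L(2)] by simp
    have len: "length C = length L + 1" using mset_eq_length[OF L(2)] by simp
    have q: "walk L" "distinct L" "y \<notin> set L" using L(1) by (auto simp: closed_def walk_Cons)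
    have "intact C L z" if z: "z \<in> Ys C v n" for z
      unfolding intact_def
    proof (intro allI impI)
      fix d assume d: "cyc C z d"
      have zX: "z \<notin> ?X" "z \<noteq> y" using nX[of z] z old Ys_mono[of C v n] unfolding Ys_Suc by auto
      have "cyc (y # L) z d" using d L(3) by simp
      moreover have "z \<noteq> hd L" "z \<noteq> last L" using ends zX(1) by auto
      ultimately show "con L z d" using zX(2) Lne by (auto simp: cyc_def con_Cons)
    qed
    moreover have "set L \<subseteq> V - {v}" using st cl v by (auto simp: closed_def)
    ultimately obtain D where D: "closed D" "set D = insert v (set L)"
      using h q(1,2) L(4) ends unfolding hopP_def by blast
    have lD: "length D = length C" using closed_length[OF D q(2)] st len v by auto
    have yv: "y \<noteq> v" using st v by auto
    have "longest D" by (rule longest_cong[OF C(1) D(1) lD])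
    moreover have "y \<in> V - set D" using D(2) q(3) yv EV[OF y(2)] by simp
    ultimately have "comp {y} D" using off_comp lD C(2) by simp
    then have "x \<in> {y} \<union> set D" using y(2) by (auto simp: comp_def nb_def)
    then show False using D(2) st n xv y(2) irr by auto
  qed
qed

lemma hop_all:
  assumes C: "longest C" "length C \<ge> 3" and v: "v \<in> V - set C"
  shows "hopP C v n \<and> nocon C (Xs C v n) \<and> Xs C v n \<subseteq> set C"
proof (induction n)
  case 0
  have h: "hopP C v 0" using hopP_0 v by blast
  have "nocon C (Xs C v 0)" unfolding nocon_def using hop_nocon[OF C v h] by auto
  moreover have "nb v \<subseteq> set C" using off_comp[OF C v] irr[of v] by (auto simp: comp_def in_nb)
  ultimately show ?case using h by (simp add: Xs_def)
next
  case (Suc n)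
  then have h: "hopP C v n" and nc: "nocon C (Xs C v n)" and sub: "Xs C v n \<subseteq> set C" by auto
  have cl: "closed C" using C by (simp add: longest_def)
  have h': "hopP C v (Suc n)" by (rule hopP_Suc[OF cl C(2) nc h])
  have aux: "a \<notin> Ys C v (Suc n)" if aX: "a \<in> Xs C v (Suc n)" for a
  proof
    assume a: "a \<in> Ys C v (Suc n)"
    then have "a \<notin> Xs C v n" using Yf_notin[OF cl C(2) nc] unfolding Ys_Suc by blast
    then obtain y' where "y' \<in> Ys C v (Suc n)" "E y' a" using aX by (auto simp: Xs_def in_nb)
    then show False using hop_cross[OF C v h nc _ a] by blast
  qed
  have "nocon C (Xs C v (Suc n))" unfolding nocon_def using hop_nocon[OF C v h'] aux by blast
  then show ?case using h' hop_sub[OF C v h nc sub] by blast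
qed

text \<open>The sets Y increase inside the cycle and become constant; from then on X contains the
  neighbours of every cycle vertex between two vertices of X.\<close>

theorem hopping:
  assumes C: "longest C" "length C \<ge> 3" and v: "v \<in> V - set C"
  shows "\<exists>X. nb v \<subseteq> X \<and> X \<subseteq> set C \<and> nocon C X \<and> (\<forall>y\<in>Yf C X. nb y \<subseteq> X) \<and>
    (\<forall>Q. walk Q --> distinct Q --> set Q \<subseteq> V - {v} --> length Q \<ge> 2 --> hd Q \<in> X --> last Q \<in> X -->
     (\<forall>z\<in>Yf C X. intact C Q z) --> (\<exists>D. closed D \<and> set D = insert v (set Q)))"
proof -
  have fY: "finite (Ys C v n)" for n
  proof -
    have "Ys C v n \<subseteq> set C" by (cases n) (auto simp: Ys_Suc Yf_def)
    then show ?thesis using finite_subset by blast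
  qed
  have "\<exists>n. Ys C v (Suc n) = Ys C v n"
  proof (rule ccontr)
    assume n: "\<not> ?thesis"
    have "n \<le> card (Ys C v n)" for n
    proof (induction n)
      case (Suc n)
      have "Ys C v n \<subset> Ys C v (Suc n)" using Ys_mono n by blast
      then have "card (Ys C v n) < card (Ys C v (Suc n))" using fY psubset_card_mono by blast
      then show ?case using Suc by simp
    qed simp
    then have "Suc (length C) \<le> card (Ys C v (Suc (length C)))" .
    also have "\<dots> \<le> card (set C)" by (rule card_mono) (auto simp: Ys_Suc Yf_def)
    also have "\<dots> \<le> length C" by (rule card_length)
    finally show False by simp
  qed
  then obtain n where n: "Ys C v (Suc n) = Ys C v n" by blast
  then have Y: "Yf C (Xs C v n) = Ys C v n" unfolding Ys_Suc .
  have "\<forall>y\<in>Ys C v n. nb y \<subseteq> Xs C v n" "nb v \<subseteq> Xs C v n" by (auto simp: Xs_def)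
  then show ?thesis using hop_all[OF C v, of n] unfolding hopP_def Y[symmetric] by blast
qed

end

section \<open>Alternating paths\<close>

fun bad :: "('a => 'a => bool) => 'a list => nat" where
  "bad R (x # y # zs) = (if R x y then 0 else 1) + bad R (y # zs)"
| "bad R _ = 0"

lemma bad_Cons: "bad R (x # xs) = bad R xs + (if xs \<noteq> [] \<and> \<not> R x (hd xs) then 1 else 0)"
  by (cases xs) auto

lemma bad_Nil[simp]: "bad R [] = 0" by simp

lemma bad_append:
  "bad R (xs @ ys) = bad R xs + bad R ys + (if xs \<noteq> [] \<and> ys \<noteq> [] \<and> \<not> R (last xs) (hd ys) then 1 else 0)"
proof (induction xs)
  case (Cons x xs)
  show ?case
  proof (cases "xs = []")
    case False
    then show ?thesis using Cons by (auto simp: bad_Cons)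
  qed (auto simp: bad_Cons)
qed simp

lemma bad_rev: "(\<And>a b. R a b ==> R b a) ==> bad R (rev xs) = bad R xs"
  by (induction xs) (auto simp: bad_append bad_Cons last_rev)

lemma bad_0: "bad R xs = 0 ==> successively R xs"
  by (induction xs) (auto simp: bad_Cons successively_Cons split: if_splits)

lemma bad_pos: "bad R xs \<noteq> 0 ==> \<exists>A x y B. xs = A @ x # y # B \<and> \<not> R x y"
proof (induction xs)
  case (Cons z xs)
  show ?case
  proof (cases "bad R xs = 0")
    case False
    then obtain A x y B where "xs = A @ x # y # B" "\<not> R x y" using Cons.IH by blast
    then have "z # xs = (z # A) @ x # y # B \<and> \<not> R x y" by simp
    then show ?thesis by blast
  next
    case True
    then have "xs \<noteq> []" "\<not> R z (hd xs)" using Cons.prems by (auto simp: bad_Cons split: if_splits)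
    then have "z # xs = [] @ z # hd xs # tl xs \<and> \<not> R z (hd xs)" by simp
    then show ?thesis by blast
  qed
qed simp

definition alternates :: "'a set => 'a list => bool" where
  "alternates X = successively (\<lambda>a b. (a \<in> X) \<noteq> (b \<in> X))"

lemma alternates_Nil[simp]: "alternates X []" by (simp add: alternates_def)

lemma alternates_append: "alternates X (xs @ ys) \<longleftrightarrow> alternates X xs \<and> alternates X ys \<and>
    (xs = [] \<or> ys = [] \<or> (last xs \<in> X) \<noteq> (hd ys \<in> X))"
  by (simp add: alternates_def successively_append_iff)

lemma alternates_Cons: "alternates X (x # xs) \<longleftrightarrow> alternates X xs \<and> (xs = [] \<or> (x \<in> X) \<noteq> (hd xs \<in> X))"
  by (auto simp: alternates_def successively_Cons)

lemma alternates_rev[simp]: "alternates X (rev L) \<longleftrightarrow> alternates X L"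
  by (induction L) (auto simp: alternates_append alternates_Cons last_rev)

lemma alternates_con: "alternates X L ==> con L a b ==> (a \<in> X) \<noteq> (b \<in> X)"
  by (induction L) (auto simp: con_Cons alternates_Cons)

text \<open>Reversing M only changes the two pairs at its boundary. The vertices of \<open>F\<close>
  stay away from the boundary, so they keep their neighbours in the list.\<close>

lemma flip:
  assumes symR: "\<And>a b. R a b ==> R b a" and L: "L = P @ M @ S" "P \<noteq> []" "M \<noteq> []" "S \<noteq> []"
    and new: "R (last P) (last M)" "R (hd M) (hd S)" and old: "\<not> R (last P) (hd M) \<or> \<not> R (last M) (hd S)"
    and alt: "alternates X L" "(last P \<in> X) \<noteq> (last M \<in> X)" "(hd M \<in> X) \<noteq> (hd S \<in> X)"
    and F: "\<And>f z. f \<in> F ==> con L f z ==> R f z" "last P \<notin> F" "last M \<notin> F" "hd M \<notin> F" "hd S \<notin> F"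
  shows "\<exists>L'. bad R L' < bad R L \<and> mset L' = mset L \<and> hd L' = hd L \<and> last L' = last L \<and> alternates X L' \<and>
    (\<forall>f z. f \<in> F --> con L' f z --> R f z)"
proof (intro exI conjI allI impI)
  let ?L = "P @ rev M @ S"
  show "bad R ?L < bad R L"
    using L(2-4) new old unfolding L(1) by (auto simp: bad_append bad_rev[where R = R, OF symR] hd_rev last_rev hd_append)
  show "mset ?L = mset L" "hd ?L = hd L" "last ?L = last L" using L by (auto simp: hd_append last_append)
  show "alternates X ?L"
    using L(2-4) alt unfolding L(1) by (auto simp: alternates_append hd_rev last_rev hd_append)
  show "R f z" if "f \<in> F" "con ?L f z" for f z
  proof -
    have "f \<noteq> last P" "f \<noteq> last M" "f \<noteq> hd M" "f \<noteq> hd S" using that(1) F(2-5) by auto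
    then have "con L f z" using that(2) L(2-4) unfolding L(1) by (auto simp: con_append hd_rev last_rev hd_append)
    then show ?thesis using F(1) that(1) by blast
  qed
qed

text \<open>Reversing a suitable section of an alternating sequence removes a non-adjacent pair without
  creating another one.\<close>

lemma two_opt:
  assumes symR: "\<And>a b. R a b ==> R b a" and dj: "I \<inter> F = {}" "X \<inter> (I \<union> F) = {}" and fin: "finite X" "finite F"
    and miss: "\<And>x y y'. x \<in> X ==> y \<in> I ==> y' \<in> I ==> y \<noteq> y' ==> R x y \<or> R x y'"
    and many: "\<And>y. y \<in> I ==> 3 + card F \<le> card {x \<in> X. R y x}"
    and L: "alternates X L" "distinct L" "set L = X \<union> I \<union> F"
    and F: "\<And>f z. f \<in> F ==> con L f z ==> R f z"
    and xy: "L = A @ x # y # B" "x \<in> X" "\<not> R x y"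
  shows "\<exists>L'. bad R L' < bad R L \<and> mset L' = mset L \<and> hd L' = hd L \<and> last L' = last L \<and> alternates X L' \<and>
    (\<forall>f z. f \<in> F --> con L' f z --> R f z)"
proof -
  have yX: "y \<notin> X" using L(1) xy(1,2) by (auto simp: alternates_append alternates_Cons)
  have yI: "y \<in> I"
  proof -
    have "y \<notin> F"
    proof
      assume "y \<in> F"
      moreover have "con L y x" unfolding xy(1) by (auto simp: con_append con_Cons)
      ultimately show False using F symR xy(3) by blast
    qed
    moreover have "y \<in> X \<union> I \<union> F" using L(3) xy(1) by auto
    ultimately show ?thesis using yX by blast
  qed
  define suc where "suc f = hd (tl (dropWhile (\<lambda>z. z \<noteq> f) L))" for f
  have suc: "z = suc f" if "L = P @ f # z # Q" for P f z Q
  proof -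
    have "f \<notin> set P" using L(2) that by auto
    then have "dropWhile (\<lambda>z. z \<noteq> f) L = f # z # Q" unfolding that by (subst dropWhile_append2) auto
    then show ?thesis by (simp add: suc_def)
  qed
  \<comment> \<open>The places where z is of no use: the start of L, the start of B, and right
    behind a vertex of \<open>F\<close>. They are at most 2 + |F| in number, which is the origin of
    3 + |F| in \<open>many\<close>.\<close>
  define Ex where "Ex = insert (hd L) (insert (hd B) (suc ` F))"
  have "card Ex \<le> Suc (Suc (card (suc ` F)))" unfolding Ex_def using fin(2) by (simp add: card_insert_if)
  also have "\<dots> < 3 + card F" using card_image_le[OF fin(2), of suc] by simp
  also have "\<dots> \<le> card {x \<in> X. R y x}" by (rule many[OF yI])
  finally have "\<not> {x \<in> X. R y x} \<subseteq> Ex" using card_mono[of Ex "{x \<in> X. R y x}"] fin(2) by (auto simp: Ex_def)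
  then obtain z where z: "z \<in> X" "R y z" "z \<noteq> hd L" "z \<noteq> hd B" "z \<notin> suc ` F" unfolding Ex_def by blast
  have zx: "z \<noteq> x" "z \<noteq> y" using z symR xy(3) yX by auto
  have "z \<in> set L" using L(3) z(1) by blast
  then consider "z \<in> set B" | "z \<in> set A" using xy(1) zx by auto
  then show ?thesis
  proof cases
    case 1
    then obtain B1 B2 where B: "B = B1 @ z # B2" by (meson split_list)
    have B1: "B1 \<noteq> []" using z(4) B by auto
    define w where "w = last B1"
    have LL: "L = (A @ [x]) @ (y # B1) @ (z # B2)" using xy(1) B by simp
    have lw: "L = (A @ x # y # butlast B1) @ w # z # B2" unfolding LL w_def using append_butlast_last_id[OF B1] by auto
    have "w \<notin> X" using alternates_con[OF L(1), of w z] z(1) unfolding lw by (auto simp: con_append con_Cons)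
    moreover have "w \<notin> F" using suc[OF lw] z(5) by auto
    moreover have "w \<in> X \<union> I \<union> F" using L(3) lw by auto
    ultimately have wI: "w \<in> I" by blast
    have wy: "w \<noteq> y" using L(2) B1 unfolding LL w_def by auto
    have xw: "R x w" using miss[OF xy(2) yI wI] wy xy(3) by blast
    show ?thesis
      by (rule flip[where R = R and X = X and F = F, OF symR LL]) (use B1 xw z(1,2) xy(2,3) L(1) F \<open>w \<notin> X\<close> \<open>w \<notin> F\<close> yX yI dj in \<open>auto simp: w_def\<close>)
  next
    case 2
    then obtain A1 A2 where A: "A = A1 @ z # A2" by (meson split_list)
    have A1: "A1 \<noteq> []" using z(3) A xy(1) by auto
    define w where "w = last A1"
    let ?M = "z # A2 @ [x]"
    have LL: "L = A1 @ ?M @ (y # B)" using xy(1) A by simp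
    have lw: "L = butlast A1 @ w # z # (A2 @ x # y # B)" unfolding LL w_def using append_butlast_last_id[OF A1] by auto
    have "w \<notin> X" using alternates_con[OF L(1), of w z] z(1) unfolding lw by (auto simp: con_append con_Cons)
    moreover have "w \<notin> F" using suc[OF lw] z(5) by auto
    moreover have "w \<in> X \<union> I \<union> F" using L(3) lw by auto
    ultimately have wI: "w \<in> I" by blast
    have wy: "w \<noteq> y" using L(2) A1 last_in_set[OF A1] unfolding LL w_def by auto
    have xw: "R w x" using miss[OF xy(2) yI wI] wy xy(3) symR by blast
    show ?thesis
      by (rule flip[where R = R and X = X and F = F, OF symR LL]) (use A1 xw z(1) symR[OF z(2)] xy(2,3) L(1) F \<open>w \<notin> X\<close> \<open>w \<notin> F\<close> yX yI dj in \<open>auto simp: w_def\<close>)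
  qed
qed

text \<open>A 2-opt descent on the number of non-adjacent consecutive pairs. \<open>F\<close>
  contains vertices that must not be moved apart from their list neighbours: none for two long
  segments, the representative of a whole segment for three.\<close>

lemma alternating_path:
  assumes symR: "\<And>a b. R a b ==> R b a" and dj: "I \<inter> F = {}" "X \<inter> (I \<union> F) = {}" and fin: "finite X" "finite F"
    and miss: "\<And>x y y'. x \<in> X ==> y \<in> I ==> y' \<in> I ==> y \<noteq> y' ==> R x y \<or> R x y'"
    and many: "\<And>y. y \<in> I ==> 3 + card F \<le> card {x \<in> X. R y x}"
    and L: "alternates X L" "distinct L" "set L = X \<union> I \<union> F"
    and F: "\<And>f z. f \<in> F ==> con L f z ==> R f z"
  shows "\<exists>L'. successively R L' \<and> mset L' = mset L \<and> hd L' = hd L \<and> last L' = last L"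
  using L F
proof (induction "bad R L" arbitrary: L rule: less_induct)
  case less
  show ?case
  proof (cases "bad R L = 0")
    case True
    then show ?thesis using bad_0 by (intro exI[of _ L]) auto
  next
    case False
    then obtain A x y B where xy: "L = A @ x # y # B" "\<not> R x y" using bad_pos by blast
    have Lne: "L \<noteq> []" using xy by simp
    have "\<exists>L'. bad R L' < bad R L \<and> mset L' = mset L \<and> hd L' = hd L \<and> last L' = last L \<and> alternates X L' \<and>
      (\<forall>f z. f \<in> F --> con L' f z --> R f z)"
    proof (cases "x \<in> X")
      case True
      show ?thesis
        by (rule two_opt[where R = R and I = I and F = F and X = X and L = L and A = A and B = B and x = x and y = y]) (fact symR dj fin miss many less.prems xy True)+
    next
      case False
      then have yX: "y \<in> X" using less.prems(1) xy(1) by (auto simp: alternates_append alternates_Cons)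
      have r: "rev L = rev B @ y # x # rev A" using xy by simp
      have nyx: "\<not> R y x" using symR xy(2) by blast
      have "alternates X (rev L)" "distinct (rev L)" "set (rev L) = X \<union> I \<union> F" "\<And>f z. f \<in> F ==> con (rev L) f z ==> R f z"
        using less.prems by (simp_all add: alternates_rev)
      note rp = this
      have "\<exists>L'. bad R L' < bad R (rev L) \<and> mset L' = mset (rev L) \<and> hd L' = hd (rev L) \<and> last L' = last (rev L) \<and>
        alternates X L' \<and> (\<forall>f z. f \<in> F --> con L' f z --> R f z)"
        by (rule two_opt[where R = R and I = I and F = F and X = X and L = "rev L" and A = "rev B" and B = "rev A" and x = y and y = x]) (fact symR dj fin miss many rp r yX nyx)+
      then obtain L' where L': "bad R L' < bad R (rev L)" "mset L' = mset (rev L)" "hd L' = hd (rev L)" "last L' = last (rev L)"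
        "alternates X L'" "\<forall>f z. f \<in> F --> con L' f z --> R f z" by blast
      have "L' \<noteq> []" using L'(2) Lne by auto
      then show ?thesis using L' Lne bad_rev[where R = R, OF symR]
        by (intro exI[of _ "rev L'"]) (simp add: alternates_rev hd_rev last_rev)
    qed
    then obtain L' where L': "bad R L' < bad R L" "mset L' = mset L" "hd L' = hd L" "last L' = last L" "alternates X L'"
      "\<forall>f z. f \<in> F --> con L' f z --> R f z" by blast
    have "distinct L'" "set L' = X \<union> I \<union> F"
      using mset_eq_distinct[OF L'(2)] mset_eq_setD[OF L'(2)] less.prems(2,3) by auto
    then obtain L2 where "successively R L2 \<and> mset L2 = mset L' \<and> hd L2 = hd L' \<and> last L2 = last L'"
      using less.hyps[OF L'(1) L'(5)] L'(6) by blast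
    then show ?thesis using L' by auto
  qed
qed

fun weave :: "'a list => 'a list => 'a list" where
  "weave (x # xs) (j # js) = x # j # weave xs js"
| "weave xs js = xs"

lemma weave:
  assumes "length xs = length js + 1"
  shows "mset (weave xs js) = mset xs + mset js" "hd (weave xs js) = hd xs" "last (weave xs js) = last xs" "weave xs js \<noteq> []"
    "set xs \<subseteq> X ==> set js \<inter> X = {} ==> alternates X (weave xs js)"
proof -
  have *: "mset (weave xs js) = mset xs + mset js \<and> hd (weave xs js) = hd xs \<and> last (weave xs js) = last xs \<and> weave xs js \<noteq> [] \<and>
    (set xs \<subseteq> X --> set js \<inter> X = {} --> alternates X (weave xs js))"
    using assms
  proof (induction xs js rule: weave.induct)
    case (1 x xs j js)
    then have IH: "mset (weave xs js) = mset xs + mset js" "hd (weave xs js) = hd xs" "last (weave xs js) = last xs" "weave xs js \<noteq> []"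
      "set xs \<subseteq> X --> set js \<inter> X = {} --> alternates X (weave xs js)" by auto
    have "xs \<noteq> []" using 1 by auto
    then show ?case using IH by (auto simp: alternates_Cons)
  next
    case ("2_1" js)
    then show ?case by simp
  next
    case ("2_2" xs)
    then show ?case by (cases xs) (auto simp: alternates_Cons)
  qed
  then show "mset (weave xs js) = mset xs + mset js" "hd (weave xs js) = hd xs" "last (weave xs js) = last xs" "weave xs js \<noteq> []"
    "set xs \<subseteq> X ==> set js \<inter> X = {} ==> alternates X (weave xs js)" by auto
qed

lemma list_ends:
  assumes X: "finite X" "a \<in> X" "b \<in> X" "a \<noteq> b"
  shows "\<exists>xs. distinct xs \<and> set xs = X \<and> hd xs = a \<and> last xs = b"
proof -
  obtain ys where ys: "set ys = X - {a, b}" "distinct ys" using finite_distinct_list[of "X - {a, b}"] X(1) by auto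
  show ?thesis using ys X by (intro exI[of _ "a # ys @ [b]"]) auto
qed

lemma list_ends_con:
  assumes X: "finite X" "a \<in> X" "b \<in> X" "a \<noteq> b" and gh: "g \<in> X" "h \<in> X" "g \<noteq> h" "{a, b} \<noteq> {g, h}"
  shows "\<exists>xs. distinct xs \<and> set xs = X \<and> hd xs = a \<and> last xs = b \<and> con xs g h"
proof -
  obtain ys where ys: "set ys = X - {a, b, g, h}" "distinct ys" using finite_distinct_list[of "X - {a, b, g, h}"] X(1) by auto
  consider "a = g" "b \<noteq> h" | "a = h" "b \<noteq> g" | "b = g" "a \<noteq> h" "a \<noteq> g" | "b = h" "a \<noteq> g" "a \<noteq> h" | "a \<noteq> g" "a \<noteq> h" "b \<noteq> g" "b \<noteq> h"
    using gh X(4) by blast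
  then show ?thesis
  proof cases
    case 1 then show ?thesis using ys X gh by (intro exI[of _ "a # h # ys @ [b]"]) auto
  next
    case 2 then show ?thesis using ys X gh by (intro exI[of _ "a # g # ys @ [b]"]) auto
  next
    case 3 then show ?thesis using ys X gh by (intro exI[of _ "a # ys @ [h, b]"]) (auto simp: con_append con_Cons)
  next
    case 4 then show ?thesis using ys X gh by (intro exI[of _ "a # ys @ [g, b]"]) (auto simp: con_append con_Cons)
  next
    case 5 then show ?thesis using ys X gh by (intro exI[of _ "a # g # h # ys @ [b]"]) auto
  qed
qed

section \<open>The final count\<close>

definition big :: "('a \<times> 'a list) list => ('a \<times> 'a list) list" where
  "big s = filter (\<lambda>(w, t). 2 \<le> length t) s"

text \<open>For a cycle cut at X this is |C| - 2|X|, by \<open>length_flat_excess\<close>.\<close>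

definition excess :: "('a \<times> 'a list) list => nat" where
  "excess s = sum_list (map (\<lambda>(w, t). length t - 1) s)"

definition singles :: "('a \<times> 'a list) list => 'a set" where
  "singles s = {y. \<exists>w. (w, [y]) \<in> set s}"

lemma big_simps[simp]: "big [] = []" "big ((w, t) # s) = (if 2 \<le> length t then (w, t) # big s else big s)"
    "big (xs @ ys) = big xs @ big ys"
  by (auto simp: big_def)

lemma excess_simps[simp]: "excess [] = 0" "excess ((w, t) # s) = (length t - 1) + excess s"
    "excess (xs @ ys) = excess xs + excess ys"
  by (auto simp: excess_def)

lemma length_flat_excess: "(\<And>v t. (v, t) \<in> set s ==> t \<noteq> []) ==> length (flat s) = 2 * length s + excess s"
proof (induction s rule: flat.induct)
  case (2 v t s)
  then have "length (flat s) = 2 * length s + excess s" "t \<noteq> []" by auto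
  then show ?case by (cases t) auto
qed simp

lemma big_excess: "length (big s) \<le> excess s"
  by (induction s rule: flat.induct) auto

lemma excess_mem: "(w, t) \<in> set s ==> length t \<le> excess s + 1"
  by (induction s rule: flat.induct) auto

lemma seg_flat: "(w, t) \<in> set s ==> x \<in> set t ==> x \<in> set (flat s)"
  by (induction s rule: flat.induct) auto

lemma singles_flat: "singles s \<subseteq> set (flat s)"
  by (auto simp: singles_def intro: seg_flat)

lemma card_singles:
  "distinct (flat s) ==> (\<And>v t. (v, t) \<in> set s ==> t \<noteq> []) ==> card (singles s) + length (big s) = length s"
proof (induction s rule: flat.induct)
  case 1
  then show ?case by (simp add: singles_def)
next
  case (2 v t s)
  have IH: "card (singles s) + length (big s) = length s" using 2 by auto
  have t: "t \<noteq> []" using "2.prems"(2) by auto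
  have f: "finite (singles s)" by (rule finite_subset[OF singles_flat]) simp
  show ?case
  proof (cases "2 \<le> length t")
    case True
    then have "singles ((v, t) # s) = singles s" by (auto simp: singles_def)
    then show ?thesis using IH True by simp
  next
    case False
    then obtain y where y: "t = [y]" using t by (cases t) (auto simp: Suc_le_eq)
    then have "singles ((v, t) # s) = insert y (singles s)" by (auto simp: singles_def)
    moreover have "y \<notin> singles s" using singles_flat[of s] "2.prems"(1) y by auto
    ultimately show ?thesis using IH f y by simp
  qed
qed

lemma con_appendD: "con (xs @ ys) y a ==> (xs \<noteq> [] ==> y \<noteq> last xs) ==> (ys \<noteq> [] ==> y \<noteq> hd ys) ==> con xs y a \<or> con ys y a"
  by (auto simp: con_append)

lemma single_nbrs:
  assumes d: "distinct (flat s)" and y: "(x, [y]) \<in> set s" and c: "cyc (flat s) y a"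
  shows "a \<in> vs s"
proof -
  obtain P S where s: "s = P @ (x, [y]) # S" using y by (meson split_list)
  have f: "flat s = (flat P @ [x]) @ y # flat S" by (simp add: s)
  have h: "hd (flat s) \<in> vs s" using hd_flat[of s] s by (cases P) auto
  have hy: "y \<noteq> hd (flat s)" using d hd_flat_nx[of P x "y # flat S"] f nx_vs[of P x] seg_disj[OF d y, of y] h by auto
  from c consider "con (flat s) y a" | "y = last (flat s)" "a = hd (flat s)" using hy by (auto simp: cyc_def)
  then show ?thesis
  proof cases
    case 1
    then have "a = x \<or> (flat S \<noteq> [] \<and> a = hd (flat S))" using con_at[of "flat P @ [x]" y "flat S" a] d f by simp
    then show ?thesis using s hd_flat[of S] by (cases S) auto
  qed (use h in simp)
qed

lemma not_single_nbr:
  assumes t: "(x, t) \<in> set s" "y \<in> set t" "t \<noteq> [y]" and d: "distinct t"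
  shows "\<exists>a. cyc (flat s) y a \<and> a \<in> set t"
proof -
  obtain P S where s: "s = P @ (x, t) # S" using t(1) by (meson split_list)
  obtain A B where AB: "t = A @ y # B" using t(2) by (meson split_list)
  have sub: "cyc (flat s) y a" if "con t y a" for a
    using that by (simp add: s cyc_def con_append con_Cons)
  show ?thesis
  proof (cases "A = []")
    case False
    then have "con t y (last A)" using con_at[of A y B] d AB by simp
    then show ?thesis using sub con_mem[of t y] by blast
  next
    case True
    then have "B \<noteq> []" using t(3) AB by auto
    then have "con t y (hd B)" using con_at[of A y B] d AB by simp
    then show ?thesis using sub con_mem[of t y] by blast
  qed
qed

lemma distinct_seg: "distinct (flat s) ==> (w, t) \<in> set s ==> distinct t"
  by (induction s rule: flat.induct) auto

lemma Yf_single: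
  assumes d: "distinct (flat s)" and z: "z \<in> Yf (flat s) (vs s)" "z \<notin> vs s"
  shows "z \<in> singles s"
proof -
  have "z \<in> set (flat s)" using z by (simp add: Yf_def)
  then obtain w t where wt: "(w, t) \<in> set s" "z \<in> set t" using flat_cases[of z s] z(2) by blast
  have "t = [z]"
  proof (rule ccontr)
    assume "t \<noteq> [z]"
    then obtain a where "cyc (flat s) z a" "a \<in> set t" using not_single_nbr[OF wt] distinct_seg[OF d wt(1)] by blast
    then show False using z(1) seg_disj[OF d wt(1)] by (auto simp: Yf_def)
  qed
  then show ?thesis using wt by (auto simp: singles_def)
qed

section \<open>Cycles cut at the hopping set\<close>

context tgraph
begin

text \<open>What remains of a counterexample: m stands for NC2, \<open>vs s\<close> for the hopping
  set X, and \<open>singles s\<close> for the vertices between two vertices of X. The clause on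
  paths is the hopping lemma, and the final bound is the negated conclusion.\<close>

definition hopped :: "'a => nat => ('a \<times> 'a list) list => bool" where
  "hopped v m s \<longleftrightarrow> ring {v} s \<and> longest (flat s) \<and> length (flat s) \<ge> 3 \<and>
     (\<forall>D w. longest D --> w \<in> V - set D --> deg w \<le> deg v) \<and>
     (\<forall>y\<in>singles s. nb y \<subseteq> vs s) \<and> (\<exists>y\<in>singles s. nb v \<inter> nb y \<noteq> {}) \<and>
     (\<forall>Q. walk Q --> distinct Q --> set Q \<subseteq> V - {v} --> length Q \<ge> 2 --> hd Q \<in> vs s --> last Q \<in> vs s -->
       (\<forall>y\<in>singles s. intact (flat s) Q y) --> (\<exists>D. closed D \<and> set D = insert v (set Q))) \<and>
     (\<forall>x y. x \<in> V --> y \<in> V --> x \<noteq> y --> \<not> E x y --> nb x \<inter> nb y \<noteq> {} --> m \<le> card (nb x \<union> nb y)) \<and>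
     length (flat s) \<le> 2 * m + 3"

lemma hoppedD:
  assumes "hopped v m s"
  shows "ring {v} s" "longest (flat s)" "length (flat s) \<ge> 3" "\<And>D w. longest D ==> w \<in> V - set D ==> deg w \<le> deg v"
    "\<And>y. y \<in> singles s ==> nb y \<subseteq> vs s" "\<exists>y\<in>singles s. nb v \<inter> nb y \<noteq> {}"
    "\<And>Q. walk Q ==> distinct Q ==> set Q \<subseteq> V - {v} ==> length Q \<ge> 2 ==> hd Q \<in> vs s ==> last Q \<in> vs s ==>
       (\<And>y. y \<in> singles s ==> intact (flat s) Q y) ==> (\<exists>D. closed D \<and> set D = insert v (set Q))"
    "\<And>x y. x \<in> V ==> y \<in> V ==> x \<noteq> y ==> \<not> E x y ==> nb x \<inter> nb y \<noteq> {} ==> m \<le> card (nb x \<union> nb y)"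
    "length (flat s) \<le> 2 * m + 3"
  using assms unfolding hopped_def by auto

lemma hopped_rot:
  assumes h: "hopped v m (xs @ ys)"
  shows "hopped v m (ys @ xs)"
proof -
  have c: "closed (flat (ys @ xs))" using closed_rot[of "flat xs" "flat ys"] hoppedD(2)[OF h] by (simp add: longest_def)
  have l: "longest (flat (ys @ xs))" using longest_cong[OF hoppedD(2)[OF h] c] by simp
  have e: "vs (ys @ xs) = vs (xs @ ys)" "singles (ys @ xs) = singles (xs @ ys)" by (auto simp: singles_def)
  have "set (flat (ys @ xs)) = set (flat (xs @ ys))" "length (ys @ xs) = length (xs @ ys)" "set (ys @ xs) = set (xs @ ys)" by auto
  then have r: "ring {v} (ys @ xs)" using hoppedD(1)[OF h] c unfolding ring_def e by simp
  have "intact (flat (ys @ xs)) = intact (flat (xs @ ys))"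
    unfolding intact_def using cyc_rot[of "flat xs" "flat ys"] by (intro ext) simp
  moreover have "length (flat (ys @ xs)) = length (flat (xs @ ys))" by simp
  ultimately show ?thesis using h l r unfolding hopped_def e by simp
qed

text \<open>\<open>single_gap\<close> is needed for the vertex y: it lies between two neighbours of
  v, hence belongs to \<open>singles s\<close> and shares a neighbour with v.\<close>

lemma hopped_ex:
  assumes C: "longest C" "length C \<ge> 3" and v: "v \<in> V - set C"
    and mx: "\<And>D w. longest D ==> w \<in> V - set D ==> deg w \<le> deg v"
    and nc: "\<And>x y. x \<in> V ==> y \<in> V ==> x \<noteq> y ==> \<not> E x y ==> nb x \<inter> nb y \<noteq> {} ==> m \<le> card (nb x \<union> nb y)"
    and m: "length C \<le> 2 * m + 3"
  shows "\<exists>s. hopped v m s"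
proof -
  obtain s0 w y where s0: "lframe {v} s0" "length (flat s0) = length C" "set (flat s0) = set C" "(w, [y]) \<in> set s0"
    using single_gap[OF C v] mx by blast
  note f0 = frameD[OF lframeD(1)[OF s0(1)]]
  define C0 where "C0 = flat s0"
  have C0: "longest C0" "length C0 \<ge> 3" "v \<in> V - set C0" using lframeD(2)[OF s0(1)] s0 C v by (auto simp: C0_def)
  have cl: "closed C0" using C0(1) by (simp add: longest_def)
  obtain X where X: "nb v \<subseteq> X" "X \<subseteq> set C0" "nocon C0 X" "\<And>y. y \<in> Yf C0 X ==> nb y \<subseteq> X"
    "\<And>Q. walk Q ==> distinct Q ==> set Q \<subseteq> V - {v} ==> length Q \<ge> 2 ==> hd Q \<in> X ==> last Q \<in> X ==>
     (\<forall>z\<in>Yf C0 X. intact C0 Q z) ==> \<exists>D. closed D \<and> set D = insert v (set Q)"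
    using hopping[OF C0] by blast
  have "x \<in> nb v" if "x \<in> vs s0" for x using f0(13)[OF that] Ec[of v] by (auto simp: in_nb)
  then have vs0: "vs s0 \<subseteq> nb v" by blast
  have w: "w \<in> vs s0" using s0(4) by (force simp: vs_def)
  then have wX: "w \<in> X" "w \<in> set C0" using vs0 X(1,2) by auto
  obtain A B where AB: "C0 = A @ w # B" using wX(2) by (meson split_list)
  define D where "D = w # B @ A"
  have cD: "cyc D = cyc C0" using cyc_rot[of A "w # B"] by (intro ext) (simp add: D_def AB)
  have clD: "closed D" using closed_rot[of A "w # B"] cl AB by (simp add: D_def)
  have lD: "longest D" by (rule longest_cong[OF C0(1) clD]) (simp add: D_def AB)
  have stD: "set D = set C0" "length D = length C0" by (auto simp: D_def AB)
  have dD: "distinct D" using clD by (simp add: closed_def)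
  define s where "s = cuts X D"
  have fs: "flat s = D" by (simp add: s_def)
  have vsX: "vs s = X"
  proof -
    have "vs s = X \<inter> set D" unfolding s_def by (rule vs_cuts) (use wX in \<open>simp add: D_def\<close>)
    then show ?thesis using X(2) stD by auto
  qed
  have ne: "t \<noteq> []" if xt: "(x, t) \<in> set s" for x t
  proof
    assume t: "t = []"
    obtain P S where s: "s = P @ (x, t) # S" using xt by (meson split_list)
    have xX: "x \<in> X" using vsX s by auto
    show False
    proof (cases S)
      case Nil
      have Dx: "D = flat P @ [x]" using fs s t Nil by simp
      then have "last D = x" "D \<noteq> []" by simp_all
      moreover have "hd D = w" by (simp add: D_def)
      ultimately have "cyc D x w" by (simp add: cyc_def)
      then show False using X(3) xX wX cD by (auto simp: nocon_def)
    next
      case (Cons yu S')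
      obtain y u where yu: "yu = (y, u)" using prod.exhaust[of yu] by blast
      have yX: "y \<in> X" using vsX s Cons yu by auto
      have "D = flat P @ x # y # u @ flat S'" using fs s t Cons yu by simp
      then have "cyc D x y" by (auto simp: cyc_def con_append con_Cons)
      then show False using X(3) xX yX cD by (auto simp: nocon_def)
    qed
  qed
  have Yf_s: "z \<in> Yf C0 X \<longleftrightarrow> z \<in> singles s" for z
  proof
    assume z: "z \<in> Yf C0 X"
    then have "z \<notin> X" using Yf_notin[OF cl C0(2) X(3)] by blast
    moreover have "z \<in> Yf (flat s) (vs s)" using z unfolding fs vsX Yf_def cD stD .
    ultimately show "z \<in> singles s" using Yf_single[of s z] dD fs vsX by simp
  next
    assume "z \<in> singles s"
    then obtain x where x: "(x, [z]) \<in> set s" by (auto simp: singles_def)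
    have "a \<in> X" if "cyc C0 z a" for a using single_nbrs[of s x z a] x dD that by (simp add: fs vsX cD)
    moreover have "z \<in> set C0" using seg_flat[OF x, of z] fs stD by simp
    ultimately show "z \<in> Yf C0 X" by (simp add: Yf_def)
  qed
  have yY: "y \<in> Yf C0 X"
  proof -
    have "a \<in> X" if "cyc C0 y a" for a using single_nbrs[OF f0(2) s0(4)] that vs0 X(1) by (auto simp: C0_def)
    moreover have "y \<in> set C0" using s0(4) by (auto simp: C0_def intro: seg_flat)
    ultimately show ?thesis by (simp add: Yf_def)
  qed
  have "w \<in> nb v \<inter> nb y"
  proof -
    obtain P S where "s0 = P @ (w, [y]) # S" using s0(4) by (meson split_list)
    then have "E w y" using f0(3) by (auto simp: walk_append walk_Cons)
    then show ?thesis using w vs0 sym by (auto simp: in_nb)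
  qed
  then have 1: "\<exists>y\<in>singles s. nb v \<inter> nb y \<noteq> {}" using yY Yf_s by blast
  have cv: "card (vs s) = length s" by (rule card_vs) (use fs dD in simp)
  have "2 \<le> card (vs s0)" using f0(1,10) by simp
  also have "\<dots> \<le> card X" using vs0 X(1,2) finite_subset[OF X(2)] by (intro card_mono) auto
  finally have "2 \<le> length s" using cv vsX by simp
  moreover have "nb v \<subseteq> {v} \<union> X" using X(1) by blast
  moreover have "{v} \<inter> set D = {}" "v \<in> V" using C0(3) stD by auto
  ultimately have "ring {v} s" unfolding ring_def fs vsX using clD ne cv vsX by simp
  moreover have "\<forall>y\<in>singles s. nb y \<subseteq> vs s" using X(4) Yf_s vsX by blast
  moreover have "\<exists>D. closed D \<and> set D = insert v (set Q)" if "walk Q" "distinct Q" "set Q \<subseteq> V - {v}" "length Q \<ge> 2"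
    "hd Q \<in> vs s" "last Q \<in> vs s" "\<forall>y\<in>singles s. intact (flat s) Q y" for Q
    using X(5)[OF that(1-4)] that(5-7) Yf_s unfolding vsX fs intact_def cD by blast
  moreover have "length (flat s) = length C" using fs stD s0(2) by (simp add: C0_def)
  ultimately show ?thesis using lD C(2) mx 1 nc m unfolding hopped_def fs by (intro exI[of _ s]) (auto simp: fs)
qed

text \<open>Q loses \<open>zs\<close> and gains \<open>os\<close>. Hopping closes it through v, one
  more vertex, so more must be lost than gained. If a single vertex is lost, the new cycle is
  longest again and the maximality of deg v applies.\<close>

lemma reroute:
  assumes h: "hopped v m s" and Q: "walk Q" "mset (zs @ Q) = mset (flat s @ os)" and os: "distinct os" "set os \<subseteq> Oset {v} s"
    and e: "hd Q \<in> vs s" "last Q \<in> vs s" "length Q \<ge> 2" and i: "\<And>y. y \<in> singles s ==> intact (flat s) Q y"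
  shows "length os + 1 \<le> length zs" "zs = [z] ==> deg z \<le> deg v"
proof -
  note r = ringD[OF hoppedD(1)[OF h]]
  have "distinct (flat s @ os)" using r(2) os by (auto simp: Oset_def)
  then have d: "distinct (zs @ Q)" using mset_eq_distinct[OF Q(2)] by simp
  have st: "set zs \<union> set Q = set (flat s) \<union> set os" using mset_eq_setD[OF Q(2)] by simp
  have QV: "set zs \<union> set Q \<subseteq> V - {v}" using st os r(5,8) by (auto simp: Oset_def)
  obtain D where D: "closed D" "set D = insert v (set Q)"
    using hoppedD(7)[OF h Q(1) _ _ e(3,1,2) i] d QV by auto
  have lD: "length D = length Q + 1" using closed_length[OF D] d QV by auto
  have lQ: "length zs + length Q = length (flat s) + length os" using mset_eq_length[OF Q(2)] by simp
  have "length D \<le> length (flat s)" using hoppedD(2)[OF h] D(1) unfolding longest_def by blast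
  then show le: "length os + 1 \<le> length zs" using lD lQ by simp
  show "deg z \<le> deg v" if z: "zs = [z]"
  proof -
    have "longest D" by (rule longest_cong[OF hoppedD(2)[OF h] D(1)]) (use le lD lQ z in simp)
    moreover have "z \<in> V - set D" using D(2) d QV z by auto
    ultimately show ?thesis using hoppedD(4)[OF h] by blast
  qed
qed

text \<open>The one-vertex segments lie in \<open>Ms\<close> and \<open>Ns\<close>, next to
  attachments of these blocks or to vj and vi; a path that traverses both blocks without a break
  leaves them intact.\<close>

lemma intact_blocks:
  assumes d: "distinct (flat ((vi, Ti) # Ms @ (vj, Tj) # Ns))" (is "distinct (flat ?s)") and l: "length Ti \<ge> 2" "length Tj \<ge> 2"
    and y: "y \<in> singles ((vi, Ti) # Ms @ (vj, Tj) # Ns)"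
    and b: "\<And>a b. con (flat Ms @ [vj]) a b ==> con Q a b" "\<And>a b. con (flat Ns @ [vi]) a b ==> con Q a b"
  shows "intact (flat ((vi, Ti) # Ms @ (vj, Tj) # Ns)) Q y"
  unfolding intact_def
proof (intro allI impI)
  fix a assume c: "cyc (flat ?s) y a"
  obtain w where w: "(w, [y]) \<in> set ?s" using y by (auto simp: singles_def)
  have yv: "y \<notin> vs ?s" using seg_disj[OF d w] by simp
  have yT: "y \<notin> set Ti" "y \<notin> set Tj"
    using seg_inj[OF d w, of vi Ti y] seg_inj[OF d w, of vj Tj y] l by auto
  have lst: "Ti \<noteq> []" "Tj \<noteq> []" using l by auto
  then have yl: "y \<noteq> last Ti" "y \<noteq> hd Ti" "y \<noteq> last Tj" "y \<noteq> hd Tj" using yT by (metis last_in_set hd_in_set)+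
  have nM: "hd (flat Ms @ [vj]) \<in> vs ?s" using nx_vs[of Ms vj] by (auto simp: hd_flat_nx)
  have nN: "hd (flat Ns @ [vi]) \<in> vs ?s" using nx_vs[of Ns vi] by (auto simp: hd_flat_nx)
  have f: "flat ?s = (vi # Ti) @ (flat Ms @ [vj]) @ Tj @ flat Ns" by simp
  have cT: "\<not> con (vi # Ti) y a" "\<not> con Tj y a" using con_mem[of "vi # Ti" y a] con_mem[of Tj y a] yT yv by auto
  have "con (flat Ms @ [vj]) y a \<or> con (flat Ns @ [vi]) y a"
  proof (cases "con (flat ?s) y a")
    case True
    have "nx Ms vj \<in> vs ?s" using nM by (simp add: hd_flat_nx)
    then have "y \<noteq> nx Ms vj" using yv by blast
    then have "con ((flat Ms @ [vj]) @ Tj @ flat Ns) y a"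
      using True con_appendD[of "vi # Ti" "(flat Ms @ [vj]) @ Tj @ flat Ns" y a] cT yl lst f by (simp add: hd_flat_nx)
    then have "con (flat Ms @ [vj]) y a \<or> con (Tj @ flat Ns) y a"
      using con_appendD[of "flat Ms @ [vj]" "Tj @ flat Ns" y a] yl yv lst by simp
    moreover have "con (flat Ns) y a" if "con (Tj @ flat Ns) y a"
    proof -
      have "flat Ns \<noteq> [] ==> y \<noteq> hd (flat Ns)" using nN yv by (cases Ns) (auto simp: hd_flat)
      then show ?thesis using con_appendD[OF that] cT yl by blast
    qed
    ultimately show ?thesis by (auto simp: con_append)
  next
    case False
    then have "y = last (flat ?s) \<and> a = vi" using c yv by (auto simp: cyc_def)
    then show ?thesis using yl lst by (cases "flat Ns = []") (auto simp: f con_append)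
  qed
  then show "con Q y a" using b by blast
qed

lemma hopped_pair:
  assumes h: "hopped v m ((vi, Ti) # Ms @ (vj, Tj) # Ns)" and l: "length Ti \<ge> 2" "length Tj \<ge> 2"
    and Q: "walk Q" "mset (zs @ Q) = mset (flat ((vi, Ti) # Ms @ (vj, Tj) # Ns) @ os)"
    and os: "distinct os" "set os \<subseteq> Oset {v} ((vi, Ti) # Ms @ (vj, Tj) # Ns)"
    and e: "hd Q \<in> vs ((vi, Ti) # Ms @ (vj, Tj) # Ns)" "last Q \<in> vs ((vi, Ti) # Ms @ (vj, Tj) # Ns)"
    and b: "\<And>a b. con (flat Ms @ [vj]) a b ==> con Q a b" "\<And>a b. con (flat Ns @ [vi]) a b ==> con Q a b"
    and len: "length zs \<le> 1"
  shows "\<exists>z. zs = [z] \<and> os = [] \<and> deg z \<le> deg v"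
proof -
  note r = ringD[OF hoppedD(1)[OF h]]
  have "length zs + length Q = length (flat ((vi, Ti) # Ms @ (vj, Tj) # Ns)) + length os" using mset_eq_length[OF Q(2)] by simp
  then have "length Q \<ge> 2" using len l by simp
  note R = reroute[OF h Q os e this intact_blocks[OF r(2) l _ b]]
  have "length os + 1 \<le> length zs" using R(1) by blast
  then obtain z where "zs = [z]" "os = []" using len by (cases zs) auto
  then show ?thesis using R(2) by blast
qed

lemma hopped_walks:
  assumes h: "hopped v m ((vi, Ti) # Ms @ (vj, Tj) # Ns)"
  shows "walk (Ti @ flat Ms @ [vj])" "walk (Tj @ flat Ns @ [vi])" "walk (flat Ns @ vi # Ti)" "walk (flat Ms @ vj # Tj)"
    "Ti \<noteq> []" "Tj \<noteq> []" "E vi (hd Ti)" "E vj (hd Tj)" "E (last Ti) (nx Ms vj)" "E (last Tj) (nx Ns vi)"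
    "nx Ms vj \<noteq> vi" "nx Ns vi \<noteq> vj" "nx Ms vj \<noteq> nx Ns vi" "distinct (vi # Ti @ flat Ms @ vj # Tj @ flat Ns)"
    "walk (flat Ms @ [vj])" "walk (flat Ns @ [vi])" "walk Ti" "walk Tj"
proof -
  note r = ringD[OF hoppedD(1)[OF h]]
  have ne: "Ti \<noteq> []" "Tj \<noteq> []" using r(9) by auto
  have cl: "closed (flat ((vi, Ti) # Ms @ (vj, Tj) # Ns))" using hoppedD(1)[OF h] by (simp add: ring_def)
  note p = ring_pairD[OF cl ne]
  show "walk (Ti @ flat Ms @ [vj])" "walk (Tj @ flat Ns @ [vi])" "Ti \<noteq> []" "Tj \<noteq> []" "E vi (hd Ti)" "E vj (hd Tj)"
    "E (last Ti) (nx Ms vj)" "E (last Tj) (nx Ns vi)" "nx Ms vj \<noteq> vi" "nx Ns vi \<noteq> vj" "distinct (vi # Ti @ flat Ms @ vj # Tj @ flat Ns)"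
    "walk Ti" "walk Tj"
    by (fact p)+
  have "walk (vi # Ti)" "walk (vj # Tj)" using p(1-4,7,8) by (auto simp: walk_Cons)
  then show "walk (flat Ns @ vi # Ti)" "walk (flat Ms @ vj # Tj)" using p(5,6,11,12) by (auto simp: walk_append)
  show "walk (flat Ms @ [vj])" "walk (flat Ns @ [vi])" using p(16,17) by (auto simp: walk_append)
  have "nx Ms vj \<in> insert vj (set (flat Ms))" "nx Ns vi \<in> insert vi (set (flat Ns))"
    using nx_vs[of Ms vj] nx_vs[of Ns vi] vs_flat by fast+
  then show "nx Ms vj \<noteq> nx Ns vi" using p(15) by auto
qed

lemma hopped_ff:
  assumes h: "hopped v m ((vi, Ti) # Ms @ (vj, Tj) # Ns)" (is "hopped v m ?s") and l: "length Ti \<ge> 2" "length Tj \<ge> 2"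
  shows "\<not> link (Oset {v} ?s) (hd Ti) (hd Tj)"
proof
  assume "link (Oset {v} ?s) (hd Ti) (hd Tj)"
  then obtain os where os: "distinct os" "set os \<subseteq> Oset {v} ?s" "walk (hd Ti # os @ [hd Tj])" by (auto simp: link_def)
  note p = hopped_walks[OF h]
  have w: "walk (rev (Ti @ flat Ms @ [vj]) @ os @ (Tj @ flat Ns @ [vi]))"
    by (rule walk_link[OF os(3)]) (use p(1,2,5,6) in \<open>simp_all add: last_rev del: rev_append\<close>)
  have b: "con (rev (Ti @ flat Ms @ [vj]) @ os @ (Tj @ flat Ns @ [vi])) a b"
    if "con (flat Ms @ [vj]) a b \<or> con (flat Ns @ [vi]) a b" for a b
    unfolding con_append[of "rev (Ti @ flat Ms @ [vj])"] con_append[of os] con_rev con_append[of Ti] con_append[of Tj] using that by blast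
  show False using hopped_pair[OF h l w, of "[]" os] os(1,2) b by (auto simp: hd_rev_snoc)
qed

lemma hopped_ll:
  assumes h: "hopped v m ((vi, Ti) # Ms @ (vj, Tj) # Ns)" (is "hopped v m ?s") and l: "length Ti \<ge> 2" "length Tj \<ge> 2"
  shows "\<not> link (Oset {v} ?s) (last Ti) (last Tj)"
proof
  assume "link (Oset {v} ?s) (last Ti) (last Tj)"
  then obtain os where os: "distinct os" "set os \<subseteq> Oset {v} ?s" "walk (last Ti # os @ [last Tj])" by (auto simp: link_def)
  note p = hopped_walks[OF h]
  let ?Q = "((flat Ns @ [vi]) @ Ti) @ os @ rev ((flat Ms @ [vj]) @ Tj)"
  have w: "walk ?Q"
    by (rule walk_link[OF os(3)]) (use p(3-6) in \<open>simp_all add: hd_rev del: rev_append\<close>)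
  have b: "con ?Q a b" if "con (flat Ms @ [vj]) a b \<or> con (flat Ns @ [vi]) a b" for a b
    unfolding con_append[of "(flat Ns @ [vi]) @ Ti"] con_append[of os] con_rev con_append[of "flat Ns @ [vi]"] con_append[of "flat Ms @ [vj]"]
    using that by blast
  have e: "hd ?Q = nx Ns vi" "last ?Q = nx Ms vj" by (simp_all add: hd_flat_nx last_rev del: rev_append)
  have "\<exists>z. [] = [z] \<and> os = [] \<and> deg z \<le> deg v"
    by (rule hopped_pair[OF h l w _ os(1,2)]) (use b nx_vs[of Ns vi] nx_vs[of Ms vj] in \<open>auto simp: e simp del: append_assoc rev_append\<close>)
  then show False by simp
qed

text \<open>A detour over the link loses only the other vertex of a two-vertex segment. So nothing
  may be gained, the link is an edge, and the lost vertex is low.\<close>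

lemma hopped_fl:
  assumes h: "hopped v m ((vi, Ti) # Ms @ (vj, Tj) # Ns)" (is "hopped v m ?s") and l: "length Ti \<ge> 2" "length Tj \<ge> 2"
    and two: "length Ti = 2 \<or> length Tj = 2"
    and os: "distinct os" "set os \<subseteq> Oset {v} ((vi, Ti) # Ms @ (vj, Tj) # Ns)" "walk (hd Ti # os @ [last Tj])"
  shows "os = [] \<and> (\<exists>z\<in>set Ti \<union> set Tj. deg z \<le> deg v)"
proof -
  note p = hopped_walks[OF h]
  from two show ?thesis
  proof
    assume "length Ti = 2"
    then obtain p1 p2 where T: "Ti = [p1, p2]" using len2_ex by blast
    let ?Q = "((flat Ms @ [vj]) @ Tj) @ rev os @ (p1 # rev (flat Ns @ [vi]))"
    have "walk (last Tj # rev os @ [hd Ti])" using walk_rev[of "hd Ti # os @ [last Tj]"] os(3) by simp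
    moreover have "walk (p1 # rev (flat Ns @ [vi]))" using p(7,16) T sym by (subst walk_Cons) (simp add: hd_rev del: rev_append)
    ultimately have w: "walk ?Q" using p(4,6) T by (intro walk_link[of "last Tj" "rev os" "hd Ti"]) simp_all
    have b: "con ?Q a b" if "con (flat Ms @ [vj]) a b \<or> con (flat Ns @ [vi]) a b" for a b
      unfolding con_append[of "(flat Ms @ [vj]) @ Tj"] con_append[of "rev os"] con_Cons[of p1] con_rev con_append[of "flat Ms @ [vj]"]
      using that by blast
    have e: "hd ?Q = nx Ms vj" "last ?Q = nx Ns vi" by (simp_all add: hd_flat_nx last_rev del: rev_append)
    have "\<exists>z. [p2] = [z] \<and> os = [] \<and> deg z \<le> deg v"
      by (rule hopped_pair[OF h l w _ os(1,2)]) (use b nx_vs[of Ns vi] nx_vs[of Ms vj] T in \<open>auto simp: e simp del: append_assoc rev_append\<close>)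
    then show ?thesis using T by auto
  next
    assume "length Tj = 2"
    then obtain q1 q2 where T: "Tj = [q1, q2]" using len2_ex by blast
    let ?Q = "rev (Ti @ (flat Ms @ [vj])) @ os @ (q2 # (flat Ns @ [vi]))"
    have "walk (q2 # (flat Ns @ [vi]))" using p(2) T by (simp add: walk_Cons)
    then have w: "walk ?Q" using p(1,5) T os(3) by (intro walk_link[OF os(3)]) (simp_all add: last_rev del: rev_append)
    have b: "con ?Q a b" if "con (flat Ms @ [vj]) a b \<or> con (flat Ns @ [vi]) a b" for a b
      unfolding con_append[of "rev (Ti @ (flat Ms @ [vj]))"] con_append[of os] con_Cons[of q2] con_rev con_append[of Ti]
      using that by blast
    have e: "hd ?Q = vj" "last ?Q = vi" by simp_all
    have "\<exists>z. [q1] = [z] \<and> os = [] \<and> deg z \<le> deg v"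
      by (rule hopped_pair[OF h l w _ os(1,2)]) (use b T in \<open>auto simp: e simp del: append_assoc rev_append\<close>)
    then show ?thesis using T by auto
  qed
qed

text \<open>A detour through the middle vertex q2 loses only one end of the three-vertex segment: q1
  if it comes from p1, q3 if it comes from p2.\<close>

lemma hopped_mid:
  assumes h: "hopped v m ((vi, [p1, p2]) # Ms @ (vj, [q1, q2, q3]) # Ns)" (is "hopped v m ?s")
    and os: "distinct os" "set os \<subseteq> Oset {v} ((vi, [p1, p2]) # Ms @ (vj, [q1, q2, q3]) # Ns)" and a: "a = p1 \<or> a = p2" "walk (a # os @ [q2])"
  shows "os = [] \<and> (\<exists>z\<in>{q1, q3}. deg z \<le> deg v)"
proof -
  note p = hopped_walks[OF h]
  have l: "2 \<le> length [p1, p2]" "2 \<le> length [q1, q2, q3]" by simp_all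
  from a(1) show ?thesis
  proof
    assume a1: "a = p1"
    define X0 where "X0 = [p1, p2] @ (flat Ms @ [vj])"
    define Y0 where "Y0 = [q2, q3] @ (flat Ns @ [vi])"
    have X0: "walk X0" "hd X0 = p1" "last X0 = vj" "X0 \<noteq> []" using p(1) by (simp_all add: X0_def)
    have Y0: "walk Y0" "hd Y0 = q2" "last Y0 = vi" "Y0 \<noteq> []" using p(2) by (simp_all add: Y0_def walk_Cons)
    have w: "walk (rev X0 @ os @ Y0)" using X0 Y0 a1 by (intro walk_link[OF a(2)]) (simp_all add: last_rev)
    have b: "con (rev X0 @ os @ Y0) a b" if "con (flat Ms @ [vj]) a b \<or> con (flat Ns @ [vi]) a b" for a b
    proof -
      have "con X0 a b \<or> con Y0 a b" unfolding X0_def Y0_def con_append[of "[p1, p2]"] con_append[of "[q2, q3]"] using that by blast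
      then show ?thesis by (auto simp: con_append)
    qed
    have mm: "mset ([q1] @ rev X0 @ os @ Y0) = mset (flat ?s @ os)" by (simp add: X0_def Y0_def)
    have "\<exists>z. [q1] = [z] \<and> os = [] \<and> deg z \<le> deg v"
      by (rule hopped_pair[OF h l w mm os]) (use b X0 Y0 in \<open>auto simp: hd_rev\<close>)
    then show ?thesis by auto
  next
    assume a2: "a = p2"
    let ?Q = "((flat Ns @ [vi]) @ [p1, p2]) @ os @ rev ((flat Ms @ [vj]) @ [q1, q2])"
    have "walk ((flat Ms @ [vj]) @ [q1, q2])" using p(4) by (simp add: walk_append walk_Cons)
    then have w: "walk ?Q" using p(3) a2 by (intro walk_link[OF a(2)]) (simp_all add: hd_rev del: rev_append)
    have b: "con ?Q a b" if "con (flat Ms @ [vj]) a b \<or> con (flat Ns @ [vi]) a b" for a b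
      unfolding con_append[of "(flat Ns @ [vi]) @ [p1, p2]"] con_append[of os] con_rev con_append[of "flat Ns @ [vi]"] con_append[of "flat Ms @ [vj]"]
      using that by blast
    have e: "hd ?Q = nx Ns vi" "last ?Q = nx Ms vj" by (simp_all add: hd_flat_nx last_rev del: rev_append)
    have "\<exists>z. [q3] = [z] \<and> os = [] \<and> deg z \<le> deg v"
      by (rule hopped_pair[OF h l w _ os(1,2)]) (use b nx_vs[of Ns vi] nx_vs[of Ms vj] in \<open>auto simp: e simp del: append_assoc rev_append\<close>)
    then show ?thesis by auto
  qed
qed

text \<open>An independent set with all its neighbours in X. If t segments are long, it has |X| + 1
  - t elements, which decides how many connecting paths an alternating cycle needs.\<close>

abbreviation Ind :: "'a => ('a \<times> 'a list) list => 'a set" where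
  "Ind v s \<equiv> insert v (singles s)"

lemma hopped_facts:
  assumes h: "hopped v m s"
  shows "length (flat s) = 2 * length s + excess s" "card V = length (flat s) + 1 + card (Oset {v} s)"
    "\<And>y. y \<in> Ind v s ==> nb y \<subseteq> vs s" "\<And>y. y \<in> Ind v s ==> y \<in> V - vs s" "\<And>y y'. y \<in> Ind v s ==> y' \<in> Ind v s ==> \<not> E y y'"
    "card (vs s) = length s" "card (Ind v s) + length (big s) = length s + 1" "\<And>y. y \<in> Ind v s ==> deg y \<le> length s"
    "finite (vs s)" "finite (Ind v s)" "2 \<le> card (Ind v s)" "finite (Oset {v} s)"
proof -
  note r = ringD[OF hoppedD(1)[OF h]]
  show "length (flat s) = 2 * length s + excess s" by (rule length_flat_excess) (use r(9) in blast)
  show fo: "finite (Oset {v} s)" using fin by (simp add: Oset_def)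
  have v: "v \<in> V" "v \<notin> set (flat s)" using r(6,8) by auto
  have "V = insert v (set (flat s) \<union> Oset {v} s)" using v(1) r(5) by (auto simp: Oset_def)
  then have "card V = card (insert v (set (flat s) \<union> Oset {v} s))" by (rule arg_cong)
  also have "\<dots> = card (set (flat s) \<union> Oset {v} s) + 1" using v fo by (subst card_insert_disjoint) (auto simp: Oset_def)
  also have "card (set (flat s) \<union> Oset {v} s) = length (flat s) + card (Oset {v} s)"
    using fo distinct_card[OF r(2)] by (subst card_Un_disjoint) (auto simp: Oset_def)
  finally show "card V = length (flat s) + 1 + card (Oset {v} s)" by simp
  have "nb v \<subseteq> vs s"
  proof
    fix x assume "x \<in> nb v"
    then have "E v x" by (simp add: in_nb)
    then show "x \<in> vs s" using r(11)[of v x] irr by auto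
  qed
  then show nbI: "\<And>y. y \<in> Ind v s ==> nb y \<subseteq> vs s" using hoppedD(5)[OF h] by auto
  have sv: "y \<notin> vs s" if y: "y \<in> singles s" for y
  proof -
    obtain w where "(w, [y]) \<in> set s" using y by (auto simp: singles_def)
    then show ?thesis using seg_disj[OF r(2), of w "[y]" y] by simp
  qed
  show inV: "\<And>y. y \<in> Ind v s ==> y \<in> V - vs s"
    using v r(5) sv vs_flat[of s] singles_flat[of s] by auto
  show ind: "\<And>y y'. y \<in> Ind v s ==> y' \<in> Ind v s ==> \<not> E y y'" using nbI inV in_nb by blast
  show cv: "card (vs s) = length s" by (rule r(10))
  have fs: "finite (singles s)" by (rule finite_subset[OF singles_flat]) simp
  have vs: "v \<notin> singles s" using v(2) singles_flat[of s] by blast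
  show "card (Ind v s) + length (big s) = length s + 1" using card_singles[OF r(2,9)] fs vs by simp
  show fv: "finite (vs s)" by (simp add: vs_def)
  show "\<And>y. y \<in> Ind v s ==> deg y \<le> length s" using card_mono[OF fv nbI] cv by (simp add: deg_def)
  show "finite (Ind v s)" using fs by simp
  obtain y where "y \<in> singles s" using hoppedD(6)[OF h] by blast
  then have "singles s \<noteq> {}" by blast
  then have "0 < card (singles s)" using fs by (simp add: card_gt_0_iff)
  then show "2 \<le> card (Ind v s)" using fs vs by simp
qed

text \<open>v and some vertex of \<open>singles s\<close> are at distance two with neighbourhoods
  inside X, whence m <= |X|; now |C| = 2|X| + excess <= 2 m + 3.\<close>

lemma hopped_excess:
  assumes h: "hopped v m s"
  shows "excess s \<le> 3" "m \<le> length s"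
proof -
  note f = hopped_facts[OF h]
  obtain y0 where y0: "y0 \<in> singles s" "nb v \<inter> nb y0 \<noteq> {}" using hoppedD(6)[OF h] by blast
  have "v \<noteq> y0" using y0(1) singles_flat[of s] ringD(8)[OF hoppedD(1)[OF h]] by auto
  then have "m \<le> card (nb v \<union> nb y0)"
    by (intro hoppedD(8)[OF h]) (use y0 f(4)[of v] f(4)[of y0] f(5)[of v y0] in auto)
  also have "\<dots> \<le> card (vs s)" by (rule card_mono[OF f(9)]) (use f(3)[of v] f(3)[of y0] y0 in auto)
  finally show "m \<le> length s" using f(6) by simp
  then show "excess s \<le> 3" using hoppedD(9)[OF h] f(1) by simp
qed

text \<open>Two long segments give |X| <= m, so vertices of \<open>Ind v s\<close> with a common
  neighbour together see all of X. A third vertex of this set supplies, by the degree condition,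
  common neighbours and large degrees; if there are only two, they share a neighbour by construction
  and the low vertex z takes the third place in the degree condition.\<close>

lemma hopped_degrees:
  assumes h: "hopped v m s" and t: "2 \<le> length (big s)" and z: "z \<in> V - vs s - Ind v s" "deg z \<le> deg v"
  shows "\<And>y. y \<in> Ind v s ==> length (big s) + 1 \<le> deg y"
    "\<And>x y y'. x \<in> vs s ==> y \<in> Ind v s ==> y' \<in> Ind v s ==> y \<noteq> y' ==> E x y \<or> E x y'" "length (big s) + 1 \<le> length s"
proof -
  note f = hopped_facts[OF h]
  let ?k = "length s"
  have ex: "length (big s) \<le> excess s" by (rule big_excess)
  have kl: "length (flat s) \<le> 2 * m + 3" by (rule hoppedD(9)[OF h])
  have km: "?k \<le> m" using kl f(1) ex t by simp
  have full: "nb y \<union> nb y' = vs s" if y: "y \<in> Ind v s" "y' \<in> Ind v s" "y \<noteq> y'" "nb y \<inter> nb y' \<noteq> {}" for y y'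
  proof -
    have "m \<le> card (nb y \<union> nb y')" by (rule hoppedD(8)[OF h]) (use y f(4,5) in auto)
    moreover have "nb y \<union> nb y' \<subseteq> vs s" using f(3) y by blast
    ultimately show ?thesis using km f(6,9) by (intro card_seteq) auto
  qed
  obtain y0 where y0: "y0 \<in> singles s" "nb v \<inter> nb y0 \<noteq> {}" using hoppedD(6)[OF h] by blast
  have "v \<noteq> y0" using y0(1) f(4) singles_flat[of s] ringD(8)[OF hoppedD(1)[OF h]] by auto
  show k3: "length (big s) + 1 \<le> length s" using f(7,11) by simp
  have three: "card V \<le> deg a + deg b + deg c" if "a \<in> Ind v s" "b \<in> Ind v s" "c \<in> Ind v s" "a \<noteq> b" "a \<noteq> c" "b \<noteq> c" for a b c
    using that f(4,5) by (intro sigma) auto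
  have nV: "2 * ?k + excess s + 1 \<le> card V" using f(1,2) by simp
  have trip: "\<exists>c\<in>Ind v s. c \<noteq> a \<and> c \<noteq> b" if "3 \<le> card (Ind v s)" for a b
  proof (rule ccontr)
    assume "\<not> ?thesis"
    then have "Ind v s \<subseteq> {a, b}" by blast
    then have "card (Ind v s) \<le> card {a, b}" by (rule card_mono[rotated]) simp
    also have "\<dots> \<le> 2" by (simp add: card_insert_if)
    finally show False using that by simp
  qed
  have two: "{y, y'} = {v, y0}" if c: "\<not> 3 \<le> card (Ind v s)" and y: "y \<in> Ind v s" "y' \<in> Ind v s" "y \<noteq> y'" for y y'
  proof -
    have c2: "card (Ind v s) = 2" using c f(11) by simp
    have "{v, y0} = Ind v s" using y0(1) \<open>v \<noteq> y0\<close> c2 f(10) by (intro card_seteq) auto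
    moreover have "{y, y'} = Ind v s" using y c2 f(10) by (intro card_seteq) auto
    ultimately show ?thesis by simp
  qed
  show "E x y \<or> E x y'" if x: "x \<in> vs s" and y: "y \<in> Ind v s" "y' \<in> Ind v s" "y \<noteq> y'" for x y y'
  proof -
    have "nb y \<inter> nb y' \<noteq> {}"
    proof (cases "3 \<le> card (Ind v s)")
      case True
      then obtain c where c: "c \<in> Ind v s" "c \<noteq> y" "c \<noteq> y'" using trip by blast
      have "card V \<le> deg y + deg y' + deg c" using three[OF y(1,2) c(1) y(3)] c by simp
      then have s: "?k < deg y + deg y'" using nV f(8)[OF c(1)] by simp
      show ?thesis
      proof
        assume e: "nb y \<inter> nb y' = {}"
        have "deg y + deg y' = card (nb y \<union> nb y')" unfolding deg_def using fin_nb e by (subst card_Un_disjoint) auto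
        also have "\<dots> \<le> card (vs s)" using f(3) y f(9) by (intro card_mono) auto
        finally show False using s f(6) by simp
      qed
    next
      case False
      then show ?thesis using two[OF False y] y0(2) by (auto simp: doubleton_eq_iff)
    qed
    then have "nb y \<union> nb y' = vs s" using full y by blast
    then show ?thesis using x sym unfolding nb_def by blast
  qed
  show "length (big s) + 1 \<le> deg y" if y: "y \<in> Ind v s" for y
  proof (cases "3 \<le> card (Ind v s)")
    case True
    then obtain b where b: "b \<in> Ind v s" "b \<noteq> y" using trip by blast
    obtain c where c: "c \<in> Ind v s" "c \<noteq> y" "c \<noteq> b" using trip[OF True] by blast
    have "card V \<le> deg y + deg b + deg c" using three[OF y b(1) c(1)] b c by auto
    then show ?thesis using nV f(8)[OF b(1)] f(8)[OF c(1)] ex by simp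
  next
    case False
    have vI: "v \<in> Ind v s" "y0 \<in> Ind v s" using y0 by auto
    have "card V \<le> deg v + deg y0 + deg z"
    proof (rule sigma)
      show "v \<in> V" "y0 \<in> V" "z \<in> V" "v \<noteq> y0" "v \<noteq> z" "y0 \<noteq> z" "\<not> E v y0" "\<not> E v z" "\<not> E y0 z"
        using f(4)[OF vI(1)] f(4)[OF vI(2)] z y0(1) \<open>v \<noteq> y0\<close> f(5)[OF vI] f(3)[OF vI(1)] f(3)[OF vI(2)] by (auto simp: nb_def)
    qed
    moreover have "?k = length (big s) + 1" using False f(7,11) by simp
    moreover have "deg v \<le> ?k" "deg y0 \<le> ?k" using f(8) vI by auto
    ultimately have "deg v = ?k \<and> deg y0 = ?k" using nV z(2) ex by simp
    moreover have "y = v \<or> y = y0"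
    proof -
      have "{v, y0} = Ind v s" using vI \<open>v \<noteq> y0\<close> False f(10,11) by (intro card_seteq) auto
      then show ?thesis using y by blast
    qed
    ultimately show ?thesis using \<open>?k = length (big s) + 1\<close> by auto
  qed
qed

lemma successively_off: "successively R L ==> r \<notin> set L ==> (\<And>a b. a \<noteq> r ==> b \<noteq> r ==> R a b ==> E a b) ==> walk L"
proof (induction L)
  case (Cons x L)
  then show ?case by (cases L) (auto simp: walk_Cons)
qed simp

lemma close_up:
  assumes h: "hopped v m s" and L: "walk L" "distinct L" "L \<noteq> []" "set L \<subseteq> V" and P: "walk P" "distinct P" "P \<noteq> []" "set P \<subseteq> V" "set P \<inter> set L = {}"
    and e: "E (last L) (hd P)" "E (last P) (hd L)" and l: "length (flat s) < length L + length P"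
  shows False
proof -
  have "closed (L @ P)" unfolding closed_def using L P e by (auto simp: walk_append)
  then have "length (L @ P) \<le> length (flat s)" using hoppedD(2)[OF h] unfolding longest_def by blast
  then show False using l by simp
qed

text \<open>With two long segments |X| = |Ind| + 1, so an alternating path can start and end in X.
  It has 2|X| - 1 vertices and P closes it; excess + 2 vertices on P make the cycle longer than |C|
  = 2|X| + excess.\<close>

lemma finish2:
  assumes h: "hopped v m s" and t: "length (big s) = 2" and z: "z \<in> V - vs s - Ind v s" "deg z \<le> deg v"
    and P: "walk P" "distinct P" "set P \<subseteq> V - vs s - Ind v s" "excess s + 2 \<le> length P"
    and ab: "a \<in> vs s" "b \<in> vs s" "a \<noteq> b" "E b (hd P)" "E (last P) a"
  shows False
proof -
  note f = hopped_facts[OF h]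
  have t2: "2 \<le> length (big s)" using t by simp
  note d = hopped_degrees[OF h t2 z]
  obtain xs where xs: "distinct xs" "set xs = vs s" "hd xs = a" "last xs = b" using list_ends[OF f(9) ab(1-3)] by blast
  obtain js where js: "set js = Ind v s" "distinct js" using finite_distinct_list[OF f(10)] by blast
  have l: "length xs = length js + 1" using distinct_card[OF xs(1)] distinct_card[OF js(2)] xs(2) js(1) f(6,7) t by simp
  note w = weave[OF l]
  have dj: "vs s \<inter> Ind v s = {}" using f(4) by blast
  have dw: "distinct (weave xs js)"
  proof -
    have "mset (weave xs js) = mset (xs @ js)" using w(1) by simp
    from mset_eq_distinct[OF this] show ?thesis using xs js dj by auto
  qed
  have sw: "set (weave xs js) = vs s \<union> Ind v s \<union> {}" using mset_eq_setD[of "weave xs js" "xs @ js"] w(1) xs js by simp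
  have "\<exists>L'. successively E L' \<and> mset L' = mset (weave xs js) \<and> hd L' = hd (weave xs js) \<and> last L' = last (weave xs js)"
  proof (rule alternating_path[where R = E and I = "Ind v s" and F = "{}" and X = "vs s"])
    show "\<And>a b. E a b ==> E b a" by (rule sym)
    show "vs s \<inter> (Ind v s \<union> {}) = {}" using dj by simp
    show "\<And>x y y'. x \<in> vs s ==> y \<in> Ind v s ==> y' \<in> Ind v s ==> y \<noteq> y' ==> E x y \<or> E x y'" by (rule d(2))
    show "3 + card {} \<le> card {x \<in> vs s. E y x}" if "y \<in> Ind v s" for y
    proof -
      have "{x \<in> vs s. E y x} = nb y" using f(3)[OF that] by (auto simp: in_nb)
      then show ?thesis using d(1)[OF that] t by (simp add: deg_def)
    qed
    show "alternates (vs s) (weave xs js)" using w(5) xs js dj by auto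
  qed (use dw sw f(9) in auto)
  then obtain L where L: "walk L" "mset L = mset (weave xs js)" "hd L = a" "last L = b" using w(2,3) xs by (auto simp: walk_def)
  have dL: "distinct L" "set L = vs s \<union> Ind v s" "length L = length xs + length js"
    using mset_eq_distinct[OF L(2)] mset_eq_setD[OF L(2)] mset_eq_length[OF L(2)] mset_eq_length[of "weave xs js" "xs @ js"] dw sw w(1) by simp_all
  have LV: "set L \<subseteq> V" using dL(2) f(4) ringD(5)[OF hoppedD(1)[OF h]] vs_flat[of s] by blast
  show False
    by (rule close_up[OF h L(1) dL(1) _ LV P(1,2)]) (use L dL P ab l f(1) distinct_card[OF xs(1)] xs(2) f(6) in \<open>auto\<close>)
qed

text \<open>With three long segments |X| = |Ind| + 2, so a second connecting path T is inserted
  inside the alternating path, where its first vertex r represents it. The condition on {a, b}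
  allows g and h' to be neighbours in a list of X with ends a and b.\<close>

lemma finish3:
  assumes h: "hopped v m s" and t: "length (big s) = 3" and z: "z \<in> V - vs s - Ind v s" "deg z \<le> deg v"
    and P: "walk P" "distinct P" "set P \<subseteq> V - vs s - Ind v s" "P \<noteq> []"
    and T: "walk T" "distinct T" "set T \<subseteq> V - vs s - Ind v s - set P" "T \<noteq> []" and l: "excess s + 3 \<le> length P + length T"
    and ab: "a \<in> vs s" "b \<in> vs s" "a \<noteq> b" "E b (hd P)" "E (last P) a"
    and gh: "g \<in> vs s" "h' \<in> vs s" "g \<noteq> h'" "E g (hd T)" "E (last T) h'" and ne: "{a, b} \<noteq> {g, h'}"
  shows False
proof -
  note f = hopped_facts[OF h]
  have t2: "2 \<le> length (big s)" using t by simp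
  note d = hopped_degrees[OF h t2 z]
  define r where "r = hd T"
  have r: "r \<in> set T" using T(4) by (simp add: r_def)
  have rn: "r \<notin> vs s" "r \<notin> Ind v s" using r T(3) by auto
  \<comment> \<open>r stands for the whole of T, so its only neighbours are the two vertices at
    which T is attached.\<close>
  define R where "R a b = (if a = r then b \<in> {g, h'} else if b = r then a \<in> {g, h'} else E a b)" for a b
  have symR: "R a b ==> R b a" for a b using sym by (auto simp: R_def split: if_splits)
  obtain xs where xs: "distinct xs" "set xs = vs s" "hd xs = a" "last xs = b" "con xs g h'"
    using list_ends_con[OF f(9) ab(1-3) gh(1-3) ne] by blast
  obtain A B p q where xs2: "xs = (A @ [p]) @ (q # B)" "{p, q} = {g, h'}"
  proof -
    obtain A B where "xs = A @ g # h' # B \<or> xs = A @ h' # g # B" using con_split[OF xs(5)] by blast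
    then show ?thesis using that[of A g h' B] that[of A h' g B] by auto
  qed
  obtain js where js: "set js = Ind v s" "distinct js" using finite_distinct_list[OF f(10)] by blast
  have lx: "length xs = length js + 2" using distinct_card[OF xs(1)] distinct_card[OF js(2)] xs(2) js(1) f(6,7) t by simp
  define j1 where "j1 = take (length A) js"
  define j2 where "j2 = drop (length A) js"
  have j12: "js = j1 @ j2" by (simp add: j1_def j2_def)
  have l1: "length (A @ [p]) = length j1 + 1" and l2: "length (q # B) = length j2 + 1" using lx xs2(1) by (simp_all add: j1_def j2_def)
  note w1 = weave[OF l1] and w2 = weave[OF l2]
  define W where "W = weave (A @ [p]) j1 @ r # weave (q # B) j2"
  have dj: "vs s \<inter> Ind v s = {}" using f(4) by blast
  have mW: "mset W = mset (r # xs @ js)" using w1(1) w2(1) unfolding W_def xs2(1) j12 by simp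
  have dW: "distinct W" using mset_eq_distinct[OF mW] xs(1,2) js dj rn by auto
  have sW: "set W = vs s \<union> Ind v s \<union> {r}" using mset_eq_setD[OF mW] xs(2) js(1) by auto
  have hW: "hd W = a" "last W = b" using w1(2,4) w2(3,4) xs(3,4) xs2(1) by (auto simp: W_def hd_append split: if_splits)
  have pq: "p \<in> vs s" "q \<in> vs s" using xs(2) xs2(1) by auto
  have "\<exists>L'. successively R L' \<and> mset L' = mset W \<and> hd L' = hd W \<and> last L' = last W"
  proof (rule alternating_path[where R = R and I = "Ind v s" and F = "{r}" and X = "vs s"])
    show "\<And>a b. R a b ==> R b a" by (rule symR)
    show "Ind v s \<inter> {r} = {}" using rn by simp
    show "vs s \<inter> (Ind v s \<union> {r}) = {}" using dj rn by simp
    show "R x y \<or> R x y'" if "x \<in> vs s" "y \<in> Ind v s" "y' \<in> Ind v s" "y \<noteq> y'" for x y y'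
    proof -
      have "x \<noteq> r" "y \<noteq> r" "y' \<noteq> r" using that rn by auto
      then show ?thesis using d(2)[OF that] by (simp add: R_def)
    qed
    show "3 + card {r} \<le> card {x \<in> vs s. R y x}" if "y \<in> Ind v s" for y
    proof -
      have "{x \<in> vs s. R y x} = nb y" using f(3)[OF that] rn that by (auto simp: in_nb R_def)
      then show ?thesis using d(1)[OF that] t by (simp add: deg_def)
    qed
    have "set (A @ [p]) \<subseteq> vs s" "set (q # B) \<subseteq> vs s" "set j1 \<inter> vs s = {}" "set j2 \<inter> vs s = {}"
      unfolding xs(2)[symmetric] xs2(1) using dj js(1) unfolding j12 xs(2)[symmetric] xs2(1) by auto
    then have "alternates (vs s) (weave (A @ [p]) j1)" "alternates (vs s) (weave (q # B) j2)" using w1(5) w2(5) by blast+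
    then show "alternates (vs s) W"
      using w1(3) w2(2) pq rn by (auto simp: W_def alternates_append alternates_Cons)
    show "R f z" if "f \<in> {r}" "con W f z" for f z
    proof -
      have "z = p \<or> z = q" using that con_at[of "weave (A @ [p]) j1" r "weave (q # B) j2" z] dW w1(3,4) w2(2) by (auto simp: W_def)
      then show ?thesis using that(1) xs2(2) by (auto simp: R_def)
    qed
  qed (use dW sW f(9) in auto)
  then obtain L where L: "successively R L" "mset L = mset W" "hd L = a" "last L = b" using hW by auto
  have dL: "distinct L" "set L = vs s \<union> Ind v s \<union> {r}" "length L = length xs + length js + 1"
    using mset_eq_distinct[OF L(2)] mset_eq_setD[OF L(2)] mset_eq_length[OF L(2)] mset_eq_length[OF mW] dW sW by simp_all
  then obtain L1 L2 where L12: "L = L1 @ r # L2" by (metis UnI2 insertI1 split_list)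
  have L1: "L1 \<noteq> []" using L(3) L12 ab(1) rn(1) by auto
  have L2: "L2 \<noteq> []" using L(4) L12 ab(2) rn(1) by auto
  have w12: "walk L1" "walk L2"
  proof -
    have "successively R L1" "successively R L2" using L(1) unfolding L12 by (auto simp: successively_append_iff successively_Cons)
    moreover have "r \<notin> set L1" "r \<notin> set L2" using dL(1) L12 by auto
    ultimately show "walk L1" "walk L2" using successively_off[of R _ r] by (auto simp: R_def)
  qed
  have "R (last L1) r" "R r (hd L2)" using L(1) L1 L2 unfolding L12 by (auto simp: successively_append_iff successively_Cons)
  then have e: "last L1 \<in> {g, h'}" "hd L2 \<in> {g, h'}" using gh(1,2) rn by (auto simp: R_def split: if_splits)
  have "set L1 \<inter> set L2 = {}" using dL(1) unfolding L12 by auto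
  then have "last L1 \<noteq> hd L2" using last_in_set[OF L1] hd_in_set[OF L2] by (metis disjoint_iff)
  \<comment> \<open>2-opt may have reversed the order of g and h' around r; T is read in the
    matching direction.\<close>
  then obtain T' where T': "walk T'" "mset T' = mset T" "E (last L1) (hd T')" "E (last T') (hd L2)"
    using that[of T] that[of "rev T"] T(1,4) gh(4,5) e sym by (auto simp: hd_rev last_rev)
  have dT: "distinct T'" "set T' = set T" "length T' = length T"
    using mset_eq_distinct[OF T'(2)] mset_eq_setD[OF T'(2)] mset_eq_length[OF T'(2)] T(2) by simp_all
  have T'ne: "T' \<noteq> []" using dT(2) T(4) by auto
  have "walk (T' @ L2)" using T'(1,4) w12 by (simp add: walk_append)
  then have w: "walk (L1 @ T' @ L2)" using T'(3) T'ne w12 by (simp add: walk_append[of L1])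
  have st: "set L1 \<union> set L2 = vs s \<union> Ind v s" using dL(1,2) rn unfolding L12 by auto
  have "set T' \<inter> (set L1 \<union> set L2) = {}" using T(3) unfolding st dT(2) by blast
  then have dd: "distinct (L1 @ T' @ L2)" using dL(1) dT(1) unfolding L12 by auto
  have "vs s \<subseteq> V" "Ind v s \<subseteq> V" "set T \<subseteq> V" using ringD(5)[OF hoppedD(1)[OF h]] vs_flat[of s] f(4) T(3) by blast+
  moreover have "set (L1 @ T' @ L2) = set L1 \<union> set L2 \<union> set T" using dT(2) by auto
  ultimately have sV: "set (L1 @ T' @ L2) \<subseteq> V" unfolding st by blast
  have dP: "set P \<inter> set (L1 @ T' @ L2) = {}" using st dT(2) T(3) P(3) by auto
  have hl: "hd (L1 @ T' @ L2) = a" "last (L1 @ T' @ L2) = b" using L(3,4) L1 L2 L12 by auto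
  have PV: "set P \<subseteq> V" using P(3) by blast
  have ee: "E (last (L1 @ T' @ L2)) (hd P)" "E (last P) (hd (L1 @ T' @ L2))" unfolding hl by (fact ab)+
  have len: "length (flat s) < length (L1 @ T' @ L2) + length P"
    using dL(3) lx l f(1) dT(3) distinct_card[OF xs(1)] xs(2) f(6) L12 by simp
  show False using close_up[OF h w dd _ sV P(1,2,4) PV dP ee len] L1 by simp
qed

end

lemma big_Nil_excess: "big s = [] ==> excess s = 0"
  by (induction s rule: flat.induct) (auto split: if_splits)

lemma set_big: "(w, t) \<in> set (big s) \<longleftrightarrow> (w, t) \<in> set s \<and> 2 \<le> length t"
  by (auto simp: big_def)

lemma card_Un5: "card (A \<union> B \<union> C \<union> D \<union> F) \<le> card A + card B + card C + card D + card F"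
  using card_Un_le[of "A \<union> B \<union> C \<union> D" F] card_Un_le[of "A \<union> B \<union> C" D] card_Un_le[of "A \<union> B" C] card_Un_le[of A B] by linarith

section \<open>Edges between the long segments\<close>

context tgraph
begin

lemma hopped_big:
  assumes h: "hopped v m s" and t: "(w, t) \<in> set s" "2 \<le> length t"
  shows "set t \<subseteq> V - vs s - Ind v s"
proof
  fix z assume z: "z \<in> set t"
  note r = ringD[OF hoppedD(1)[OF h]]
  have f: "z \<in> set (flat s)" by (rule seg_flat[OF t(1) z])
  have "z \<notin> singles s"
  proof
    assume "z \<in> singles s"
    then obtain w' where "(w', [z]) \<in> set s" by (auto simp: singles_def)
    then have "t = [z]" using seg_inj[OF r(2) t(1) _ z, of w' "[z]"] by simp
    then show False using t(2) by simp
  qed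
  then show "z \<in> V - vs s - Ind v s" using f r(5,8) seg_disj[OF r(2) t(1) z] by auto
qed

lemma hopped_nbrs:
  assumes h: "hopped v m s" and t: "(w, t) \<in> set s" "2 \<le> length t" "x \<in> set t" and e: "E x y"
  shows "y \<in> vs s \<or> y \<in> Oset {v} s \<or> (\<exists>w' t'. (w', t') \<in> set s \<and> 2 \<le> length t' \<and> y \<in> set t')"
proof -
  note r = ringD[OF hoppedD(1)[OF h]]
  have x: "x \<notin> vs s" using hopped_big[OF h t(1,2)] t(3) by blast
  have "y \<notin> Ind v s" using hopped_facts(3)[OF h, of y] x sym[OF e] by (auto simp: nb_def)
  then have y: "y \<noteq> v" "y \<notin> singles s" by auto
  show ?thesis
  proof (cases "y \<in> set (flat s)")
    case True
    then consider "y \<in> vs s" | w' t' where "(w', t') \<in> set s" "y \<in> set t'" using flat_cases[of y s] by blast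
    then show ?thesis
    proof cases
      case 2
      have "t' \<noteq> [y]" using y(2) 2(1) by (auto simp: singles_def)
      then have "2 \<le> length t'" using 2(2) by (cases t'; cases "tl t'") auto
      then show ?thesis using 2 by blast
    qed simp
  next
    case False
    then show ?thesis using EV2[OF e] y(1) by (simp add: Oset_def)
  qed
qed

text \<open>The degree condition for v, \<open>last Ti\<close> and \<open>hd Tj\<close>. The latter
  two see only X, the two segments, the other long segments G, and \<open>Os\<close>, where they
  share no neighbour. In the constant 7, six come from the vertices of \<open>Ti\<close> and
  \<open>Tj\<close> that they cannot see (themselves, each other, and one forbidden end each) and
  one from v in n = |C| + 1 + |Os|.\<close>

lemma final_count:
  assumes h: "hopped v m ((vi, Ti) # Ms @ (vj, Tj) # Ns)" (is "hopped v m ?s") and l: "length Ti \<ge> 2" "length Tj \<ge> 2"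
    and two: "length Ti = 2 \<or> length Tj = 2" and ne: "\<not> E (last Ti) (hd Tj)"
    and G: "G = {y. \<exists>w t. (w, t) \<in> set (Ms @ Ns) \<and> 2 \<le> length t \<and> y \<in> set t}"
    and X: "X = vs ((vi, Ti) # Ms @ (vj, Tj) # Ns)"
  shows "length ((vi, Ti) # Ms @ (vj, Tj) # Ns) + excess ((vi, Ti) # Ms @ (vj, Tj) # Ns) + 7 \<le>
    card (nb (last Ti) \<inter> X) + card (nb (hd Tj) \<inter> X) + 2 * (length Ti + length Tj) + card (nb (last Ti) \<inter> G) + card (nb (hd Tj) \<inter> G)"
proof -
  define e1 where "e1 = last Ti"
  define e2 where "e2 = hd Tj"
  define N where "N x = {y \<in> Oset {v} ?s. E x y}" for x
  note f = hopped_facts[OF h]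
  note p = hopped_walks[OF h]
  note r = ringD[OF hoppedD(1)[OF h]]
  have h2: "hopped v m ((vj, Tj) # Ns @ (vi, Ti) # Ms)" using hopped_rot[of v m "(vi, Ti) # Ms" "(vj, Tj) # Ns"] h by simp
  have O2: "Oset {v} ((vj, Tj) # Ns @ (vi, Ti) # Ms) = Oset {v} ?s" by (auto simp: Oset_def)
  have ein: "e1 \<in> set Ti" "e2 \<in> set Tj" using p(5,6) by (simp_all add: e1_def e2_def)
  have dT: "distinct Ti" "distinct Tj" "set Ti \<inter> set Tj = {}" using p(14) by auto
  have hl: "hd Ti \<noteq> e1" "e2 \<noteq> last Tj" using hd_ne_last[OF dT(1) l(1)] hd_ne_last[OF dT(2) l(2)] by (simp_all add: e1_def e2_def)
  have bigs: "y \<in> set Ti \<or> y \<in> set Tj \<or> y \<in> G" if "(w', t') \<in> set ?s" "2 \<le> length t'" "y \<in> set t'" for y w' t'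
    using that unfolding G by auto
  have s1: "nb e1 \<subseteq> (nb e1 \<inter> X) \<union> (set Ti - {e1}) \<union> (set Tj - {e2, last Tj}) \<union> (nb e1 \<inter> G) \<union> N e1"
  proof
    fix y assume "y \<in> nb e1"
    then have e: "E e1 y" by (simp add: in_nb)
    have "y \<noteq> e1" "y \<noteq> e2" "y \<noteq> last Tj" using e irr ne link_E[OF e, of "Oset {v} ?s"] hopped_ll[OF h l] by (auto simp: e1_def e2_def)
    moreover have "y \<in> X \<or> y \<in> Oset {v} ?s \<or> y \<in> set Ti \<or> y \<in> set Tj \<or> y \<in> G"
      using hopped_nbrs[OF h _ l(1) ein(1) e, of vi] bigs unfolding X by auto
    ultimately show "y \<in> (nb e1 \<inter> X) \<union> (set Ti - {e1}) \<union> (set Tj - {e2, last Tj}) \<union> (nb e1 \<inter> G) \<union> N e1"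
      using e by (auto simp: N_def in_nb)
  qed
  have s2: "nb e2 \<subseteq> (nb e2 \<inter> X) \<union> (set Tj - {e2}) \<union> (set Ti - {e1, hd Ti}) \<union> (nb e2 \<inter> G) \<union> N e2"
  proof
    fix y assume "y \<in> nb e2"
    then have e: "E e2 y" by (simp add: in_nb)
    have "y \<noteq> e2" "y \<noteq> e1" "y \<noteq> hd Ti"
      using e irr ne sym[OF e] link_E[OF sym[OF e], of "Oset {v} ?s"] hopped_ff[OF h l] by (auto simp: e1_def e2_def)
    moreover have "y \<in> X \<or> y \<in> Oset {v} ?s \<or> y \<in> set Ti \<or> y \<in> set Tj \<or> y \<in> G"
      using hopped_nbrs[OF h _ l(2) ein(2) e, of vj] bigs unfolding X by auto
    ultimately show "y \<in> (nb e2 \<inter> X) \<union> (set Tj - {e2}) \<union> (set Ti - {e1, hd Ti}) \<union> (nb e2 \<inter> G) \<union> N e2"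
      using e by (auto simp: N_def in_nb)
  qed
  have c: "card (set Ti - {e1}) = length Ti - 1" "card (set Tj - {e2}) = length Tj - 1"
    "card (set Tj - {e2, last Tj}) = length Tj - 2" "card (set Ti - {e1, hd Ti}) = length Ti - 2"
    using ein hl p(5,6) distinct_card[OF dT(1)] distinct_card[OF dT(2)] by (simp_all add: card_Diff_subset)
  have fX: "finite X" using f(9) by (simp add: X)
  have fN: "finite (N x)" for x using f(12) by (simp add: N_def)
  have "deg e1 \<le> card ((nb e1 \<inter> X) \<union> (set Ti - {e1}) \<union> (set Tj - {e2, last Tj}) \<union> (nb e1 \<inter> G) \<union> N e1)"
    unfolding deg_def using fX fN fin_nb by (intro card_mono[OF _ s1]) auto
  then have d1: "deg e1 \<le> card (nb e1 \<inter> X) + (length Ti - 1) + (length Tj - 2) + card (nb e1 \<inter> G) + card (N e1)"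
    unfolding c[symmetric] using card_Un5 le_trans by blast
  have "deg e2 \<le> card ((nb e2 \<inter> X) \<union> (set Tj - {e2}) \<union> (set Ti - {e1, hd Ti}) \<union> (nb e2 \<inter> G) \<union> N e2)"
    unfolding deg_def using fX fN fin_nb by (intro card_mono[OF _ s2]) auto
  then have d2: "deg e2 \<le> card (nb e2 \<inter> X) + (length Tj - 1) + (length Ti - 2) + card (nb e2 \<inter> G) + card (N e2)"
    unfolding c[symmetric] using card_Un5 le_trans by blast
  have "N e1 \<inter> N e2 = {}"
  proof -
    have False if y: "y \<in> N e1" "y \<in> N e2" for y
    proof -
      have "walk (hd Tj # [y] @ [last Ti])" using y Ec[of y] by (auto simp: walk_Cons N_def e1_def e2_def)
      moreover have "set [y] \<subseteq> Oset {v} ((vj, Tj) # Ns @ (vi, Ti) # Ms)" using y unfolding O2 by (simp add: N_def)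
      ultimately show False using hopped_fl[OF h2 l(2,1), of "[y]"] two by auto
    qed
    then show ?thesis by blast
  qed
  then have "card (N e1) + card (N e2) = card (N e1 \<union> N e2)" using fN by (subst card_Un_disjoint) auto
  also have "\<dots> \<le> card (Oset {v} ?s)" using f(12) by (intro card_mono) (auto simp: N_def)
  finally have cN: "card (N e1) + card (N e2) \<le> card (Oset {v} ?s)" .
  have eV: "e1 \<in> V - vs ?s - Ind v ?s" "e2 \<in> V - vs ?s - Ind v ?s"
    using hopped_big[OF h, of vi Ti] hopped_big[OF h, of vj Tj] l ein by auto
  have "card V \<le> deg v + deg e1 + deg e2"
  proof (rule sigma)
    show "v \<in> V" "e1 \<in> V" "e2 \<in> V" "v \<noteq> e1" "v \<noteq> e2" using eV f(4)[of v] by auto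
    show "e1 \<noteq> e2" using ein dT by auto
    show "\<not> E v e1" "\<not> E v e2" using f(3)[of v] eV by (auto simp: nb_def)
    show "\<not> E e1 e2" using ne by (simp add: e1_def e2_def)
  qed
  moreover have "deg v \<le> length ?s" using f(8)[of v] by simp
  ultimately have "2 * length ?s + excess ?s + 1 + card (Oset {v} ?s) \<le> length ?s + deg e1 + deg e2" using f(1,2) by simp
  moreover obtain i j where ij: "length Ti = i + 2" "length Tj = j + 2" using l by (metis le_add_diff_inverse2)
  ultimately have "length ?s + excess ?s + 7 \<le> card (nb e1 \<inter> X) + card (nb e2 \<inter> X) + 2 * (i + 2 + (j + 2)) + card (nb e1 \<inter> G) + card (nb e2 \<inter> G)"
    using d1 d2 cN unfolding ij distrib_left by linarith
  then show ?thesis unfolding e1_def e2_def ij .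
qed

text \<open>Sizes (2,2,2). \<open>finish3\<close>, with the third segment inserted, excludes the
  edge from \<open>last Ti\<close> to \<open>hd Tj\<close>. It also forces a neighbour in X of one
  of these vertices and one of the other to be equal or to be the two attachments around the third
  segment. The count then leaves only the configuration in the conclusion.\<close>

lemma final_third:
  assumes h: "hopped v m ((vi, Ti) # Ms @ (vj, Tj) # Ns)" (is "hopped v m ?s") and l: "length Ti = 2" "length Tj = 2"
    and e: "E (hd Ti) (last Tj)" and z: "z \<in> V - vs ((vi, Ti) # Ms @ (vj, Tj) # Ns) - Ind v ((vi, Ti) # Ms @ (vj, Tj) # Ns)" "deg z \<le> deg v"
    and b: "big Ms @ big Ns = [(vl, [r1, r2])]" and g: "E vl r1" "E r2 hh" "vl \<in> vs ((vi, Ti) # Ms @ (vj, Tj) # Ns)" "hh \<in> vs ((vi, Ti) # Ms @ (vj, Tj) # Ns)" "vl \<noteq> hh"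
    and ne: "{vi, nx Ms vj} \<noteq> {vl, hh}" "\<not> E (last Ti) r2" "\<not> E (hd Tj) r1"
  shows "E (last Ti) r1 \<and> nx Ms vj \<in> {vl, hh} \<and> vj \<in> {vl, hh} \<and> length ((vi, Ti) # Ms @ (vj, Tj) # Ns) = 4"
proof -
  note f = hopped_facts[OF h]
  note p = hopped_walks[OF h]
  note r = ringD[OF hoppedD(1)[OF h]]
  obtain p1 p2 where Ti: "Ti = [p1, p2]" using len2_ex[OF l(1)] by blast
  obtain q1 q2 where Tj: "Tj = [q1, q2]" using len2_ex[OF l(2)] by blast
  have "length (big Ms @ big Ns) = 1" using b by simp
  then have t3: "length (big ?s) = 3" using l by simp
  have "(vl, [r1, r2]) \<in> set (big Ms @ big Ns)" using b by simp
  then have ml: "(vl, [r1, r2]) \<in> set Ms \<union> set Ns" by (auto simp: set_big)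
  then have lm: "(vl, [r1, r2]) \<in> set ?s" by auto
  have ex3: "excess ?s \<le> 3" by (rule hopped_excess(1)[OF h])
  have TV: "set Ti \<subseteq> V - vs ?s - Ind v ?s" "set Tj \<subseteq> V - vs ?s - Ind v ?s" "set [r1, r2] \<subseteq> V - vs ?s - Ind v ?s"
    using hopped_big[OF h, of vi Ti] hopped_big[OF h, of vj Tj] hopped_big[OF h lm] l by auto
  have rT: "{r1, r2} \<inter> (set Ti \<union> set Tj) = {}"
  proof -
    have "set [r1, r2] \<subseteq> set (flat Ms) \<union> set (flat Ns)" using ml seg_flat by fastforce
    then show ?thesis using p(14) by auto
  qed
  have wT: "walk [r1, r2]" "distinct [r1, r2]"
  proof -
    obtain A B where "?s = A @ (vl, [r1, r2]) # B" using lm by (meson split_list)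
    then have "flat ?s = flat A @ vl # [r1, r2] @ flat B" by simp
    then show "walk [r1, r2]" "distinct [r1, r2]" using r(2,3) by (simp_all add: walk_append[of "flat A"] walk_Cons)
  qed
  have nv: "nx Ms vj \<in> vs ?s" "vi \<in> vs ?s" "vj \<in> vs ?s" using nx_vs[of Ms vj] by auto
  have e12: "E p1 q2" using e Ti Tj by simp
  have pw: "E p1 p2" "E q1 q2" "distinct [p1, p2, q1, q2]" using p(14,17,18) Ti Tj by (auto simp: walk_Cons)
  have fin3: False if P: "walk P" "mset P = mset (Ti @ Tj)" and ab: "a \<in> vs ?s" "b \<in> vs ?s" "a \<noteq> b" "E b (hd P)" "E (last P) a" "{a, b} \<noteq> {vl, hh}" for P a b
  proof -
    have d: "distinct P" "set P = set Ti \<union> set Tj" "length P = 4"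
      using mset_eq_distinct[OF P(2)] mset_eq_setD[OF P(2)] mset_eq_length[OF P(2)] pw(3) Ti Tj by auto
    show False
    proof (rule finish3[OF h t3 z P(1) d(1) _ _ wT _ _ _ ab(1-5) g(3,4,5)])
      show "set P \<subseteq> V - vs ?s - Ind v ?s" using d(2) TV by blast
      show "set [r1, r2] \<subseteq> V - vs ?s - Ind v ?s - set P" using TV(3) rT d(2) by auto
    qed (use d ex3 g ab in auto)
  qed
  have nE: "\<not> E p2 q1"
  proof
    assume "E p2 q1"
    then have "walk [p1, q2, q1, p2]" using e12 pw(2) sym by (auto simp: walk_Cons)
    moreover have "E vi p1" "E p2 (nx Ms vj)" using p(7,9) Ti by auto
    ultimately show False using fin3[of "[p1, q2, q1, p2]" "nx Ms vj" vi] nv p(11) ne(1) Ti Tj by (auto simp: insert_commute)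
  qed
  define A where "A = nb p2 \<inter> vs ?s"
  define B where "B = nb q1 \<inter> vs ?s"
  define G where "G = {y. \<exists>w t. (w, t) \<in> set (Ms @ Ns) \<and> 2 \<le> length t \<and> y \<in> set t}"
  have "(w, t) = (vl, [r1, r2])" if "(w, t) \<in> set (Ms @ Ns)" "2 \<le> length t" for w t
  proof -
    have "(w, t) \<in> set (big Ms @ big Ns)" using that by (auto simp: set_big)
    then show ?thesis using b by simp
  qed
  then have G: "G \<subseteq> {r1, r2}" unfolding G_def by fastforce
  have "length ?s + excess ?s + 7 \<le> card A + card B + 2 * (length Ti + length Tj) + card (nb p2 \<inter> G) + card (nb q1 \<inter> G)"
    using final_count[OF h _ _ _ _ G_def refl] l nE Ti Tj unfolding A_def B_def by simp
  moreover have "excess ?s = 3"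
  proof -
    have "excess Ms + excess Ns \<ge> 1" using big_excess[of Ms] big_excess[of Ns] arg_cong[OF b, of length] by simp
    then show ?thesis using ex3 l by simp
  qed
  ultimately have cnt: "length ?s + 2 \<le> card A + card B + card (nb p2 \<inter> G) + card (nb q1 \<inter> G)" using l by simp
  have g1: "nb p2 \<inter> G \<subseteq> {r1}" "nb q1 \<inter> G \<subseteq> {r2}" using G ne Ti Tj by (auto simp: in_nb)
  then have cg: "card (nb p2 \<inter> G) \<le> 1" "card (nb q1 \<inter> G) \<le> 1" using card_mono[of "{r1}"] card_mono[of "{r2}"] by auto
  have k4: "length ?s \<ge> 4" using hopped_degrees(3)[OF h _ z] t3 by simp
  have inA: "nx Ms vj \<in> A" "vj \<in> B" using p(8,9) sym nv Ti Tj by (auto simp: A_def B_def in_nb)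
  have no: "a = b \<or> {a, b} = {vl, hh}" if "b \<in> A" "a \<in> B" for a b
  proof (rule ccontr)
    assume n: "\<not> ?thesis"
    have "walk [p2, p1, q2, q1]" using e12 pw sym by (auto simp: walk_Cons)
    then show False using fin3[of "[p2, p1, q2, q1]" a b] n that sym Ti Tj by (auto simp: A_def B_def in_nb)
  qed
  \<comment> \<open>A neighbour a outside {vl, hh} would force both neighbour sets into {a}, too
    small for the count when |X| >= 4.\<close>
  have AB: "A \<subseteq> {vl, hh} \<and> B \<subseteq> {vl, hh}"
  proof (rule ccontr)
    assume n: "\<not> ?thesis"
    then obtain a where a: "a \<notin> {vl, hh}" "a \<in> A \<or> a \<in> B" by blast
    have "A \<subseteq> {a} \<and> B \<subseteq> {a}"
    proof (cases "a \<in> A")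
      case True
      then have "B \<subseteq> {a}" using no a(1) by blast
      moreover then have "A \<subseteq> {a}" using no a(1) inA(2) by blast
      ultimately show ?thesis by blast
    next
      case False
      then have "a \<in> B" using a by blast
      then have "A \<subseteq> {a}" using no a(1) by blast
      moreover then have "B \<subseteq> {a}" using no a(1) inA(1) by blast
      ultimately show ?thesis by blast
    qed
    then have "card A \<le> 1" "card B \<le> 1" using card_mono[of "{a}" A] card_mono[of "{a}" B] by auto
    then show False using cnt cg k4 by simp
  qed
  then have c2: "card A \<le> 2" "card B \<le> 2" using card_mono[of "{vl, hh}" A] card_mono[of "{vl, hh}" B] g(5) by auto
  have "E p2 r1"
  proof (rule ccontr)
    assume "\<not> E p2 r1"
    then have "nb p2 \<inter> G = {}" using g1(1) by (auto simp: in_nb)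
    then show False using cnt cg c2 k4 by simp
  qed
  moreover have "length ?s = 4" using cnt cg c2 k4 by simp
  ultimately show ?thesis using AB inA Ti by auto
qed

text \<open>By \<open>hopped_fl\<close> the link is an edge and there is a low vertex, so the
  closing lemmas apply. Without a third long segment \<open>finish2\<close> and the count suffice.
  With three, \<open>final_third\<close> leaves one configuration, and only if the third segment
  lies between \<open>Ti\<close> and \<open>Tj\<close>.\<close>

lemma final_fl:
  assumes h: "hopped v m ((vi, Ti) # Ms @ (vj, Tj) # Ns)" (is "hopped v m ?s") and l: "length Ti \<ge> 2" "length Tj \<ge> 2"
    and two: "length Ti = 2 \<or> length Tj = 2"
  shows "\<not> link (Oset {v} ((vi, Ti) # Ms @ (vj, Tj) # Ns)) (hd Ti) (last Tj)"
proof
  assume "link (Oset {v} ?s) (hd Ti) (last Tj)"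
  then obtain os where os: "distinct os" "set os \<subseteq> Oset {v} ?s" "walk (hd Ti # os @ [last Tj])" by (auto simp: link_def)
  note fl = hopped_fl[OF h l two os]
  have e: "E (hd Ti) (last Tj)" using fl os(3) by (simp add: walk_Cons)
  note f = hopped_facts[OF h]
  note p = hopped_walks[OF h]
  have TV: "set Ti \<subseteq> V - vs ?s - Ind v ?s" "set Tj \<subseteq> V - vs ?s - Ind v ?s"
    using hopped_big[OF h, of vi Ti] hopped_big[OF h, of vj Tj] l by auto
  obtain z where z: "z \<in> V - vs ?s - Ind v ?s" "deg z \<le> deg v" using fl TV by blast
  have bs: "length (big ?s) = length (big Ms @ big Ns) + 2" using l by simp
  have ex3: "excess ?s \<le> 3" by (rule hopped_excess(1)[OF h])
  have exs: "excess ?s = (length Ti - 1) + (length Tj - 1) + excess Ms + excess Ns" by simp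
  have be: "length (big Ms @ big Ns) \<le> excess Ms + excess Ns" using big_excess[of Ms] big_excess[of Ns] by simp
  have k: "length (big ?s) + 1 \<le> length ?s" using hopped_degrees(3)[OF h _ z] bs by simp
  have nv: "nx Ms vj \<in> vs ?s" "vi \<in> vs ?s" "vj \<in> vs ?s" "nx Ns vi \<in> vs ?s" using nx_vs[of Ms vj] nx_vs[of Ns vi] by auto
  have dT: "distinct (Ti @ Tj)" using p(14) by auto
  have "length (big Ms @ big Ns) = 0 \<or> length (big Ms @ big Ns) = 1" using be exs ex3 l by linarith
  then show False
  proof
    assume "length (big Ms @ big Ns) = 0"
    then have b0: "big Ms = []" "big Ns = []" "length (big ?s) = 2" using bs by auto
    have x0: "excess ?s + 2 = length Ti + length Tj" using exs big_Nil_excess[OF b0(1)] big_Nil_excess[OF b0(2)] l by simp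
    have fin2: False if P: "walk P" "mset P = mset (Ti @ Tj)" and ab: "a \<in> vs ?s" "b \<in> vs ?s" "a \<noteq> b" "E b (hd P)" "E (last P) a" for P a b
    proof -
      have d: "distinct P" "set P = set Ti \<union> set Tj" "length P = length Ti + length Tj"
        using mset_eq_distinct[OF P(2)] mset_eq_setD[OF P(2)] mset_eq_length[OF P(2)] dT by auto
      have "set P \<subseteq> V - vs ?s - Ind v ?s" using TV d(2) by blast
      moreover have "excess ?s + 2 \<le> length P" using x0 d(3) by linarith
      ultimately show False using finish2[OF h b0(3) z P(1) d(1) _ _ ab] by blast
    qed
    have nE: "\<not> E (last Ti) (hd Tj)"
    proof
      assume e2: "E (last Ti) (hd Tj)"
      from two show False
      proof
        assume "length Ti = 2"
        then obtain p1 p2 where T: "Ti = [p1, p2]" using len2_ex by blast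
        have "walk (rev Tj @ [p2])" using p(6,18) e2 sym T by (simp add: walk_append last_rev)
        then have "walk (p1 # rev Tj @ [p2])" using e T p(6) by (simp add: walk_Cons[of p1] hd_append hd_rev)
        then show False using fin2[of "p1 # rev Tj @ [p2]" "nx Ms vj" vi] nv p(7,9,11) T by auto
      next
        assume "length Tj = 2"
        then obtain q1 q2 where T: "Tj = [q1, q2]" using len2_ex by blast
        have "walk (rev Ti @ [q2])" using p(5,17) e T by (simp add: walk_append last_rev)
        then have "walk (q1 # rev Ti @ [q2])" using e2 sym T p(5) by (simp add: walk_Cons[of q1] hd_append hd_rev)
        then show False using fin2[of "q1 # rev Ti @ [q2]" "nx Ns vi" vj] nv p(8,10,12) T by auto
      qed
    qed
    define A where "A = nb (last Ti) \<inter> vs ?s"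
    define B where "B = nb (hd Tj) \<inter> vs ?s"
    have inA: "nx Ms vj \<in> A" "vj \<in> B" using p(8,9) sym nv by (auto simp: A_def B_def in_nb)
    have no: "a = b" if "b \<in> A" "a \<in> B" for a b
    proof (rule ccontr)
      assume n: "a \<noteq> b"
      have "walk (rev Ti @ rev Tj)" using p(5,6,17,18) e by (simp add: walk_append last_rev hd_rev)
      then show False using fin2[of "rev Ti @ rev Tj" a b] n that sym p(5,6) by (auto simp: A_def B_def in_nb hd_rev last_rev)
    qed
    have "A \<subseteq> {vj}" "B \<subseteq> {nx Ms vj}" using no inA by blast+
    then have "card A \<le> 1" "card B \<le> 1" using card_mono[of "{vj}" A] card_mono[of "{nx Ms vj}" B] by auto
    moreover define G where "G = {y. \<exists>w t. (w, t) \<in> set (Ms @ Ns) \<and> 2 \<le> length t \<and> y \<in> set t}"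
    moreover have "G = {}" using b0(1,2) set_big[of _ _ Ms] set_big[of _ _ Ns] unfolding G_def by auto
    then have "card (nb (last Ti) \<inter> G) = 0" "card (nb (hd Tj) \<inter> G) = 0" by simp_all
    moreover have "length ?s + excess ?s + 7 \<le> card A + card B + 2 * (length Ti + length Tj) + card (nb (last Ti) \<inter> G) + card (nb (hd Tj) \<inter> G)"
      unfolding A_def B_def by (rule final_count[OF h l two nE G_def refl])
    moreover have "3 \<le> length ?s" using k b0(3) by linarith
    ultimately show False using x0 ex3 unfolding distrib_left by linarith
  next
    assume l1: "length (big Ms @ big Ns) = 1"
    then obtain vl Tl where b: "big Ms @ big Ns = [(vl, Tl)]" by (cases "big Ms @ big Ns") auto
    have l2: "length Ti = 2" "length Tj = 2" "excess Ms + excess Ns = 1" using exs ex3 be l1 l by linarith+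
    have "(vl, Tl) \<in> set (big Ms @ big Ns)" using b by simp
    then have ml: "(vl, Tl) \<in> set Ms \<or> (vl, Tl) \<in> set Ns" "2 \<le> length Tl" by (auto simp: set_big)
    then have "length Tl \<le> 2" using excess_mem[of vl Tl Ms] excess_mem[of vl Tl Ns] l2(3) by linarith
    then obtain r1 r2 where Tl: "Tl = [r1, r2]" using len2_ex[of Tl] ml(2) by auto
    note b' = b[unfolded Tl]
    from ml(1) show False
    proof
      assume "(vl, Tl) \<in> set Ms"
      then obtain M1 M2 where M: "Ms = M1 @ (vl, [r1, r2]) # M2" using Tl by (meson split_list)
      have ha: "hopped v m ((vi, Ti) # M1 @ (vl, [r1, r2]) # (M2 @ (vj, Tj) # Ns))" using h M by simp
      have hb: "hopped v m ((vl, [r1, r2]) # M2 @ (vj, Tj) # (Ns @ (vi, Ti) # M1))"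
        using hopped_rot[of v m "(vi, Ti) # M1" "(vl, [r1, r2]) # M2 @ (vj, Tj) # Ns"] h M by simp
      note pa = hopped_walks[OF ha] and pb = hopped_walks[OF hb]
      define hh where "hh = nx M2 vj"
      have g: "E vl r1" "E r2 hh" using pb(7,9) by (simp_all add: hh_def)
      have hv: "hh \<in> insert vj (vs M2)" unfolding hh_def by (rule nx_vs)
      then have gv: "vl \<in> vs ?s" "hh \<in> vs ?s" using M by auto
      have dd: "distinct (vi # Ti @ flat M1 @ vl # [r1, r2] @ flat M2 @ vj # Tj @ flat Ns)" using p(14) M by simp
      have ne: "vl \<noteq> hh" "vi \<noteq> hh" "vi \<noteq> vl" using hv dd vs_flat[of M2] by auto
      have n1: "\<not> E (last Ti) r2" using hopped_ll[OF ha] l2 link_E by auto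
      have n2: "\<not> E (hd Tj) r1" using hopped_ff[OF hb] l2 link_E sym by fastforce
      have x: "E (last Ti) r1 \<and> nx Ms vj \<in> {vl, hh} \<and> vj \<in> {vl, hh} \<and> length ?s = 4"
        by (rule final_third[OF h l2(1,2) e z b' g gv ne(1) _ n1 n2]) (use ne in auto)
      have "M2 = []"
      proof (rule ccontr)
        assume "M2 \<noteq> []"
        then have "hh \<in> vs M2" by (simp add: hh_def nx_mem)
        then have "hh \<noteq> vj" using dd vs_flat[of M2] by auto
        then show False using x dd by auto
      qed
      have "M1 = []"
      proof (rule ccontr)
        assume "M1 \<noteq> []"
        then have "nx Ms vj \<in> vs M1" using nx_mem[of M1 vj] M by (cases M1) auto
        then show False using x hv \<open>M2 = []\<close> dd vs_flat[of M1] by auto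
      qed
      have N: "Ns \<noteq> []" using x M \<open>M1 = []\<close> \<open>M2 = []\<close> by auto
      have t3: "length (big ?s) = 3" using bs l1 by simp
      have "nx Ns vi \<in> vs Ns" using nx_mem[OF N] .
      then have nn: "nx Ns vi \<noteq> vi" "nx Ns vi \<noteq> vj" using dd vs_flat[of Ns] by auto
      obtain p1 p2 where Ti: "Ti = [p1, p2]" using len2_ex[OF l2(1)] by blast
      have hh: "hh = vj" using \<open>M2 = []\<close> by (simp add: hh_def)
      \<comment> \<open>The roles are exchanged: the third segment and \<open>Ti\<close> form the
        closing path, and \<open>Tj\<close> is inserted.\<close>
      show False
      proof (rule finish3[OF h t3 z, of "[r2, r1, p2, p1]" Tj vi vj vj "nx Ns vi"])
        show "walk [r2, r1, p2, p1]" using x Ti p(17) pb(17) sym by (auto simp: walk_Cons)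
        show "distinct [r2, r1, p2, p1]" "distinct Tj" using dd Ti by auto
        have rV: "set [r1, r2] \<subseteq> V - vs ?s - Ind v ?s" using hopped_big[OF h, of vl "[r1, r2]"] M by auto
        then show "set [r2, r1, p2, p1] \<subseteq> V - vs ?s - Ind v ?s" using TV(1) Ti by auto
        show "set Tj \<subseteq> V - vs ?s - Ind v ?s - set [r2, r1, p2, p1]" using TV(2) dd Ti by auto
        show "E vj (hd [r2, r1, p2, p1])" using g(2) hh sym by simp
        show "E (last [r2, r1, p2, p1]) vi" using p(7) Ti sym by simp
        show "{vi, vj} \<noteq> {vj, nx Ns vi}" using nn p(14) by (auto simp: doubleton_eq_iff)
      qed (use p nv l2 ex3 nn in auto)
    next
      assume "(vl, Tl) \<in> set Ns"
      then obtain N1 N2 where N: "Ns = N1 @ (vl, [r1, r2]) # N2" using Tl by (meson split_list)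
      have ha: "hopped v m ((vi, Ti) # (Ms @ (vj, Tj) # N1) @ (vl, [r1, r2]) # N2)" using h N by simp
      have hb: "hopped v m ((vj, Tj) # N1 @ (vl, [r1, r2]) # (N2 @ (vi, Ti) # Ms))"
        using hopped_rot[of v m "(vi, Ti) # Ms" "(vj, Tj) # N1 @ (vl, [r1, r2]) # N2"] h N by simp
      note pa = hopped_walks[OF ha] and pb = hopped_walks[OF hb]
      define hh where "hh = nx N2 vi"
      have g: "E vl r1" "E r2 hh" using pa(8,10) by (simp_all add: hh_def)
      have hv: "hh \<in> insert vi (vs N2)" unfolding hh_def by (rule nx_vs)
      then have gv: "vl \<in> vs ?s" "hh \<in> vs ?s" using N by auto
      have dd: "distinct (vi # Ti @ flat Ms @ vj # Tj @ flat N1 @ vl # [r1, r2] @ flat N2)" using p(14) N by simp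
      have ne: "vl \<noteq> hh" "vl \<noteq> vj" "hh \<noteq> vj" "vl \<noteq> vi" using hv dd vs_flat[of N2] by auto
      have "nx Ms vj \<in> insert vj (vs Ms)" by (rule nx_vs)
      then have nM: "nx Ms vj \<noteq> vl" using dd vs_flat[of Ms] by auto
      have n1: "\<not> E (last Ti) r2" using hopped_ll[OF ha] l2 link_E by auto
      have n2: "\<not> E (hd Tj) r1" using hopped_ff[OF hb] l2 link_E by auto
      have "E (last Ti) r1 \<and> nx Ms vj \<in> {vl, hh} \<and> vj \<in> {vl, hh} \<and> length ?s = 4"
        by (rule final_third[OF h l2(1,2) e z b' g gv ne(1) _ n1 n2]) (use ne nM in auto)
      then show False using ne by auto
    qed
  qed
qed

text \<open>Sizes (2,3). All links between the two long segments end in q2. Deleting X and q2 would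
  therefore leave too many components unless q1 and q3 are linked; this link yields a path through
  all five vertices, to which \<open>finish2\<close> applies.\<close>

lemma final_mid:
  assumes h: "hopped v m ((vi, [p1, p2]) # Ms @ (vj, [q1, q2, q3]) # Ns)" (is "hopped v m ?s") and a: "a \<in> {p1, p2}"
  shows "\<not> link (Oset {v} ((vi, [p1, p2]) # Ms @ (vj, [q1, q2, q3]) # Ns)) a q2"
proof
  assume "link (Oset {v} ?s) a q2"
  then obtain os0 where os0: "distinct os0" "set os0 \<subseteq> Oset {v} ?s" "walk (a # os0 @ [q2])" by (auto simp: link_def)
  have a': "a = p1 \<or> a = p2" using a by blast
  note mid = hopped_mid[OF h os0(1,2) a' os0(3)]
  have e: "E a q2" using mid os0(3) by (simp add: walk_Cons)
  note f = hopped_facts[OF h]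
  note p = hopped_walks[OF h]
  note r = ringD[OF hoppedD(1)[OF h]]
  let ?O = "Oset {v} ?s"
  let ?X = "vs ?s"
  have h2: "hopped v m ((vj, [q1, q2, q3]) # Ns @ (vi, [p1, p2]) # Ms)"
    using hopped_rot[of v m "(vi, [p1, p2]) # Ms" "(vj, [q1, q2, q3]) # Ns"] h by simp
  have O2: "Oset {v} ((vj, [q1, q2, q3]) # Ns @ (vi, [p1, p2]) # Ms) = ?O" by (auto simp: Oset_def)
  have l: "2 \<le> length [p1, p2]" "2 \<le> length [q1, q2, q3]" by simp_all
  have TV: "{p1, p2} \<subseteq> V - ?X - Ind v ?s" "{q1, q2, q3} \<subseteq> V - ?X - Ind v ?s"
    using hopped_big[OF h, of vi "[p1, p2]"] hopped_big[OF h, of vj "[q1, q2, q3]"] by auto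
  obtain z where z: "z \<in> V - ?X - Ind v ?s" "deg z \<le> deg v" using mid TV(2) by blast
  have "length (big Ms) + length (big Ns) = 0"
    using hopped_excess(1)[OF h] big_excess[of Ms] big_excess[of Ns] by simp
  then have b0: "big Ms = []" "big Ns = []" by auto
  have t2: "length (big ?s) = 2" using b0 by simp
  have x0: "excess ?s = 3" using big_Nil_excess[OF b0(1)] big_Nil_excess[OF b0(2)] by simp
  have cross: "b = q2" if b: "b' \<in> {p1, p2}" "b \<in> {q1, q2, q3}" "link ?O b' b" for b b'
  proof -
    have "\<not> link ?O p1 q1" "\<not> link ?O p2 q3" "\<not> link ?O p1 q3"
      using hopped_ff[OF h l] hopped_ll[OF h l] final_fl[OF h l] by auto
    moreover have "\<not> link ?O p2 q1" using final_fl[OF h2 l(2,1)] link_sym[of ?O p2 q1] unfolding O2 by auto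
    ultimately show ?thesis using b by auto
  qed
  have dd: "distinct (vi # [p1, p2] @ flat Ms @ vj # [q1, q2, q3] @ flat Ns)" by (rule p(14))
  define s0 where s0: "s0 = ?s"
  note h0 = h[folded s0] and r0 = r[folded s0] and cross0 = cross[folded s0] and TV0 = TV[folded s0] and f0 = f(6)[folded s0]
  have vj: "(vj, [q1, q2, q3]) \<in> set s0" by (simp add: s0)
  have big0: "(w, t) = (vi, [p1, p2]) \<or> (w, t) = (vj, [q1, q2, q3])" if "(w, t) \<in> set s0" "2 \<le> length t" for w t
  proof -
    have "(w, t) \<in> set (big ?s)" using that by (simp only: set_big s0 simp_thms)
    then show ?thesis using b0 by auto
  qed
  have q13: "q1 \<noteq> q3" "q1 \<noteq> q2" "q3 \<noteq> q2" using dd by auto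
  have "link (Oset {v} s0) q1 q3"
  proof (rule ccontr)
    assume n: "\<not> ?thesis"
    define cl where "cl x = (x = q1, x = q3, {(w, t) \<in> set s0. x \<in> set t} - {(vj, [q1, q2, q3])})" for x
    define S where "S = insert q3 (hds s0)"
    have tne: "\<forall>(w, t)\<in>set s0. t \<noteq> []" using r0(9) by blast
    have hin: "hd t \<in> set t" if "(w, t) \<in> set s0" for w t using r0(9)[OF that] by simp
    have cl1: "cl x = (False, False, {(w, t)})" if x: "(w, t) \<in> set s0" "(w, t) \<noteq> (vj, [q1, q2, q3])" "x \<in> set t" for x w t
    proof -
      have u: "(w', t') = (w, t)" if "(w', t') \<in> set s0" "x \<in> set t'" for w' t'
        using seg_inj[OF r0(2) that(1) x(1) that(2) x(3)] .
      then have "x \<notin> {q1, q2, q3}" using x(2) u[OF vj] by auto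
      moreover have "{(w, t) \<in> set s0. x \<in> set t} - {(vj, [q1, q2, q3])} = {(w, t)}" using x u by blast
      ultimately show ?thesis unfolding cl_def prod.inject by blast
    qed
    have clq: "cl q1 = (True, False, {})" "cl q3 = (False, True, {})"
    proof -
      have "{(w, t) \<in> set s0. x \<in> set t} - {(vj, [q1, q2, q3])} = {}" if "x \<in> {q1, q3}" for x
      proof -
        have "(w, t) = (vj, [q1, q2, q3])" if "(w, t) \<in> set s0" "x \<in> set t" for w t
          using seg_inj[OF r0(2) that(1) vj that(2)] \<open>x \<in> {q1, q3}\<close> by auto
        then show ?thesis by blast
      qed
      then show "cl q1 = (True, False, {})" "cl q3 = (False, True, {})" using q13 by (auto simp: cl_def)
    qed
    have inS: "x = q1 \<or> x = q3 \<or> (\<exists>w t. (w, t) \<in> set s0 \<and> (w, t) \<noteq> (vj, [q1, q2, q3]) \<and> x = hd t \<and> x \<in> set t)" if xS: "x \<in> S" for x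
    proof -
      consider "x = q3" | w t where "(w, t) \<in> set s0" "x = hd t" using xS unfolding S_def hds_def by auto
      then show ?thesis
      proof cases
        case 2
        then show ?thesis using hin[OF 2(1)] by (cases "(w, t) = (vj, [q1, q2, q3])") auto
      qed simp
    qed
    have q3h: "q3 \<notin> hds s0"
    proof
      assume "q3 \<in> hds s0"
      then obtain w t where wt: "(w, t) \<in> set s0" "q3 = hd t" unfolding hds_def by auto
      have "q3 \<in> set t" using hin[OF wt(1)] wt(2) by metis
      then have "(w, t) = (vj, [q1, q2, q3])" by (intro seg_inj[OF r0(2) wt(1) vj]) auto
      then have "hd t = q1" by auto
      then show False using wt(2) q13(1) by simp
    qed
    have "card (hds s0) = length s0" by (rule hds_card[OF tne r0(2)])
    then have cS: "card S = length s0 + 1" using q3h unfolding S_def by (simp add: hds_def)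
    have "card S + 1 \<le> card (insert q2 (vs s0))"
    proof (rule tough_cl[where cl = cl and Cs = "set (flat s0)" and H = "{v}" and h = v and Os = "Oset {v} s0"])
      show "insert q2 (vs s0) \<subseteq> set (flat s0)" using vs_flat[of s0] seg_flat[OF vj, of q2] by auto
      show "set (flat s0) \<subseteq> V" "{v} \<subseteq> V - set (flat s0)" "(Oset {v} s0) = V - set (flat s0) - {v}" using r0(5,6,8) by (auto simp: Oset_def)
      show "\<And>z y. z \<in> {v} ==> E z y ==> y \<in> {v} \<union> insert q2 (vs s0)" using r0(11) by blast
      show "S \<subseteq> set (flat s0) - insert q2 (vs s0)"
      proof
        fix x assume "x \<in> S"
        then consider "x \<in> {q1, q3}" | w t where "(w, t) \<in> set s0" "(w, t) \<noteq> (vj, [q1, q2, q3])" "x \<in> set t" using inS by blast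
        then show "x \<in> set (flat s0) - insert q2 (vs s0)"
        proof cases
          case 1 then show ?thesis using TV0(2) q13 seg_flat[OF vj, of x] by auto
        next
          case 2
          have "x \<noteq> q2"
          proof
            assume "x = q2"
            then have "(w, t) = (vj, [q1, q2, q3])" using 2(3) by (intro seg_inj[OF r0(2) 2(1) vj]) auto
            then show False using 2(2) by simp
          qed
          then show ?thesis using seg_flat[OF 2(1,3)] seg_disj[OF r0(2) 2(1,3)] by blast
        qed
      qed
      show "inj_on cl S"
      proof (rule inj_onI)
        fix x y assume xy: "x \<in> S" "y \<in> S" "cl x = cl y"
        have *: "x = q1 \<or> x = q3 \<or> (\<exists>w t. x = hd t \<and> cl x = (False, False, {(w, t)}))" if "x \<in> S" for x
          using inS[OF that] cl1 by blast
        show "x = y" using *[OF xy(1)] *[OF xy(2)] xy(3) clq by auto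
      qed
      show "cl x = cl y" if x: "x \<in> set (flat s0) - insert q2 (vs s0)" and y: "y \<in> set (flat s0) - insert q2 (vs s0)" and lk: "link (Oset {v} s0) x y" for x y
      proof -
        have *: "x \<in> {q1, q3} \<or> (\<exists>w t. (w, t) \<in> set s0 \<and> (w, t) \<noteq> (vj, [q1, q2, q3]) \<and> x \<in> set t)" if "x \<in> set (flat s0) - insert q2 (vs s0)" for x
        proof -
          obtain w t where "(w, t) \<in> set s0" "x \<in> set t" using flat_cases[of x s0] \<open>x \<in> set (flat s0) - insert q2 (vs s0)\<close> by blast
          then show ?thesis using that by (cases "(w, t) = (vj, [q1, q2, q3])") auto
        qed
        have same: "(w, t) = (w', t')" if wt: "(w, t) \<in> set s0" "b \<in> set t" "(w', t') \<in> set s0" "b' \<in> set t'" "link (Oset {v} s0) b b'" "b \<noteq> q2" "b' \<noteq> q2" for w t w' t' b b'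
        proof (rule ccontr)
          assume ne: "(w, t) \<noteq> (w', t')"
          have big: "2 \<le> length t" if "(w, t) \<in> set s0" "b \<in> set t" "link (Oset {v} s0) b b'" "b' \<notin> (vs s0)" for w t b b'
          proof (rule ccontr)
            assume "\<not> 2 \<le> length t"
            then have "t = [b]" using that(2) by (cases t; cases "tl t") auto
            then have "nb b \<subseteq> (vs s0)" using hoppedD(5)[OF h0, of b] that(1) by (auto simp: singles_def)
            moreover obtain os where os: "set os \<subseteq> (Oset {v} s0)" "walk (b # os @ [b'])" using \<open>link (Oset {v} s0) b b'\<close> by (auto simp: link_def)
            ultimately have "hd (os @ [b']) \<in> (vs s0)" by (auto simp: walk_Cons in_nb)
            then show False using os(1) that(4) vs_flat[of s0] by (cases os) (auto simp: Oset_def)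
          qed
          have t2: "2 \<le> length t" using big[OF wt(1,2,5)] seg_disj[OF r0(2) wt(3,4)] by blast
          have t2': "2 \<le> length t'" using big[OF wt(3,4) link_sym[OF wt(5)]] seg_disj[OF r0(2) wt(1,2)] by blast
          have "(w, t) = (vi, [p1, p2]) \<and> (w', t') = (vj, [q1, q2, q3]) \<or> (w', t') = (vi, [p1, p2]) \<and> (w, t) = (vj, [q1, q2, q3])"
            using big0[OF wt(1) t2] big0[OF wt(3) t2'] ne by blast
          then show False using cross0[of b b'] cross0[of b' b] link_sym[OF wt(5)] wt by auto
        qed
        show ?thesis
        proof (cases "x \<in> {q1, q3}")
          case True
          then have xq: "(vj, [q1, q2, q3]) \<in> set s0" "x \<in> set [q1, q2, q3]" "x \<noteq> q2" using x vj by auto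
          have "y \<in> {q1, q3}" using *[OF y] same[OF xq(1,2) _ _ lk xq(3)] y by blast
          then show ?thesis using True n lk link_sym[OF lk] by auto
        next
          case False
          then obtain w t where wt: "(w, t) \<in> set s0" "(w, t) \<noteq> (vj, [q1, q2, q3])" "x \<in> set t" using *[OF x] by blast
          obtain w' t' where wt': "(w', t') \<in> set s0" "y \<in> set t'" using flat_cases[of y s0] y by blast
          have "(w, t) = (w', t')" by (rule same[OF wt(1,3) wt' lk]) (use x y in auto)
          then show ?thesis using cl1[OF wt] cl1[of w t y] wt wt' by simp
        qed
      qed
    qed auto
    moreover have "card (insert q2 (vs s0)) \<le> card (vs s0) + 1" by (simp add: card_insert_if vs_def)
    ultimately show False using cS f0 by simp
  qed
  then have "link ?O q1 q3" unfolding s0 .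
  then obtain os where os: "distinct os" "set os \<subseteq> ?O" "walk (q1 # os @ [q3])" by (auto simp: link_def)
  have ed: "E p1 p2" "E q1 q2" "E q2 q3" using p(17,18) by (auto simp: walk_Cons)
  have nv: "nx Ms vj \<in> ?X" "vi \<in> ?X" "vj \<in> ?X" "nx Ns vi \<in> ?X" using nx_vs[of Ms vj] nx_vs[of Ns vi] by auto
  have OV: "?O \<subseteq> V - ?X - Ind v ?s" using vs_flat[of ?s] singles_flat[of ?s] by (auto simp: Oset_def)
  have qO: "{p1, p2, q1, q2, q3} \<inter> ?O = {}" by (auto simp: Oset_def)
  have fin2: False if P: "walk P" "mset P = mset ([p1, p2, q1, q2, q3] @ os)" and ab: "a \<in> ?X" "b \<in> ?X" "a \<noteq> b" "E b (hd P)" "E (last P) a" for P a b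
  proof -
    have "distinct ([p1, p2, q1, q2, q3] @ os)" using dd os qO by auto
    then have d: "distinct P" "set P = {p1, p2, q1, q2, q3} \<union> set os" "length P = 5 + length os"
    proof -
      assume "distinct ([p1, p2, q1, q2, q3] @ os)"
      then show "distinct P" using mset_eq_distinct[OF P(2)] by blast
      have "set P = set ([p1, p2, q1, q2, q3] @ os)" by (rule mset_eq_setD[OF P(2)])
      then show "set P = {p1, p2, q1, q2, q3} \<union> set os" by simp
      have "length P = length ([p1, p2, q1, q2, q3] @ os)" by (rule mset_eq_length[OF P(2)])
      then show "length P = 5 + length os" by simp
    qed
    have "set os \<subseteq> V - ?X - Ind v ?s" using os(2) OV by (rule subset_trans)
    moreover have "set P = {p1, p2} \<union> {q1, q2, q3} \<union> set os" unfolding d(2) by auto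
    ultimately have "set P \<subseteq> V - ?X - Ind v ?s" using TV by (simp only: Un_least)
    moreover have "excess ?s + 2 \<le> length P" using x0 d(3) by linarith
    ultimately show False using finish2[OF h t2 z P(1) d(1) _ _ ab] by blast
  qed
  from a' show False
  proof
    assume a1: "a = p1"
    have "walk [p2, p1, q2, q1]" using e a1 ed sym by (auto simp: walk_Cons)
    then have "walk ([p2, p1, q2, q1] @ os @ [q3])" by (intro walk_link[OF os(3)]) auto
    then show False by (rule fin2[where a = "nx Ns vi" and b = "nx Ms vj"]) (use p(9,10,13) nv sym in auto)
  next
    assume a2: "a = p2"
    have os': "walk (q3 # rev os @ [q1])" using walk_rev[of "q1 # os @ [q3]"] os(3) by simp
    have "walk [p1, p2, q2, q3]" using e a2 ed by (auto simp: walk_Cons)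
    then have "walk ([p1, p2, q2, q3] @ rev os @ [q1])" by (intro walk_link[OF os']) auto
    then show False by (rule fin2[where a = vj and b = vi]) (use p(7,8) nv sym dd in auto)
  qed
qed

text \<open>Toughness links two segments, and both are long because a one-vertex segment has all its
  neighbours in X. The bound on the excess leaves sizes (2,2) and (2,3) for the pair, and every kind
  of link is excluded.\<close>

theorem hopped_False:
  assumes h: "hopped v m s"
  shows False
proof -
  note r = ringD[OF hoppedD(1)[OF h]]
  have nb2: "2 \<le> length t" if t: "(w, t) \<in> set s" "b \<in> set t" "link (Oset {v} s) b b'" "b' \<notin> vs s" for w t b b'
  proof (rule ccontr)
    assume "\<not> 2 \<le> length t"
    then have "t = [b]" using t(2) by (cases t; cases "tl t") auto
    then have "nb b \<subseteq> vs s" using hoppedD(5)[OF h, of b] t(1) by (auto simp: singles_def)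
    moreover obtain os where os: "set os \<subseteq> Oset {v} s" "walk (b # os @ [b'])" using t(3) by (auto simp: link_def)
    ultimately have "hd (os @ [b']) \<in> vs s" by (auto simp: walk_Cons in_nb)
    then show False using os(1) t(4) vs_flat[of s] by (cases os) (auto simp: Oset_def)
  qed
  have pair: "\<exists>Ms Ns. hopped v m ((a, t) # Ms @ (b, u) # Ns) \<and> Oset {v} ((a, t) # Ms @ (b, u) # Ns) = Oset {v} s"
    if ab: "(a, t) \<in> set s" "(b, u) \<in> set s" "(a, t) \<noteq> (b, u)" for a t b u
  proof -
    obtain A B where s: "s = A @ (a, t) # B" using ab(1) by (meson split_list)
    have l: "hopped v m (((a, t) # B) @ A)" using hopped_rot[of v m A "(a, t) # B"] h s by simp
    have "(b, u) \<in> set (B @ A)" using ab(2,3) s by auto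
    then obtain Ms Ns where BA: "B @ A = Ms @ (b, u) # Ns" by (meson split_list)
    have "set (flat (B @ A)) = set (flat (Ms @ (b, u) # Ns))" using BA by simp
    then have "Oset {v} ((a, t) # Ms @ (b, u) # Ns) = Oset {v} s" using s by (auto simp: Oset_def)
    then show ?thesis using l BA by auto
  qed
  have no: False if ab: "(a, t) \<in> set s" "(b, u) \<in> set s" "(a, t) \<noteq> (b, u)" "length t = 2" "length u = 2 \<or> length u = 3"
    and lk: "x \<in> set t" "y \<in> set u" "link (Oset {v} s) x y" for a t b u x y
  proof -
    obtain Ms Ns where g: "hopped v m ((a, t) # Ms @ (b, u) # Ns)" and O: "Oset {v} ((a, t) # Ms @ (b, u) # Ns) = Oset {v} s"
      using pair[OF ab(1-3)] by blast
    have g2: "hopped v m ((b, u) # Ns @ (a, t) # Ms)" using hopped_rot[of v m "(a, t) # Ms" "(b, u) # Ns"] g by simp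
    have O2: "Oset {v} ((b, u) # Ns @ (a, t) # Ms) = Oset {v} s" unfolding O[symmetric] by (auto simp: Oset_def)
    have l: "2 \<le> length t" "2 \<le> length u" using ab(4,5) by auto
    have n: "\<not> link (Oset {v} s) (hd t) (hd u)" "\<not> link (Oset {v} s) (last t) (last u)" "\<not> link (Oset {v} s) (hd t) (last u)"
      "\<not> link (Oset {v} s) (last t) (hd u)"
      using hopped_ff[OF g l] hopped_ll[OF g l] final_fl[OF g l] final_fl[OF g2 l(2,1)] ab(4) link_sym[of "Oset {v} s" "last t" "hd u"] unfolding O O2 by auto
    obtain p1 p2 where t: "t = [p1, p2]" using len2_ex[OF ab(4)] by blast
    from ab(5) show False
    proof
      assume "length u = 2"
      then obtain q1 q2 where "u = [q1, q2]" using len2_ex by blast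
      then show False using n lk t by auto
    next
      assume "length u = 3"
      then obtain q1 q2 q3 where u: "u = [q1, q2, q3]" by (auto simp: length_Suc_conv numeral_3_eq_3)
      have "\<not> link (Oset {v} s) x q2" using final_mid[of v m a p1 p2 Ms b q1 q2 q3 Ns x] g lk(1) t u O by auto
      then show False using n lk t u by auto
    qed
  qed
  obtain a t b u x y where l: "(a, t) \<in> set s" "(b, u) \<in> set s" "(a, t) \<noteq> (b, u)" "x \<in> set t" "y \<in> set u" "link (Oset {v} s) x y"
    using tough_link[OF hoppedD(1)[OF h]] by blast
  have l2: "2 \<le> length t" "2 \<le> length u"
    using nb2[OF l(1,4,6)] nb2[OF l(2,5) link_sym[OF l(6)]] seg_disj[OF r(2) l(1,4)] seg_disj[OF r(2) l(2,5)] by auto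
  obtain Ms Ns where g: "hopped v m ((a, t) # Ms @ (b, u) # Ns)" using pair[OF l(1-3)] by blast
  have "(length t - 1) + (length u - 1) \<le> 3" using hopped_excess(1)[OF g] by simp
  then consider "length t = 2" "length u = 2 \<or> length u = 3" | "length u = 2" "length t = 2 \<or> length t = 3" using l2 by linarith
  then show False
  proof cases
    case 1
    then show False using no[OF l(1-3) 1 l(4-6)] by blast
  next
    case 2
    then show False using no[OF l(2,1) l(3)[symmetric] 2 l(5,4) link_sym[OF l(6)]] by blast
  qed
qed

theorem circumference_bound:
  assumes C: "longest C" "length C \<ge> 3" and V: "set C \<noteq> V"
    and nc: "\<And>x y. x \<in> V ==> y \<in> V ==> x \<noteq> y ==> \<not> E x y ==> nb x \<inter> nb y \<noteq> {} ==> m \<le> card (nb x \<union> nb y)"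
  shows "2 * m + 4 \<le> length C"
proof (rule ccontr)
  assume n: "\<not> ?thesis"
  have CV: "set C \<subseteq> V" using C by (auto simp: longest_def closed_def)
  then obtain v0 where v0: "v0 \<in> V - set C" using V by blast
  \<comment> \<open>The maximum is taken over the vertices missed by any longest cycle, since
    detours lead from one longest cycle to another.\<close>
  define S where "S = {w. \<exists>D. longest D \<and> w \<in> V - set D}"
  have S: "S \<subseteq> V" "v0 \<in> S" using C v0 by (auto simp: S_def)
  define d where "d = Max (deg ` S)"
  have fS: "finite (deg ` S)" using fin S finite_subset by blast
  then have "d \<in> deg ` S" unfolding d_def using S(2) by (intro Max_in) auto
  then obtain v where v: "v \<in> S" "deg v = d" by auto
  have mx: "deg w \<le> deg v" if "longest D" "w \<in> V - set D" for D w
    unfolding v(2) d_def using that fS by (intro Max_ge) (auto simp: S_def)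
  obtain D where D: "longest D" "v \<in> V - set D" using v(1) by (auto simp: S_def)
  have "length D = length C" using D(1) C(1) unfolding longest_def by (meson le_antisym)
  then have "3 \<le> length D" "length D \<le> 2 * m + 3" using C(2) n by auto
  have "\<exists>s. hopped v m s"
    by (rule hopped_ex[OF D(1) _ D(2)]) (use mx nc \<open>3 \<le> length D\<close> \<open>length D \<le> 2 * m + 3\<close> in blast)+
  then obtain s where "hopped v m s" by blast
  then show False by (rule hopped_False)
qed

section \<open>Existence of a longest cycle\<close>

lemma two_le_deg:
  assumes x: "x \<in> V"
  shows "2 \<le> deg x"
proof (rule ccontr)
  assume "\<not> ?thesis"
  then have c: "card (nb x) \<le> 1" by (simp add: deg_def)
  have "\<not> V \<subseteq> {x}" using n3 card_mono[of "{x}" V] by auto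
  then obtain y0 where y0: "y0 \<in> V" "y0 \<noteq> x" by blast
  obtain y where y: "y \<in> V" "y \<noteq> x" "nb x \<subseteq> {y}"
  proof (cases "nb x = {}")
    case True
    then show ?thesis using that[of y0] y0 by blast
  next
    case False
    then obtain y where y: "y \<in> nb x" by blast
    have "\<forall>a\<in>nb x. \<forall>b\<in>nb x. a = b" using c card_le_Suc0_iff_eq[OF fin_nb] by simp
    then have "nb x \<subseteq> {y}" using y by blast
    moreover have "y \<in> V" "y \<noteq> x" using y nb_V[of x] irr[of x] by (auto simp: in_nb)
    ultimately show ?thesis using that by blast
  qed
  have "\<not> V \<subseteq> {x, y}" using n3 card_mono[of "{x, y}" V] y(2) by auto
  then obtain z where z: "z \<in> V" "z \<noteq> x" "z \<noteq> y" by blast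
  have "card {x, z} \<le> card {y}"
  proof (rule tough[of "{y}" "{x, z}" "\<lambda>a. if a = x then {x} else V - {x, y}"])
    show "b \<in> (if p = x then {x} else V - {x, y})" if q: "p \<in> {x, z}" "a \<in> (if p = x then {x} else V - {x, y})" "E a b" "b \<notin> {y}" for p a b
    proof (cases "p = x")
      case True
      then show ?thesis using q y(3) by (auto simp: nb_def)
    next
      case False
      then have "b \<noteq> x" using q(2) y(3) sym[OF q(3)] by (auto simp: nb_def)
      then show ?thesis using False q(4) EV2[OF q(3)] by simp
    qed
  qed (use x y z in \<open>auto split: if_splits\<close>)
  then show False using z by simp
qed

lemma closed_le_card: "closed C ==> length C \<le> card V"
  using card_mono[OF fin, of "set C"] distinct_card[of C] by (simp add: closed_def)

text \<open>The first vertex of a longest path has all its neighbours on the path. As its degree is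
  at least two, one of them is not the second vertex and closes a cycle of length three or
  more.\<close>

lemma ex_closed: "\<exists>C. closed C \<and> 3 \<le> length C"
proof -
  define Ps where "Ps n \<longleftrightarrow> (\<exists>P. walk P \<and> distinct P \<and> set P \<subseteq> V \<and> length P = n)" for n
  have V: "V \<noteq> {}" using n3 by auto
  then obtain x0 where x0: "x0 \<in> V" by blast
  have "Ps 1" unfolding Ps_def by (rule exI[of _ "[x0]"]) (use x0 in simp)
  moreover have "n \<le> card V" if n: "Ps n" for n
  proof -
    obtain P where P: "distinct P" "set P \<subseteq> V" "length P = n" using n by (auto simp: Ps_def)
    then show ?thesis using card_mono[OF fin P(2)] distinct_card[OF P(1)] by simp
  qed
  ultimately obtain N where N: "Ps N" "\<And>n. Ps n ==> n \<le> N" "1 \<le> N"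
    using Nat.ex_has_greatest_nat[of Ps 1 "card V"] by blast
  obtain P where P: "walk P" "distinct P" "set P \<subseteq> V" "length P = N" using N(1) by (auto simp: Ps_def)
  obtain x L where xL: "P = x # L" using P(4) N(3) by (cases P) auto
  have x: "x \<in> V" using P(3) xL by simp
  have sub: "nb x \<subseteq> set L"
  proof
    fix y assume "y \<in> nb x"
    then have e: "E x y" by (simp add: in_nb)
    show "y \<in> set L"
    proof (rule ccontr)
      assume "y \<notin> set L"
      then have "Ps (Suc N)" unfolding Ps_def
        by (intro exI[of _ "y # P"]) (use P xL e sym[OF e] irr EV2[OF e] in \<open>auto simp: walk_Cons\<close>)
      then show False using N(2) by fastforce
    qed
  qed
  have "\<not> nb x \<subseteq> {hd L}" using two_le_deg[OF x] card_mono[of "{hd L}" "nb x"] by (auto simp: deg_def)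
  then obtain y where "y \<in> nb x" and yL: "y \<noteq> hd L" by blast
  then have y: "E x y" "y \<noteq> hd L" by (simp_all add: in_nb)
  then have "y \<in> set L" using sub by (auto simp: in_nb)
  then obtain A B where AB: "L = A @ y # B" by (meson split_list)
  have A: "A \<noteq> []" using y(2) AB by auto
  have "walk (x # A @ [y])" using P(1) A unfolding xL AB by (auto simp: walk_Cons walk_append)
  then have "closed (x # A @ [y])" unfolding closed_def using P(2,3) xL AB sym[OF y(1)] by auto
  moreover have "3 \<le> length (x # A @ [y])" using A by (cases A) auto
  ultimately show ?thesis by blast
qed

lemma ex_longest: "\<exists>C. longest C \<and> 3 \<le> length C"
proof -
  obtain C0 where C0: "closed C0" "3 \<le> length C0" using ex_closed by blast
  obtain C where C: "closed C" "\<And>D. closed D ==> length D \<le> length C" "length C0 \<le> length C"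
    using ex_has_greatest_nat[of closed C0 length "Suc (card V)"] C0(1) closed_le_card by (metis less_Suc_eq_le)
  then show ?thesis using C0(2) unfolding longest_def by (intro exI[of _ C]) auto
qed

end

section \<open>Transfer to loop-free symmetric digraphs\<close>

lemma pcas_zip: "pcas x (zip (x # xs) (xs @ [y])) y \<and> pawalk_verts x (zip (x # xs) (xs @ [y])) = x # xs @ [y]"
  by (induction xs arbitrary: x) auto

lemma set_zip_succ: "successively R (x # xs @ [y]) ==> (a, b) \<in> set (zip (x # xs) (xs @ [y])) ==> R a b"
  by (induction xs arbitrary: x) auto

context pair_graph
begin

abbreviation adj :: "'a => 'a => bool" where
  "adj x y \<equiv> (x, y) \<in> parcs G"

lemma sgraph_adj: "sgraph (pverts G) adj"
proof
  show "finite (pverts G)" by (rule pair_finite_verts)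
  show "adj y x" if "adj x y" for x y
    using pair_sym_arcs that unfolding symmetric_def by (auto dest: symD)
  show "\<not> adj x x" for x using pair_no_loops[of "(x, x)"] by auto
  show "x \<in> pverts G" if "adj x y" for x y using in_arcsD1 that .
qed

lemma degree_adj: "degree G x = card {y. adj x y}"
proof -
  have "out_arcs (with_proj G) x = Pair x ` {y. adj x y}" by (auto simp: out_arcs_def)
  then show ?thesis unfolding degree_def out_degree_def by (simp add: card_image inj_on_def)
qed

text \<open>What is reachable from x after deleting \<open>W\<close> stays inside
  \<open>K x\<close>, so the members of \<open>S\<close> lie in different strong components and
  \<open>scc_of\<close> is injective on \<open>S\<close>.\<close>

lemma tough_adj:
  assumes t: "one_tough G" and W: "W \<subseteq> pverts G" "W \<noteq> {}" and S: "S \<subseteq> pverts G - W" and K: "\<And>x. x \<in> S ==> x \<in> K x"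
    and cl: "\<And>x a b. x \<in> S ==> a \<in> K x ==> adj a b ==> b \<notin> W ==> b \<in> K x"
    and dj: "\<And>x y. x \<in> S ==> y \<in> S ==> x \<noteq> y ==> y \<notin> K x"
  shows "card S \<le> card W"
proof -
  let ?D = "with_proj G \<restriction> (pverts G - W)"
  interpret D: fin_digraph ?D
  proof
    show "finite (verts ?D)" using pair_finite_verts by simp
    show "finite (arcs ?D)" using pair_finite_arcs by simp
  qed auto
  have dom: "b \<in> K x" if x: "x \<in> S" and r: "x \<rightarrow>\<^sup>*\<^bsub>?D\<^esub> b" for x b
    using r unfolding reachable_def
  proof (induction rule: rtrancl_on_induct)
    case base
    then show ?case using K x by blast
  next
    case (step y z)
    have "adj y z" using step(2) by (auto simp: arcs_ends_def arc_to_ends_def)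
    then show ?case using cl[OF x step(5)] step(4) by simp
  qed
  have inj: "inj_on (pre_digraph.scc_of ?D) S"
  proof (rule inj_onI)
    fix x y assume xy: "x \<in> S" "y \<in> S" "D.scc_of x = D.scc_of y"
    have "y \<in> D.scc_of y" using D.in_scc_of_self xy(2) S by auto
    then have "x \<rightarrow>\<^sup>*\<^bsub>?D\<^esub> y" using xy(3) D.scc_of_def by auto
    then show "x = y" using dom[OF xy(1)] dj xy by blast
  qed
  have "D.scc_of ` S \<subseteq> D.sccs_verts" using D.scc_of_in_sccs_verts S by auto
  then have "card S \<le> card D.sccs_verts" using card_inj_on_le[OF inj _ D.finite_sccs_verts] by blast
  also have "\<dots> = card D.sccs" by (rule D.card_sccs_verts)
  also have "\<dots> \<le> card W" using t W unfolding one_tough_def by blast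
  finally show ?thesis .
qed

text \<open>The triple itself shows that the independence number is at least 3, so that
  \<open>sigma3\<close> is the minimum over such triples.\<close>

lemma sigma_adj:
  assumes s: "card (pverts G) \<le> sigma3 G" and abc: "a \<in> pverts G" "b \<in> pverts G" "c \<in> pverts G" "a \<noteq> b" "a \<noteq> c" "b \<noteq> c"
    "\<not> adj a b" "\<not> adj a c" "\<not> adj b c"
  shows "card (pverts G) \<le> degree G a + degree G b + degree G c"
proof -
  interpret sgraph "pverts G" adj by (rule sgraph_adj)
  have ind: "independent_set G {a, b, c}" using abc sym irr unfolding independent_set_def by auto
  have c3: "card {a, b, c} = 3" using abc by simp
  have "finite {card S |S. independent_set G S}"
  proof (rule finite_subset)
    show "{card S |S. independent_set G S} \<subseteq> {..card (pverts G)}"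
      using pair_finite_verts by (auto simp: independent_set_def intro: card_mono)
  qed simp
  then have "3 \<le> independence_number G" unfolding independence_number_def using ind c3 by (intro Max_ge) force+
  then have e: "sigma3 G = Min {degree G v1 + degree G v2 + degree G v3 |v1 v2 v3. card {v1, v2, v3} = 3 \<and> independent_set G {v1, v2, v3}}"
    by (simp add: sigma3_def)
  have "{degree G v1 + degree G v2 + degree G v3 |v1 v2 v3. card {v1, v2, v3} = 3 \<and> independent_set G {v1, v2, v3}}
      \<subseteq> (\<lambda>(x, y, z). degree G x + degree G y + degree G z) ` (pverts G \<times> pverts G \<times> pverts G)"
    by (force simp: independent_set_def)
  then have "finite {degree G v1 + degree G v2 + degree G v3 |v1 v2 v3. card {v1, v2, v3} = 3 \<and> independent_set G {v1, v2, v3}}"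
    using finite_subset pair_finite_verts by (meson finite_SigmaI finite_imageI)
  then have "sigma3 G \<le> degree G a + degree G b + degree G c" unfolding e using ind c3 by (intro Min_le) blast+
  then show ?thesis using s by simp
qed

lemma distance_two:
  assumes "x \<noteq> y" "\<not> adj x y" "adj x z" "adj z y"
  shows "distance G x y = 2"
proof (rule antisym)
  have V: "x \<in> pverts G" "z \<in> pverts G" "y \<in> pverts G" using assms(3,4) in_arcsD1 in_arcsD2 by blast+
  have "awalk x [(x, z), (z, y)] y" using assms V by (simp add: awalk_def)
  from min_cost_le_walk_cost[OF this, of "\<lambda>_. 1"] show "distance G x y \<le> 2" unfolding distance_def by simp
  have "2 \<le> ereal (awalk_cost (\<lambda>_. 1) p)" if p: "awalk x p y" for p
  proof -
    have "length p \<ge> 2"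
    proof (rule ccontr)
      assume "\<not> ?thesis"
      then consider "p = []" | e where "p = [e]" by (cases p; cases "tl p") auto
      then show False
      proof cases
        case 1
        then show False using p assms(1) by (simp add: awalk_def)
      next
        case 2
        then have "e = (x, y)" "e \<in> parcs G" using p by (auto simp: awalk_def prod_eq_iff)
        then show False using assms(2) by simp
      qed
    qed
    moreover have "awalk_cost (\<lambda>_. 1) p = real (length p)" by (induction p) auto
    ultimately show ?thesis by simp
  qed
  then show "2 \<le> distance G x y" unfolding distance_def \<mu>_def by (intro INF_greatest) auto
qed

text \<open>The non-adjacent pair rules out completeness, and the common neighbour puts it at
  distance two, so it takes part in the minimum.\<close>

lemma NC2_le:
  assumes "x \<noteq> y" "\<not> adj x y" "adj x z" "adj z y"
  shows "NC2 G \<le> card ({w. adj x w} \<union> {w. adj y w})"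
proof -
  have V: "x \<in> pverts G" "y \<in> pverts G" using assms(3,4) in_arcsD1 in_arcsD2 by blast+
  have "\<not> complete G" unfolding complete_def complete_digraph_def using assms(1,2) V by auto
  then have e: "NC2 G = Min {card (neighbourhood G u \<union> neighbourhood G v) |u v. u \<in> pverts G \<and> v \<in> pverts G \<and> distance G u v = 2}"
    by (simp add: NC2_def)
  have nbh: "neighbourhood G u = {w. adj u w}" for u by (simp add: neighbourhood_def)
  have "{card (neighbourhood G u \<union> neighbourhood G v) |u v. u \<in> pverts G \<and> v \<in> pverts G \<and> distance G u v = 2}
      \<subseteq> (\<lambda>(u, v). card (neighbourhood G u \<union> neighbourhood G v)) ` (pverts G \<times> pverts G)" by force
  then have "finite {card (neighbourhood G u \<union> neighbourhood G v) |u v. u \<in> pverts G \<and> v \<in> pverts G \<and> distance G u v = 2}"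
    using finite_subset pair_finite_verts by (meson finite_SigmaI finite_imageI)
  then have "NC2 G \<le> card (neighbourhood G x \<union> neighbourhood G y)" unfolding e
    using V distance_two[OF assms] by (intro Min_le) blast+
  then show ?thesis by (simp add: nbh)
qed

lemma circumference_ge:
  assumes C: "C \<noteq> []" "distinct C" "successively adj C" "adj (last C) (hd C)" "set C \<subseteq> pverts G" and l3: "3 \<le> length C"
  shows "length C \<le> circumference G"
proof -
  obtain x xs where x: "C = x # xs" using C(1) by (cases C) auto
  define p where "p = zip (x # xs) (xs @ [x])"
  have l: "length p = length C" by (simp add: p_def x)
  have w: "successively adj (x # xs @ [x])"
    using C(3,4) unfolding x by (cases xs rule: rev_cases) (auto simp: successively_Cons successively_append_iff hd_append split: if_splits)
  have "set p \<subseteq> parcs G" using set_zip_succ[OF w] unfolding p_def by auto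
  then have "awalk x p x" using C(5) x pcas_zip[of x xs x] by (simp add: awalk_def p_def)
  moreover have "distinct (tl (pawalk_verts x p))" using pcas_zip[of x xs x] C(2) x by (simp add: p_def)
  moreover have "p \<noteq> []" by (simp add: p_def)
  ultimately have "cycle p" unfolding cycle_def by auto
  \<comment> \<open>A cycle repeats no vertex, so the lengths are bounded by the number of vertices
    and the maximum is meaningful.\<close>
  moreover have "finite {length p |p. cycle p \<and> 3 \<le> length p}"
  proof (rule finite_subset)
    show "{length p |p. cycle p \<and> 3 \<le> length p} \<subseteq> {..card (pverts G)}"
    proof
      fix k assume "k \<in> {length p |p. cycle p \<and> 3 \<le> length p}"
      then obtain q u where q: "k = length q" "awalk u q u" "distinct (tl (pawalk_verts u q))" unfolding cycle_def by auto
      have "length (pawalk_verts u q) = Suc (length q)" by (induction q arbitrary: u) auto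
      then have "length (tl (pawalk_verts u q)) = length q" by simp
      moreover have "set (pawalk_verts u q) \<subseteq> pverts G" using q(2) by (auto elim: awalkE)
      then have "set (tl (pawalk_verts u q)) \<subseteq> pverts G" by (cases "pawalk_verts u q") auto
      then have "card (set (tl (pawalk_verts u q))) \<le> card (pverts G)" using pair_finite_verts card_mono by blast
      ultimately show "k \<in> {..card (pverts G)}" using distinct_card[OF q(3)] q(1) by simp
    qed
  qed simp
  moreover have "length C \<in> {length p |p. cycle p \<and> 3 \<le> length p}"
    using \<open>cycle p\<close> l l3 by (intro CollectI exI[of _ p]) simp
  ultimately show ?thesis unfolding circumference_def by (intro Max_ge) auto
qed

end

theorem mainTheorem1:
  fixes G :: "'a pair_pre_digraph" and n :: nat
  assumes "pair_graph G"
    and "n = card (pverts G)"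
    and "one_tough G"
    and "sigma3 G \<ge> n" and "n \<ge> 3"
  shows "circumference G \<ge> min n (2 * NC2 G + 4)"
proof -
  interpret pair_graph G by fact
  interpret g: sgraph "pverts G" adj by (rule sgraph_adj)
  have dg: "g.deg x = degree G x" for x by (simp add: g.deg_def g.nb_def degree_adj)
  interpret g: tgraph "pverts G" adj
  proof
    show "card S \<le> card W" if "W \<subseteq> pverts G" "W \<noteq> {}" "S \<subseteq> pverts G - W" "\<And>x. x \<in> S \<Longrightarrow> x \<in> K x"
      "\<And>x a b. x \<in> S \<Longrightarrow> a \<in> K x \<Longrightarrow> adj a b \<Longrightarrow> b \<notin> W \<Longrightarrow> b \<in> K x" "\<And>x y. x \<in> S \<Longrightarrow> y \<in> S \<Longrightarrow> x \<noteq> y \<Longrightarrow> y \<notin> K x"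
      for W S and K :: "'a \<Rightarrow> 'a set"
      by (rule tough_adj[where K = K]) (use assms(3) that in blast)+
    show "card (pverts G) \<le> g.deg a + g.deg b + g.deg c" if "a \<in> pverts G" "b \<in> pverts G" "c \<in> pverts G" "a \<noteq> b" "a \<noteq> c" "b \<noteq> c"
      "\<not> adj a b" "\<not> adj a c" "\<not> adj b c" for a b c
      unfolding dg by (rule sigma_adj) (use assms(2,4) that in auto)
    show "3 \<le> card (pverts G)" using assms(2,5) by simp
  qed
  obtain C where C: "g.longest C" "3 \<le> length C" using g.ex_longest by blast
  have cl: "g.closed C" using C(1) by (simp add: g.longest_def)
  have "length C \<le> circumference G" by (rule circumference_ge) (use cl C(2) in \<open>auto simp: g.closed_def g.walk_def\<close>)
  moreover have "min n (2 * NC2 G + 4) \<le> length C"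
  proof (cases "set C = pverts G")
    case True
    then have "length C = n" using distinct_card[of C] cl assms(2) by (simp add: g.closed_def)
    then show ?thesis by simp
  next
    case False
    have "2 * NC2 G + 4 \<le> length C"
    proof (rule g.circumference_bound[OF C False])
      fix x y assume xy: "x \<in> pverts G" "y \<in> pverts G" "x \<noteq> y" "\<not> adj x y" "g.nb x \<inter> g.nb y \<noteq> {}"
      then obtain z where "adj x z" "adj y z" by (auto simp: g.nb_def)
      then show "NC2 G \<le> card (g.nb x \<union> g.nb y)" using NC2_le[OF xy(3,4)] g.sym by (auto simp: g.nb_def)
    qed
    then show ?thesis by simp
  qed
  ultimately show ?thesis by simp
qed

end
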